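(* Given an abstract pizza $\mathcal P=\left\{\{q_\ell\}_{\ell=0}^p,\ \{\beta_\ell,Q_\ell,\mu_\ell\}_{\ell=1}^p\right\}$, there is a non-negative Lipschitz function $f:T_\beta\to\mathbb R$, where $\beta=\min_\ell\beta_\ell$ and $T_\beta$ is the standard $\beta$-H\"older triangle, such that $\mathcal P$ is the abstract pizza corresponding to a pizza $\Lambda=\{T_\ell\}_{\ell=1}^p$ on $T_\beta$ associated with $f$.
   Context: Fix a polynomially bounded o-minimal structure over $\mathbb R$ with field of exponents $\mathbb F$. All sets, functions and maps are germs at the origin, definable in this structure. An arc is a germ of a map $\gamma:[0,\epsilon)\to\mathbb R^N$, $\gamma(0)=0$, $|\gamma(t)|=t$, identified with its image; $V(X)$ is the set of arcs in $X$. $ord_\gamma f$ is the exponent $q$ with $f(\gamma(t))=ct^q+o(t^q)$, $c\ne0$ ($\infty$ if $f\equiv0$ on $\gamma$). The standard $\beta$-H\"older triangle is $T_\beta=\{(u,v)\in\mathbb R^2:u\ge0,\ 0\le v\le u^\beta\}$, $\beta\in\mathbb F_{\ge1}$, with boundary arcs $\gamma_1=\{v=0\}$, $\gamma_2=\{v=u^\beta\}$, oriented from $\gamma_1$ to $\gamma_2$. A $\beta$-H\"older triangle is a set inner bi-Lipschitz homeomorphic to $T_\beta$ (inner metric: length of shortest path), and $\mu(T)=\beta$ is its exponent. $T(\lambda,\lambda')$ denotes the subtriangle bounded by arcs $\lambda,\lambda'$. A set is normally embedded if its inner metric is equivalent to the metric induced from $\mathbb R^N$. Abstract pizza. It consists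 of exponents $q_\ell\in\mathbb F_{\ge1}\cup\{\infty\}$ ($0\le\ell\le p$) and, for $1\le\ell\le p$, exponents $\beta_\ell\in\mathbb F_{\ge1}$, sets $Q_\ell=[q_{\ell-1},q_\ell]\subset\mathbb F_{\ge1}\cup\{\infty\}$ (a point or the closed interval with endpoints $q_{\ell-1},q_\ell$, in whichever order), and affine functions $\mu_\ell:Q_\ell\to\mathbb F\cup\{\infty\}$, non-constant when $Q_\ell$ is not a point, with $\mu_\ell(q)\le q$ for all $q\in Q_\ell$ and $\min_{q\in Q_\ell}\mu_\ell(q)=\beta_\ell$; if $Q_\ell=\{q_\ell\}$ is a point, $\mu_\ell(q_\ell)=\beta_\ell$ is a single exponent. It also includes the exponents $\nu_\ell$ determined by $\nu_0=\nu_p=\infty$, $\nu_\ell=\max(\mu_\ell(q_\ell),\mu_{\ell+1}(q_\ell))$ for $0<\ell<p$. Pizza of a function. Let $f\ge0$ be a Lipschitz function on a normally embedded H\"older triangle $T=T(\gamma_1,\gamma_2)$. $Q_f(T)=\{ord_\gamma f:\gamma\in V(T)\}$. $T$ is elementary if whenever $ord_\gamma f=ord_{\gamma'}f=q$, $f$ has order $q$ on every arc of $T(\gamma,\gamma')$. The width $\mu_T(\gamma,f)$ is the infimum of exponents of H\"older triangles $T''\subset T$ containing $\gamma$ with $Q_f(T'')$ a point ($\infty$ if none); if $T$ is elementary it depends only on $q=ord_\gamma f$ and is written $\mu_{T,f}(q)$. $T$ is a pizza slice if it is elementary and either $Q_f(T)$ is not a point and $\mu_{T,f}$ is affine on $Q_f(T)$,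 or $Q_f(T)=\{q\}$ and $\mu_{T,f}(q)=\mu(T)$. A pizza on $T$ associated with $f$ is a decomposition $\Lambda=\{T_\ell\}_{\ell=1}^p$ into pizza slices $T_\ell=T(\lambda_{\ell-1},\lambda_\ell)$, ordered along $T$, with $\lambda_0=\gamma_1$, $\lambda_p=\gamma_2$, $T_\ell\cap T_{\ell+1}=\lambda_\ell$. The corresponding abstract pizza has $q_\ell=ord_{\lambda_\ell}f$, $\beta_\ell=\mu(T_\ell)$, $Q_\ell=Q_f(T_\ell)$, $\mu_\ell=\mu_{T_\ell,f}$ (and $\nu_\ell$ given by the formula above). *)

theory Defs
  imports "HOL-Analysis.Analysis" "HOL-Library.Landau_Symbols"
begin

section \<open>Polynomially bounded o-minimal structures over the reals\<close>

text \<open>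
  Points of real \<open>n\<close>-space are lists of length \<open>n\<close>, so that all \<open>n\<close> live in one type;
  \<open>D n\<close> is the collection of definable subsets of real \<open>n\<close>-space (parameters are allowed).
\<close>

locale o_minimal_structure =
  fixes D :: "nat \<Rightarrow> real list set set"
  assumes dim: "A \<in> D n \<Longrightarrow> xs \<in> A \<Longrightarrow> length xs = n"
    and whole: "{xs. length xs = n} \<in> D n"
    and union: "A \<in> D n \<Longrightarrow> B \<in> D n \<Longrightarrow> A \<union> B \<in> D n"
    and complement: "A \<in> D n \<Longrightarrow> {xs. length xs = n} - A \<in> D n"
    and cylinder_left: "A \<in> D n \<Longrightarrow> {x # xs |x xs. xs \<in> A} \<in> D (Suc n)"
    and cylinder_right: "A \<in> D n \<Longrightarrow> {xs @ [x] |x xs. xs \<in> A} \<in> D (Suc n)"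
    and diagonal: "i < n \<Longrightarrow> j < n \<Longrightarrow> {xs. length xs = n \<and> xs ! i = xs ! j} \<in> D n"
    and projection: "A \<in> D (Suc n) \<Longrightarrow> butlast ` A \<in> D n"
    and singleton: "{[r]} \<in> D 1"
    and order: "{[x, y] |x y. x < y} \<in> D 2"
    and addition: "{[x, y, x + y] |x y. True} \<in> D 3"
    and multiplication: "{[x, y, x * y] |x y. True} \<in> D 3"
    and o_minimal: "A \<in> D 1 \<Longrightarrow> \<exists>\<I>. finite \<I> \<and> (\<forall>I\<in>\<I>. is_interval I) \<and> {x. [x] \<in> A} = \<Union>\<I>"

locale polynomially_bounded_structure = o_minimal_structure +
  assumes polynomially_bounded:
    "{[x, f x] |x. True} \<in> D 2 \<Longrightarrow> \<exists>N::nat. \<forall>\<^sub>F x in at_top. \<bar>f x\<bar> \<le> x ^ N"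

text \<open>The field of exponents.\<close>

definition exponents :: "(nat \<Rightarrow> real list set set) \<Rightarrow> real set" where
  "exponents D = {r. {[x, x powr r] |x. x > 0} \<in> D 2}"

text \<open>The order in which the coordinates are listed is irrelevant, since \<open>D\<close> is closed under
  permutations of coordinates.\<close>

definition definable :: "(nat \<Rightarrow> real list set set) \<Rightarrow> 'a::euclidean_space set \<Rightarrow> bool" where
  "definable D X \<longleftrightarrow>
    (\<exists>bs. distinct bs \<and> set bs = (Basis :: 'a set) \<and> (\<lambda>x. map (\<lambda>b. x \<bullet> b) bs) ` X \<in> D DIM('a))"

definition definable_on ::
  "(nat \<Rightarrow> real list set set) \<Rightarrow> 'a::euclidean_space set \<Rightarrow> ('a \<Rightarrow> 'b::euclidean_space) \<Rightarrow> bool" where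
  "definable_on D X f \<longleftrightarrow> definable D ((\<lambda>x. (x, f x)) ` X)"


section \<open>Germs, arcs and orders\<close>

text \<open>
  A germ at the origin is given by any of its representatives. Every predicate below depends only
  on the germs of its arguments; in particular the values of a total function away from the origin,
  or outside the set carrying the germ, play no role.
\<close>

definition germ_subset :: "'a::real_normed_vector set \<Rightarrow> 'a set \<Rightarrow> bool" where
  "germ_subset A B \<longleftrightarrow> (\<forall>\<^sub>F x in nhds 0. x \<in> A \<longrightarrow> x \<in> B)"

definition germ_eq :: "'a::real_normed_vector set \<Rightarrow> 'a set \<Rightarrow> bool" where
  "germ_eq A B \<longleftrightarrow> (\<forall>\<^sub>F x in nhds 0. x \<in> A \<longleftrightarrow> x \<in> B)"

definition arc_germ ::
  "(nat \<Rightarrow> real list set set) \<Rightarrow> (real \<Rightarrow> 'a::euclidean_space) \<Rightarrow> bool" where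
  "arc_germ D \<gamma> \<longleftrightarrow> \<gamma> 0 = 0 \<and> (\<exists>e>0. definable_on D {0..<e} \<gamma> \<and> (\<forall>t\<in>{0..<e}. norm (\<gamma> t) = t))"

text \<open>
  Since an arc is parametrized by the distance to the origin, near the origin its image is the set
  of all \<open>x\<close> with \<open>\<gamma> (norm x) = x\<close>; conversely \<open>arc_of A\<close> is the parametrization of the curve \<open>A\<close>.
\<close>

definition arc_image :: "(real \<Rightarrow> 'a::real_normed_vector) \<Rightarrow> 'a set" where
  "arc_image \<gamma> = {x. \<gamma> (norm x) = x}"

definition arc_of :: "'a::real_normed_vector set \<Rightarrow> real \<Rightarrow> 'a" where
  "arc_of A t = (THE x. x \<in> A \<and> norm x = t)"

definition arcs_in ::
  "(nat \<Rightarrow> real list set set) \<Rightarrow> 'a::euclidean_space set \<Rightarrow> (real \<Rightarrow> 'a) set" where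
  "arcs_in D X = {\<gamma>. arc_germ D \<gamma> \<and> germ_subset (arc_image \<gamma>) X}"

definition order_along :: "('a \<Rightarrow> real) \<Rightarrow> (real \<Rightarrow> 'a) \<Rightarrow> ereal" where
  "order_along f \<gamma> =
    (if \<forall>\<^sub>F t in at_right 0. f (\<gamma> t) = 0 then \<infinity>
     else ereal (THE q. \<exists>c. c \<noteq> 0 \<and>
       (\<lambda>t. f (\<gamma> t) - c * t powr q) \<in> o[at_right 0](\<lambda>t. t powr q)))"

definition order_set ::
  "(nat \<Rightarrow> real list set set) \<Rightarrow> 'a::euclidean_space set \<Rightarrow> ('a \<Rightarrow> real) \<Rightarrow> ereal set" where
  "order_set D T f = order_along f ` arcs_in D T"

text \<open>Definable Lipschitz function germs on a set germ \<open>X\<close> with nonnegative values.\<close>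

definition nonneg_lipschitz_germ ::
  "(nat \<Rightarrow> real list set set) \<Rightarrow> 'a::euclidean_space set \<Rightarrow> ('a \<Rightarrow> real) \<Rightarrow> bool" where
  "nonneg_lipschitz_germ D X f \<longleftrightarrow>
    (\<exists>r>0. \<exists>L. definable_on D (X \<inter> ball 0 r) f \<and> L-lipschitz_on (X \<inter> ball 0 r) f \<and>
      (\<forall>x\<in>X \<inter> ball 0 r. 0 \<le> f x))"


section \<open>The inner metric\<close>

definition path_length :: "(real \<Rightarrow> 'a::metric_space) \<Rightarrow> ennreal" where
  "path_length g =
    (SUP ts\<in>{ts. sorted ts \<and> set ts \<subseteq> {0..1}}.
      ennreal (\<Sum>i<length ts - 1. dist (g (ts ! i)) (g (ts ! Suc i))))"

definition inner_dist :: "'a::metric_space set \<Rightarrow> 'a \<Rightarrow> 'a \<Rightarrow> ennreal" where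
  "inner_dist X x y =
    (INF g\<in>{g. path g \<and> path_image g \<subseteq> X \<and> pathstart g = x \<and> pathfinish g = y}. path_length g)"

definition normally_embedded :: "'a::euclidean_space set \<Rightarrow> bool" where
  "normally_embedded X \<longleftrightarrow>
    (\<exists>r>0. \<exists>K. \<forall>x\<in>X \<inter> ball 0 r. \<forall>y\<in>X \<inter> ball 0 r. inner_dist X x y \<le> ennreal (K * dist x y))"

text \<open>
  The germ at the origin of \<open>h\<close> is a definable inner bi-Lipschitz homeomorphism between the germs
  of \<open>X\<close> and \<open>Y\<close>. The inner metrics are those of the representatives \<open>X\<close> and \<open>Y\<close>; near the origin
  they do not depend on the choice of representatives.
\<close>

definition inner_bilipschitz_germ ::
  "(nat \<Rightarrow> real list set set) \<Rightarrow> 'a::euclidean_space set \<Rightarrow> 'b::euclidean_space set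
    \<Rightarrow> ('a \<Rightarrow> 'b) \<Rightarrow> bool" where
  "inner_bilipschitz_germ D X Y h \<longleftrightarrow>
    0 \<in> X \<and> h 0 = 0 \<and>
    (\<exists>U V g K. open U \<and> 0 \<in> U \<and> open V \<and> 0 \<in> V \<and>
      definable_on D (X \<inter> U) h \<and> homeomorphism (X \<inter> U) (Y \<inter> V) h g \<and>
      (\<forall>x\<in>X \<inter> U. \<forall>y\<in>X \<inter> U.
        inner_dist Y (h x) (h y) \<le> ennreal K * inner_dist X x y \<and>
        inner_dist X x y \<le> ennreal K * inner_dist Y (h x) (h y)))"


section \<open>Hoelder triangles\<close>

definition std_triangle :: "real \<Rightarrow> (real \<times> real) set" where
  "std_triangle \<beta> = {(u, v). 0 \<le> u \<and> 0 \<le> v \<and> v \<le> u powr \<beta>}"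

definition std_lower :: "(real \<times> real) set" where
  "std_lower = {(u, v). 0 \<le> u \<and> v = 0}"

definition std_upper :: "real \<Rightarrow> (real \<times> real) set" where
  "std_upper \<beta> = {(u, v). 0 \<le> u \<and> v = u powr \<beta>}"

text \<open>\<open>holder_triangle D \<beta> T\<close> also expresses that \<open>\<beta>\<close> is the exponent of \<open>T\<close>.\<close>

definition holder_triangle ::
  "(nat \<Rightarrow> real list set set) \<Rightarrow> real \<Rightarrow> 'a::euclidean_space set \<Rightarrow> bool" where
  "holder_triangle D \<beta> T \<longleftrightarrow>
    \<beta> \<in> exponents D \<and> 1 \<le> \<beta> \<and> (\<exists>h. inner_bilipschitz_germ D (std_triangle \<beta>) T h)"

text \<open>The same with boundary arcs \<open>\<gamma>\<^sub>1\<close> and \<open>\<gamma>\<^sub>2\<close>, oriented from \<open>\<gamma>\<^sub>1\<close> to \<open>\<gamma>\<^sub>2\<close>; these are the images of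
  the boundary arcs of the standard triangle, expressed here through preimages under \<open>h\<close>.\<close>

definition holder_triangle_between ::
  "(nat \<Rightarrow> real list set set) \<Rightarrow> real \<Rightarrow> 'a::euclidean_space set
    \<Rightarrow> (real \<Rightarrow> 'a) \<Rightarrow> (real \<Rightarrow> 'a) \<Rightarrow> bool" where
  "holder_triangle_between D \<beta> T \<gamma>\<^sub>1 \<gamma>\<^sub>2 \<longleftrightarrow>
    \<beta> \<in> exponents D \<and> 1 \<le> \<beta> \<and> arc_germ D \<gamma>\<^sub>1 \<and> arc_germ D \<gamma>\<^sub>2 \<and>
    (\<exists>h. inner_bilipschitz_germ D (std_triangle \<beta>) T h \<and>
      germ_eq std_lower {x \<in> std_triangle \<beta>. h x \<in> arc_image \<gamma>\<^sub>1} \<and>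
      germ_eq (std_upper \<beta>) {x \<in> std_triangle \<beta>. h x \<in> arc_image \<gamma>\<^sub>2})"

text \<open>\<open>T'\<close> is the subtriangle of \<open>T\<close> bounded by \<open>\<gamma>\<^sub>1\<close> and \<open>\<gamma>\<^sub>2\<close>; its germ is unique.\<close>

definition subtriangle ::
  "(nat \<Rightarrow> real list set set) \<Rightarrow> 'a::euclidean_space set
    \<Rightarrow> (real \<Rightarrow> 'a) \<Rightarrow> (real \<Rightarrow> 'a) \<Rightarrow> 'a set \<Rightarrow> bool" where
  "subtriangle D T \<gamma>\<^sub>1 \<gamma>\<^sub>2 T' \<longleftrightarrow>
    germ_subset T' T \<and> (\<exists>\<alpha>. holder_triangle_between D \<alpha> T' \<gamma>\<^sub>1 \<gamma>\<^sub>2)"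


section \<open>Pizza slices and pizzas\<close>

definition elementary ::
  "(nat \<Rightarrow> real list set set) \<Rightarrow> 'a::euclidean_space set \<Rightarrow> ('a \<Rightarrow> real) \<Rightarrow> bool" where
  "elementary D T f \<longleftrightarrow>
    (\<forall>\<gamma>\<in>arcs_in D T. \<forall>\<gamma>'\<in>arcs_in D T. order_along f \<gamma> = order_along f \<gamma>' \<longrightarrow>
      (\<forall>T'. subtriangle D T \<gamma> \<gamma>' T' \<longrightarrow>
        (\<forall>\<theta>\<in>arcs_in D T'. order_along f \<theta> = order_along f \<gamma>)))"

definition arc_width ::
  "(nat \<Rightarrow> real list set set) \<Rightarrow> 'a::euclidean_space set \<Rightarrow> ('a \<Rightarrow> real)
    \<Rightarrow> (real \<Rightarrow> 'a) \<Rightarrow> ereal" where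
  "arc_width D T f \<gamma> =
    Inf {ereal \<alpha> |\<alpha> T'. holder_triangle D \<alpha> T' \<and> germ_subset T' T \<and> \<gamma> \<in> arcs_in D T' \<and>
      is_singleton (order_set D T' f)}"

text \<open>\<open>m\<close> is the width function of \<open>T\<close>: the width of an arc is \<open>m q\<close>, where \<open>q\<close> is the order of \<open>f\<close>
  on it. This determines \<open>m\<close> on \<open>order_set D T f\<close>.\<close>

definition width_function ::
  "(nat \<Rightarrow> real list set set) \<Rightarrow> 'a::euclidean_space set \<Rightarrow> ('a \<Rightarrow> real)
    \<Rightarrow> (ereal \<Rightarrow> ereal) \<Rightarrow> bool" where
  "width_function D T f m \<longleftrightarrow> (\<forall>\<gamma>\<in>arcs_in D T. arc_width D T f \<gamma> = m (order_along f \<gamma>))"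

text \<open>At \<open>q = \<infinity>\<close> this is the arithmetic of \<open>ereal\<close>: the value is \<open>\<infinity>\<close> for positive slope \<open>a\<close>, and \<open>b\<close>
  for \<open>a = 0\<close>.\<close>

definition ereal_affine_on :: "ereal set \<Rightarrow> (ereal \<Rightarrow> ereal) \<Rightarrow> bool" where
  "ereal_affine_on Q m \<longleftrightarrow> (\<exists>a b. \<forall>q\<in>Q. m q = ereal a * q + ereal b)"

definition pizza_slice ::
  "(nat \<Rightarrow> real list set set) \<Rightarrow> 'a::euclidean_space set \<Rightarrow> ('a \<Rightarrow> real) \<Rightarrow> bool" where
  "pizza_slice D T f \<longleftrightarrow>
    elementary D T f \<and>
    (\<exists>\<beta> m. holder_triangle D \<beta> T \<and> width_function D T f m \<and>
      (\<not> is_singleton (order_set D T f) \<and> ereal_affine_on (order_set D T f) m \<or>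
       (\<exists>q. order_set D T f = {q} \<and> m q = ereal \<beta>)))"

text \<open>The slices are \<open>\<Lambda> 1, \<dots>, \<Lambda> p\<close>, and \<open>\<Lambda> l\<close> is bounded by the arcs \<open>lam (l - 1)\<close> and \<open>lam l\<close>.\<close>

definition pizza ::
  "(nat \<Rightarrow> real list set set) \<Rightarrow> 'a::euclidean_space set \<Rightarrow> (real \<Rightarrow> 'a) \<Rightarrow> (real \<Rightarrow> 'a)
    \<Rightarrow> ('a \<Rightarrow> real) \<Rightarrow> nat \<Rightarrow> (nat \<Rightarrow> real \<Rightarrow> 'a) \<Rightarrow> (nat \<Rightarrow> 'a set) \<Rightarrow> bool" where
  "pizza D T \<gamma>\<^sub>1 \<gamma>\<^sub>2 f p lam \<Lambda> \<longleftrightarrow>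
    (\<exists>\<beta>. holder_triangle_between D \<beta> T \<gamma>\<^sub>1 \<gamma>\<^sub>2) \<and> normally_embedded T \<and>
    nonneg_lipschitz_germ D T f \<and>
    1 \<le> p \<and>
    germ_eq (arc_image (lam 0)) (arc_image \<gamma>\<^sub>1) \<and> germ_eq (arc_image (lam p)) (arc_image \<gamma>\<^sub>2) \<and>
    germ_eq T (\<Union>l\<in>{1..p}. \<Lambda> l) \<and>
    (\<forall>l\<in>{1..p}. subtriangle D T (lam (l - 1)) (lam l) (\<Lambda> l) \<and> pizza_slice D (\<Lambda> l) f) \<and>
    (\<forall>l\<in>{1..<p}. germ_eq (\<Lambda> l \<inter> \<Lambda> (Suc l)) (arc_image (lam l))) \<and>
    (\<forall>k\<in>{1..p}. \<forall>l\<in>{1..p}. Suc k < l \<longrightarrow> germ_eq (\<Lambda> k \<inter> \<Lambda> l) {0})"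


section \<open>Abstract pizzas\<close>

text \<open>Only the values at indices in the ranges below, and the values of \<open>pz_mu l\<close> on \<open>pz_Q l\<close>,
  are meaningful.\<close>

record abstract_pizza =
  pz_len :: nat
  pz_q :: "nat \<Rightarrow> ereal"
  pz_beta :: "nat \<Rightarrow> real"
  pz_Q :: "nat \<Rightarrow> ereal set"
  pz_mu :: "nat \<Rightarrow> ereal \<Rightarrow> ereal"
  pz_nu :: "nat \<Rightarrow> ereal"

definition orders :: "(nat \<Rightarrow> real list set set) \<Rightarrow> ereal set" where
  "orders D = ereal ` {r \<in> exponents D. 1 \<le> r} \<union> {\<infinity>}"

definition order_interval ::
  "(nat \<Rightarrow> real list set set) \<Rightarrow> ereal \<Rightarrow> ereal \<Rightarrow> ereal set" where
  "order_interval D a b = {q \<in> orders D. min a b \<le> q \<and> q \<le> max a b}"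

definition pizza_nu :: "abstract_pizza \<Rightarrow> bool" where
  "pizza_nu P \<longleftrightarrow>
    pz_nu P 0 = \<infinity> \<and> pz_nu P (pz_len P) = \<infinity> \<and>
    (\<forall>l. 0 < l \<and> l < pz_len P \<longrightarrow>
      pz_nu P l = max (pz_mu P l (pz_q P l)) (pz_mu P (Suc l) (pz_q P l)))"

definition is_abstract_pizza :: "(nat \<Rightarrow> real list set set) \<Rightarrow> abstract_pizza \<Rightarrow> bool" where
  "is_abstract_pizza D P \<longleftrightarrow>
    1 \<le> pz_len P \<and>
    (\<forall>l\<le>pz_len P. pz_q P l \<in> orders D) \<and>
    (\<forall>l\<in>{1..pz_len P}.
      pz_beta P l \<in> exponents D \<and> 1 \<le> pz_beta P l \<and>
      pz_Q P l = order_interval D (pz_q P (l - 1)) (pz_q P l) \<and>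
      pz_mu P l ` pz_Q P l \<subseteq> ereal ` exponents D \<union> {\<infinity>} \<and>
      ereal_affine_on (pz_Q P l) (pz_mu P l) \<and>
      (\<not> is_singleton (pz_Q P l) \<longrightarrow> \<not> pz_mu P l constant_on pz_Q P l) \<and>
      (\<forall>q\<in>pz_Q P l. pz_mu P l q \<le> q) \<and>
      ereal (pz_beta P l) \<in> pz_mu P l ` pz_Q P l \<and>
      (\<forall>q\<in>pz_Q P l. ereal (pz_beta P l) \<le> pz_mu P l q)) \<and>
    pizza_nu P"

text \<open>\<open>P\<close> is the abstract pizza corresponding to the pizza with arcs \<open>lam\<close> and slices \<open>\<Lambda>\<close>.\<close>

definition corresponding_abstract_pizza ::
  "(nat \<Rightarrow> real list set set) \<Rightarrow> ('a::euclidean_space \<Rightarrow> real) \<Rightarrow> nat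
    \<Rightarrow> (nat \<Rightarrow> real \<Rightarrow> 'a) \<Rightarrow> (nat \<Rightarrow> 'a set) \<Rightarrow> abstract_pizza \<Rightarrow> bool" where
  "corresponding_abstract_pizza D f p lam \<Lambda> P \<longleftrightarrow>
    pz_len P = p \<and>
    (\<forall>l\<le>p. pz_q P l = order_along f (lam l)) \<and>
    (\<forall>l\<in>{1..p}.
      holder_triangle D (pz_beta P l) (\<Lambda> l) \<and>
      pz_Q P l = order_set D (\<Lambda> l) f \<and>
      width_function D (\<Lambda> l) f (pz_mu P l)) \<and>
    pizza_nu P"

end

theory Submission
  imports Defs
begin

text \<open>
  The construction is explicit. On a single slice of exponent \<open>\<beta>\<close>, let \<open>w\<close> be the vertical distance
  from the boundary curve at which the width \<open>\<mu>\<close> is largest. If \<open>\<mu> q = a * q + b\<close>, then a function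
  that has order \<open>q\<close> and width \<open>\<mu> q\<close> along the curve \<open>w = u powr \<mu> q\<close>, for every \<open>q\<close>, is
  \<open>(w / u powr b) powr (1 / a)\<close>; it is continued by its boundary values to those \<open>w\<close> that lie below or above all
  these curves. On a slice with a single order \<open>q\<close> the function is \<open>u powr q\<close>, or \<open>0\<close> for \<open>q = \<infinity>\<close>. The condition \<open>\<mu> q \<le> q\<close> bounds the partial
  derivative in \<open>w\<close>, and \<open>q \<ge> 1\<close> the one in \<open>u\<close>, so the function is Lipschitz
  (\<open>monomial_lipschitz\<close>, \<open>slice_profile_monomial\<close>). The slices are stacked in the standard triangle;
  since the function is the power \<open>u powr q\<close> on each of the curves that separate them, the functions on the slices add up
  to one Lipschitz function by telescoping (\<open>telescoping_step\<close>).

  What has to be proved is that no arc and no Hoelder triangle behaves otherwise than the explicit ones. Three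
  facts carry this.

  Orders exist and are exponents (\<open>definable_germ_order\<close>). A definable function of one variable is
  monotone near \<open>0\<close> (\<open>definable_germ_monotone\<close>), hence \<open>g (t * x) / g x\<close> has a limit, which is multiplicative
  and monotone in \<open>t\<close>, and therefore a definable power of \<open>t\<close>. Dividing \<open>g\<close> by this power leaves a slowly varying
  definable function, which must have a positive limit, because otherwise it or its reciprocal has an inverse
  that violates polynomial boundedness.

  A Hoelder triangle in the plane fills the space between its boundary arcs. By invariance of domain,
  the ends of a vertical section of the triangle lie on the boundary arcs
  (\<open>holder_chart_section\<close>). The function is monotone on vertical segments, so its order on the boundary arcs
  is its order on the whole triangle (\<open>has_order_of_boundary\<close>); this makes each slice elementary.

  The exponent of a thin triangle is large (\<open>holder_exponent_lower_bound\<close>). If both boundary arcs lie within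
  distance \<open>u powr m\<close> of a common curve, vertical segments inside the triangle join them, so that their inner distance
  is of order at least \<open>m\<close>, and the exponent of the triangle is at least \<open>m\<close>. Since the zone of order \<open>q\<close> lies
  within distance \<open>u powr \<mu> q\<close> of a curve, up to a constant, this is the lower bound for the width; the zone itself,
  bounded by two definable Lipschitz graphs, is a Hoelder triangle of exponent \<open>\<mu> q\<close>
  (\<open>region_holder_triangle\<close>), which is the upper bound.
\<close>

section \<open>A calculus of definable sets and maps\<close>

definition coords :: "'a::euclidean_space list \<Rightarrow> 'a \<Rightarrow> real list" where
  "coords bs x = map (\<lambda>b. x \<bullet> b) bs"

lemma length_coords [simp]: "length (coords bs x) = length bs"
  by (simp add: coords_def)

lemma length_basis_list:
  assumes "distinct bs" "set bs = (Basis :: 'a::euclidean_space set)"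
  shows "length bs = DIM('a)"
  using assms distinct_card by fastforce

lemma inj_coords:
  assumes "set bs = (Basis :: 'a::euclidean_space set)"
  shows "inj (coords bs)"
proof (rule injI)
  fix x y :: 'a assume "coords bs x = coords bs y"
  then have "\<forall>b\<in>set bs. x \<bullet> b = y \<bullet> b" by (simp add: coords_def)
  then show "x = y" using assms by (simp add: euclidean_eq_iff[of x])
qed

lemma surj_coords:
  assumes "distinct bs" "set bs = (Basis :: 'a::euclidean_space set)" "length xs = DIM('a)"
  obtains x where "coords bs x = xs"
proof
  let ?x = "\<Sum>b\<in>Basis. (xs ! (THE i. i < length bs \<and> bs ! i = b)) *\<^sub>R b"
  have len: "length bs = length xs" using length_basis_list assms by metis
  show "coords bs ?x = xs"
  proof (rule nth_equalityI)
    fix i assume "i < length (coords bs ?x)"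
    then have i: "i < length bs" by simp
    then have b: "bs ! i \<in> Basis" using assms(2) nth_mem by blast
    have "(THE j. j < length bs \<and> bs ! j = bs ! i) = i"
      using i assms(1) nth_eq_iff_index_eq by blast
    then show "coords bs ?x ! i = xs ! i"
      using i b by (simp add: coords_def)
  qed (simp add: len)
qed

lemma obtain_basis_list:
  obtains bs where "distinct bs" "set bs = (Basis :: 'a::euclidean_space set)"
  using finite_distinct_list[OF finite_Basis] by blast

text \<open>Maps that only rearrange, duplicate or drop coordinates: preimages under them are substitutions
  of variables, which is all that is needed to move between different tuples of variables.\<close>

definition coordmap :: "('a::euclidean_space \<Rightarrow> 'b::euclidean_space) \<Rightarrow> bool" where
  "coordmap L \<longleftrightarrow> (\<forall>b\<in>Basis. \<exists>b'\<in>Basis. \<forall>x. L x \<bullet> b = x \<bullet> b')"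

lemma coordmap_id: "coordmap (\<lambda>x. x)"
  by (auto simp: coordmap_def)

lemma coordmap_fst: "coordmap L \<Longrightarrow> coordmap (\<lambda>x. fst (L x))"
  unfolding coordmap_def
proof
  fix b :: 'b assume L: "\<forall>b\<in>Basis. \<exists>b'\<in>Basis. \<forall>x. L x \<bullet> b = x \<bullet> b'" and b: "b \<in> Basis"
  then have "(b, 0::'c) \<in> Basis" by (simp add: Basis_prod_def)
  with L show "\<exists>b'\<in>Basis. \<forall>x. fst (L x) \<bullet> b = x \<bullet> b'" by (force simp: inner_prod_def)
qed

lemma coordmap_snd: "coordmap L \<Longrightarrow> coordmap (\<lambda>x. snd (L x))"
  unfolding coordmap_def
proof
  fix b :: 'c assume L: "\<forall>b\<in>Basis. \<exists>b'\<in>Basis. \<forall>x. L x \<bullet> b = x \<bullet> b'" and b: "b \<in> Basis"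
  then have "(0::'b, b) \<in> Basis" by (simp add: Basis_prod_def)
  with L show "\<exists>b'\<in>Basis. \<forall>x. snd (L x) \<bullet> b = x \<bullet> b'" by (force simp: inner_prod_def)
qed

lemma coordmap_Pair: "coordmap L \<Longrightarrow> coordmap M \<Longrightarrow> coordmap (\<lambda>x. (L x, M x))"
  unfolding coordmap_def Basis_prod_def by (auto simp: inner_prod_def)

lemma coordmap_projections [simp]: "coordmap fst" "coordmap snd"
  using coordmap_fst[OF coordmap_id] coordmap_snd[OF coordmap_id] by simp_all

lemmas coordmap_intros [simp] = coordmap_Pair coordmap_fst coordmap_snd coordmap_id

context o_minimal_structure
begin

lemma D_Diff: "A \<in> D n \<Longrightarrow> B \<in> D n \<Longrightarrow> A - B \<in> D n"
proof -
  assume AB: "A \<in> D n" "B \<in> D n"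
  have "A - B = {xs. length xs = n} - (({xs. length xs = n} - A) \<union> B)"
    using dim[OF AB(1)] by auto
  then show ?thesis using AB complement union by metis
qed

lemma D_Int: "A \<in> D n \<Longrightarrow> B \<in> D n \<Longrightarrow> A \<inter> B \<in> D n"
  using D_Diff[of A n "A - B"] D_Diff[of A n B] by (simp add: Int_Diff double_diff Diff_Diff_Int)

lemma D_take: "A \<in> D (n + k) \<Longrightarrow> take n ` A \<in> D n"
proof (induction k arbitrary: A)
  case 0
  have "take n ` A = A" using dim[OF 0] by (force simp: image_def)
  then show ?case using 0 by simp
next
  case (Suc k)
  have "butlast ` A \<in> D (n + k)" using Suc.prems projection by simp
  then have "take n ` butlast ` A \<in> D n" by (rule Suc.IH)
  moreover have "take n (butlast xs) = take n xs" if "xs \<in> A" for xs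
    using dim[OF Suc.prems that] by (simp add: butlast_conv_take)
  ultimately show ?case by (simp add: image_image cong: image_cong)
qed

lemma D_cylinder: "A \<in> D k \<Longrightarrow> {xs @ ys |xs ys. length xs = n \<and> ys \<in> A} \<in> D (n + k)"
proof (induction n)
  case 0 then show ?case by simp
next
  case (Suc n)
  have "{x # zs |x zs. zs \<in> {xs @ ys |xs ys. length xs = n \<and> ys \<in> A}} \<in> D (Suc (n + k))"
    using Suc by (intro cylinder_left) auto
  moreover have "{x # zs |x zs. zs \<in> {xs @ ys |xs ys. length xs = n \<and> ys \<in> A}} =
      {xs @ ys |xs ys. length xs = Suc n \<and> ys \<in> A}"
  proof (intro equalityI subsetI)
    fix zs assume "zs \<in> {xs @ ys |xs ys. length xs = Suc n \<and> ys \<in> A}"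
    then obtain xs ys where *: "zs = xs @ ys" "length xs = Suc n" "ys \<in> A" by blast
    then obtain x xs' where "xs = x # xs'" "length xs' = n" by (auto simp: length_Suc_conv)
    then show "zs \<in> {x # zs |x zs. zs \<in> {xs @ ys |xs ys. length xs = n \<and> ys \<in> A}}"
      using * by auto
  next
    fix zs assume "zs \<in> {x # zs |x zs. zs \<in> {xs @ ys |xs ys. length xs = n \<and> ys \<in> A}}"
    then obtain x xs ys where "zs = (x # xs) @ ys" "length (x # xs) = Suc n" "ys \<in> A" by auto
    then show "zs \<in> {xs @ ys |xs ys. length xs = Suc n \<and> ys \<in> A}" by blast
  qed
  ultimately show ?case by simp
qed

lemma D_diagonals:
  "k \<le> m \<Longrightarrow> (\<And>j. j < k \<Longrightarrow> s j < n + m) \<Longrightarrow>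
    {zs. length zs = n + m \<and> (\<forall>j<k. zs ! (n + j) = zs ! s j)} \<in> D (n + m)"
proof (induction k)
  case 0 then show ?case using whole by simp
next
  case (Suc k)
  have "{zs. length zs = n + m \<and> (\<forall>j<k. zs ! (n + j) = zs ! s j)} \<inter>
      {zs. length zs = n + m \<and> zs ! (n + k) = zs ! s k} \<in> D (n + m)"
    using Suc by (intro D_Int diagonal) auto
  moreover have "{zs. length zs = n + m \<and> (\<forall>j<k. zs ! (n + j) = zs ! s j)} \<inter>
      {zs. length zs = n + m \<and> zs ! (n + k) = zs ! s k} =
      {zs :: real list. length zs = n + m \<and> (\<forall>j<Suc k. zs ! (n + j) = zs ! s j)}"
    by (auto simp: less_Suc_eq)
  ultimately show ?case by (simp only:)
qed

text \<open>Substituting the variables \<open>xs ! i\<close>, for \<open>i\<close> in \<open>is\<close>, for the variables of \<open>A\<close>: adjoin the latter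
  as new coordinates on the right, equate them with the former, and project them away.\<close>

lemma D_reindex:
  assumes "A \<in> D k" "length is = k" "\<And>i. i \<in> set is \<Longrightarrow> i < n"
  shows "{xs. length xs = n \<and> map (\<lambda>i. xs ! i) is \<in> A} \<in> D n"
proof -
  let ?B = "{xs @ ys |xs ys. length xs = n \<and> ys \<in> A} \<inter>
      {zs. length zs = n + k \<and> (\<forall>j<k. zs ! (n + j) = zs ! (is ! j))}"
  have "?B \<in> D (n + k)"
    using assms by (intro D_Int D_cylinder D_diagonals) (auto simp: trans_less_add1)
  then have "take n ` ?B \<in> D n" by (rule D_take)
  moreover have "take n ` ?B = {xs. length xs = n \<and> map (\<lambda>i. xs ! i) is \<in> A}" (is "_ = ?R")
  proof (intro equalityI subsetI)
    fix xs assume "xs \<in> take n ` ?B"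
    then obtain ys where *: "length xs = n" "ys \<in> A"
        "\<forall>j<k. (xs @ ys) ! (n + j) = (xs @ ys) ! (is ! j)" by auto
    then have "map (\<lambda>i. xs ! i) is = ys"
      using dim[OF assms(1), of ys] assms by (intro nth_equalityI) (auto simp: nth_append)
    then show "xs \<in> ?R" using * by simp
  next
    fix xs assume xs: "xs \<in> ?R"
    have "(xs @ map (\<lambda>i. xs ! i) is) ! (n + j) = (xs @ map (\<lambda>i. xs ! i) is) ! (is ! j)" if "j < k" for j
      using xs assms(2) assms(3)[of "is ! j"] that by (simp add: nth_append)
    then have "xs @ map (\<lambda>i. xs ! i) is \<in> ?B"
      using assms(2) xs by auto
    then have "take n (xs @ map (\<lambda>i. xs ! i) is) \<in> take n ` ?B" by (rule imageI)
    then show "xs \<in> take n ` ?B" using xs by simp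
  qed
  ultimately show ?thesis by simp
qed

lemma definable_coords:
  "definable D (X :: 'a::euclidean_space set) \<longleftrightarrow>
    (\<exists>bs. distinct bs \<and> set bs = (Basis :: 'a set) \<and> coords bs ` X \<in> D DIM('a))"
  unfolding definable_def coords_def[abs_def] ..

text \<open>For the identity map this says that definability does not depend on the chosen order of the
  basis.\<close>

lemma coordmap_vimage_coords:
  fixes L :: "'a::euclidean_space \<Rightarrow> 'b::euclidean_space"
  assumes "definable D X" "coordmap L" and bs: "distinct bs" "set bs = (Basis :: 'a set)"
  shows "coords bs ` (L -` X) \<in> D DIM('a)"
proof -
  obtain cs where cs: "distinct cs" "set cs = (Basis :: 'b set)" "coords cs ` X \<in> D DIM('b)"
    using assms(1) unfolding definable_coords by (elim exE conjE)
  obtain \<sigma> where \<sigma>: "\<And>b. b \<in> Basis \<Longrightarrow> \<sigma> b \<in> Basis \<and> (\<forall>x. L x \<bullet> b = x \<bullet> \<sigma> b)"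
    using assms(2) unfolding coordmap_def by metis
  define idx where "idx b = (SOME i. i < length bs \<and> bs ! i = \<sigma> b)" for b
  have idx: "idx b < length bs \<and> bs ! idx b = \<sigma> b" if "b \<in> set cs" for b
  proof -
    have "\<sigma> b \<in> set bs" using \<sigma>[of b] that bs(2) cs(2) by blast
    then have "\<exists>i. i < length bs \<and> bs ! i = \<sigma> b" by (simp add: in_set_conv_nth)
    then show ?thesis unfolding idx_def by (rule someI_ex)
  qed
  have lb: "length bs = DIM('a)" "length cs = DIM('b)"
    using length_basis_list[OF bs] length_basis_list[OF cs(1,2)] by auto
  have L: "map (\<lambda>i. coords bs x ! i) (map idx cs) = coords cs (L x)" for x
    using idx \<sigma> cs(2) by (auto simp: coords_def)
  have "{xs. length xs = DIM('a) \<and> map (\<lambda>i. xs ! i) (map idx cs) \<in> coords cs ` X} \<in> D DIM('a)"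
    using cs(3) lb idx by (intro D_reindex) auto
  moreover have "{xs. length xs = DIM('a) \<and> map (\<lambda>i. xs ! i) (map idx cs) \<in> coords cs ` X} =
      coords bs ` (L -` X)"
  proof (intro equalityI subsetI)
    fix xs assume xs: "xs \<in> {xs. length xs = DIM('a) \<and> map (\<lambda>i. xs ! i) (map idx cs) \<in> coords cs ` X}"
    then obtain x where x: "coords bs x = xs" using surj_coords[OF bs] by blast
    then have "coords cs (L x) \<in> coords cs ` X" using xs L[of x] by auto
    then have "L x \<in> X" using inj_coords[OF cs(2)] by (simp add: inj_image_mem_iff)
    then show "xs \<in> coords bs ` (L -` X)" using x by blast
  next
    fix xs assume "xs \<in> coords bs ` (L -` X)"
    then obtain x where x: "xs = coords bs x" "L x \<in> X" by blast
    then have "map (\<lambda>i. xs ! i) (map idx cs) = coords cs (L x)" using L[of x] by simp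
    then show "xs \<in> {xs. length xs = DIM('a) \<and> map (\<lambda>i. xs ! i) (map idx cs) \<in> coords cs ` X}"
      using x lb by simp
  qed
  ultimately show ?thesis by simp
qed

lemma definable_vimage:
  fixes L :: "'a::euclidean_space \<Rightarrow> 'b::euclidean_space"
  shows "definable D X \<Longrightarrow> coordmap L \<Longrightarrow> definable D (L -` X)"
proof -
  assume X: "definable D X" "coordmap L"
  obtain bs where bs: "distinct bs" "set bs = (Basis :: 'a set)" by (rule obtain_basis_list)
  then show ?thesis unfolding definable_coords[of "L -` X"]
    using coordmap_vimage_coords[OF X bs] by (intro exI conjI)
qed

text \<open>First-order formulas (\<open>dP\<close>) and terms (\<open>dF\<close>) of the structure, with a point of a Euclidean space as the
  tuple of free variables. Binding a further variable passes to a product space, so that the closure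
  rules below can be applied by matching on the outermost symbol.\<close>

definition dP :: "('a::euclidean_space \<Rightarrow> bool) \<Rightarrow> bool" where
  "dP P \<longleftrightarrow> definable D (Collect P)"

definition dF :: "('a::euclidean_space \<Rightarrow> 'b::euclidean_space) \<Rightarrow> bool" where
  "dF f \<longleftrightarrow> dP (\<lambda>z. snd z = f (fst z))"

lemma dP_coords:
  "distinct bs \<Longrightarrow> set bs = (Basis :: 'a::euclidean_space set) \<Longrightarrow>
    dP P \<longleftrightarrow> coords bs ` Collect P \<in> D DIM('a)"
  unfolding dP_def
proof
  assume "distinct bs" "set bs = Basis" "definable D (Collect P)"
  then show "coords bs ` Collect P \<in> D DIM('a)"
    using coordmap_vimage_coords[OF _ coordmap_id, of "Collect P" bs] by simp
next
  assume "distinct bs" "set bs = Basis" "coords bs ` Collect P \<in> D DIM('a)"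
  then show "definable D (Collect P)" unfolding definable_coords by (intro exI conjI)
qed

lemma dP_vimage: "dP P \<Longrightarrow> coordmap L \<Longrightarrow> dP (\<lambda>x. P (L x))"
  unfolding dP_def using definable_vimage[of "Collect P" L] by (simp add: vimage_def)

lemma dP_not: "dP P \<Longrightarrow> dP (\<lambda>x :: 'a::euclidean_space. \<not> P x)"
proof -
  assume P: "dP P"
  obtain bs where bs: "distinct bs" "set bs = (Basis :: 'a set)" by (rule obtain_basis_list)
  have "{xs. length xs = DIM('a)} - coords bs ` Collect P \<in> D DIM('a)"
    using P bs dP_coords complement by blast
  moreover have "{xs. length xs = DIM('a)} - coords bs ` Collect P = coords bs ` Collect (\<lambda>x. \<not> P x)"
    using surj_coords[OF bs] inj_coords[OF bs(2)] length_basis_list[OF bs]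
    by (auto simp: inj_eq image_iff) metis
  ultimately show ?thesis using dP_coords[OF bs] by simp
qed

lemma dP_disj: "dP P \<Longrightarrow> dP Q \<Longrightarrow> dP (\<lambda>x :: 'a::euclidean_space. P x \<or> Q x)"
proof -
  assume P: "dP P" "dP Q"
  obtain bs where bs: "distinct bs" "set bs = (Basis :: 'a set)" by (rule obtain_basis_list)
  show ?thesis using P union dP_coords[OF bs] by (simp add: Collect_disj_eq image_Un)
qed

lemma dP_conj: "dP P \<Longrightarrow> dP Q \<Longrightarrow> dP (\<lambda>x. P x \<and> Q x)"
  using dP_not[OF dP_disj[OF dP_not[of P] dP_not[of Q]]] by simp

lemma dP_imp: "dP P \<Longrightarrow> dP Q \<Longrightarrow> dP (\<lambda>x. P x \<longrightarrow> Q x)"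
  unfolding imp_conv_disj by (intro dP_disj dP_not)

lemma dP_const: "dP (\<lambda>x :: 'a::euclidean_space. c)"
proof -
  obtain bs where bs: "distinct bs" "set bs = (Basis :: 'a set)" by (rule obtain_basis_list)
  have "{xs. length xs = DIM('a)} = coords bs ` Collect (\<lambda>x. True)"
    using surj_coords[OF bs] length_basis_list[OF bs] by (auto simp: image_iff) metis
  then have "dP (\<lambda>x :: 'a. True)" using whole[of "DIM('a)"] dP_coords[OF bs, of "\<lambda>x. True"] by simp
  then show ?thesis using dP_not by (cases c) force+
qed

lemma dP_ex_prod:
  fixes P :: "'a::euclidean_space \<times> 'b::euclidean_space \<Rightarrow> bool"
  assumes "dP P" shows "dP (\<lambda>x. \<exists>y. P (x, y))"
proof -
  obtain as where as: "distinct as" "set as = (Basis :: 'a set)" by (rule obtain_basis_list)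
  obtain bs where bs: "distinct bs" "set bs = (Basis :: 'b set)" by (rule obtain_basis_list)
  let ?cs = "map (\<lambda>a. (a, 0)) as @ map (\<lambda>b. (0, b)) bs"
  have cs: "distinct ?cs" "set ?cs = (Basis :: ('a \<times> 'b) set)"
    using as bs by (auto simp: distinct_map inj_on_def Basis_prod_def)
  have "coords ?cs ` Collect P \<in> D (DIM('a) + DIM('b))"
    using dP_coords[OF cs, of P] assms by simp
  then have "take DIM('a) ` coords ?cs ` Collect P \<in> D DIM('a)" by (rule D_take)
  moreover have "take DIM('a) (coords ?cs z) = coords as (fst z)" for z
    using length_basis_list[OF as] by (auto simp: coords_def comp_def inner_prod_def)
  ultimately have "coords as ` fst ` Collect P \<in> D DIM('a)" by (simp add: image_image)
  moreover have "fst ` Collect P = {x. \<exists>y. P (x, y)}" by force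
  ultimately show ?thesis using dP_coords[OF as] by simp
qed

lemma dP_ex: "dP (\<lambda>z. P (fst z) (snd z)) \<Longrightarrow> dP (\<lambda>x. \<exists>y. P x y)"
  using dP_ex_prod[of "\<lambda>z. P (fst z) (snd z)"] by simp

lemma dP_all: "dP (\<lambda>z. P (fst z) (snd z)) \<Longrightarrow> dP (\<lambda>x. \<forall>y. P x y)"
  using dP_not[OF dP_ex[OF dP_not[of "\<lambda>z. P (fst z) (snd z)"]]] by simp

lemma dP_subst:
  assumes "dP P" "dF f" shows "dP (\<lambda>x. P (f x))"
proof -
  have "dP (\<lambda>x. \<exists>y. y = f x \<and> P y)"
    using assms dP_vimage[OF assms(1), of snd] unfolding dF_def
    by (intro dP_ex dP_conj) simp_all
  then show ?thesis by simp
qed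

lemma dF_Pair: "dF f \<Longrightarrow> dF g \<Longrightarrow> dF (\<lambda>x. (f x, g x))"
proof -
  assume f: "dF f" and g: "dF g"
  have "dP (\<lambda>z. fst (snd z) = f (fst z) \<and> snd (snd z) = g (fst z))"
    using dP_vimage[OF f[unfolded dF_def], of "\<lambda>z. (fst z, fst (snd z))"]
      dP_vimage[OF g[unfolded dF_def], of "\<lambda>z. (fst z, snd (snd z))"]
    by (intro dP_conj) simp_all
  then show ?thesis unfolding dF_def by (simp add: prod_eq_iff)
qed

lemma dF_comp: "dF g \<Longrightarrow> dF f \<Longrightarrow> dF (\<lambda>x. g (f x))"
proof -
  assume g: "dF g" and f: "dF f"
  have "dP (\<lambda>z. \<exists>y. y = f (fst z) \<and> snd z = g y)"
    using dP_vimage[OF f[unfolded dF_def], of "\<lambda>z. (fst (fst z), snd z)"]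
      dP_vimage[OF g[unfolded dF_def], of "\<lambda>z. (snd z, snd (fst z))"]
    by (intro dP_ex dP_conj) simp_all
  then show ?thesis unfolding dF_def by simp
qed

lemma dF_id: "dF (\<lambda>x :: 'a::euclidean_space. x)"
proof -
  obtain as where as: "distinct as" "set as = (Basis :: 'a set)" by (rule obtain_basis_list)
  let ?cs = "map (\<lambda>a. (a, 0)) as @ map (\<lambda>b. (0, b)) as"
  let ?n = "DIM('a)"
  have n: "length as = ?n" using length_basis_list[OF as] .
  have cs: "distinct ?cs" "set ?cs = (Basis :: ('a \<times> 'a) set)"
    using as by (auto simp: distinct_map inj_on_def Basis_prod_def)
  have "{zs. length zs = ?n + ?n \<and> (\<forall>j<?n. zs ! (?n + j) = zs ! j)} \<in> D (?n + ?n)"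
    by (rule D_diagonals) auto
  moreover have "{zs. length zs = ?n + ?n \<and> (\<forall>j<?n. zs ! (?n + j) = zs ! j)} =
      coords ?cs ` Collect (\<lambda>z :: 'a \<times> 'a. snd z = fst z)" (is "?A = ?B")
  proof (intro equalityI subsetI)
    fix zs assume zs: "zs \<in> ?A"
    then obtain z where z: "coords ?cs z = zs" using surj_coords[OF cs, of zs] by auto
    have c: "coords ?cs z = coords as (fst z) @ coords as (snd z)"
      by (auto simp: coords_def comp_def inner_prod_def)
    have "coords as (snd z) = coords as (fst z)"
      using zs z c n by (intro nth_equalityI) (auto simp: nth_append)
    then have "snd z = fst z" using inj_coords[OF as(2)] by (simp add: inj_eq)
    then show "zs \<in> ?B" using z by blast
  next
    fix zs assume "zs \<in> ?B"
    then obtain z :: 'a where "zs = coords as z @ coords as z"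
      by (auto simp: coords_def comp_def inner_prod_def)
    then show "zs \<in> ?A" using n by (auto simp: nth_append)
  qed
  ultimately show ?thesis using dP_coords[OF cs] unfolding dF_def by simp
qed

lemma dF_coordmap:
  fixes L :: "'a::euclidean_space \<Rightarrow> 'b::euclidean_space"
  shows "coordmap L \<Longrightarrow> dF L"
proof -
  assume L: "coordmap L"
  have "coordmap (\<lambda>z :: 'a \<times> 'b. L (fst z))"
    using L coordmap_projections(1)[where 'a = 'a and 'b = 'b] unfolding coordmap_def by metis
  then show ?thesis
    using dP_vimage[OF dF_id[unfolded dF_def], of "\<lambda>z. (L (fst z), snd z)"] unfolding dF_def by simp
qed

lemma dF_fst: "dF f \<Longrightarrow> dF (\<lambda>x. fst (f x))"
  using dF_comp[OF dF_coordmap[of fst], of f] by simp_all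

lemma dF_snd: "dF f \<Longrightarrow> dF (\<lambda>x. snd (f x))"
  using dF_comp[OF dF_coordmap[of snd], of f] by simp_all

lemma dP_eq: "dF f \<Longrightarrow> dF g \<Longrightarrow> dP (\<lambda>x. f x = g x)"
  using dP_subst[OF dF_id[unfolded dF_def] dF_Pair, of g f] by simp

lemma dP_less_pairs: "dP (\<lambda>z :: real \<times> real. fst z < snd z)"
proof -
  have cs: "distinct [(1,0), (0,1)::real \<times> real]" "set [(1,0), (0,1)] = (Basis :: (real \<times> real) set)"
    by (auto simp: Basis_prod_def)
  have "coords [(1,0), (0,1)] ` Collect (\<lambda>z :: real \<times> real. fst z < snd z) = {[x, y] |x y. x < y}"
    by (auto simp: coords_def image_iff)
  then show ?thesis using dP_coords[OF cs] order by (simp add: numeral_2_eq_2)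
qed

lemma dP_graph2:
  assumes "{[x, y, h x y] |x y. True} \<in> D 3"
  shows "dP (\<lambda>z :: (real \<times> real) \<times> real. snd z = h (fst (fst z)) (snd (fst z)))"
proof -
  let ?cs = "[((1,0),0), ((0,1),0), ((0,0),1)] :: ((real \<times> real) \<times> real) list"
  have cs: "distinct ?cs" "set ?cs = (Basis :: ((real \<times> real) \<times> real) set)"
    by (auto simp: Basis_prod_def zero_prod_def)
  have "coords ?cs ` Collect (\<lambda>z :: (real \<times> real) \<times> real. snd z = h (fst (fst z)) (snd (fst z))) =
      {[x, y, h x y] |x y. True}"
    by (auto simp: coords_def image_iff)
  then show ?thesis using dP_coords[OF cs] assms by (simp add: numeral_3_eq_3)
qed

lemma dP_less: "dF f \<Longrightarrow> dF g \<Longrightarrow> dP (\<lambda>x. f x < (g x :: real))"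
  using dP_subst[OF dP_less_pairs dF_Pair, of f g] by simp

lemma dP_le: "dF f \<Longrightarrow> dF g \<Longrightarrow> dP (\<lambda>x. f x \<le> (g x :: real))"
  using dP_not[OF dP_less[of g f]] by (simp add: not_less)

lemma dF_add: "dF f \<Longrightarrow> dF g \<Longrightarrow> dF (\<lambda>x. f x + g x :: real)"
  using dF_comp[of "\<lambda>z. fst z + snd z" "\<lambda>x. (f x, g x)"] dP_graph2[OF addition] dF_Pair[of f g]
  unfolding dF_def by simp

lemma dF_mult: "dF f \<Longrightarrow> dF g \<Longrightarrow> dF (\<lambda>x. f x * g x :: real)"
  using dF_comp[of "\<lambda>z. fst z * snd z" "\<lambda>x. (f x, g x)"] dP_graph2[OF multiplication] dF_Pair[of f g]
  unfolding dF_def by simp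

lemma dF_const_real: "dF (\<lambda>x :: 'a::euclidean_space. c :: real)"
proof -
  have cs: "distinct [1::real]" "set [1] = (Basis :: real set)" by auto
  have "coords [1] ` Collect (\<lambda>x. x = c) = {[c]}" by (auto simp: coords_def)
  then have "dP (\<lambda>x. x = c)" using dP_coords[OF cs] singleton by simp
  then show ?thesis using dP_vimage[of "\<lambda>x. x = c" snd] unfolding dF_def
    by simp_all
qed

lemma dF_const_pair: "dF (\<lambda>x :: 'a::euclidean_space. c :: real \<times> real)"
  using dF_Pair[OF dF_const_real dF_const_real, of "fst c" "snd c"] by simp

lemma dF_if: "dP P \<Longrightarrow> dF f \<Longrightarrow> dF g \<Longrightarrow> dF (\<lambda>x. if P x then f x else g x)"
proof -
  assume P: "dP P" and f: "dF f" and g: "dF g"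
  have "dP (\<lambda>z. P (fst z) \<and> snd z = f (fst z) \<or> \<not> P (fst z) \<and> snd z = g (fst z))"
    using f g dP_vimage[OF P, of fst] unfolding dF_def
    by (intro dP_disj dP_conj dP_not) simp_all
  then show ?thesis unfolding dF_def by (simp add: if_splits cong: if_cong) (smt (verit) Collect_cong dP_def)
qed

lemmas dP_intros = dP_conj dP_disj dP_imp dP_const dP_ex dP_all dP_less dP_le dP_eq dP_not
lemmas dF_intros = dF_Pair dF_const_real dF_const_pair dF_add dF_mult dF_if dF_fst dF_snd dF_id

lemma dF_uminus: "dF f \<Longrightarrow> dF (\<lambda>x. - f x :: real)"
  using dF_mult[OF dF_const_real[of "-1"], of f] by simp

lemma dF_diff: "dF f \<Longrightarrow> dF g \<Longrightarrow> dF (\<lambda>x. f x - g x :: real)"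
  using dF_add[OF _ dF_uminus, of f g] by simp

lemma dF_inverse: "dF f \<Longrightarrow> dF (\<lambda>x. inverse (f x) :: real)"
proof -
  assume f: "dF f"
  have "dP (\<lambda>z::real\<times>real. fst z = 0 \<and> snd z = 0 \<or> fst z * snd z = 1)"
    by (intro dP_intros dF_intros)
  moreover have "(fst z = 0 \<and> snd z = 0 \<or> fst z * snd z = 1) = (snd z = inverse (fst z))" for z :: "real \<times> real"
    by (cases "fst z = 0") (auto simp: field_simps)
  ultimately have "dF (\<lambda>x::real. inverse x)" unfolding dF_def by simp
  from dF_comp[OF this f] show ?thesis .
qed

lemma dF_divide: "dF f \<Longrightarrow> dF g \<Longrightarrow> dF (\<lambda>x. f x / g x :: real)"
  using dF_mult[OF _ dF_inverse, of f g] by (simp add: divide_inverse)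

lemma dF_max: "dF f \<Longrightarrow> dF g \<Longrightarrow> dF (\<lambda>x. max (f x) (g x) :: real)"
  unfolding max_def by (intro dF_if dP_le)

lemma dF_min: "dF f \<Longrightarrow> dF g \<Longrightarrow> dF (\<lambda>x. min (f x) (g x) :: real)"
  unfolding min_def by (intro dF_if dP_le)

lemma dF_abs: "dF f \<Longrightarrow> dF (\<lambda>x. \<bar>f x\<bar> :: real)"
  unfolding abs_if by (intro dF_if dP_less dF_uminus dF_intros)

lemma dF_sum: "finite I \<Longrightarrow> (\<And>i. i \<in> I \<Longrightarrow> dF (f i)) \<Longrightarrow> dF (\<lambda>x. \<Sum>i\<in>I. f i x :: real)"
  by (induction rule: finite_induct) (auto intro!: dF_intros)

lemma dF_norm_pair: "dF f \<Longrightarrow> dF (\<lambda>x. norm (f x :: real \<times> real))"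
proof -
  assume f: "dF f"
  have "dP (\<lambda>z :: (real \<times> real) \<times> real. 0 \<le> snd z \<and>
      snd z * snd z = fst (fst z) * fst (fst z) + snd (fst z) * snd (fst z))"
    by (intro dP_intros dF_intros)
  moreover have "(0 \<le> snd z \<and>
      snd z * snd z = fst (fst z) * fst (fst z) + snd (fst z) * snd (fst z)) = (snd z = norm (fst z))"
    for z :: "(real \<times> real) \<times> real"
  proof (cases z)
    case (Pair ab c)
    obtain a b where ab: "ab = (a, b)" by fastforce
    have "0 \<le> c \<and> c * c = a * a + b * b \<longleftrightarrow> c = sqrt (a * a + b * b)"
      by (metis real_sqrt_ge_zero real_sqrt_mult_self real_sqrt_unique power2_eq_square abs_of_nonneg
          sum_squares_ge_zero)
    then show ?thesis by (simp add: Pair ab norm_prod_def power2_eq_square)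
  qed
  ultimately have "dF (norm :: real \<times> real \<Rightarrow> real)" unfolding dF_def by simp
  from dF_comp[OF this f] show ?thesis .
qed

lemmas dF_arith = dF_intros dF_uminus dF_diff dF_divide dF_max dF_min dF_abs dF_norm_pair

lemma definable_on_dP:
  "definable_on D X f \<longleftrightarrow> dP (\<lambda>z. fst z \<in> X \<and> snd z = f (fst z))"
proof -
  have "(\<lambda>x. (x, f x)) ` X = Collect (\<lambda>z. fst z \<in> X \<and> snd z = f (fst z))" by force
  then show ?thesis unfolding definable_on_def dP_def by simp
qed

lemma definable_onI: "dP (\<lambda>x. x \<in> X) \<Longrightarrow> dF f \<Longrightarrow> definable_on D X f"
  unfolding definable_on_dP dF_def
  by (intro dP_conj dP_vimage[of "\<lambda>x. x \<in> X" fst]) simp_all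

lemma definable_on_domain: "definable_on D X f \<Longrightarrow> dP (\<lambda>x. x \<in> X)"
  unfolding definable_on_dP by (drule dP_ex_prod) simp

text \<open>Extending by a definable map turns a map definable on a set into a definable total map, so that
  the rules for terms apply to it.\<close>

lemma definable_on_extend:
  fixes f g :: "'a::euclidean_space \<Rightarrow> 'b::euclidean_space"
  assumes "definable_on D X f" "dF g" shows "dF (\<lambda>x. if x \<in> X then f x else g x)"
proof -
  have "dP (\<lambda>z :: 'a \<times> 'b. \<not> fst z \<in> X)"
    using dP_vimage[OF definable_on_domain[OF assms(1)], of fst] by (intro dP_not) simp
  then have "dP (\<lambda>z. fst z \<in> X \<and> snd z = f (fst z) \<or> \<not> fst z \<in> X \<and> snd z = g (fst z))"
    using assms unfolding definable_on_dP dF_def by (simp add: dP_disj dP_conj)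
  moreover have "(fst z \<in> X \<and> snd z = f (fst z) \<or> \<not> fst z \<in> X \<and> snd z = g (fst z)) =
      (snd z = (if fst z \<in> X then f (fst z) else g (fst z)))" for z by auto
  ultimately show ?thesis unfolding dF_def by simp
qed

lemma exponents_iff: "r \<in> exponents D \<longleftrightarrow> dP (\<lambda>z :: real \<times> real. 0 < fst z \<and> snd z = fst z powr r)"
proof -
  have cs: "distinct [(1,0), (0,1)::real \<times> real]" "set [(1,0), (0,1)] = (Basis :: (real \<times> real) set)"
    by (auto simp: Basis_prod_def)
  have "coords [(1,0), (0,1)] ` Collect (\<lambda>z :: real \<times> real. 0 < fst z \<and> snd z = fst z powr r) =
      {[x, x powr r] |x. x > 0}"
    by (auto simp: coords_def image_iff)
  then show ?thesis using dP_coords[OF cs] by (simp add: exponents_def numeral_2_eq_2)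
qed

text \<open>The value \<open>0\<close> at nonpositive arguments makes the power a definable total function.\<close>

lemma dF_powr:
  assumes "r \<in> exponents D" "dF f"
  shows "dF (\<lambda>x. if 0 < f x then f x powr r else 0)"
proof -
  have "definable_on D {x. 0 < x} (\<lambda>x. x powr r)"
    using assms(1) by (simp add: definable_on_dP exponents_iff)
  then have "dF (\<lambda>x. if x \<in> {x. 0 < x} then x powr r else 0)"
    by (intro definable_on_extend dF_intros)
  from dF_comp[OF this assms(2)] show ?thesis by simp
qed

end

section \<open>Germs of definable functions of one variable\<close>

lemma eventually_interval_at_right:
  fixes I :: "real set"
  assumes "is_interval I"
  shows "eventually (\<lambda>x. x \<in> I) (at_right a) \<or> eventually (\<lambda>x. x \<notin> I) (at_right a)"
proof (cases "\<exists>b>a. \<forall>y>a. y < b \<longrightarrow> y \<notin> I")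
  case True then show ?thesis by (simp add: eventually_at_right_field)
next
  case False
  then obtain x where x: "a < x" "x \<in> I" by (metis gt_ex)
  have "y \<in> I" if y: "a < y" "y < x" for y
  proof -
    obtain z where "a < z" "z < y" "z \<in> I" using False y by blast
    then show ?thesis using assms x y unfolding is_interval_1 by (meson less_imp_le)
  qed
  then show ?thesis using x by (auto simp: eventually_at_right_field)
qed

text \<open>By compactness of \<open>[x, y]\<close>, finitely many of the given neighbourhoods lead from \<open>x\<close> to \<open>y\<close>.\<close>

lemma local_to_global_relation:
  fixes f :: "real \<Rightarrow> 'a"
  assumes "transp R"
    and r: "\<And>x. 0 < x \<Longrightarrow> x < e \<Longrightarrow> \<exists>b>x. \<forall>y. x < y \<and> y < b \<longrightarrow> R (f x) (f y)"
    and l: "\<And>x. 0 < x \<Longrightarrow> x < e \<Longrightarrow> \<exists>b<x. \<forall>y. b < y \<and> y < x \<longrightarrow> R (f y) (f x)"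
    and xy: "0 < x" "x < y" "y < e"
  shows "R (f x) (f y)"
proof -
  have "x < y \<longrightarrow> R (f x) (f y)"
  proof (rule Bolzano[where P = "\<lambda>a b. a < b \<longrightarrow> R (f a) (f b)"])
    show "x \<le> y" using xy by simp
    fix a b c assume "a < b \<longrightarrow> R (f a) (f b)" "b < c \<longrightarrow> R (f b) (f c)" "a \<le> b" "b \<le> c"
    then show "a < c \<longrightarrow> R (f a) (f c)" using assms(1) by (metis order_le_less transpD)
  next
    fix z assume z: "x \<le> z" "z \<le> y"
    then obtain b c where b: "b > z" "\<forall>y. z < y \<and> y < b \<longrightarrow> R (f z) (f y)"
      and c: "c < z" "\<forall>y. c < y \<and> y < z \<longrightarrow> R (f y) (f z)"
      using r[of z] l[of z] xy by force
    show "\<exists>d>0. \<forall>a b. a \<le> z \<and> z \<le> b \<and> b - a < d \<longrightarrow> a < b \<longrightarrow> R (f a) (f b)"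
    proof (intro exI conjI allI impI)
      show "min (b - z) (z - c) > 0" using b c by simp
      fix a' b' assume *: "a' \<le> z \<and> z \<le> b' \<and> b' - a' < min (b - z) (z - c)" "a' < b'"
      show "R (f a') (f b')"
        using * b(2)[rule_format, of b'] c(2)[rule_format, of a'] assms(1)
        by (cases "a' = z"; cases "b' = z") (auto dest: transpD)
    qed
  qed
  then show ?thesis using xy by simp
qed

text \<open>Distinct strict local minima have distinct rational intervals of strict minimality, so there are
  only countably many of them.\<close>

lemma not_all_strict_local_min:
  fixes f :: "real \<Rightarrow> 'a::linorder"
  assumes "e > 0"
    and "\<And>x. 0 < x \<Longrightarrow> x < e \<Longrightarrow> \<exists>a<x. \<exists>b>x. \<forall>y. a < y \<and> y < b \<and> y \<noteq> x \<longrightarrow> f x < f y"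
  shows False
proof -
  have "\<exists>p :: rat \<times> rat. of_rat (fst p) < x \<and> x < of_rat (snd p) \<and>
      (\<forall>y. of_rat (fst p) < y \<and> y < of_rat (snd p) \<and> y \<noteq> x \<longrightarrow> f x < f y)" if x: "x \<in> {0<..<e}" for x
  proof -
    obtain a b where ab: "a < x" "x < b" "\<And>y. a < y \<Longrightarrow> y < b \<Longrightarrow> y \<noteq> x \<Longrightarrow> f x < f y"
      using assms(2)[of x] x by auto
    obtain p q where "a < of_rat p" "of_rat p < x" "x < of_rat q" "of_rat q < b"
      using of_rat_dense ab by meson
    then show ?thesis using ab by (intro exI[of _ "(p, q)"]) auto
  qed
  then obtain P :: "real \<Rightarrow> rat \<times> rat" where P: "\<And>x. x \<in> {0<..<e} \<Longrightarrow>
      of_rat (fst (P x)) < x \<and> x < of_rat (snd (P x)) \<and>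
      (\<forall>y. of_rat (fst (P x)) < y \<and> y < of_rat (snd (P x)) \<and> y \<noteq> x \<longrightarrow> f x < f y)"
    by metis
  have "inj_on P {0<..<e}"
  proof (rule inj_onI, rule ccontr)
    fix x y assume xy: "x \<in> {0<..<e}" "y \<in> {0<..<e}" "P x = P y" "x \<noteq> y"
    then have "f x < f y" "f y < f x" using P[of x] P[of y] by auto
    then show False by simp
  qed
  moreover have "countable (P ` {0<..<e})" by (rule countableI_type)
  ultimately have "countable {0<..<e}" by (metis countable_image_inj_on)
  then show False using assms(1) uncountable_open_interval by blast
qed

lemma transp_real_relations: "transp ((<) :: real \<Rightarrow> _)" "transp ((>) :: real \<Rightarrow> _)" "transp ((=) :: real \<Rightarrow> _)"
  by (auto simp: transp_def)

context o_minimal_structure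
begin

lemma definable_at_right:
  assumes "dP (P :: real \<Rightarrow> bool)"
  shows "eventually P (at_right a) \<or> eventually (\<lambda>x. \<not> P x) (at_right a)"
proof -
  have cs: "distinct [1::real]" "set [1] = (Basis :: real set)" by auto
  have "coords [1] ` Collect P \<in> D 1" using dP_coords[OF cs] assms by simp
  from o_minimal[OF this] obtain \<I> where \<I>: "finite \<I>" "\<forall>I\<in>\<I>. is_interval I" "{x. [x] \<in> coords [1] ` Collect P} = \<Union>\<I>"
    by (elim exE conjE)
  have "eventually (\<lambda>x. x \<in> \<Union>\<I>) (at_right a) \<or> eventually (\<lambda>x. x \<notin> \<Union>\<I>) (at_right a)"
    using \<I>(1,2)
  proof (induction rule: finite_induct)
    case empty then show ?case by simp
  next
    case (insert I \<J>)
    then have "eventually (\<lambda>x. x \<in> I) (at_right a) \<or> eventually (\<lambda>x. x \<notin> I) (at_right a)"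
      by (simp add: eventually_interval_at_right)
    moreover have "eventually (\<lambda>x. x \<in> \<Union>\<J>) (at_right a) \<or> eventually (\<lambda>x. x \<notin> \<Union>\<J>) (at_right a)"
      using insert by simp
    moreover have "eventually (\<lambda>x. x \<in> \<Union>(insert I \<J>)) (at_right a)" if "eventually (\<lambda>x. x \<in> I) (at_right a)"
      using that by (rule eventually_mono) simp
    moreover have "eventually (\<lambda>x. x \<in> \<Union>(insert I \<J>)) (at_right a)" if "eventually (\<lambda>x. x \<in> \<Union>\<J>) (at_right a)"
      using that by (rule eventually_mono) simp
    moreover have "eventually (\<lambda>x. x \<notin> \<Union>(insert I \<J>)) (at_right a)"
      if "eventually (\<lambda>x. x \<notin> I) (at_right a)" "eventually (\<lambda>x. x \<notin> \<Union>\<J>) (at_right a)"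
      using that by eventually_elim simp
    ultimately show ?case by argo
  qed
  moreover have "P x \<longleftrightarrow> x \<in> \<Union>\<I>" for x
    unfolding \<I>(3)[symmetric] by (auto simp: coords_def)
  then have "P = (\<lambda>x. x \<in> \<Union>\<I>)" by (rule ext)
  ultimately show ?thesis by (simp only:)
qed

lemma definable_at_left:
  assumes "dP (P :: real \<Rightarrow> bool)"
  shows "eventually P (at_left a) \<or> eventually (\<lambda>x. \<not> P x) (at_left a)"
proof -
  have "dP (\<lambda>x. P (- x))" by (intro dP_subst[OF assms] dF_arith)
  from definable_at_right[OF this, of "- a"] show ?thesis
    by (simp add: at_left_minus eventually_filtermap)
qed

text \<open>The monotonicity theorem at \<open>0\<close>. To the right of a point, \<open>f\<close> is eventually above, below
  or equal to its value there, and similarly to the left; by o-minimality both behaviours are the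
  same at all points near \<open>0\<close>. Points where the two behaviours disagree are strict local extrema.\<close>

lemma definable_germ_monotone:
  fixes f :: "real \<Rightarrow> real"
  assumes f: "dF f"
  obtains e R where "e > 0" "R = (<) \<or> R = (>) \<or> R = (=)"
    "\<And>x y. 0 < x \<Longrightarrow> x < y \<Longrightarrow> y < e \<Longrightarrow> R (f x) (f y)"
proof -
  define rr where "rr R x = (\<exists>b. x < b \<and> (\<forall>y. x < y \<and> y < b \<longrightarrow> R (f x) (f y)))"
    for R :: "real \<Rightarrow> real \<Rightarrow> bool" and x
  define ll where "ll R x = (\<exists>b. b < x \<and> (\<forall>y. b < y \<and> y < x \<longrightarrow> R (f y) (f x)))"
    for R :: "real \<Rightarrow> real \<Rightarrow> bool" and x
  let ?\<R> = "{(<), (>), (=)} :: (real \<Rightarrow> real \<Rightarrow> bool) set"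
  have dR: "dP (\<lambda>z. R (s z) (t z))" if "R \<in> ?\<R>" "dF s" "dF t"
    for R and s t :: "'a::euclidean_space \<Rightarrow> real"
    using that dP_less[of s t] dP_less[of t s] dP_eq[of s t] by auto
  have drr: "dP (rr R)" "dP (ll R)" if "R \<in> ?\<R>" for R
    unfolding rr_def ll_def by (intro dP_intros dR that dF_comp[OF f] dF_arith)+
  have ex_r: "\<exists>R\<in>?\<R>. rr R x" for x
  proof -
    have 1: "dP (\<lambda>y. f x < f y)" "dP (\<lambda>y. f x > f y)" by (intro dP_intros dF_comp[OF f] dF_arith)+
    have "rr (<) x \<or> rr (>) x \<or> rr (=) x"
    proof (rule ccontr)
      assume "\<not> ?thesis"
      then have "\<not> eventually (\<lambda>y. f x < f y) (at_right x)" "\<not> eventually (\<lambda>y. f x > f y) (at_right x)"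
        "\<not> eventually (\<lambda>y. f x = f y) (at_right x)"
        unfolding rr_def eventually_at_right_field by blast+
      moreover then have "eventually (\<lambda>y. \<not> f x < f y) (at_right x)" "eventually (\<lambda>y. \<not> f x > f y) (at_right x)"
        using definable_at_right 1 by blast+
      then have "eventually (\<lambda>y. f x = f y) (at_right x)" by eventually_elim simp
      ultimately show False by blast
    qed
    then show ?thesis by auto
  qed
  have ex_l: "\<exists>R\<in>?\<R>. ll R x" for x
  proof -
    have 1: "dP (\<lambda>y. f y < f x)" "dP (\<lambda>y. f y > f x)" by (intro dP_intros dF_comp[OF f] dF_arith)+
    have "ll (<) x \<or> ll (>) x \<or> ll (=) x"
    proof (rule ccontr)
      assume "\<not> ?thesis"
      then have "\<not> eventually (\<lambda>y. f y < f x) (at_left x)" "\<not> eventually (\<lambda>y. f y > f x) (at_left x)"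
        "\<not> eventually (\<lambda>y. f y = f x) (at_left x)"
        unfolding ll_def eventually_at_left_field by blast+
      moreover then have "eventually (\<lambda>y. \<not> f y < f x) (at_left x)" "eventually (\<lambda>y. \<not> f y > f x) (at_left x)"
        using definable_at_left 1 by blast+
      then have "eventually (\<lambda>y. f y = f x) (at_left x)" by eventually_elim simp
      ultimately show False by blast
    qed
    then show ?thesis by auto
  qed
  \<comment> \<open>One of three alternatives that hold pointwise holds on a whole neighbourhood of \<open>0\<close>.\<close>
  have uniform: "\<exists>R\<in>?\<R>. eventually (Q R) (at_right 0)"
    if dQ: "\<And>R. R \<in> ?\<R> \<Longrightarrow> dP (Q R)" and ex: "\<And>x. \<exists>R\<in>?\<R>. Q R x" for Q :: "_ \<Rightarrow> real \<Rightarrow> bool"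
  proof (rule ccontr)
    assume "\<not> ?thesis"
    then have "eventually (\<lambda>x. \<not> Q R x) (at_right 0)" if "R \<in> ?\<R>" for R
      using definable_at_right[OF dQ[OF that], of 0] that by blast
    then have "eventually (\<lambda>x. \<not> Q (<) x) (at_right 0)" "eventually (\<lambda>x. \<not> Q (>) x) (at_right 0)"
      "eventually (\<lambda>x. \<not> Q (=) x) (at_right 0)" by blast+
    then have "eventually (\<lambda>x::real. False) (at_right 0)"
    proof eventually_elim
      case (elim x) then show ?case using ex[of x] by auto
    qed
    then show False by simp
  qed
  obtain R where R: "R \<in> ?\<R>" "eventually (rr R) (at_right 0)" using uniform[OF drr(1) ex_r] by blast
  obtain L where L: "L \<in> ?\<R>" "eventually (ll L) (at_right 0)" using uniform[OF drr(2) ex_l] by blast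
  have "eventually (\<lambda>x. rr R x \<and> ll L x) (at_right 0)" using R(2) L(2) by eventually_elim simp
  then obtain e where e: "e > 0" and RL: "\<And>x. 0 < x \<Longrightarrow> x < e \<Longrightarrow> rr R x \<and> ll L x"
    unfolding eventually_at_right_field by blast
  have "R = L"
  proof -
    have 1: "L = (=)" if R0: "R = (=)"
    proof -
      have "rr (=) (e/2)" using RL[of "e/2"] e R0 by simp
      then obtain b where b: "e/2 < b" "\<And>y. e/2 < y \<Longrightarrow> y < b \<Longrightarrow> f (e/2) = f y"
        unfolding rr_def by blast
      define y where "y = (e/2 + min b e) / 2"
      have y: "e/2 < y" "y < b" "y < e" "0 < y" using b(1) e by (auto simp: y_def min_def)
      obtain c where c: "c < y" "\<And>z. c < z \<Longrightarrow> z < y \<Longrightarrow> L (f z) (f y)"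
        using RL[of y] y unfolding ll_def by auto
      obtain z where "max c (e/2) < z" "z < y" using dense c(1) y(1) by (metis max_less_iff_conj)
      then have "L (f y) (f y)" using c(2)[of z] b(2)[of z] b(2)[of y] y by auto
      then show ?thesis using L(1) by auto
    qed
    have 2: "R = (=)" if L0: "L = (=)"
    proof -
      have "ll (=) (e/2)" using RL[of "e/2"] e L0 by simp
      then obtain b where b: "b < e/2" "\<And>y. b < y \<Longrightarrow> y < e/2 \<Longrightarrow> f y = f (e/2)"
        unfolding ll_def by blast
      define y where "y = (e/2 + max b 0) / 2"
      have y: "y < e/2" "b < y" "y < e" "0 < y" using b(1) e by (auto simp: y_def max_def)
      obtain c where c: "c > y" "\<And>z. y < z \<Longrightarrow> z < c \<Longrightarrow> R (f y) (f z)"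
        using RL[of y] y unfolding rr_def by auto
      obtain z where "z < min c (e/2)" "y < z" using dense c(1) y(1) by (metis min_less_iff_conj)
      then have "R (f y) (f y)" using c(2)[of z] b(2)[of z] b(2)[of y] y by auto
      then show ?thesis using R(1) by auto
    qed
    have 3: False if "R = (<)" "L = (>)"
    proof (rule not_all_strict_local_min[OF e, of f])
      fix x assume "0 < x" "x < e"
      from RL[OF this] that obtain a b where "a < x" "x < b" "\<forall>y. x < y \<and> y < b \<longrightarrow> f x < f y"
        "\<forall>y. a < y \<and> y < x \<longrightarrow> f x < f y" unfolding rr_def ll_def by auto
      then show "\<exists>a<x. \<exists>b>x. \<forall>y. a < y \<and> y < b \<and> y \<noteq> x \<longrightarrow> f x < f y"
        by (intro exI[of _ a] exI[of _ b] conjI) (auto simp: neq_iff)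
    qed
    have 4: False if "R = (>)" "L = (<)"
    proof (rule not_all_strict_local_min[OF e, of "\<lambda>x. - f x"])
      fix x assume "0 < x" "x < e"
      from RL[OF this] that obtain a b where "a < x" "x < b" "\<forall>y. x < y \<and> y < b \<longrightarrow> f x > f y"
        "\<forall>y. a < y \<and> y < x \<longrightarrow> f x > f y" unfolding rr_def ll_def by auto
      then show "\<exists>a<x. \<exists>b>x. \<forall>y. a < y \<and> y < b \<and> y \<noteq> x \<longrightarrow> - f x < - f y"
        by (intro exI[of _ a] exI[of _ b] conjI) (auto simp: neq_iff)
    qed
    show ?thesis using R(1) L(1) 1 2 3 4 by auto
  qed
  have "R (f x) (f y)" if "0 < x" "x < y" "y < e" for x y
  proof (rule local_to_global_relation[where e = e and f = f])
    show "transp R" using R(1) transp_real_relations by auto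
  qed (use RL \<open>R = L\<close> that in \<open>auto simp: rr_def ll_def\<close>)
  then show ?thesis using that e R(1) by blast
qed

text \<open>Each real \<open>c\<close> is eventually a lower bound of \<open>f\<close>, or eventually an upper bound; the limit is the cut
  between the two kinds.\<close>

lemma definable_germ_limit:
  fixes f :: "real \<Rightarrow> real"
  assumes f: "dF f"
  shows "\<exists>L. ((\<lambda>x. ereal (f x)) \<longlongrightarrow> L) (at_right 0)"
proof
  define L where "L = Sup {ereal c |c. eventually (\<lambda>x. c < f x) (at_right 0)}"
  have dich: "eventually (\<lambda>x. c < f x) (at_right 0) \<or> eventually (\<lambda>x. \<not> c < f x) (at_right 0)" for c
    by (intro definable_at_right dP_intros f dF_arith)
  show "((\<lambda>x. ereal (f x)) \<longlongrightarrow> L) (at_right 0)"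
  proof (rule order_tendstoI)
    fix a assume "a < L"
    then obtain c where c: "a < ereal c" "eventually (\<lambda>x. c < f x) (at_right 0)"
      unfolding L_def less_Sup_iff by auto
    show "eventually (\<lambda>x. a < ereal (f x)) (at_right 0)"
      using c(2)
    proof eventually_elim
      case (elim x)
      then have "ereal c < ereal (f x)" by simp
      with c(1) show ?case by (rule less_trans)
    qed
  next
    fix a assume "L < a"
    then obtain c where c: "L < ereal c" "ereal c < a" using ereal_dense2 by blast
    have "\<not> eventually (\<lambda>x. c < f x) (at_right 0)"
    proof
      assume "eventually (\<lambda>x. c < f x) (at_right 0)"
      then have "ereal c \<in> {ereal c |c. eventually (\<lambda>x. c < f x) (at_right 0)}" by blast
      then have "ereal c \<le> L" unfolding L_def by (rule Sup_upper)
      then show False using c(1) by simp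
    qed
    then have "eventually (\<lambda>x. \<not> c < f x) (at_right 0)" using dich by blast
    then show "eventually (\<lambda>x. ereal (f x) < a) (at_right 0)"
    proof eventually_elim
      case (elim x)
      then have "ereal (f x) \<le> ereal c" by simp
      then show ?case using c(2) by (rule le_less_trans)
    qed
  qed
qed

lemma exponents_iff_dF: "r \<in> exponents D \<longleftrightarrow> dF (\<lambda>x :: real. if 0 < x then x powr r else 0)"
proof
  assume "r \<in> exponents D"
  from dF_powr[OF this dF_id] show "dF (\<lambda>x :: real. if 0 < x then x powr r else 0)" .
next
  assume "dF (\<lambda>x :: real. if 0 < x then x powr r else 0)"
  then have "dP (\<lambda>z :: real \<times> real. 0 < fst z \<and> snd z = (if 0 < fst z then fst z powr r else 0))"
    unfolding dF_def by (intro dP_conj dP_less dF_arith)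
  then show "r \<in> exponents D" unfolding exponents_iff by (simp cong: conj_cong)
qed

lemma exponents_0: "0 \<in> exponents D" and exponents_1: "1 \<in> exponents D"
proof -
  have "dF (\<lambda>x :: real. if 0 < x then 1 else 0 :: real)" "dF (\<lambda>x :: real. if 0 < x then x else 0 :: real)"
    by (intro dF_arith dP_intros)+
  then show "0 \<in> exponents D" "1 \<in> exponents D" by (simp_all add: exponents_iff_dF cong: if_cong)
qed

lemma exponents_add: "r \<in> exponents D \<Longrightarrow> s \<in> exponents D \<Longrightarrow> r + s \<in> exponents D"
proof -
  assume "r \<in> exponents D" "s \<in> exponents D"
  then have "dF (\<lambda>x :: real. (if 0 < x then x powr r else 0) * (if 0 < x then x powr s else 0))"
    by (intro dF_mult) (simp_all add: exponents_iff_dF)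
  moreover have "(if 0 < x then x powr r else 0) * (if 0 < x then x powr s else 0) =
      (if 0 < x then x powr (r + s) else 0)" for x :: real by (simp add: powr_add)
  ultimately show ?thesis by (simp add: exponents_iff_dF)
qed

lemma exponents_uminus: "r \<in> exponents D \<Longrightarrow> - r \<in> exponents D"
proof -
  assume "r \<in> exponents D"
  then have "dF (\<lambda>x :: real. inverse (if 0 < x then x powr r else 0))"
    by (intro dF_inverse) (simp add: exponents_iff_dF)
  moreover have "inverse (if 0 < x then x powr r else 0) = (if 0 < x then x powr - r else 0)" for x :: real
    by (simp add: powr_minus)
  ultimately show ?thesis by (simp add: exponents_iff_dF)
qed

lemma exponents_diff: "r \<in> exponents D \<Longrightarrow> s \<in> exponents D \<Longrightarrow> r - s \<in> exponents D"
  using exponents_add[of r "- s"] exponents_uminus[of s] by simp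

lemma exponents_mult: "r \<in> exponents D \<Longrightarrow> s \<in> exponents D \<Longrightarrow> r * s \<in> exponents D"
proof -
  assume "r \<in> exponents D" "s \<in> exponents D"
  from dF_powr[OF this(2) this(1)[unfolded exponents_iff_dF]]
  have "dF (\<lambda>x :: real. if 0 < (if 0 < x then x powr r else 0) then (if 0 < x then x powr r else 0) powr s else 0)" .
  moreover have "(if 0 < (if 0 < x then x powr r else 0) then (if 0 < x then x powr r else 0) powr s else 0) =
     (if 0 < x then x powr (r * s) else 0)" for x :: real
    by (auto simp: powr_powr)
  ultimately show ?thesis by (simp add: exponents_iff_dF)
qed

lemma exponents_inverse: "r \<in> exponents D \<Longrightarrow> inverse r \<in> exponents D"
proof (cases "r = 0")
  case True then show ?thesis using exponents_0 by simp
next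
  case False
  assume "r \<in> exponents D"
  then have "dP (\<lambda>z :: real \<times> real. 0 < fst z \<and> snd z = fst z powr r)" by (simp add: exponents_iff)
  from dP_vimage[OF this, of "\<lambda>z. (snd z, fst z)"]
  have "dP (\<lambda>z :: real \<times> real. 0 < snd z \<and> fst z = snd z powr r)" by simp
  moreover have "0 < snd z \<and> fst z = snd z powr r \<longleftrightarrow> 0 < fst z \<and> snd z = fst z powr (inverse r)"
    for z :: "real \<times> real" using False by (auto simp: powr_powr)
  ultimately show ?thesis by (simp add: exponents_iff)
qed

lemma exponents_divide: "r \<in> exponents D \<Longrightarrow> s \<in> exponents D \<Longrightarrow> r / s \<in> exponents D"
  by (simp add: divide_inverse exponents_mult exponents_inverse)

lemma exponents_of_nat: "of_nat n \<in> exponents D"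
  by (induction n) (auto intro: exponents_add exponents_0 exponents_1)

end

section \<open>Orders of growth lie in the field of exponents\<close>

text \<open>Monotonicity squeezes \<open>L (n * x) = n * L x\<close> between the values of \<open>L\<close> at the integers next to \<open>n * x\<close>, so the
  deviation of \<open>L x\<close> from \<open>L 1 * x\<close> is at most \<open>L 1 / n\<close>.\<close>

lemma additive_monotone_imp_linear:
  fixes L :: "real \<Rightarrow> real"
  assumes add: "\<And>x y. L (x + y) = L x + L y" and mono: "\<And>x y. x \<le> y \<Longrightarrow> L x \<le> L y"
  shows "L x = L 1 * x"
proof -
  have L0: "L 0 = 0" using add[of 0 0] by simp
  have nat: "L (of_nat n * y) = of_nat n * L y" for n y
    by (induction n) (auto simp: L0 add algebra_simps)
  have neg: "L (- y) = - L y" for y using add[of y "- y"] L0 by simp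
  have int: "L (of_int k) = of_int k * L 1" for k
    by (cases k rule: int_cases2) (use nat[of _ 1] neg in auto)
  have L1: "L 1 \<ge> 0" using mono[of 0 1] L0 by simp
  have bound: "of_nat n * \<bar>L x - L 1 * x\<bar> \<le> L 1" for n
  proof -
    let ?k = "\<lfloor>of_nat n * x\<rfloor>"
    have k: "of_int ?k \<le> of_nat n * x" "of_nat n * x \<le> of_int (?k + 1)" by linarith+
    then have "of_int ?k * L 1 \<le> of_nat n * L x" "of_nat n * L x \<le> of_int (?k + 1) * L 1"
      using mono[OF k(1)] mono[OF k(2)] int nat by metis+
    moreover have "of_int ?k * L 1 \<le> of_nat n * x * L 1" "of_nat n * x * L 1 \<le> of_int (?k + 1) * L 1"
      using k L1 by (auto intro: mult_right_mono)
    ultimately have "\<bar>of_nat n * (L x - L 1 * x)\<bar> \<le> L 1" by (auto simp: algebra_simps abs_le_iff)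
    then show ?thesis by (simp add: abs_mult)
  qed
  show ?thesis
  proof (rule ccontr)
    assume "L x \<noteq> L 1 * x"
    then have "\<bar>L x - L 1 * x\<bar> > 0" by simp
    then obtain n where "L 1 < of_nat n * \<bar>L x - L 1 * x\<bar>" using reals_Archimedean3 by blast
    then show False using bound[of n] by simp
  qed
qed

lemma filterlim_scale_at_right_0: "t > 0 \<Longrightarrow> filterlim (\<lambda>x::real. t * x) (at_right 0) (at_right 0)"
  unfolding filterlim_at
  by (auto simp: eventually_at_right_field intro!: tendsto_eq_intros)

lemma multiplicative_monotone_imp_powr:
  fixes \<phi> :: "real \<Rightarrow> real"
  assumes pos: "\<And>t. t > 0 \<Longrightarrow> \<phi> t > 0"
    and mult: "\<And>s t. s > 0 \<Longrightarrow> t > 0 \<Longrightarrow> \<phi> (s * t) = \<phi> s * \<phi> t"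
    and mono: "(\<forall>s t. 0 < s \<longrightarrow> s \<le> t \<longrightarrow> \<phi> s \<le> \<phi> t) \<or> (\<forall>s t. 0 < s \<longrightarrow> s \<le> t \<longrightarrow> \<phi> t \<le> \<phi> s)"
  obtains r where "\<And>t. t > 0 \<Longrightarrow> \<phi> t = t powr r"
proof -
  define L where "L x = ln (\<phi> (exp x))" for x
  have add: "L (x + y) = L x + L y" for x y
    using pos[of "exp x"] pos[of "exp y"] by (simp add: L_def exp_add mult ln_mult)
  have "L x = L 1 * x" for x
    using mono
  proof
    assume *: "\<forall>s t. 0 < s \<longrightarrow> s \<le> t \<longrightarrow> \<phi> s \<le> \<phi> t"
    have "L x \<le> L y" if "x \<le> y" for x y
      unfolding L_def using * that pos by simp
    then show ?thesis by (rule additive_monotone_imp_linear[OF add])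
  next
    assume *: "\<forall>s t. 0 < s \<longrightarrow> s \<le> t \<longrightarrow> \<phi> t \<le> \<phi> s"
    have "- L x \<le> - L y" if "x \<le> y" for x y
      unfolding L_def using * that pos by simp
    then have "- L x = - L 1 * x" by (intro additive_monotone_imp_linear[of "\<lambda>x. - L x"]) (simp_all add: add)
    then show ?thesis by simp
  qed
  then have "\<phi> t = t powr L 1" if "t > 0" for t
  proof -
    have "ln (\<phi> t) = L 1 * ln t" using that \<open>\<And>x. L x = L 1 * x\<close>[of "ln t"] L_def[of "ln t"] by simp
    then show ?thesis using pos[OF that] that by (metis exp_ln powr_def less_irrefl mult.commute)
  qed
  then show ?thesis by (rule that)
qed

context polynomially_bounded_structure
begin

lemma polynomially_bounded_dF: "dF (f :: real \<Rightarrow> real) \<Longrightarrow> \<exists>N::nat. \<forall>\<^sub>F x in at_top. \<bar>f x\<bar> \<le> x ^ N"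
proof (rule polynomially_bounded)
  assume f: "dF f"
  have cs: "distinct [(1,0), (0,1)::real \<times> real]" "set [(1,0), (0,1)] = (Basis :: (real \<times> real) set)"
    by (auto simp: Basis_prod_def)
  have "coords [(1,0), (0,1)] ` Collect (\<lambda>z :: real \<times> real. snd z = f (fst z)) = {[x, f x] |x. True}"
    by (auto simp: coords_def image_iff)
  then show "{[x, f x] |x. True} \<in> D 2"
    using f dP_coords[OF cs] by (simp add: dF_def numeral_2_eq_2)
qed

text \<open>Polynomial boundedness at infinity, applied to \<open>y \<mapsto> 1 / g (1 / y)\<close>.\<close>

lemma polynomial_lower_bound:
  fixes g :: "real \<Rightarrow> real"
  assumes g: "dF g" and pos: "eventually (\<lambda>x. g x > 0) (at_right 0)"
  shows "\<exists>N::nat. eventually (\<lambda>x. x ^ N \<le> g x) (at_right 0)"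
proof -
  have "dF (\<lambda>y. inverse (g (inverse y)))" by (intro dF_inverse dF_comp[OF g] dF_arith)
  from polynomially_bounded_dF[OF this]
  obtain N where "\<forall>\<^sub>F y in at_top. \<bar>inverse (g (inverse y))\<bar> \<le> y ^ N"
    by (elim exE)
  then have "\<forall>\<^sub>F y in at_top. \<bar>inverse (g (inverse y))\<bar> \<le> inverse (inverse y) ^ N" by simp
  then have "\<forall>\<^sub>F x in at_right 0. \<bar>inverse (g x)\<bar> \<le> inverse x ^ N"
    unfolding eventually_at_right_to_top by simp
  moreover have "\<forall>\<^sub>F x in at_right 0. (x::real) > 0" by (simp add: eventually_at_right_less)
  ultimately have "\<forall>\<^sub>F x in at_right 0. x ^ N \<le> g x"
    using pos
  proof eventually_elim
    case (elim x)
    then have "inverse (g x) \<le> inverse (x ^ N)" by (simp add: power_inverse)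
    then show ?case using elim(3) by (rule inverse_le_imp_le)
  qed
  then show ?thesis by blast
qed

text \<open>If the ratio tended to infinity, then \<open>g\<close> would decrease faster than any power of \<open>x\<close> along
  the geometric sequence \<open>x / t ^ n\<close>.\<close>

lemma ratio_not_infinite:
  fixes g :: "real \<Rightarrow> real"
  assumes g: "dF g" and pos: "eventually (\<lambda>x. g x > 0) (at_right 0)" and t: "t > 1"
  shows "\<not> filterlim (\<lambda>x. g (t * x) / g x) at_top (at_right 0)"
proof
  assume lim: "filterlim (\<lambda>x. g (t * x) / g x) at_top (at_right 0)"
  obtain N :: nat where N: "eventually (\<lambda>x. x ^ N \<le> g x) (at_right 0)"
    using polynomial_lower_bound[OF g pos] by blast
  define M where "M = 2 * t ^ N"
  have "eventually (\<lambda>x. g (t * x) / g x \<ge> M) (at_right 0)"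
    using lim by (simp add: filterlim_at_top)
  then have "eventually (\<lambda>x. x ^ N \<le> g x \<and> g x > 0 \<and> g (t * x) \<ge> M * g x) (at_right 0)"
    using N pos by eventually_elim (simp add: pos_le_divide_eq)
  then obtain e where e: "e > 0" and E: "\<And>x. 0 < x \<Longrightarrow> x < e \<Longrightarrow> x ^ N \<le> g x \<and> g x > 0 \<and> g (t * x) \<ge> M * g x"
    unfolding eventually_at_right_field by blast
  define a where "a = e / 2"
  have a: "0 < a" "a < e" using e by (auto simp: a_def)
  have xn: "0 < a / t ^ n" "a / t ^ n < e" for n
  proof -
    show "0 < a / t ^ n" using a t by simp
    have "a / t ^ n \<le> a" using a t one_le_power[of t n] by (simp add: divide_le_eq)
    then show "a / t ^ n < e" using a by simp
  qed
  have "M ^ n * g (a / t ^ n) \<le> g a" for n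
  proof (induction n)
    case (Suc n)
    have "M * g (a / t ^ Suc n) \<le> g (t * (a / t ^ Suc n))" using E[OF xn[of "Suc n"]] by simp
    also have "t * (a / t ^ Suc n) = a / t ^ n" using t by simp
    finally have "M ^ n * (M * g (a / t ^ Suc n)) \<le> M ^ n * g (a / t ^ n)"
      using t by (intro mult_left_mono) (auto simp: M_def)
    then show ?case using Suc by (simp add: algebra_simps)
  qed simp
  then have "M ^ n * (a / t ^ n) ^ N \<le> g a" for n
    using E[OF xn[of n]] t by (smt (verit) M_def mult_left_mono zero_le_power zero_le_mult_iff)
  moreover have "M ^ n * (a / t ^ n) ^ N = 2 ^ n * a ^ N" for n
    using t by (simp add: M_def power_mult_distrib power_divide field_simps flip: power_mult)
  ultimately have bnd: "2 ^ n * a ^ N \<le> g a" for n by simp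
  obtain n where "g a / a ^ N < 2 ^ n" using real_arch_pow[of 2] by auto
  then show False using bnd[of n] a by (simp add: divide_less_eq)
qed

text \<open>The limit exists in \<open>[0, \<infinity>]\<close> by o-minimality; the values \<open>0\<close> and \<open>\<infinity>\<close> are excluded by
  the growth bound for \<open>1 / g\<close> and \<open>g\<close>.\<close>

lemma ratio_limit:
  fixes g :: "real \<Rightarrow> real"
  assumes g: "dF g" and pos: "eventually (\<lambda>x. g x > 0) (at_right 0)" and t: "t > 0"
  shows "\<exists>l>0. ((\<lambda>x. g (t * x) / g x) \<longlongrightarrow> l) (at_right 0)"
proof -
  have pos': "eventually (\<lambda>x. g (t * x) > 0) (at_right 0)" if "t > 0" for t
    using filterlim_scale_at_right_0[OF that] pos by (rule eventually_compose_filterlim[rotated])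
  have *: "\<exists>l>0. ((\<lambda>x. g (t * x) / g x) \<longlongrightarrow> l) (at_right 0)" if t: "t > 1" for t
  proof -
    have "dF (\<lambda>x. g (t * x) / g x)" by (intro dF_arith dF_comp[OF g])
    from definable_germ_limit[OF this]
    obtain L where L: "((\<lambda>x. ereal (g (t * x) / g x)) \<longlongrightarrow> L) (at_right 0)"
      by (elim exE)
    have pt: "eventually (\<lambda>x. g (t * x) / g x > 0) (at_right 0)"
    proof -
      have "eventually (\<lambda>x. g (t * x) > 0) (at_right 0)" using pos'[of t] t by simp
      with pos show ?thesis by eventually_elim simp
    qed
    have "L \<ge> 0" by (rule tendsto_lowerbound[OF L]) (use pt in \<open>auto elim: eventually_mono\<close>)
    moreover have "L \<noteq> \<infinity>"
      using ratio_not_infinite[OF g pos t] L by (auto simp: tendsto_PInfty_eq_at_top)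
    moreover have "L \<noteq> 0"
    proof
      assume "L = 0"
      then have "((\<lambda>x. g (t * x) / g x) \<longlongrightarrow> 0) (at_right 0)" using L by (simp add: zero_ereal_def)
      then have "filterlim (\<lambda>x. inverse (g (t * x) / g x)) at_top (at_right 0)"
        using pt by (rule filterlim_inverse_at_top)
      then have "filterlim (\<lambda>x. inverse (g (t * x)) / inverse (g x)) at_top (at_right 0)"
        by (simp add: divide_inverse mult.commute)
      moreover have "dF (\<lambda>x. inverse (g x))" by (intro dF_inverse g)
      moreover have "eventually (\<lambda>x. inverse (g x) > 0) (at_right 0)"
        using pos by eventually_elim simp
      ultimately show False using ratio_not_infinite[of "\<lambda>x. inverse (g x)", OF _ _ t] by simp
    qed
    ultimately obtain l where "L = ereal l" "l > 0" by (cases L) (auto simp: zero_ereal_def)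
    then show ?thesis using L by auto
  qed
  consider "t > 1" | "t = 1" | "t < 1" by linarith
  then show ?thesis
  proof cases
    case 1 then show ?thesis using * by blast
  next
    case 2
    have "((\<lambda>x. g (t * x) / g x) \<longlongrightarrow> 1) (at_right 0)"
      by (rule tendsto_eventually) (use pos 2 in \<open>auto elim: eventually_mono\<close>)
    then show ?thesis by (intro exI[of _ 1]) simp
  next
    case 3
    then have "inverse t > 1" using t by (simp add: one_less_inverse)
    then obtain l where l: "l > 0" "((\<lambda>x. g (inverse t * x) / g x) \<longlongrightarrow> l) (at_right 0)" using * by blast
    from filterlim_compose[OF l(2) filterlim_scale_at_right_0[OF t]]
    have "((\<lambda>x. g x / g (t * x)) \<longlongrightarrow> l) (at_right 0)" using t by (simp add: field_simps)
    from tendsto_inverse[OF this] l(1) show ?thesis by (intro exI[of _ "inverse l"]) simp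
  qed
qed

text \<open>A definable function that is slowly varying and tends to infinity has an inverse that grows
  faster than every power.\<close>

lemma slowly_varying_not_infinite:
  fixes G :: "real \<Rightarrow> real"
  assumes G: "dF G" and pos: "eventually (\<lambda>x. G x > 0) (at_right 0)"
    and slow: "((\<lambda>x. G (1/2 * x) / G x) \<longlongrightarrow> 1) (at_right 0)"
  shows "\<not> filterlim G at_top (at_right 0)"
proof
  assume lim: "filterlim G at_top (at_right 0)"
  obtain e R where e: "e > 0" and R: "R = (<) \<or> R = (>) \<or> R = (=)"
    and mono: "\<And>x y. 0 < x \<Longrightarrow> x < y \<Longrightarrow> y < e \<Longrightarrow> R (G x) (G y)"
    using definable_germ_monotone[OF G] by blast
  have inj: "x = y" if "0 < x" "x < e" "0 < y" "y < e" "G x = G y" for x y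
  proof (rule ccontr)
    assume "x \<noteq> y"
    then have "R (G x) (G x)" using mono[of x y] mono[of y x] that by (auto simp: neq_iff)
    then have "R = (=)" using R by auto
    have "eventually (\<lambda>z. G z > G (e/2)) (at_right 0)" using lim by (simp add: filterlim_at_top_dense)
    moreover have "eventually (\<lambda>z. z < e/2 \<and> 0 < z) (at_right 0)"
      using e unfolding eventually_at_right_field by (intro exI[of _ "e/2"]) simp
    ultimately have "eventually (\<lambda>z::real. False) (at_right 0)"
    proof eventually_elim
      case (elim z) then show ?case using mono[of z "e/2"] \<open>R = (=)\<close> e by auto
    qed
    then show False by simp
  qed
  define S where "S y x \<longleftrightarrow> 0 < x \<and> x < e \<and> G x = y" for x y
  \<comment> \<open>\<open>H y\<close> is \<open>1 / x\<close> for the solution \<open>x\<close> of \<open>G x = y\<close>; it is unique since \<open>G\<close> is strictly monotone.\<close>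
  define H where "H y = (if \<exists>x. S y x then inverse (THE x. S y x) else 0)" for y
  have HG: "H (G x) = inverse x" if "0 < x" "x < e" for x
  proof -
    have "(THE x'. S (G x) x') = x" using inj that by (auto simp: S_def)
    moreover have "S (G x) x" using that by (simp add: S_def)
    ultimately show ?thesis unfolding H_def by auto
  qed
  have "dP (\<lambda>z. (\<exists>x. (0 < x \<and> x < e \<and> G x = fst z) \<and> snd z = inverse x) \<or>
      (\<forall>x. \<not> (0 < x \<and> x < e \<and> G x = fst z)) \<and> snd z = 0)"
    by (intro dP_intros dF_comp[OF G] dF_inverse dF_arith)
  moreover have "((\<exists>x. (0 < x \<and> x < e \<and> G x = fst z) \<and> snd z = inverse x) \<or>
      (\<forall>x. \<not> (0 < x \<and> x < e \<and> G x = fst z)) \<and> snd z = 0) \<longleftrightarrow> snd z = H (fst z)" for z :: "real \<times> real"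
  proof (cases "\<exists>x. S (fst z) x")
    case True
    then obtain x where x: "0 < x" "x < e" "G x = fst z" by (auto simp: S_def)
    then show ?thesis using HG[of x] inj by (auto 4 3)
  next
    case False
    then show ?thesis by (auto simp: S_def H_def)
  qed
  ultimately have "dF H" unfolding dF_def by simp
  from polynomially_bounded_dF[OF this] obtain N where "\<forall>\<^sub>F y in at_top. \<bar>H y\<bar> \<le> y ^ N" by (elim exE)
  then have "\<forall>\<^sub>F x in at_right 0. \<bar>H (G x)\<bar> \<le> G x ^ N"
    using lim by (rule eventually_compose_filterlim)
  moreover have "eventually (\<lambda>z. z < e \<and> 0 < z) (at_right 0)"
    using e unfolding eventually_at_right_field by (intro exI[of _ e]) simp
  ultimately have 1: "\<forall>\<^sub>F x in at_right 0. inverse x \<le> G x ^ N"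
    by eventually_elim (use HG in auto)
  \<comment> \<open>Along \<open>a / 2 ^ n\<close>, slow variation makes \<open>G\<close> grow at most like \<open>q ^ n\<close>, and \<open>G ^ N\<close> at most like
     \<open>(3/2) ^ n\<close>, whereas \<open>1 / x\<close> grows like \<open>2 ^ n\<close>.\<close>
  define q :: real where "q = (3/2) powr (1 / of_nat (Suc N))"
  have q: "q > 1" unfolding q_def by (intro gr_one_powr) auto
  have "q ^ N \<le> q ^ Suc N" using q by (intro power_increasing) auto
  also have "q ^ Suc N = q powr of_nat (Suc N)" using q by (intro powr_realpow[symmetric]) simp
  also have "\<dots> = 3/2" unfolding q_def powr_powr by simp
  finally have qN: "q ^ N \<le> 3/2" .
  have "\<forall>\<^sub>F x in at_right 0. G (1/2 * x) / G x < q" using order_tendstoD(2)[OF slow q] .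
  with 1 pos have "\<forall>\<^sub>F x in at_right 0. inverse x \<le> G x ^ N \<and> G x > 0 \<and> G (1/2 * x) \<le> q * G x"
    by eventually_elim (simp add: divide_less_eq)
  then obtain d where d: "d > 0" and E: "\<And>x. 0 < x \<Longrightarrow> x < d \<Longrightarrow>
      inverse x \<le> G x ^ N \<and> G x > 0 \<and> G (1/2 * x) \<le> q * G x"
    unfolding eventually_at_right_field by blast
  define a where "a = d / 2"
  have a: "0 < a" "a < d" using d by (auto simp: a_def)
  have xn: "0 < a / 2 ^ n" "a / 2 ^ n < d" for n
  proof -
    show "0 < a / 2 ^ n" using a by simp
    have "a / 2 ^ n \<le> a" using a one_le_power[of "2::real" n] by (simp add: divide_le_eq)
    then show "a / 2 ^ n < d" using a by simp
  qed
  have Gn: "G (a / 2 ^ n) \<le> q ^ n * G a" for n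
  proof (induction n)
    case (Suc n)
    have "G (a / 2 ^ Suc n) \<le> q * G (a / 2 ^ n)" using E[OF xn[of n]] by (simp add: field_simps)
    also have "\<dots> \<le> q * (q ^ n * G a)" using Suc q by (intro mult_left_mono) auto
    finally show ?case by simp
  qed simp
  have bnd: "2 ^ n / a \<le> (3/2) ^ n * G a ^ N" for n
  proof -
    have "2 ^ n / a = inverse (a / 2 ^ n)" by simp
    also have "\<dots> \<le> G (a / 2 ^ n) ^ N" using E[OF xn[of n]] by simp
    also have "\<dots> \<le> (q ^ n * G a) ^ N" using Gn[of n] E[OF xn[of n]] by (intro power_mono) auto
    also have "\<dots> = (q ^ N) ^ n * G a ^ N" by (simp add: power_mult_distrib flip: power_mult) (simp add: mult.commute)
    also have "\<dots> \<le> (3/2) ^ n * G a ^ N"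
      using qN q E[of a] a by (intro mult_right_mono power_mono) auto
    finally show ?thesis .
  qed
  obtain n where "a * G a ^ N < (4/3) ^ n" using real_arch_pow[of "4/3"] by auto
  then have "(3/2) ^ n * (a * G a ^ N) < (3/2) ^ n * (4/3) ^ n" by simp
  also have "\<dots> = 2 ^ n" by (simp flip: power_mult_distrib)
  finally show False using bnd[of n] a by (simp add: field_simps)
qed

lemma slowly_varying_limit:
  fixes G :: "real \<Rightarrow> real"
  assumes G: "dF G" and pos: "eventually (\<lambda>x. G x > 0) (at_right 0)"
    and slow: "((\<lambda>x. G (1/2 * x) / G x) \<longlongrightarrow> 1) (at_right 0)"
  shows "\<exists>c>0. (G \<longlongrightarrow> c) (at_right 0)"
proof -
  obtain L where L: "((\<lambda>x. ereal (G x)) \<longlongrightarrow> L) (at_right 0)" using definable_germ_limit[OF G] by (elim exE)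
  have "L \<ge> 0" by (rule tendsto_lowerbound[OF L]) (use pos in \<open>auto elim: eventually_mono\<close>)
  moreover have "L \<noteq> \<infinity>"
    using slowly_varying_not_infinite[OF G pos slow] L by (auto simp: tendsto_PInfty_eq_at_top)
  moreover have "L \<noteq> 0"
  proof
    assume "L = 0"
    then have "(G \<longlongrightarrow> 0) (at_right 0)" using L by (simp add: zero_ereal_def)
    then have "filterlim (\<lambda>x. inverse (G x)) at_top (at_right 0)" using pos by (rule filterlim_inverse_at_top)
    moreover have "dF (\<lambda>x. inverse (G x))" by (intro dF_inverse G)
    moreover have "eventually (\<lambda>x. inverse (G x) > 0) (at_right 0)" using pos by eventually_elim simp
    moreover have "((\<lambda>x. inverse (G (1/2 * x)) / inverse (G x)) \<longlongrightarrow> 1) (at_right 0)"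
    proof -
      have "inverse (a / b) = inverse a / inverse b" for a b :: real by (simp add: field_simps)
      then show ?thesis using tendsto_inverse[OF slow] by (simp only: inverse_1 zero_neq_one not_False_eq_True)
    qed
    ultimately show False using slowly_varying_not_infinite[of "\<lambda>x. inverse (G x)"] by simp
  qed
  ultimately obtain l where "L = ereal l" "l > 0" by (cases L) (auto simp: zero_ereal_def)
  then show ?thesis using L by auto
qed

text \<open>Miller's theorem: \<open>g (t * x) / g x\<close> tends to a multiplicative function of \<open>t\<close>, that is to a
  power \<open>t powr r\<close>; this power is definable as a limit of a definable family, and
  \<open>g x / x powr r\<close> varies slowly.\<close>

theorem definable_germ_order:
  fixes g :: "real \<Rightarrow> real"
  assumes g: "dF g" and pos: "eventually (\<lambda>x. g x > 0) (at_right 0)"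
  obtains r c where "r \<in> exponents D" "c > 0" "((\<lambda>x. g x / x powr r) \<longlongrightarrow> c) (at_right 0)"
proof -
  define \<phi> where "\<phi> t = (SOME l. l > 0 \<and> ((\<lambda>x. g (t * x) / g x) \<longlongrightarrow> l) (at_right 0))" for t
  have \<phi>: "\<phi> t > 0 \<and> ((\<lambda>x. g (t * x) / g x) \<longlongrightarrow> \<phi> t) (at_right 0)" if "t > 0" for t
    unfolding \<phi>_def by (rule someI_ex) (rule ratio_limit[OF g pos that])
  have mult: "\<phi> (s * t) = \<phi> s * \<phi> t" if st: "s > 0" "t > 0" for s t
  proof -
    have pt: "eventually (\<lambda>x. g (t * x) > 0) (at_right 0)"
      using filterlim_scale_at_right_0[OF st(2)] pos by (rule eventually_compose_filterlim[rotated])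
    have "((\<lambda>x. g (s * (t * x)) / g (t * x) * (g (t * x) / g x)) \<longlongrightarrow> \<phi> s * \<phi> t) (at_right 0)"
      using \<phi> st by (intro tendsto_mult filterlim_compose[OF _ filterlim_scale_at_right_0]) blast+
    then have "((\<lambda>x. g (s * t * x) / g x) \<longlongrightarrow> \<phi> s * \<phi> t) (at_right 0)"
      by (rule Lim_transform_eventually) (use pt in \<open>eventually_elim, simp add: mult.assoc\<close>)
    then show ?thesis using \<phi>[of "s * t"] st tendsto_unique[OF trivial_limit_at_right_real] by (metis mult_pos_pos)
  qed
  have mono: "(\<forall>s t. 0 < s \<longrightarrow> s \<le> t \<longrightarrow> \<phi> s \<le> \<phi> t) \<or> (\<forall>s t. 0 < s \<longrightarrow> s \<le> t \<longrightarrow> \<phi> t \<le> \<phi> s)"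
  proof -
    obtain e R where e: "e > 0" and R: "R = (<) \<or> R = (>) \<or> R = (=)"
      and m: "\<And>x y. 0 < x \<Longrightarrow> x < y \<Longrightarrow> y < e \<Longrightarrow> R (g x) (g y)"
      using definable_germ_monotone[OF g] by blast
    have near: "eventually (\<lambda>x. 0 < x \<and> s * x < e \<and> t * x < e \<and> g x > 0) (at_right 0)"
      if "0 < s" "s \<le> t" for s t
    proof -
      have "eventually (\<lambda>x. 0 < x \<and> x < e / t) (at_right 0)"
        using e that unfolding eventually_at_right_field by (intro exI[of _ "e / t"]) auto
      then show ?thesis using pos
      proof eventually_elim
        case (elim x)
        then have "t * x < e" using that by (simp add: field_simps)
        moreover have "s * x \<le> t * x" using that elim by simp
        ultimately have "s * x < e \<and> t * x < e" by linarith
        then show ?case using elim by simp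
      qed
    qed
    have inc: "g (s * x) \<le> g (t * x)" if "R = (<) \<or> R = (=)" "0 < s" "s \<le> t" "0 < x" "t * x < e" for s t x
      using m[of "s * x" "t * x"] that by (cases "s = t") auto
    have dec: "g (t * x) \<le> g (s * x)" if "R = (>)" "0 < s" "s \<le> t" "0 < x" "t * x < e" for s t x
      using m[of "s * x" "t * x"] that by (cases "s = t") auto
    show ?thesis
    proof (cases "R = (>)")
      case False
      have "\<phi> s \<le> \<phi> t" if st: "0 < s" "s \<le> t" for s t
      proof (rule tendsto_le)
        show "((\<lambda>x. g (t * x) / g x) \<longlongrightarrow> \<phi> t) (at_right 0)" "((\<lambda>x. g (s * x) / g x) \<longlongrightarrow> \<phi> s) (at_right 0)"
          using \<phi> st by auto
        show "eventually (\<lambda>x. g (s * x) / g x \<le> g (t * x) / g x) (at_right 0)"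
          using near[OF st] by eventually_elim (use False R inc st in \<open>auto intro!: divide_right_mono\<close>)
      qed simp
      then show ?thesis by blast
    next
      case True
      have "\<phi> t \<le> \<phi> s" if st: "0 < s" "s \<le> t" for s t
      proof (rule tendsto_le)
        show "((\<lambda>x. g (t * x) / g x) \<longlongrightarrow> \<phi> t) (at_right 0)" "((\<lambda>x. g (s * x) / g x) \<longlongrightarrow> \<phi> s) (at_right 0)"
          using \<phi> st by auto
        show "eventually (\<lambda>x. g (t * x) / g x \<le> g (s * x) / g x) (at_right 0)"
          using near[OF st] by eventually_elim (use True dec st in \<open>auto intro!: divide_right_mono\<close>)
      qed simp
      then show ?thesis by blast
    qed
  qed
  obtain r where r: "\<And>t. t > 0 \<Longrightarrow> \<phi> t = t powr r"
    by (rule multiplicative_monotone_imp_powr[of \<phi>]) (use \<phi> mult mono in auto)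
  have lim_iff: "((\<lambda>x. h x) \<longlongrightarrow> y) (at_right 0) \<longleftrightarrow>
      (\<forall>\<epsilon>. 0 < \<epsilon> \<longrightarrow> (\<exists>\<delta>. 0 < \<delta> \<and> (\<forall>x. 0 < x \<and> x < \<delta> \<longrightarrow> \<bar>h x - y\<bar> < \<epsilon>)))"
    for h :: "real \<Rightarrow> real" and y
    unfolding tendsto_iff dist_real_def eventually_at_right_field by (simp only: imp_conjL)
  have "dP (\<lambda>z :: real \<times> real. 0 < fst z \<and> (\<forall>\<epsilon>. 0 < \<epsilon> \<longrightarrow> (\<exists>\<delta>. 0 < \<delta> \<and>
      (\<forall>x. 0 < x \<and> x < \<delta> \<longrightarrow> \<bar>g (fst z * x) / g x - snd z\<bar> < \<epsilon>))))"
    by (intro dP_intros dF_comp[OF g] dF_arith)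
  moreover have "(0 < fst z \<and> (\<forall>\<epsilon>. 0 < \<epsilon> \<longrightarrow> (\<exists>\<delta>. 0 < \<delta> \<and>
      (\<forall>x. 0 < x \<and> x < \<delta> \<longrightarrow> \<bar>g (fst z * x) / g x - snd z\<bar> < \<epsilon>)))) \<longleftrightarrow>
      0 < fst z \<and> snd z = fst z powr r" for z :: "real \<times> real"
    unfolding lim_iff[symmetric]
  proof (rule conj_cong[OF refl])
    assume z: "0 < fst z"
    show "((\<lambda>x. g (fst z * x) / g x) \<longlongrightarrow> snd z) (at_right 0) \<longleftrightarrow> snd z = fst z powr r"
      using \<phi>[OF z] tendsto_unique[OF trivial_limit_at_right_real] unfolding r[OF z] by metis
  qed
  ultimately have rD: "r \<in> exponents D" unfolding exponents_iff by simp
  define G where "G x = g x / (if 0 < x then x powr r else 0)" for x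
  have G_eq: "eventually (\<lambda>x. G x = g x / x powr r) (at_right 0)"
    unfolding eventually_at_right_field by (intro exI[of _ 1]) (simp add: G_def)
  have "dF G" unfolding G_def[abs_def] by (intro dF_divide g dF_powr[OF rD] dF_arith)
  moreover have xpos: "\<forall>\<^sub>F x in at_right 0. (x::real) > 0" by (simp add: eventually_at_right_less)
  then have Gpos: "eventually (\<lambda>x. G x > 0) (at_right 0)"
    using pos by eventually_elim (simp add: G_def)
  moreover have "((\<lambda>x. G (1/2 * x) / G x) \<longlongrightarrow> 1) (at_right 0)"
  proof (rule Lim_transform_eventually)
    define h where "h = (1/2 :: real)"
    have h: "h > 0" by (simp add: h_def)
    have hp: "h powr r \<noteq> 0" using h by simp
    have "((\<lambda>x. g (h * x) / g x) \<longlongrightarrow> h powr r) (at_right 0)"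
      using \<phi>[OF h] unfolding r[OF h] by (rule conjunct2)
    from tendsto_divide[OF this tendsto_const hp]
    have "((\<lambda>x. g (h * x) / g x / h powr r) \<longlongrightarrow> 1) (at_right 0)"
      unfolding divide_self[OF hp] .
    then show "((\<lambda>x. g (1/2 * x) / g x / (1/2) powr r) \<longlongrightarrow> 1) (at_right 0)"
      unfolding h_def .
    have "g (h * x) / g x / h powr r = G (h * x) / G x" if "x > 0" for x
      using that h by (simp add: G_def powr_mult)
    then show "\<forall>\<^sub>F x in at_right 0. g (1/2 * x) / g x / (1/2) powr r = G (1/2 * x) / G x"
      using xpos unfolding h_def by (auto elim: eventually_mono)
  qed
  ultimately have "\<exists>c>0. (G \<longlongrightarrow> c) (at_right 0)" by (rule slowly_varying_limit)
  then obtain c where c: "c > 0" "(G \<longlongrightarrow> c) (at_right 0)" by blast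
  have "((\<lambda>x. g x / x powr r) \<longlongrightarrow> c) (at_right 0)"
    using c(2) G_eq by (rule Lim_transform_eventually)
  then show ?thesis by (rule that[OF rD c(1)])
qed

end

section \<open>Lipschitz maps and the inner metric\<close>

definition lipschitzian :: "'a::metric_space set \<Rightarrow> ('a \<Rightarrow> 'b::metric_space) \<Rightarrow> bool" where
  "lipschitzian S f \<longleftrightarrow> (\<exists>L. L-lipschitz_on S f)"

lemma lipschitzianI: "(\<And>x y. x \<in> S \<Longrightarrow> y \<in> S \<Longrightarrow> dist (f x) (f y) \<le> L * dist x y) \<Longrightarrow> lipschitzian S f"
  unfolding lipschitzian_def
proof (intro exI lipschitz_onI)
  fix x y assume *: "\<And>x y. x \<in> S \<Longrightarrow> y \<in> S \<Longrightarrow> dist (f x) (f y) \<le> L * dist x y" "x \<in> S" "y \<in> S"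
  have "dist (f x) (f y) \<le> L * dist x y" using * by blast
  also have "\<dots> \<le> max L 0 * dist x y" by (intro mult_right_mono) auto
  finally show "dist (f x) (f y) \<le> max L 0 * dist x y" .
qed simp

lemma lipschitzianE:
  assumes "lipschitzian S f"
  obtains L where "L \<ge> 0" "\<And>x y. x \<in> S \<Longrightarrow> y \<in> S \<Longrightarrow> dist (f x) (f y) \<le> L * dist x y"
  using assms unfolding lipschitzian_def lipschitz_on_def by blast

lemma lipschitzian_continuous_on: "lipschitzian S f \<Longrightarrow> continuous_on S f"
  unfolding lipschitzian_def using lipschitz_on_continuous_on by blast

lemma lipschitzian_subset: "lipschitzian S f \<Longrightarrow> T \<subseteq> S \<Longrightarrow> lipschitzian T f"
  unfolding lipschitzian_def using lipschitz_on_subset by blast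

lemma lipschitzian_const: "lipschitzian S (\<lambda>x. c)"
  by (rule lipschitzianI[where L = 0]) simp

lemma lipschitzian_id: "lipschitzian S (\<lambda>x. x)"
  by (rule lipschitzianI[where L = 1]) simp

lemma lipschitzian_fst: "lipschitzian S (\<lambda>x. fst x)"
  by (rule lipschitzianI[where L = 1]) (simp add: dist_fst_le)

lemma lipschitzian_snd: "lipschitzian S (\<lambda>x. snd x)"
  by (rule lipschitzianI[where L = 1]) (simp add: dist_snd_le)

lemma dist_pair_le: "dist (a, b) (c, d) \<le> dist a c + dist b d"
  unfolding dist_Pair_Pair by (rule sqrt_sum_squares_le_sum) auto

lemma lipschitzian_comp:
  assumes g: "lipschitzian T g" and f: "lipschitzian S f" and "f ` S \<subseteq> T"
  shows "lipschitzian S (\<lambda>x. g (f x))"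
proof -
  from g obtain L where L: "L \<ge> 0" "\<And>x y. x \<in> T \<Longrightarrow> y \<in> T \<Longrightarrow> dist (g x) (g y) \<le> L * dist x y"
    by (rule lipschitzianE) blast
  from f obtain M where M: "\<And>x y. x \<in> S \<Longrightarrow> y \<in> S \<Longrightarrow> dist (f x) (f y) \<le> M * dist x y"
    by (rule lipschitzianE) blast
  show ?thesis
  proof (rule lipschitzianI[where L = "L * M"])
    fix x y assume xy: "x \<in> S" "y \<in> S"
    have "dist (g (f x)) (g (f y)) \<le> L * dist (f x) (f y)" using L(2) xy assms(3) by blast
    also have "\<dots> \<le> L * (M * dist x y)" using M xy L(1) by (intro mult_left_mono)
    finally show "dist (g (f x)) (g (f y)) \<le> L * M * dist x y" by simp
  qed
qed

lemma lipschitzian_binop: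
  fixes f :: "'a::metric_space \<Rightarrow> 'b::metric_space" and g :: "'a \<Rightarrow> 'c::metric_space" and h :: "'b \<Rightarrow> 'c \<Rightarrow> 'd::metric_space"
  assumes f: "lipschitzian S f" and g: "lipschitzian S g"
    and h: "\<And>a b c d. dist (h a b) (h c d) \<le> dist a c + dist b d"
  shows "lipschitzian S (\<lambda>x. h (f x) (g x))"
proof -
  from f obtain L where L: "\<And>x y. x \<in> S \<Longrightarrow> y \<in> S \<Longrightarrow> dist (f x) (f y) \<le> L * dist x y"
    by (rule lipschitzianE) blast
  from g obtain M where M: "\<And>x y. x \<in> S \<Longrightarrow> y \<in> S \<Longrightarrow> dist (g x) (g y) \<le> M * dist x y"
    by (rule lipschitzianE) blast
  show ?thesis
  proof (rule lipschitzianI[where L = "L + M"])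
    fix x y assume xy: "x \<in> S" "y \<in> S"
    have "dist (h (f x) (g x)) (h (f y) (g y)) \<le> dist (f x) (f y) + dist (g x) (g y)" by (rule h)
    also have "\<dots> \<le> (L + M) * dist x y" using L[OF xy] M[OF xy] by (simp add: algebra_simps)
    finally show "dist (h (f x) (g x)) (h (f y) (g y)) \<le> (L + M) * dist x y" .
  qed
qed

lemma lipschitzian_Pair: "lipschitzian S f \<Longrightarrow> lipschitzian S g \<Longrightarrow> lipschitzian S (\<lambda>x. (f x, g x))"
  by (rule lipschitzian_binop[where h = Pair]) (auto simp: dist_pair_le)

lemma lipschitzian_add: "lipschitzian S f \<Longrightarrow> lipschitzian S g \<Longrightarrow> lipschitzian S (\<lambda>x. f x + g x :: real)"
  by (rule lipschitzian_binop[where h = "(+)"]) (auto simp: dist_real_def)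

lemma lipschitzian_diff: "lipschitzian S f \<Longrightarrow> lipschitzian S g \<Longrightarrow> lipschitzian S (\<lambda>x. f x - g x :: real)"
  by (rule lipschitzian_binop[where h = "(-)"]) (auto simp: dist_real_def)

lemma lipschitzian_max: "lipschitzian S f \<Longrightarrow> lipschitzian S g \<Longrightarrow> lipschitzian S (\<lambda>x. max (f x) (g x) :: real)"
  by (rule lipschitzian_binop[where h = max]) (auto simp: dist_real_def max_def)

lemma lipschitzian_min: "lipschitzian S f \<Longrightarrow> lipschitzian S g \<Longrightarrow> lipschitzian S (\<lambda>x. min (f x) (g x) :: real)"
  by (rule lipschitzian_binop[where h = min]) (auto simp: dist_real_def min_def)

lemma lipschitzian_cmult: "lipschitzian S f \<Longrightarrow> lipschitzian S (\<lambda>x. c * f x :: real)"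
proof (erule lipschitzianE)
  fix L assume L: "\<And>x y. x \<in> S \<Longrightarrow> y \<in> S \<Longrightarrow> dist (f x) (f y) \<le> L * dist x y"
  show ?thesis
  proof (rule lipschitzianI[where L = "\<bar>c\<bar> * L"])
    fix x y assume "x \<in> S" "y \<in> S"
    from mult_left_mono[OF L[OF this], of "\<bar>c\<bar>"]
    show "dist (c * f x) (c * f y) \<le> \<bar>c\<bar> * L * dist x y"
      by (simp add: dist_real_def abs_mult flip: right_diff_distrib)
  qed
qed

lemma lipschitzian_sum:
  "finite I \<Longrightarrow> (\<And>i. i \<in> I \<Longrightarrow> lipschitzian S (f i)) \<Longrightarrow> lipschitzian S (\<lambda>x. \<Sum>i\<in>I. f i x :: real)"
  by (induction rule: finite_induct) (auto intro: lipschitzian_const lipschitzian_add)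

lemmas lipschitzian_intros = lipschitzian_const lipschitzian_id lipschitzian_fst lipschitzian_snd
  lipschitzian_Pair lipschitzian_add lipschitzian_diff lipschitzian_max lipschitzian_min
  lipschitzian_cmult

text \<open>Extending the power function by \<open>0\<close> to \<open>u \<le> 0\<close> makes it definable as a total function.\<close>

definition pw :: "real \<Rightarrow> real \<Rightarrow> real" where
  "pw m u = (if 0 < u then u powr m else 0)"

lemma pw_nonneg: "0 \<le> pw m u" by (simp add: pw_def)
lemma pw_0 [simp]: "pw m 0 = 0" by (simp add: pw_def)
lemma pw_pos: "0 < u \<Longrightarrow> 0 < pw m u" by (simp add: pw_def)
lemma pw_eq': "0 \<le> u \<Longrightarrow> pw m u = u powr m" by (auto simp: pw_def)

lemma pw_antimono_exp: "u \<le> 1 \<Longrightarrow> m \<le> m' \<Longrightarrow> pw m' u \<le> pw m u"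
  by (simp add: pw_def powr_mono')

lemma pw_le_id: "0 \<le> u \<Longrightarrow> u \<le> 1 \<Longrightarrow> 1 \<le> m \<Longrightarrow> pw m u \<le> u"
  using pw_antimono_exp[of u 1 m] by (auto simp: pw_def)

lemma pw_lipschitz:
  assumes "1 \<le> m" "0 \<le> a" "a \<le> 1" "0 \<le> b" "b \<le> 1"
  shows "\<bar>pw m a - pw m b\<bar> \<le> m * \<bar>a - b\<bar>"
proof -
  have *: "\<bar>pw m a - pw m b\<bar> \<le> m * \<bar>a - b\<bar>" if "0 \<le> a" "a < b" "b \<le> 1" for a b
  proof (cases "a = 0")
    case True
    have "b powr m \<le> b powr 1" using that assms by (intro powr_mono') auto
    also have "\<dots> \<le> m * b" using that assms mult_right_mono[of 1 m b] by auto
    finally show ?thesis using True that by (simp add: pw_def)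
  next
    case False
    then have a: "a > 0" using that by simp
    have "\<exists>z>a. z < b \<and> b powr m - a powr m = (b - a) * (m * z powr (m - 1))"
      using a that by (intro MVT2) (auto intro!: derivative_eq_intros simp: powr_diff)
    then obtain z where z: "a < z" "z < b" "b powr m - a powr m = (b - a) * (m * z powr (m - 1))" by blast
    have "z powr (m - 1) \<le> 1 powr (m - 1)" using z a that assms by (intro powr_mono2) auto
    then have "m * z powr (m - 1) \<le> m" using assms by simp
    then have "(b - a) * (m * z powr (m - 1)) \<le> (b - a) * m" using that by (intro mult_left_mono) auto
    moreover have "0 \<le> (b - a) * (m * z powr (m - 1))" using that assms by simp
    ultimately show ?thesis using a that z(3) by (simp add: pw_def abs_minus_commute mult.commute)
  qed
  show ?thesis using *[of a b] *[of b a] assms by (cases a b rule: linorder_cases) (auto simp: abs_minus_commute)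
qed

lemma lipschitzian_pw: "1 \<le> m \<Longrightarrow> lipschitzian {0..1} (pw m)"
  by (rule lipschitzianI[where L = m]) (auto simp: dist_real_def intro: pw_lipschitz)

lemma path_length_le:
  fixes g :: "real \<Rightarrow> 'a::metric_space"
  assumes g: "\<And>s t. s \<in> {0..1} \<Longrightarrow> t \<in> {0..1} \<Longrightarrow> dist (g s) (g t) \<le> L * \<bar>s - t\<bar>" and L: "0 \<le> L"
  shows "path_length g \<le> ennreal L"
  unfolding path_length_def
proof (rule SUP_least)
  fix ts :: "real list" assume "ts \<in> {ts. sorted ts \<and> set ts \<subseteq> {0..1}}"
  then have ts: "sorted ts" "set ts \<subseteq> {0..1}" by auto
  have "(\<Sum>i<length ts - 1. dist (g (ts ! i)) (g (ts ! Suc i))) \<le> (\<Sum>i<length ts - 1. L * (ts ! Suc i - ts ! i))"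
  proof (rule sum_mono)
    fix i assume "i \<in> {..<length ts - 1}"
    then have i: "Suc i < length ts" by auto
    then have "ts ! i \<in> {0..1}" "ts ! Suc i \<in> {0..1}" using ts(2) nth_mem by (meson Suc_lessD subsetD)+
    moreover have "ts ! i \<le> ts ! Suc i" using ts(1) i by (simp add: sorted_iff_nth_mono)
    ultimately show "dist (g (ts ! i)) (g (ts ! Suc i)) \<le> L * (ts ! Suc i - ts ! i)"
      using g[of "ts ! i" "ts ! Suc i"] by simp
  qed
  also have "\<dots> = L * (ts ! (length ts - 1) - ts ! 0)"
    by (simp add: sum_lessThan_telescope flip: sum_distrib_left)
  also have "\<dots> \<le> L * 1"
  proof (cases ts)
    case Nil then show ?thesis using L by simp
  next
    case (Cons a list)
    then have "ts ! 0 \<in> {0..1}" "ts ! (length ts - 1) \<in> {0..1}" using ts(2) nth_mem by (simp, metis diff_less length_greater_0_conv list.distinct(1) subsetD zero_less_one)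
    then show ?thesis using L by (intro mult_left_mono) auto
  qed
  finally show "ennreal (\<Sum>i<length ts - 1. dist (g (ts ! i)) (g (ts ! Suc i))) \<le> ennreal L"
    by (simp add: ennreal_leI)
qed

lemma dist_le_inner_dist: "ennreal (dist x y) \<le> inner_dist X x y"
  unfolding inner_dist_def
proof (rule INF_greatest)
  fix g assume "g \<in> {g. path g \<and> path_image g \<subseteq> X \<and> pathstart g = x \<and> pathfinish g = y}"
  then have "g 0 = x" "g 1 = y" by (auto simp: pathstart_def pathfinish_def)
  then have "ennreal (dist x y) = ennreal (\<Sum>i<length [0,1::real] - 1. dist (g ([0,1] ! i)) (g ([0,1] ! Suc i)))"
    by simp
  also have "\<dots> \<le> path_length g" unfolding path_length_def by (rule SUP_upper) auto
  finally show "ennreal (dist x y) \<le> path_length g" .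
qed

lemma inner_dist_mono: "X \<subseteq> Y \<Longrightarrow> inner_dist Y x y \<le> inner_dist X x y"
  unfolding inner_dist_def by (rule INF_superset_mono) auto

text \<open>The image of a segment under a Lipschitz map is a short path.\<close>

lemma inner_dist_le_lipschitz_image:
  fixes r :: "'a::real_normed_vector \<Rightarrow> 'b::metric_space"
  assumes r: "\<And>p q. p \<in> closed_segment a b \<Longrightarrow> q \<in> closed_segment a b \<Longrightarrow> dist (r p) (r q) \<le> L * dist p q"
    and X: "r ` closed_segment a b \<subseteq> X" and L: "0 \<le> L"
  shows "inner_dist X (r a) (r b) \<le> ennreal (L * dist a b)"
proof -
  let ?g = "\<lambda>t. r (linepath a b t)"
  have seg: "linepath a b t \<in> closed_segment a b" if "t \<in> {0..1}" for t
    using that path_image_linepath[of a b] unfolding path_image_def by blast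
  have lip: "dist (?g s) (?g t) \<le> L * dist a b * \<bar>s - t\<bar>" if "s \<in> {0..1}" "t \<in> {0..1}" for s t
  proof -
    have "linepath a b s - linepath a b t = (s - t) *\<^sub>R (b - a)"
      by (simp add: linepath_def algebra_simps)
    then have "dist (linepath a b s) (linepath a b t) = \<bar>s - t\<bar> * dist a b"
      by (simp add: dist_norm norm_minus_commute)
    then show ?thesis using r[OF seg[OF that(1)] seg[OF that(2)]] by (simp add: mult_ac)
  qed
  then have "lipschitzian {0..1} ?g"
    by (intro lipschitzianI[where L = "L * dist a b"]) (auto simp: dist_real_def)
  then have "path ?g" unfolding path_def by (rule lipschitzian_continuous_on)
  moreover have "path_image ?g \<subseteq> X" using X seg unfolding path_image_def by blast
  moreover have "pathstart ?g = r a" "pathfinish ?g = r b"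
    by (auto simp: pathstart_def pathfinish_def linepath_def)
  ultimately have "inner_dist X (r a) (r b) \<le> path_length ?g"
    unfolding inner_dist_def by (intro INF_lower) auto
  also have "\<dots> \<le> ennreal (L * dist a b)" using lip L by (intro path_length_le) auto
  finally show ?thesis .
qed

section \<open>Regions between two graphs\<close>

definition region :: "real \<Rightarrow> (real \<Rightarrow> real) \<Rightarrow> (real \<Rightarrow> real) \<Rightarrow> (real \<times> real) set" where
  "region \<rho> y1 y2 = {(u, v). 0 \<le> u \<and> u \<le> \<rho> \<and> y1 u \<le> v \<and> v \<le> y2 u}"

text \<open>Clamping the second coordinate is a Lipschitz retraction of a strip onto the region, so the
  inner metric of the region is equivalent to the Euclidean one.\<close>

lemma inner_dist_region_le:
  assumes y: "lipschitzian {0..\<rho>} y1" "lipschitzian {0..\<rho>} y2" and le: "\<And>u. 0 \<le> u \<Longrightarrow> u \<le> \<rho> \<Longrightarrow> y1 u \<le> y2 u"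
  shows "\<exists>K\<ge>0. \<forall>x\<in>region \<rho> y1 y2. \<forall>z\<in>region \<rho> y1 y2. inner_dist (region \<rho> y1 y2) x z \<le> ennreal (K * dist x z)"
proof -
  define r where "r = (\<lambda>p :: real \<times> real. (fst p, max (y1 (fst p)) (min (snd p) (y2 (fst p)))))"
  let ?S = "{0..\<rho>} \<times> (UNIV :: real set)"
  have "lipschitzian ?S (\<lambda>p. y1 (fst p))" "lipschitzian ?S (\<lambda>p. y2 (fst p))"
    by (rule lipschitzian_comp[OF y(1) lipschitzian_fst] lipschitzian_comp[OF y(2) lipschitzian_fst]; auto)+
  then have "lipschitzian ?S r" unfolding r_def by (intro lipschitzian_intros)
  then obtain L where L: "L \<ge> 0" "\<And>p q. p \<in> ?S \<Longrightarrow> q \<in> ?S \<Longrightarrow> dist (r p) (r q) \<le> L * dist p q"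
    by (rule lipschitzianE) blast
  have conv: "convex ?S" by (intro convex_Times) auto
  have "inner_dist (region \<rho> y1 y2) x z \<le> ennreal (L * dist x z)"
    if "x \<in> region \<rho> y1 y2" "z \<in> region \<rho> y1 y2" for x z
  proof -
    have "x \<in> ?S" "z \<in> ?S" using that by (auto simp: region_def)
    then have seg: "closed_segment x z \<subseteq> ?S" using conv by (simp add: closed_segment_subset)
    have "r x = x" "r z = z" using that le by (auto simp: r_def region_def)
    moreover have "r ` closed_segment x z \<subseteq> region \<rho> y1 y2"
      using seg le by (force simp: r_def region_def)
    moreover have "inner_dist (region \<rho> y1 y2) (r x) (r z) \<le> ennreal (L * dist x z)"
      if "r ` closed_segment x z \<subseteq> region \<rho> y1 y2"
      by (rule inner_dist_le_lipschitz_image[OF _ that L(1)]) (use seg L(2) in blast)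
    ultimately show ?thesis by simp
  qed
  then show ?thesis using L(1) by blast
qed

text \<open>Stretching vertical segments of length \<open>\<phi> u\<close> to length \<open>\<psi> u\<close> is Lipschitz as soon as \<open>\<phi>\<close> and
  \<open>\<psi>\<close> are: the factor \<open>\<psi> / \<phi>\<close> may vary quickly near \<open>0\<close>, but there the segments are short.\<close>

lemma lipschitzian_stretch:
  fixes \<phi> \<psi> :: "real \<Rightarrow> real"
  assumes lip: "lipschitzian {0..\<rho>} \<phi>" "lipschitzian {0..\<rho>} \<psi>"
    and \<psi>: "\<And>u. 0 \<le> u \<Longrightarrow> u \<le> \<rho> \<Longrightarrow> 0 \<le> \<psi> u \<and> \<psi> u \<le> C * \<phi> u"
    and C: "0 \<le> C"
  shows "lipschitzian {(u, v). 0 \<le> u \<and> u \<le> \<rho> \<and> 0 \<le> v \<and> v \<le> \<phi> u} (\<lambda>p. snd p * \<psi> (fst p) / \<phi> (fst p))"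
proof -
  from lip(1) obtain L where L: "L \<ge> 0" "\<And>x y. x \<in> {0..\<rho>} \<Longrightarrow> y \<in> {0..\<rho>} \<Longrightarrow> dist (\<phi> x) (\<phi> y) \<le> L * dist x y"
    by (rule lipschitzianE) blast
  from lip(2) obtain M where M: "M \<ge> 0" "\<And>x y. x \<in> {0..\<rho>} \<Longrightarrow> y \<in> {0..\<rho>} \<Longrightarrow> dist (\<psi> x) (\<psi> y) \<le> M * dist x y"
    by (rule lipschitzianE) blast
  show ?thesis
  proof (rule lipschitzianI[where L = "C + (M + C * L)"], clarsimp)
    fix u v u' v' assume uv: "0 \<le> u" "u \<le> \<rho>" "0 \<le> v" "v \<le> \<phi> u"
      and uv': "0 \<le> u'" "u' \<le> \<rho>" "0 \<le> v'" "v' \<le> \<phi> u'"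
    let ?k = "\<psi> u / \<phi> u" and ?k' = "\<psi> u' / \<phi> u'" and ?d = "dist (u, v) (u', v')"
    have k: "0 \<le> ?k" "?k \<le> C" "0 \<le> ?k'" "?k' \<le> C"
      using \<psi>[of u] \<psi>[of u'] uv uv' C by (auto simp: divide_le_eq) 
    have du: "\<bar>u - u'\<bar> \<le> ?d" and dv: "\<bar>v - v'\<bar> \<le> ?d"
      using dist_fst_le[of "(u, v)" "(u', v')"] dist_snd_le[of "(u, v)" "(u', v')"] by (auto simp: dist_real_def)
    have "\<bar>v * ?k - v' * ?k'\<bar> \<le> C * \<bar>v - v'\<bar> + (M + C * L) * \<bar>u - u'\<bar>"
    proof (cases "\<phi> u = 0 \<or> \<phi> u' = 0")
      case True
      then consider "v = 0" | "v' = 0" using uv uv' by fastforce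
      then have "\<bar>v * ?k - v' * ?k'\<bar> \<le> C * \<bar>v - v'\<bar>"
      proof cases
        case 1
        then have "v * ?k - v' * ?k' = - (?k' * v')" by simp
        moreover have "0 \<le> ?k' * v'" using k(3) uv'(3) by (rule mult_nonneg_nonneg)
        ultimately have "\<bar>v * ?k - v' * ?k'\<bar> = ?k' * v'" by (simp only: abs_minus_cancel abs_of_nonneg)
        also have "\<dots> \<le> C * v'" using k uv' by (intro mult_right_mono)
        finally show ?thesis using 1 uv' by simp
      next
        case 2
        then have "v * ?k - v' * ?k' = ?k * v" by simp
        moreover have "0 \<le> ?k * v" using k(1) uv(3) by (rule mult_nonneg_nonneg)
        ultimately have "\<bar>v * ?k - v' * ?k'\<bar> = ?k * v" by (simp only: abs_of_nonneg)
        also have "\<dots> \<le> C * v" using k uv by (intro mult_right_mono)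
        finally show ?thesis using 2 uv by simp
      qed
      moreover have "0 \<le> (M + C * L) * \<bar>u - u'\<bar>" using M L C by simp
      ultimately show ?thesis by linarith
    next
      case False
      then have ph: "\<phi> u > 0" "\<phi> u' > 0" using uv uv' by auto
      have a: "\<bar>\<psi> u - \<psi> u'\<bar> \<le> M * \<bar>u - u'\<bar>" "\<bar>\<phi> u' - \<phi> u\<bar> \<le> L * \<bar>u - u'\<bar>"
        using M(2)[of u u'] L(2)[of u' u] uv uv' by (auto simp: dist_real_def abs_minus_commute)
      have "\<phi> u' * (?k - ?k') = (\<psi> u - \<psi> u') + ?k * (\<phi> u' - \<phi> u)"
        using ph by (simp add: field_simps)
      then have "\<bar>\<phi> u' * (?k - ?k')\<bar> \<le> \<bar>\<psi> u - \<psi> u'\<bar> + \<bar>?k * (\<phi> u' - \<phi> u)\<bar>" by linarith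
      also have "\<bar>?k * (\<phi> u' - \<phi> u)\<bar> = ?k * \<bar>\<phi> u' - \<phi> u\<bar>" using k(1) by (simp only: abs_mult abs_of_nonneg)
      also have "?k * \<bar>\<phi> u' - \<phi> u\<bar> \<le> C * (L * \<bar>u - u'\<bar>)" using k a C by (intro mult_mono) auto
      finally have 1: "\<bar>\<phi> u' * (?k - ?k')\<bar> \<le> (M + C * L) * \<bar>u - u'\<bar>" using a(1) by (simp add: algebra_simps)
      have "\<bar>v' * (?k - ?k')\<bar> \<le> \<bar>\<phi> u' * (?k - ?k')\<bar>"
        using uv' ph by (simp only: abs_mult) (intro mult_right_mono, auto)
      with 1 have 2: "\<bar>v' * (?k - ?k')\<bar> \<le> (M + C * L) * \<bar>u - u'\<bar>" by linarith
      have "\<bar>(v - v') * ?k\<bar> = ?k * \<bar>v - v'\<bar>" using k(1) by (simp only: abs_mult abs_of_nonneg mult.commute)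
      also have "\<dots> \<le> C * \<bar>v - v'\<bar>" using k by (intro mult_right_mono) auto
      finally have 3: "\<bar>(v - v') * ?k\<bar> \<le> C * \<bar>v - v'\<bar>" .
      have "a * p - b * q = (a - b) * p + b * (p - q)" for a b p q :: real by (simp add: algebra_simps)
      then have "v * ?k - v' * ?k' = (v - v') * ?k + v' * (?k - ?k')" .
      then have "\<bar>v * ?k - v' * ?k'\<bar> \<le> \<bar>(v - v') * ?k\<bar> + \<bar>v' * (?k - ?k')\<bar>"
        by (simp only: abs_triangle_ineq)
      also have "\<dots> \<le> C * \<bar>v - v'\<bar> + (M + C * L) * \<bar>u - u'\<bar>" using 3 2 by (rule add_mono)
      finally show ?thesis .
    qed
    also have "\<dots> \<le> C * ?d + (M + C * L) * ?d"
      using du dv C M L by (intro add_mono mult_left_mono) auto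
    finally show "dist (v * \<psi> u / \<phi> u) (v' * \<psi> u' / \<phi> u') \<le> (C + (M + C * L)) * ?d"
      by (simp add: dist_real_def algebra_simps)
  qed
qed

context o_minimal_structure
begin

lemma dF_pw: "m \<in> exponents D \<Longrightarrow> dF f \<Longrightarrow> dF (\<lambda>x. pw m (f x))"
  unfolding pw_def by (rule dF_powr)

lemma std_triangle_pw: "x \<in> std_triangle m \<longleftrightarrow> 0 \<le> fst x \<and> 0 \<le> snd x \<and> snd x \<le> pw m (fst x)"
  by (cases x) (auto simp: std_triangle_def pw_def)

lemma std_triangle_region: "x \<in> std_triangle m \<Longrightarrow> fst x \<le> \<rho> \<Longrightarrow> x \<in> region \<rho> (\<lambda>u. 0) (pw m)"
  by (cases x) (auto simp: std_triangle_pw region_def)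

lemma region_subset_std_triangle: "region \<rho> (\<lambda>u. 0) (pw m) \<subseteq> std_triangle m"
  by (auto simp: std_triangle_pw region_def)

lemma inner_dist_std_triangle_le:
  assumes "1 \<le> m"
  shows "\<exists>K\<ge>0. \<forall>x\<in>std_triangle m. \<forall>z\<in>std_triangle m. fst x \<le> 1 \<longrightarrow> fst z \<le> 1 \<longrightarrow>
    inner_dist (std_triangle m) x z \<le> ennreal (K * dist x z)"
proof -
  have "\<exists>K\<ge>0. \<forall>x\<in>region 1 (\<lambda>u. 0) (pw m). \<forall>z\<in>region 1 (\<lambda>u. 0) (pw m).
      inner_dist (region 1 (\<lambda>u. 0) (pw m)) x z \<le> ennreal (K * dist x z)"
    using assms by (intro inner_dist_region_le lipschitzian_const lipschitzian_pw pw_nonneg)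
  then obtain K where K: "K \<ge> 0" "\<And>x z. x \<in> region 1 (\<lambda>u. 0) (pw m) \<Longrightarrow> z \<in> region 1 (\<lambda>u. 0) (pw m) \<Longrightarrow>
      inner_dist (region 1 (\<lambda>u. 0) (pw m)) x z \<le> ennreal (K * dist x z)" by blast
  have "inner_dist (std_triangle m) x z \<le> ennreal (K * dist x z)"
    if "x \<in> std_triangle m" "z \<in> std_triangle m" "fst x \<le> 1" "fst z \<le> 1" for x z
    using inner_dist_mono[OF region_subset_std_triangle] K(2) std_triangle_region that order_trans by meson
  then show ?thesis using K(1) by blast
qed

lemma normally_embedded_std_triangle: "1 \<le> m \<Longrightarrow> normally_embedded (std_triangle m)"
proof -
  assume "1 \<le> m"
  then obtain K where K: "K \<ge> 0" "\<And>x z. x\<in>std_triangle m \<Longrightarrow> z\<in>std_triangle m \<Longrightarrow> fst x \<le> 1 \<Longrightarrow> fst z \<le> 1 \<Longrightarrow>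
    inner_dist (std_triangle m) x z \<le> ennreal (K * dist x z)" using inner_dist_std_triangle_le[of m] by blast
  have "fst x \<le> 1" if "x \<in> ball 0 1" for x :: "real \<times> real"
  proof -
    have "norm (fst x) \<le> norm x" by (metis norm_fst_le prod.collapse)
    then show ?thesis using that by simp
  qed
  then show ?thesis unfolding normally_embedded_def
    by (intro exI[of _ 1] conjI exI[of _ K] ballI K(2)) auto
qed

text \<open>The standard triangle is stretched vertically onto the region. The stretching and its inverse are Lipschitz for
  the Euclidean metrics, which are equivalent to the inner metrics on both sides.\<close>

lemma inner_bilipschitz_germ_region:
  assumes m: "m \<in> exponents D" "1 \<le> m" and \<rho>: "0 < \<rho>" "\<rho> \<le> 1"
    and dF: "dF y1" "dF y2" and lip: "lipschitzian {0..\<rho>} y1" "lipschitzian {0..\<rho>} y2"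
    and c: "0 < c" "\<And>u. 0 \<le> u \<Longrightarrow> u \<le> \<rho> \<Longrightarrow> c * pw m u \<le> y2 u - y1 u \<and> y2 u - y1 u \<le> C * pw m u"
    and y0: "y1 0 = 0"
  shows "inner_bilipschitz_germ D (std_triangle m) (region \<rho> y1 y2)
    (\<lambda>x. (fst x, y1 (fst x) + snd x * (y2 (fst x) - y1 (fst x)) / pw m (fst x)))"
    (is "inner_bilipschitz_germ D ?X ?Y ?h")
proof -
  define \<delta> where "\<delta> u = y2 u - y1 u" for u
  define g where "g x = (fst x, (snd x - y1 (fst x)) * pw m (fst x) / \<delta> (fst x))" for x :: "real \<times> real"
  define U where "U = {x :: real \<times> real. fst x < \<rho>}"
  have openU: "open U" unfolding U_def by (intro open_Collect_less continuous_intros)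
  have \<delta>0: "0 \<le> \<delta> u" "c * pw m u \<le> \<delta> u" "\<delta> u \<le> C * pw m u" if "0 \<le> u" "u \<le> \<rho>" for u
  proof -
    have "0 \<le> c * pw m u" using c(1) pw_nonneg[of m u] by simp
    then show "0 \<le> \<delta> u" "c * pw m u \<le> \<delta> u" "\<delta> u \<le> C * pw m u"
      using c(2)[OF that] by (auto simp: \<delta>_def)
  qed
  have \<delta>pos: "\<delta> u > 0" if "0 < u" "u \<le> \<rho>" for u
  proof -
    have "0 < c * pw m u" using c(1) pw_pos[OF that(1)] by simp
    then show ?thesis using \<delta>0(2)[of u] that by linarith
  qed
  have le: "y1 u \<le> y2 u" if "0 \<le> u" "u \<le> \<rho>" for u using \<delta>0[OF that] by (simp add: \<delta>_def)
  have C: "0 \<le> C"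
  proof -
    have "c * pw m \<rho> \<le> C * pw m \<rho>" using \<delta>0[of \<rho>] \<rho> by linarith
    then show ?thesis using c(1) pw_pos[OF \<rho>(1), of m] by simp
  qed
  have lpw: "lipschitzian {0..\<rho>} (pw m)" using lipschitzian_pw[OF m(2)] by (rule lipschitzian_subset) (use \<rho> in auto)
  have l\<delta>: "lipschitzian {0..\<rho>} \<delta>" unfolding \<delta>_def[abs_def] by (intro lipschitzian_intros lip)
  have lX: "lipschitzian (?X \<inter> U) ?h"
  proof -
    have "lipschitzian {(u, v). 0 \<le> u \<and> u \<le> \<rho> \<and> 0 \<le> v \<and> v \<le> pw m u} (\<lambda>p. snd p * \<delta> (fst p) / pw m (fst p))"
      using \<delta>0 by (intro lipschitzian_stretch[OF lpw l\<delta> _ C]) auto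
    then have "lipschitzian (?X \<inter> U) (\<lambda>p. snd p * \<delta> (fst p) / pw m (fst p))"
      by (rule lipschitzian_subset) (auto simp: std_triangle_pw U_def)
    moreover have "lipschitzian (?X \<inter> U) (\<lambda>p. y1 (fst p))"
      by (rule lipschitzian_comp[OF lip(1) lipschitzian_fst]) (auto simp: std_triangle_pw U_def)
    ultimately show ?thesis unfolding \<delta>_def by (intro lipschitzian_intros)
  qed
  have lY: "lipschitzian (?Y \<inter> U) g"
  proof -
    have "lipschitzian {(u, v). 0 \<le> u \<and> u \<le> \<rho> \<and> 0 \<le> v \<and> v \<le> \<delta> u} (\<lambda>p. snd p * pw m (fst p) / \<delta> (fst p))"
      using \<delta>0 c(1) by (intro lipschitzian_stretch[OF l\<delta> lpw, where C = "inverse c"]) (auto simp: pw_nonneg field_simps)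
    moreover have "lipschitzian (?Y \<inter> U) (\<lambda>p. y1 (fst p))"
      by (rule lipschitzian_comp[OF lip(1) lipschitzian_fst]) (auto simp: region_def U_def)
    then have "lipschitzian (?Y \<inter> U) (\<lambda>p. (fst p, snd p - y1 (fst p)))" by (intro lipschitzian_intros)
    ultimately have "lipschitzian (?Y \<inter> U) (\<lambda>p. snd (fst p, snd p - y1 (fst p)) * pw m (fst (fst p, snd p - y1 (fst p))) / \<delta> (fst (fst p, snd p - y1 (fst p))))"
      by (rule lipschitzian_comp) (auto simp: region_def U_def \<delta>_def)
    then show ?thesis unfolding g_def[abs_def] by (intro lipschitzian_intros) simp
  qed
  have hXY: "?h x \<in> ?Y \<inter> U \<and> g (?h x) = x" if "x \<in> ?X \<inter> U" for x
  proof -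
    obtain u v where x: "x = (u, v)" by fastforce
    have uv: "0 \<le> u" "u < \<rho>" "0 \<le> v" "v \<le> pw m u" using that by (auto simp: x std_triangle_pw U_def)
    show ?thesis
    proof (cases "u = 0")
      case True
      then show ?thesis using uv \<rho> le[of 0] y0 by (auto simp: x g_def region_def U_def)
    next
      case False
      then have u: "0 < u" using uv by simp
      have p: "pw m u > 0" "\<delta> u > 0" using u uv \<delta>pos pw_pos by auto
      have "v * \<delta> u / pw m u \<le> pw m u * \<delta> u / pw m u"
        using uv p by (intro divide_right_mono mult_right_mono) auto
      then have "v * \<delta> u / pw m u \<le> \<delta> u" using p by simp
      then show ?thesis using uv p by (auto simp: x g_def region_def U_def simp flip: \<delta>_def) (simp add: \<delta>_def)
    qed
  qed
  have gYX: "g x \<in> ?X \<inter> U \<and> ?h (g x) = x" if "x \<in> ?Y \<inter> U" for x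
  proof -
    obtain u v where x: "x = (u, v)" by fastforce
    have uv: "0 \<le> u" "u < \<rho>" "y1 u \<le> v" "v \<le> y2 u" using that by (auto simp: x region_def U_def)
    show ?thesis
    proof (cases "u = 0")
      case True
      then have "v = 0" using uv \<delta>0(3)[of 0] \<rho> y0 by (simp add: \<delta>_def)
      then show ?thesis using uv \<rho> y0 True by (auto simp: x g_def std_triangle_pw U_def)
    next
      case False
      then have u: "0 < u" using uv by simp
      have p: "pw m u > 0" "\<delta> u > 0" using u uv \<delta>pos pw_pos by auto
      have "(v - y1 u) * pw m u / \<delta> u \<le> \<delta> u * pw m u / \<delta> u"
        using uv p by (intro divide_right_mono mult_right_mono) (auto simp: \<delta>_def)
      then have "(v - y1 u) * pw m u / \<delta> u \<le> pw m u" using p by simp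
      then show ?thesis using uv p by (auto simp: x g_def std_triangle_pw U_def simp flip: \<delta>_def)
    qed
  qed
  have homeo: "homeomorphism (?X \<inter> U) (?Y \<inter> U) ?h g"
  proof (rule homeomorphismI)
    show "continuous_on (?X \<inter> U) ?h" "continuous_on (?Y \<inter> U) g"
      using lX lY by (auto intro: lipschitzian_continuous_on)
  qed (use hXY gYX in blast)+
  obtain L where L: "L \<ge> 0" "\<And>x z. x \<in> ?X \<inter> U \<Longrightarrow> z \<in> ?X \<inter> U \<Longrightarrow> dist (?h x) (?h z) \<le> L * dist x z"
    using lX by (rule lipschitzianE) blast
  obtain M where M: "M \<ge> 0" "\<And>x z. x \<in> ?Y \<inter> U \<Longrightarrow> z \<in> ?Y \<inter> U \<Longrightarrow> dist (g x) (g z) \<le> M * dist x z"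
    using lY by (rule lipschitzianE) blast
  obtain A where A: "A \<ge> 0" "\<And>x z. x \<in> ?Y \<Longrightarrow> z \<in> ?Y \<Longrightarrow> inner_dist ?Y x z \<le> ennreal (A * dist x z)"
    using inner_dist_region_le[OF lip le] by blast
  obtain B where B: "B \<ge> 0" "\<And>x z. x \<in> ?X \<Longrightarrow> z \<in> ?X \<Longrightarrow> fst x \<le> 1 \<Longrightarrow> fst z \<le> 1 \<Longrightarrow>
      inner_dist ?X x z \<le> ennreal (B * dist x z)"
    using inner_dist_std_triangle_le[OF m(2)] by blast
  define K where "K = A * L + B * M"
  have K: "inner_dist ?Y (?h x) (?h z) \<le> ennreal K * inner_dist ?X x z \<and>
      inner_dist ?X x z \<le> ennreal K * inner_dist ?Y (?h x) (?h z)" if x: "x \<in> ?X \<inter> U" and z: "z \<in> ?X \<inter> U" for x z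
  proof
    have "inner_dist ?Y (?h x) (?h z) \<le> ennreal (A * dist (?h x) (?h z))"
      using hXY[OF x] hXY[OF z] by (intro A(2)) auto
    also have "\<dots> \<le> ennreal (K * dist x z)"
    proof (rule ennreal_leI)
      have "A * dist (?h x) (?h z) \<le> A * (L * dist x z)" using L(2)[OF x z] A(1) by (intro mult_left_mono)
      also have "\<dots> \<le> K * dist x z" using B(1) M(1) by (simp add: K_def algebra_simps)
      finally show "A * dist (?h x) (?h z) \<le> K * dist x z" .
    qed
    also have "\<dots> = ennreal K * ennreal (dist x z)" using A B L M by (simp add: ennreal_mult K_def)
    also have "\<dots> \<le> ennreal K * inner_dist ?X x z" by (intro mult_left_mono dist_le_inner_dist) simp
    finally show "inner_dist ?Y (?h x) (?h z) \<le> ennreal K * inner_dist ?X x z" .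
  next
    have "inner_dist ?X x z \<le> ennreal (B * dist x z)"
      using x z \<rho> by (intro B(2)) (auto simp: U_def)
    also have "\<dots> \<le> ennreal (K * dist (?h x) (?h z))"
    proof (rule ennreal_leI)
      have "dist x z \<le> M * dist (?h x) (?h z)" using M(2)[of "?h x" "?h z"] hXY[OF x] hXY[OF z] by auto
      then have "B * dist x z \<le> B * (M * dist (?h x) (?h z))" using B(1) by (intro mult_left_mono)
      also have "\<dots> \<le> K * dist (?h x) (?h z)" using A(1) L(1) by (simp add: K_def algebra_simps)
      finally show "B * dist x z \<le> K * dist (?h x) (?h z)" .
    qed
    also have "\<dots> = ennreal K * ennreal (dist (?h x) (?h z))" using A B L M by (simp add: ennreal_mult K_def)
    also have "\<dots> \<le> ennreal K * inner_dist ?Y (?h x) (?h z)" by (intro mult_left_mono dist_le_inner_dist) simp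
    finally show "inner_dist ?X x z \<le> ennreal K * inner_dist ?Y (?h x) (?h z)" .
  qed
  have defh: "definable_on D (?X \<inter> U) ?h"
  proof (rule definable_onI)
    show "dP (\<lambda>x. x \<in> ?X \<inter> U)"
      unfolding Int_iff std_triangle_pw U_def mem_Collect_eq by (intro dP_intros dF_pw m(1) dF_arith)
    show "dF ?h" by (intro dF_arith dF_pw m(1) dF_comp[OF dF(1)] dF_comp[OF dF(2)])
  qed
  show ?thesis unfolding inner_bilipschitz_germ_def
  proof (intro conjI)
    show "0 \<in> ?X" by (simp add: std_triangle_pw)
    show "?h 0 = 0" using y0 by (simp add: zero_prod_def)
    show "\<exists>U V g K. open U \<and> 0 \<in> U \<and> open V \<and> 0 \<in> V \<and>
      definable_on D (?X \<inter> U) ?h \<and> homeomorphism (?X \<inter> U) (?Y \<inter> V) ?h g \<and>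
      (\<forall>x\<in>?X \<inter> U. \<forall>z\<in>?X \<inter> U.
        inner_dist ?Y (?h x) (?h z) \<le> ennreal K * inner_dist ?X x z \<and>
        inner_dist ?X x z \<le> ennreal K * inner_dist ?Y (?h x) (?h z))"
      using openU \<rho> defh homeo K
      by (intro exI[of _ U] exI[of _ g] exI[of _ K] conjI ballI) (auto simp: U_def)
  qed
qed

end

section \<open>Arcs and the order of a function along an arc\<close>

text \<open>The zero function plays the part of \<open>u powr \<infinity>\<close>, so that orders in \<open>\<real> \<union> {\<infinity>}\<close> can be treated uniformly:
  to have order \<open>q\<close> is to lie between two positive multiples of \<open>epow q\<close>.\<close>

definition epow :: "ereal \<Rightarrow> real \<Rightarrow> real" where
  "epow q t = (if q = \<infinity> then 0 else pw (real_of_ereal q) t)"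

lemma epow_0 [simp]: "epow q 0 = 0" by (simp add: epow_def)
lemma epow_nonneg: "0 \<le> epow q t" by (simp add: epow_def pw_nonneg)
lemma epow_PInf [simp]: "epow \<infinity> t = 0" by (simp add: epow_def)
lemma epow_ereal [simp]: "epow (ereal r) t = pw r t" by (simp add: epow_def)

lemma eventually_at_right_0_small: "(e::real) > 0 \<Longrightarrow> eventually (\<lambda>t. 0 < t \<and> t < e) (at_right 0)"
  unfolding eventually_at_right_field by (intro exI[of _ e]) simp

lemma epow_compare:
  assumes ev: "eventually (\<lambda>t. c * epow q t \<le> K * epow q' t) (at_right 0)"
    and c: "c > 0" and q: "q \<noteq> - \<infinity>" "q' \<noteq> - \<infinity>"
  shows "q' \<le> q"
proof (rule ccontr)
  assume "\<not> q' \<le> q"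
  then have less: "q < q'" by simp
  then obtain r where r: "q = ereal r" using q(1) by (cases q) auto
  have pos: "eventually (\<lambda>t. 0 < t \<and> t < 1) (at_right (0::real))" by (rule eventually_at_right_0_small) simp
  show False
  proof (cases q')
    case (real r')
    have nn: "eventually (\<lambda>t. 0 \<le> t) (at_right (0::real))" using pos by eventually_elim simp
    have "((\<lambda>t. t powr (r' - r)) \<longlongrightarrow> 0) (at_right 0)"
      by (rule tendsto_zero_powrI[where b = "r' - r"]) (use less r real nn in \<open>auto intro: tendsto_eq_intros\<close>)
    then have "((\<lambda>t. K * t powr (r' - r)) \<longlongrightarrow> K * 0) (at_right 0)" by (intro tendsto_mult tendsto_const)
    then have "eventually (\<lambda>t. K * t powr (r' - r) < c) (at_right 0)"
      using c by (intro order_tendstoD) auto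
    then have "eventually (\<lambda>t::real. False) (at_right 0)" using ev pos
    proof eventually_elim
      case (elim t)
      then have "c * t powr r \<le> K * t powr r'" by (simp add: r real pw_def)
      also have "t powr r' = t powr (r' - r) * t powr r" by (simp flip: powr_add)
      finally have "c \<le> K * t powr (r' - r)" using elim by simp
      then show ?case using elim by simp
    qed
    then show False by simp
  next
    case PInf
    from ev pos have "eventually (\<lambda>t::real. False) (at_right 0)"
    proof eventually_elim
      case (elim t)
      then have "0 < c * pw r t" using c by (simp add: pw_pos)
      then show ?case using elim by (simp add: r PInf)
    qed
    then show False by simp
  qed (use q in simp)
qed

definition growth :: "(real \<Rightarrow> real) \<Rightarrow> ereal \<Rightarrow> bool" where
  "growth g q \<longleftrightarrow> (\<exists>c1>0. \<exists>c2>0. eventually (\<lambda>t. c1 * epow q t \<le> g t \<and> g t \<le> c2 * epow q t) (at_right 0))"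

lemma growthI:
  "c1 > 0 \<Longrightarrow> c2 > 0 \<Longrightarrow> eventually (\<lambda>t. c1 * epow q t \<le> g t \<and> g t \<le> c2 * epow q t) (at_right 0) \<Longrightarrow> growth g q"
  unfolding growth_def by blast

lemma growth_unique:
  assumes "growth g q" "growth g q'" "q \<noteq> - \<infinity>" "q' \<noteq> - \<infinity>"
  shows "q = q'"
proof -
  obtain c1 c2 where c: "c1 > 0" "c2 > 0" "eventually (\<lambda>t. c1 * epow q t \<le> g t \<and> g t \<le> c2 * epow q t) (at_right 0)"
    using assms(1) unfolding growth_def by blast
  obtain d1 d2 where d: "d1 > 0" "d2 > 0" "eventually (\<lambda>t. d1 * epow q' t \<le> g t \<and> g t \<le> d2 * epow q' t) (at_right 0)"
    using assms(2) unfolding growth_def by blast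
  have "eventually (\<lambda>t. c1 * epow q t \<le> d2 * epow q' t) (at_right 0)"
    using c(3) d(3) by eventually_elim simp
  then have "q' \<le> q" using epow_compare c assms by blast
  have "eventually (\<lambda>t. d1 * epow q' t \<le> c2 * epow q t) (at_right 0)"
    using c(3) d(3) by eventually_elim simp
  then have "q \<le> q'" using epow_compare d assms by blast
  with \<open>q' \<le> q\<close> show ?thesis by simp
qed

lemma growth_of_limit:
  assumes c: "c > 0" and lim: "((\<lambda>t. g t / t powr r) \<longlongrightarrow> c) (at_right 0)"
  shows "growth g (ereal r)"
  unfolding growth_def
proof (intro exI conjI)
  show "c / 2 > 0" "2 * c > 0" using c by auto
  have "eventually (\<lambda>t. g t / t powr r > c / 2) (at_right 0)" "eventually (\<lambda>t. g t / t powr r < 2 * c) (at_right 0)"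
    using order_tendstoD(1)[OF lim, of "c / 2"] order_tendstoD(2)[OF lim, of "2 * c"] c by auto
  moreover have "eventually (\<lambda>t. 0 < t \<and> t < 1) (at_right (0::real))" by (rule eventually_at_right_0_small) simp
  ultimately show "eventually (\<lambda>t. c / 2 * epow (ereal r) t \<le> g t \<and> g t \<le> 2 * c * epow (ereal r) t) (at_right 0)"
  proof eventually_elim
    case (elim t)
    then have "t powr r > 0" by simp
    then show ?case using elim by (simp add: pw_def pos_less_divide_eq pos_divide_less_eq)
  qed
qed

lemma smallo_iff_limit:
  "(\<lambda>t. g t - c * t powr q) \<in> o[at_right 0](\<lambda>t. t powr q) \<longleftrightarrow> ((\<lambda>t. g t / t powr q) \<longlongrightarrow> c) (at_right (0::real))"
proof -
  have pos: "eventually (\<lambda>t. t powr q \<noteq> 0) (at_right (0::real))"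
    using eventually_at_right_0_small[OF zero_less_one] by eventually_elim simp
  have "(\<lambda>t. g t - c * t powr q) \<in> o[at_right 0](\<lambda>t. t powr q) \<longleftrightarrow>
      ((\<lambda>t. (g t - c * t powr q) / t powr q) \<longlongrightarrow> 0) (at_right 0)"
    by (rule iffI) (erule smalloD_tendsto, erule smalloI_tendsto[OF _ pos])
  also have "\<dots> \<longleftrightarrow> ((\<lambda>t. g t / t powr q - c) \<longlongrightarrow> 0) (at_right 0)"
    by (rule tendsto_cong) (use pos in \<open>eventually_elim, simp add: diff_divide_distrib\<close>)
  also have "\<dots> \<longleftrightarrow> ((\<lambda>t. g t / t powr q) \<longlongrightarrow> c) (at_right 0)"
    by (rule LIM_zero_iff)
  finally show ?thesis .
qed

lemma order_along_of_limit:
  assumes c: "c > 0" and lim: "((\<lambda>t. f (\<gamma> t) / t powr r) \<longlongrightarrow> c) (at_right 0)"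
  shows "order_along f \<gamma> = ereal r"
proof -
  have gr: "growth (\<lambda>t. f (\<gamma> t)) (ereal r)" using assms by (rule growth_of_limit)
  have "\<not> (\<forall>\<^sub>F t in at_right 0. f (\<gamma> t) = 0)"
  proof
    assume "\<forall>\<^sub>F t in at_right 0. f (\<gamma> t) = 0"
    then have "growth (\<lambda>t. f (\<gamma> t)) \<infinity>"
      by (intro growthI[of 1 1]) (auto elim: eventually_mono)
    from growth_unique[OF this gr] show False by simp
  qed
  moreover have "(THE q. \<exists>c. c \<noteq> 0 \<and> (\<lambda>t. f (\<gamma> t) - c * t powr q) \<in> o[at_right 0](\<lambda>t. t powr q)) = r"
    unfolding smallo_iff_limit
  proof (rule the_equality)
    show "\<exists>c. c \<noteq> 0 \<and> ((\<lambda>t. f (\<gamma> t) / t powr r) \<longlongrightarrow> c) (at_right 0)"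
      using c lim by (intro exI[of _ c]) simp
    fix q assume "\<exists>c. c \<noteq> 0 \<and> ((\<lambda>t. f (\<gamma> t) / t powr q) \<longlongrightarrow> c) (at_right 0)"
    then obtain c' where c': "c' \<noteq> 0" "((\<lambda>t. f (\<gamma> t) / t powr q) \<longlongrightarrow> c') (at_right 0)" by blast
    have "eventually (\<lambda>t. f (\<gamma> t) / t powr r > 0) (at_right 0)" using order_tendstoD(1)[OF lim] c by blast
    then have "eventually (\<lambda>t. f (\<gamma> t) / t powr q \<ge> 0) (at_right 0)"
      by eventually_elim (auto simp: zero_less_divide_iff)
    then have "c' \<ge> 0" using tendsto_lowerbound[OF c'(2)] by simp
    then have "growth (\<lambda>t. f (\<gamma> t)) (ereal q)" using c' by (intro growth_of_limit[of c']) auto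
    from growth_unique[OF this gr] show "q = r" by simp
  qed
  ultimately show ?thesis unfolding order_along_def by simp
qed

definition sector :: "(real \<times> real) set" where
  "sector = {x. 0 \<le> snd x \<and> snd x \<le> fst x}"

lemma sector_norm: "x \<in> sector \<Longrightarrow> 0 \<le> fst x \<and> fst x \<le> norm x \<and> norm x \<le> 2 * fst x"
proof -
  assume x: "x \<in> sector"
  obtain a b where ab: "x = (a, b)" by fastforce
  have "norm x \<le> \<bar>a\<bar> + \<bar>b\<bar>" unfolding ab norm_Pair using sqrt_sum_squares_le_sum_abs[of a b] by simp
  moreover have "\<bar>a\<bar> \<le> norm x" using norm_fst_le[of a b] by (simp add: ab)
  ultimately show ?thesis using x by (auto simp: ab sector_def)
qed

text \<open>The order of \<open>f\<close> on a set germ in the sector, measured by the first coordinate instead of the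
  norm. On the image of an arc this is the order along the arc; it makes sense for every set germ, and
  it only depends on the set.\<close>

definition has_order :: "(real \<times> real \<Rightarrow> real) \<Rightarrow> ereal \<Rightarrow> (real \<times> real) set \<Rightarrow> bool" where
  "has_order f q A \<longleftrightarrow> (\<exists>c1>0. \<exists>c2>0. eventually (\<lambda>x. x \<in> A \<longrightarrow>
     c1 * epow q (fst x) \<le> f x \<and> f x \<le> c2 * epow q (fst x)) (nhds 0))"

lemma has_orderI:
  "c1 > 0 \<Longrightarrow> c2 > 0 \<Longrightarrow> eventually (\<lambda>x. x \<in> A \<longrightarrow> c1 * epow q (fst x) \<le> f x \<and> f x \<le> c2 * epow q (fst x)) (nhds 0)
    \<Longrightarrow> has_order f q A"
  unfolding has_order_def by blast

lemma has_orderE: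
  assumes "has_order f q A"
  obtains c1 c2 where "c1 > 0" "c2 > 0"
    "eventually (\<lambda>x. x \<in> A \<longrightarrow> c1 * epow q (fst x) \<le> f x \<and> f x \<le> c2 * epow q (fst x)) (nhds 0)"
  using assms unfolding has_order_def by blast

lemma has_order_subset: "has_order f q A \<Longrightarrow> germ_subset B A \<Longrightarrow> has_order f q B"
proof (erule has_orderE)
  fix c1 c2 :: real assume c: "c1 > 0" "c2 > 0" and B: "germ_subset B A"
    and *: "eventually (\<lambda>x. x \<in> A \<longrightarrow> c1 * epow q (fst x) \<le> f x \<and> f x \<le> c2 * epow q (fst x)) (nhds 0)"
  have "eventually (\<lambda>x. x \<in> B \<longrightarrow> c1 * epow q (fst x) \<le> f x \<and> f x \<le> c2 * epow q (fst x)) (nhds 0)"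
    using * B unfolding germ_subset_def by eventually_elim simp
  then show ?thesis by (rule has_orderI[OF c])
qed

lemma eventually_nhds_0: "eventually P (nhds (0::'a::real_normed_vector)) \<longleftrightarrow> (\<exists>d>0. \<forall>x. norm x < d \<longrightarrow> P x)"
  by (auto simp: eventually_nhds_metric dist_norm)

lemma arc_germD:
  assumes "arc_germ D \<gamma>"
  obtains e where "e > 0" "definable_on D {0..<e} \<gamma>" "\<And>t. 0 \<le> t \<Longrightarrow> t < e \<Longrightarrow> norm (\<gamma> t) = t \<and> \<gamma> t \<in> arc_image \<gamma>"
  using assms that unfolding arc_germ_def arc_image_def by auto

lemma eventually_arc_iff:
  assumes "arc_germ D \<gamma>" "P 0"
  shows "eventually (\<lambda>t. P (\<gamma> t)) (at_right 0) \<longleftrightarrow> eventually (\<lambda>x. x \<in> arc_image \<gamma> \<longrightarrow> P x) (nhds 0)"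
proof
  assume "eventually (\<lambda>t. P (\<gamma> t)) (at_right 0)"
  then obtain d where d: "d > 0" "\<And>t. 0 < t \<Longrightarrow> t < d \<Longrightarrow> P (\<gamma> t)" unfolding eventually_at_right_field by blast
  have "P x" if "norm x < d" "x \<in> arc_image \<gamma>" for x
    using that assms(2) d(2)[of "norm x"] by (cases "x = 0") (auto simp: arc_image_def)
  then show "eventually (\<lambda>x. x \<in> arc_image \<gamma> \<longrightarrow> P x) (nhds 0)" unfolding eventually_nhds_0 using d(1) by blast
next
  assume "eventually (\<lambda>x. x \<in> arc_image \<gamma> \<longrightarrow> P x) (nhds 0)"
  then obtain d where d: "d > 0" "\<And>x. norm x < d \<Longrightarrow> x \<in> arc_image \<gamma> \<Longrightarrow> P x" unfolding eventually_nhds_0 by blast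
  obtain e where e: "e > 0" "\<And>t. 0 \<le> t \<Longrightarrow> t < e \<Longrightarrow> norm (\<gamma> t) = t \<and> \<gamma> t \<in> arc_image \<gamma>"
    using arc_germD[OF assms(1)] by metis
  have "eventually (\<lambda>t. 0 < t \<and> t < min d e) (at_right 0)" using d e by (intro eventually_at_right_0_small) simp
  then show "eventually (\<lambda>t. P (\<gamma> t)) (at_right 0)"
    by eventually_elim (use d e in force)
qed

lemma epow_sector:
  assumes x: "x \<in> sector" and q: "0 \<le> q"
  shows "epow q (fst x) \<le> epow q (norm x) \<and> epow q (norm x) \<le> 2 powr real_of_ereal q * epow q (fst x)"
proof (cases "q = \<infinity> \<or> fst x \<le> 0")
  case True
  have "norm x = 0" if "fst x \<le> 0" using sector_norm[OF x] that norm_ge_zero[of x] by linarith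
  then show ?thesis using True by (auto simp: epow_def)
next
  case False
  then obtain r where r: "q = ereal r" "r \<ge> 0" using q by (cases q) auto
  have n: "0 < fst x" "fst x \<le> norm x" "norm x \<le> 2 * fst x" using False sector_norm[OF x] by auto
  have "norm x powr r \<le> (2 * fst x) powr r" using n r by (intro powr_mono2) auto
  also have "\<dots> = 2 powr r * fst x powr r" using n by (simp add: powr_mult)
  finally show ?thesis using n r by (auto simp: pw_def intro!: powr_mono2)
qed

lemma growth_iff_has_order:
  assumes \<gamma>: "arc_germ D \<gamma>" and cone: "germ_subset (arc_image \<gamma>) sector" and f0: "f 0 = 0" and q: "0 \<le> q"
  shows "growth (\<lambda>t. f (\<gamma> t)) q \<longleftrightarrow> has_order f q (arc_image \<gamma>)"
proof -
  let ?G = "\<lambda>c1 c2 x. c1 * epow q (norm x) \<le> f x \<and> f x \<le> c2 * epow q (norm x)"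
  let ?H = "\<lambda>c1 c2 x. c1 * epow q (fst x) \<le> f x \<and> f x \<le> c2 * epow q (fst x)"
  have cn: "eventually (\<lambda>x. x \<in> arc_image \<gamma> \<longrightarrow> x \<in> sector) (nhds 0)" using cone by (simp add: germ_subset_def)
  obtain e where e: "e > 0" "\<And>t. 0 \<le> t \<Longrightarrow> t < e \<Longrightarrow> norm (\<gamma> t) = t"
    using arc_germD[OF \<gamma>] by metis
  have nt: "eventually (\<lambda>t. norm (\<gamma> t) = t) (at_right 0)"
    using eventually_at_right_0_small[OF e(1)] by eventually_elim (use e in auto)
  have "eventually (\<lambda>t. c1 * epow q t \<le> f (\<gamma> t) \<and> f (\<gamma> t) \<le> c2 * epow q t) (at_right 0) \<longleftrightarrow>
      eventually (\<lambda>t. ?G c1 c2 (\<gamma> t)) (at_right 0)" for c1 c2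
    by (rule eventually_cong[OF nt]) simp
  also have "eventually (\<lambda>t. ?G c1 c2 (\<gamma> t)) (at_right 0) \<longleftrightarrow>
      eventually (\<lambda>x. x \<in> arc_image \<gamma> \<longrightarrow> ?G c1 c2 x) (nhds 0)" for c1 c2
    by (rule eventually_arc_iff[OF \<gamma>]) (simp add: f0)
  finally have gr: "growth (\<lambda>t. f (\<gamma> t)) q \<longleftrightarrow>
      (\<exists>c1>0. \<exists>c2>0. eventually (\<lambda>x. x \<in> arc_image \<gamma> \<longrightarrow> ?G c1 c2 x) (nhds 0))"
    unfolding growth_def by simp
  define C where "C = 2 powr real_of_ereal q"
  have C: "C > 0" by (simp add: C_def)
  have ec: "epow q (fst x) \<le> epow q (norm x)" "epow q (norm x) \<le> C * epow q (fst x)" if "x \<in> sector" for x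
    using epow_sector[OF that q] by (auto simp: C_def)
  show ?thesis unfolding gr
  proof (intro iffI; elim has_orderE exE conjE)
    fix c1 c2 :: real assume c: "c1 > 0" "c2 > 0" "eventually (\<lambda>x. x \<in> arc_image \<gamma> \<longrightarrow> ?G c1 c2 x) (nhds 0)"
    have "eventually (\<lambda>x. x \<in> arc_image \<gamma> \<longrightarrow> ?H c1 (c2 * C) x) (nhds 0)"
      using c(3) cn
    proof eventually_elim
      case (elim x)
      show ?case
      proof
        assume x: "x \<in> arc_image \<gamma>"
        have "c1 * epow q (fst x) \<le> c1 * epow q (norm x)" "c2 * epow q (norm x) \<le> c2 * (C * epow q (fst x))"
          using elim x ec c by (auto intro: mult_left_mono)
        then show "?H c1 (c2 * C) x" using elim x by auto
      qed
    qed
    then show "has_order f q (arc_image \<gamma>)"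
      using c C by (intro has_orderI[of c1 "c2 * C"]) simp_all
  next
    fix c1 c2 :: real assume c: "c1 > 0" "c2 > 0" "eventually (\<lambda>x. x \<in> arc_image \<gamma> \<longrightarrow> ?H c1 c2 x) (nhds 0)"
    have "eventually (\<lambda>x. x \<in> arc_image \<gamma> \<longrightarrow> ?G (c1 / C) c2 x) (nhds 0)"
      using c(3) cn
    proof eventually_elim
      case (elim x)
      show ?case
      proof
        assume x: "x \<in> arc_image \<gamma>"
        have xs: "x \<in> sector" using elim x by simp
        have "c1 / C * epow q (norm x) \<le> c1 / C * (C * epow q (fst x))"
          using ec(2)[OF xs] c(1) C by (intro mult_left_mono) auto
        moreover have "c2 * epow q (fst x) \<le> c2 * epow q (norm x)"
          using ec(1)[OF xs] c(2) by (intro mult_left_mono) auto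
        moreover have "c1 / C * (C * epow q (fst x)) = c1 * epow q (fst x)" using C by simp
        ultimately show "?G (c1 / C) c2 x" using elim x by linarith
      qed
    qed
    moreover have "c1 / C > 0" using c C by simp
    ultimately show "\<exists>c1>0. \<exists>c2>0. eventually (\<lambda>x. x \<in> arc_image \<gamma> \<longrightarrow> ?G c1 c2 x) (nhds 0)"
      using c(2) by blast
  qed
qed

text \<open>A continuous definable function that is positive except at \<open>0\<close> is strictly increasing near
  \<open>0\<close>, hence can be used as a parameter.\<close>

context o_minimal_structure
begin

lemma definable_germ_parameter:
  fixes n :: "real \<Rightarrow> real"
  assumes n: "dF n" "continuous_on {0..\<rho>} n" "n 0 = 0" "\<And>t. 0 < t \<Longrightarrow> t \<le> \<rho> \<Longrightarrow> n t > 0" and \<rho>: "0 < \<rho>"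
  shows "\<exists>\<delta>>0. \<forall>s. 0 \<le> s \<longrightarrow> s < \<delta> \<longrightarrow> (\<exists>!t. t \<in> {0..\<rho>} \<and> n t = s)"
proof -
  obtain e R where e: "e > 0" and R: "R = (<) \<or> R = (>) \<or> R = (=)"
    and mono: "\<And>x y. 0 < x \<Longrightarrow> x < y \<Longrightarrow> y < e \<Longrightarrow> R (n x) (n y)"
    using definable_germ_monotone[OF n(1)] by blast
  define a where "a = min e \<rho> / 2"
  have a: "0 < a" "a < e" "a < \<rho>" using e \<rho> by (auto simp: a_def)
  have R_less: "R = (<)"
  proof (rule ccontr)
    assume "R \<noteq> (<)"
    then have ge: "n x \<ge> n a" if "0 < x" "x < a" for x using mono[of x a] that a R by auto
    have "(n \<longlongrightarrow> n 0) (at 0 within {0..\<rho>})" using n(2) \<rho> by (simp add: continuous_on)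
    then have "(n \<longlongrightarrow> n 0) (at_right 0)" unfolding at_within_Icc_at_right[OF \<rho>] .
    moreover have "eventually (\<lambda>x. n x \<ge> n a) (at_right 0)"
      using eventually_at_right_0_small[OF a(1)] by eventually_elim (use ge in auto)
    ultimately have "n a \<le> n 0" by (intro tendsto_lowerbound) auto
    then show False using n(3) n(4)[of a] a by simp
  qed
  have inc: "n x < n y" if "0 \<le> x" "x < y" "y \<le> a" for x y
    using mono[of x y] n(3) n(4)[of y] that a R_less by (cases "x = 0") auto
  obtain z where z: "z \<in> {a..\<rho>}" "\<And>y. y \<in> {a..\<rho>} \<Longrightarrow> n z \<le> n y"
  proof -
    have "continuous_on {a..\<rho>} n" using n(2) by (rule continuous_on_subset) (use a in auto)
    then have "\<exists>x\<in>{a..\<rho>}. \<forall>y\<in>{a..\<rho>}. n x \<le> n y" using a by (intro continuous_attains_inf) auto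
    then show ?thesis using that by blast
  qed
  have "n z > 0" using n(4) z a by auto
  moreover have "\<exists>!t. t \<in> {0..\<rho>} \<and> n t = s" if s: "0 \<le> s" "s < n z" for s
  proof -
    have "n 0 \<le> s" "s \<le> n a" using n(3) s z(2)[of a] a by auto
    moreover have "continuous_on {0..a} n" using n(2) by (rule continuous_on_subset) (use a in auto)
    ultimately have "\<exists>t. 0 \<le> t \<and> t \<le> a \<and> n t = s" using a by (intro IVT') auto
    then obtain t where t: "0 \<le> t" "t \<le> a" "n t = s" by blast
    moreover have "t' = t" if "t' \<in> {0..\<rho>}" "n t' = s" for t'
    proof -
      have "t' < a" using z(2)[of t'] that s by force
      then show ?thesis using inc[of t t'] inc[of t' t] t that by (cases t t' rule: linorder_cases) auto
    qed
    ultimately show ?thesis using a by (intro ex1I[of _ t]) auto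
  qed
  ultimately show ?thesis by blast
qed

text \<open>A definable set that meets each small sphere in exactly one point is an arc, parametrized by the
  distance to the origin.\<close>

lemma arc_of_arc_germ:
  fixes A :: "(real \<times> real) set"
  assumes A: "dP (\<lambda>x. x \<in> A)" "0 \<in> A" and \<delta>: "\<delta> > 0"
    and u: "\<And>s. 0 \<le> s \<Longrightarrow> s < \<delta> \<Longrightarrow> \<exists>!x. x \<in> A \<and> norm x = s"
  shows "arc_germ D (arc_of A)" "\<And>x. norm x < \<delta> \<Longrightarrow> x \<in> arc_image (arc_of A) \<longleftrightarrow> x \<in> A"
proof -
  have the: "arc_of A s \<in> A \<and> norm (arc_of A s) = s" if "0 \<le> s" "s < \<delta>" for s
    using theI'[OF u[OF that]] unfolding arc_of_def .
  have the_eq: "arc_of A (norm x) = x" if "x \<in> A" "norm x < \<delta>" for x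
    using u[of "norm x"] the[of "norm x"] that by auto
  have "dP (\<lambda>z :: real \<times> real \<times> real. (0 \<le> fst z \<and> fst z < \<delta>) \<and> snd z \<in> A \<and> norm (snd z) = fst z)"
    by (intro dP_intros dP_subst[OF A(1)] dF_arith)
  moreover have "(0 \<le> fst z \<and> fst z < \<delta>) \<and> snd z \<in> A \<and> norm (snd z) = fst z \<longleftrightarrow>
      fst z \<in> {0..<\<delta>} \<and> snd z = arc_of A (fst z)" for z :: "real \<times> real \<times> real"
    using the[of "fst z"] the_eq[of "snd z"] by auto
  ultimately have "definable_on D {0..<\<delta>} (arc_of A)" unfolding definable_on_dP by simp
  moreover have "arc_of A 0 = 0" using the[of 0] \<delta> by simp
  ultimately show "arc_germ D (arc_of A)" unfolding arc_germ_def using \<delta> the by auto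
  show "x \<in> arc_image (arc_of A) \<longleftrightarrow> x \<in> A" if "norm x < \<delta>" for x
    using the[of "norm x"] the_eq[of x] that by (auto simp: arc_image_def)
qed

lemma curve_arc:
  fixes p :: "real \<Rightarrow> real \<times> real"
  assumes p: "dF p" "continuous_on {0..\<rho>} p" "p 0 = 0" "\<And>t. 0 < t \<Longrightarrow> t \<le> \<rho> \<Longrightarrow> p t \<noteq> 0" and \<rho>: "0 < \<rho>"
  shows "arc_germ D (arc_of (p ` {0..\<rho>}))" "\<exists>\<delta>>0. \<forall>x. norm x < \<delta> \<longrightarrow> (x \<in> arc_image (arc_of (p ` {0..\<rho>})) \<longleftrightarrow> x \<in> p ` {0..\<rho>})"
proof -
  have "dF (\<lambda>t. norm (p t))" by (intro dF_norm_pair p)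
  moreover have "continuous_on {0..\<rho>} (\<lambda>t. norm (p t))" by (intro continuous_intros p)
  ultimately have "\<exists>\<delta>>0. \<forall>s. 0 \<le> s \<longrightarrow> s < \<delta> \<longrightarrow> (\<exists>!t. t \<in> {0..\<rho>} \<and> norm (p t) = s)"
    using p(3,4) \<rho> by (intro definable_germ_parameter) auto
  then obtain \<delta> where \<delta>: "\<delta> > 0" "\<And>s. 0 \<le> s \<Longrightarrow> s < \<delta> \<Longrightarrow> \<exists>!t. t \<in> {0..\<rho>} \<and> norm (p t) = s"
    by blast
  have u: "\<exists>!x. x \<in> p ` {0..\<rho>} \<and> norm x = s" if s: "0 \<le> s" "s < \<delta>" for s
  proof -
    obtain t where "t \<in> {0..\<rho>}" "norm (p t) = s" "\<And>t'. t' \<in> {0..\<rho>} \<Longrightarrow> norm (p t') = s \<Longrightarrow> t' = t"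
      using \<delta>(2)[OF s] by blast
    then show ?thesis
    proof (intro ex1I[of _ "p t"])
      fix x assume "x \<in> p ` {0..\<rho>} \<and> norm x = s"
      then obtain t' where t': "x = p t'" "t' \<in> {0..\<rho>}" "norm (p t') = s" by blast
      then have "t' = t" using \<open>\<And>t'. t' \<in> {0..\<rho>} \<Longrightarrow> norm (p t') = s \<Longrightarrow> t' = t\<close> by blast
      then show "x = p t" using t' by simp
    qed blast
  qed
  have "dP (\<lambda>x. \<exists>t. 0 \<le> t \<and> t \<le> \<rho> \<and> x = p t)" by (intro dP_intros dF_comp[OF p(1)] dF_arith)
  moreover have "(\<exists>t. 0 \<le> t \<and> t \<le> \<rho> \<and> x = p t) \<longleftrightarrow> x \<in> p ` {0..\<rho>}" for x by auto
  ultimately have A: "dP (\<lambda>x. x \<in> p ` {0..\<rho>})" by simp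
  have "0 \<in> p ` {0..\<rho>}" using p(3) \<rho> by (auto intro!: image_eqI[of _ _ 0])
  from arc_of_arc_germ[OF A this \<delta>(1) u]
  show "arc_germ D (arc_of (p ` {0..\<rho>}))" "\<exists>\<delta>>0. \<forall>x. norm x < \<delta> \<longrightarrow> (x \<in> arc_image (arc_of (p ` {0..\<rho>})) \<longleftrightarrow> x \<in> p ` {0..\<rho>})"
    using \<delta>(1) by blast+
qed

definition graph :: "(real \<Rightarrow> real) \<Rightarrow> (real \<times> real) set" where
  "graph y = {x. 0 \<le> fst x \<and> snd x = y (fst x)}"

lemma std_lower_graph: "std_lower = graph (\<lambda>u. 0)"
  by (auto simp: std_lower_def graph_def)

lemma std_upper_graph: "std_upper m = graph (pw m)"
  by (auto simp: std_upper_def graph_def pw_eq')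

lemma graph_arc:
  assumes y: "dF y" "continuous_on {0..\<rho>} y" "y 0 = 0" and \<rho>: "0 < \<rho>"
  shows "arc_germ D (arc_of (graph y))" "germ_eq (arc_image (arc_of (graph y))) (graph y)"
proof -
  define p where "p u = (u, y u)" for u
  have n: "\<bar>u\<bar> \<le> norm (p u)" for u using norm_fst_le[of u "y u"] by (simp add: p_def)
  have dp: "dF (\<lambda>u. norm (p u))" unfolding p_def by (intro dF_arith y)
  have cp: "continuous_on {0..\<rho>} (\<lambda>u. norm (p u))" unfolding p_def by (intro continuous_intros y)
  obtain \<delta> where \<delta>: "\<delta> > 0" "\<And>s. 0 \<le> s \<Longrightarrow> s < \<delta> \<Longrightarrow> \<exists>!t. t \<in> {0..\<rho>} \<and> norm (p t) = s"
  proof -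
    have "norm (p 0) = 0" by (simp add: p_def y(3))
    moreover have "norm (p t) > 0" if "0 < t" for t using n[of t] that by linarith
    ultimately have "\<exists>\<delta>>0. \<forall>s. 0 \<le> s \<longrightarrow> s < \<delta> \<longrightarrow> (\<exists>!t. t \<in> {0..\<rho>} \<and> norm (p t) = s)"
      by (intro definable_germ_parameter[OF dp cp _ _ \<rho>]) auto
    then show ?thesis using that by blast
  qed
  have u: "\<exists>!x. x \<in> graph y \<and> norm x = s" if s: "0 \<le> s" "s < min \<delta> \<rho>" for s
  proof -
    obtain t where t: "t \<in> {0..\<rho>}" "norm (p t) = s" "\<And>t'. t' \<in> {0..\<rho>} \<Longrightarrow> norm (p t') = s \<Longrightarrow> t' = t"
    proof -
      have "\<exists>!t. t \<in> {0..\<rho>} \<and> norm (p t) = s" by (rule \<delta>(2)) (use s in auto)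
      then show ?thesis using that by blast
    qed
    show ?thesis
    proof (rule ex1I[of _ "p t"])
      show "p t \<in> graph y \<and> norm (p t) = s" using t(1,2) by (simp add: p_def graph_def)
      fix x assume x: "x \<in> graph y \<and> norm x = s"
      then have px: "x = p (fst x)" "0 \<le> fst x" by (auto simp: p_def graph_def prod_eq_iff)
      then have "fst x \<le> s" using n[of "fst x"] x by simp
      then have "fst x \<in> {0..\<rho>}" "norm (p (fst x)) = s" using px x s by auto
      then have "fst x = t" by (rule t(3))
      then show "x = p t" using px by simp
    qed
  qed
  have A: "dP (\<lambda>x. x \<in> graph y)" unfolding graph_def mem_Collect_eq by (intro dP_intros dF_comp[OF y(1)] dF_arith)
  have 0: "0 \<in> graph y" using y(3) by (simp add: graph_def)
  have \<delta>\<rho>: "min \<delta> \<rho> > 0" using \<delta> \<rho> by simp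
  show "arc_germ D (arc_of (graph y))" by (rule arc_of_arc_germ(1)[OF A 0 \<delta>\<rho> u])
  show "germ_eq (arc_image (arc_of (graph y))) (graph y)"
    unfolding germ_eq_def eventually_nhds_0
    by (rule exI[of _ "min \<delta> \<rho>"]) (use \<delta>\<rho> arc_of_arc_germ(2)[OF A 0 \<delta>\<rho> u] in blast)
qed

end

context polynomially_bounded_structure
begin

lemma arc_growth:
  fixes f :: "real \<times> real \<Rightarrow> real"
  assumes f: "dF f" and \<gamma>: "arc_germ D \<gamma>" and nonneg: "eventually (\<lambda>t. 0 \<le> f (\<gamma> t)) (at_right 0)"
  shows "\<exists>q. order_along f \<gamma> = q \<and> growth (\<lambda>t. f (\<gamma> t)) q \<and> (q = \<infinity> \<or> (\<exists>r\<in>exponents D. q = ereal r))"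
  (is "\<exists>q. ?P q")
proof -
  obtain e where e: "e > 0" "definable_on D {0..<e} \<gamma>" using arc_germD[OF \<gamma>] by metis
  define g where "g t = (if t \<in> {0..<e} then f (\<gamma> t) else 0)" for t
  have dI: "dP (\<lambda>t :: real. t \<in> {0..<e})" unfolding atLeastLessThan_iff by (intro dP_intros dF_arith)
  have "dF (\<lambda>t. if t \<in> {0..<e} then \<gamma> t else (0, 0))"
    using e(2) by (intro definable_on_extend dF_arith)
  from dF_comp[OF f this] have "dF (\<lambda>t. if t \<in> {0..<e} then f (if t \<in> {0..<e} then \<gamma> t else (0, 0)) else 0)"
    by (intro dF_if dI dF_const_real)
  then have dg: "dF g" unfolding g_def[abs_def] by (simp cong: if_cong)
  have geq: "eventually (\<lambda>t. g t = f (\<gamma> t)) (at_right 0)"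
    using eventually_at_right_0_small[OF e(1)] by eventually_elim (simp add: g_def)
  have "dP (\<lambda>t. g t > 0)" by (intro dP_less dg dF_const_real)
  from definable_at_right[OF this, of 0] show ?thesis
  proof
    assume "eventually (\<lambda>t. g t > 0) (at_right 0)"
    then obtain r c where r: "r \<in> exponents D" "c > 0" "((\<lambda>t. g t / t powr r) \<longlongrightarrow> c) (at_right 0)"
      using definable_germ_order[OF dg] by metis
    have lim: "((\<lambda>t. f (\<gamma> t) / t powr r) \<longlongrightarrow> c) (at_right 0)"
      using r(3) by (rule Lim_transform_eventually) (use geq in \<open>eventually_elim, simp\<close>)
    show ?thesis using order_along_of_limit[of c f \<gamma> r, OF r(2) lim] growth_of_limit[OF r(2) lim] r(1) by blast
  next
    assume "eventually (\<lambda>t. \<not> g t > 0) (at_right 0)"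
    with nonneg geq have z: "eventually (\<lambda>t. f (\<gamma> t) = 0) (at_right 0)"
      by eventually_elim simp
    then have "order_along f \<gamma> = \<infinity>" by (simp add: order_along_def)
    moreover have "growth (\<lambda>t. f (\<gamma> t)) \<infinity>"
      using z by (intro growthI[of 1 1]) (auto elim: eventually_mono)
    ultimately show ?thesis by blast
  qed
qed

text \<open>The bound \<open>f x \<le> K * fst x\<close> forces the order to be at least \<open>1\<close>.\<close>

lemma arc_order:
  assumes f: "dF f" and f0: "f 0 = 0"
    and T: "germ_subset T sector" "eventually (\<lambda>x. x \<in> T \<longrightarrow> 0 \<le> f x \<and> f x \<le> K * fst x) (nhds 0)"
    and \<gamma>: "\<gamma> \<in> arcs_in D T"
  shows "order_along f \<gamma> \<in> orders D" "has_order f (order_along f \<gamma>) (arc_image \<gamma>)"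
    "\<And>q. 0 \<le> q \<Longrightarrow> has_order f q (arc_image \<gamma>) \<Longrightarrow> order_along f \<gamma> = q"
proof -
  have arc: "arc_germ D \<gamma>" and sub: "eventually (\<lambda>x. x \<in> arc_image \<gamma> \<longrightarrow> x \<in> T) (nhds 0)"
    using \<gamma> by (auto simp: arcs_in_def germ_subset_def)
  have sc: "germ_subset (arc_image \<gamma>) sector"
    using T(1) sub unfolding germ_subset_def by eventually_elim simp
  have bnd: "eventually (\<lambda>x. x \<in> arc_image \<gamma> \<longrightarrow> 0 \<le> f x \<and> f x \<le> \<bar>K\<bar> * norm x) (nhds 0)"
    using T(2) sub sc unfolding germ_subset_def
  proof eventually_elim
    case (elim x)
    have "K * fst x \<le> \<bar>K\<bar> * norm x" if "x \<in> sector"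
      using sector_norm[OF that] by (intro mult_mono) auto
    then show ?case using elim by auto
  qed
  then have bt: "eventually (\<lambda>t. 0 \<le> f (\<gamma> t) \<and> f (\<gamma> t) \<le> \<bar>K\<bar> * norm (\<gamma> t)) (at_right 0)"
    by (subst eventually_arc_iff[OF arc]) (use f0 in auto)
  obtain e where e: "e > 0" "\<And>t. 0 \<le> t \<Longrightarrow> t < e \<Longrightarrow> norm (\<gamma> t) = t"
    using arc_germD[OF arc] by metis
  have "eventually (\<lambda>t. 0 \<le> f (\<gamma> t)) (at_right 0)" using bt by eventually_elim simp
  then obtain q where q: "order_along f \<gamma> = q" "growth (\<lambda>t. f (\<gamma> t)) q" "q = \<infinity> \<or> (\<exists>r\<in>exponents D. q = ereal r)"
    using arc_growth[OF f arc] by blast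
  obtain c1 c2 where c: "c1 > 0" "eventually (\<lambda>t. c1 * epow q t \<le> f (\<gamma> t) \<and> f (\<gamma> t) \<le> c2 * epow q t) (at_right 0)"
    using q(2) unfolding growth_def by blast
  have "eventually (\<lambda>t. c1 * epow q t \<le> \<bar>K\<bar> * epow (ereal 1) t) (at_right 0)"
    using c(2) bt eventually_at_right_0_small[OF e(1)]
    by eventually_elim (use e in \<open>auto simp: pw_def\<close>)
  then have q1: "ereal 1 \<le> q" using c(1) q(3) by (intro epow_compare) auto
  then show "order_along f \<gamma> \<in> orders D" using q by (auto simp: orders_def)
  have q0: "0 \<le> q" using q1 by (simp add: zero_ereal_def) (metis ereal_less_eq(3) order_trans zero_le_one)
  show "has_order f (order_along f \<gamma>) (arc_image \<gamma>)"
    using growth_iff_has_order[of D \<gamma> f q, OF arc sc f0 q0] q by simp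
  fix q' :: ereal assume q': "0 \<le> q'" "has_order f q' (arc_image \<gamma>)"
  then have "growth (\<lambda>t. f (\<gamma> t)) q'" using growth_iff_has_order[of D \<gamma> f q', OF arc sc f0 q'(1)] by simp
  then show "order_along f \<gamma> = q'" using growth_unique[OF q(2)] q(1) q0 q'(1) by force
qed

end

section \<open>Hoelder triangles in the plane\<close>

lemma inner_bilipschitz_germ_small:
  assumes "inner_bilipschitz_germ D X Y h" "\<delta> > 0"
  shows "eventually (\<lambda>x. x \<in> X \<longrightarrow> norm (h x) < \<delta>) (nhds 0)"
proof -
  obtain U V g where U: "open U" "0 \<in> U" and h: "0 \<in> X" "h 0 = 0" and hom: "homeomorphism (X \<inter> U) (Y \<inter> V) h g"
    using assms(1) unfolding inner_bilipschitz_germ_def by blast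
  have c: "continuous_on (X \<inter> U) h" using hom by (simp add: homeomorphism_def)
  obtain d where d: "d > 0" "\<And>x. x \<in> X \<inter> U \<Longrightarrow> dist x 0 < d \<Longrightarrow> dist (h x) (h 0) < \<delta>"
    using c[unfolded continuous_on_iff, rule_format, of 0 \<delta>] U h assms(2) by auto
  obtain e where e: "e > 0" "ball 0 e \<subseteq> U" using U open_contains_ball by blast
  show ?thesis unfolding eventually_nhds_0
  proof (intro exI conjI allI impI)
    show "min d e > 0" using d e by simp
    fix x assume "norm x < min d e" "x \<in> X"
    then show "norm (h x) < \<delta>" using d(2)[of x] e h by (auto simp: subset_iff)
  qed
qed

lemma std_boundary_subset: "std_lower \<subseteq> std_triangle m" "std_upper m \<subseteq> std_triangle m"
  by (auto simp: std_lower_def std_upper_def std_triangle_def)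

context o_minimal_structure
begin

lemma region_holder_triangle:
  assumes m: "m \<in> exponents D" "1 \<le> m" and \<rho>: "0 < \<rho>" "\<rho> \<le> 1"
    and dF: "dF y1" "dF y2" and lip: "lipschitzian {0..\<rho>} y1" "lipschitzian {0..\<rho>} y2"
    and c: "0 < c" "\<And>u. 0 \<le> u \<Longrightarrow> u \<le> \<rho> \<Longrightarrow> c * pw m u \<le> y2 u - y1 u \<and> y2 u - y1 u \<le> C * pw m u"
    and y0: "y1 0 = 0"
  shows "holder_triangle D m (region \<rho> y1 y2)"
    "holder_triangle_between D m (region \<rho> y1 y2) (arc_of (graph y1)) (arc_of (graph y2))"
proof -
  let ?h = "\<lambda>x. (fst x, y1 (fst x) + snd x * (y2 (fst x) - y1 (fst x)) / pw m (fst x))"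
  have h: "inner_bilipschitz_germ D (std_triangle m) (region \<rho> y1 y2) ?h"
    by (rule inner_bilipschitz_germ_region[OF assms])
  then show "holder_triangle D m (region \<rho> y1 y2)" unfolding holder_triangle_def using m by blast
  have y20: "y2 0 = 0" using c(2)[of 0] \<rho> y0 by simp
  note g1 = graph_arc[OF dF(1) lipschitzian_continuous_on[OF lip(1)] y0 \<rho>(1)]
  note g2 = graph_arc[OF dF(2) lipschitzian_continuous_on[OF lip(2)] y20 \<rho>(1)]
  have pos: "y2 u - y1 u > 0" "pw m u > 0" if "0 < u" "u \<le> \<rho>" for u
  proof -
    show "pw m u > 0" using that by (simp add: pw_pos)
    then have "0 < c * pw m u" using c(1) by simp
    then show "y2 u - y1 u > 0" using c(2)[of u] that by linarith
  qed
  have small: "eventually (\<lambda>x :: real \<times> real. fst x < \<rho>) (nhds 0)"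
    unfolding eventually_nhds_0
  proof (intro exI[of _ \<rho>] conjI allI impI \<rho>(1))
    fix x :: "real \<times> real" assume "norm x < \<rho>"
    moreover have "norm (fst x) \<le> norm x" by (metis norm_fst_le prod.collapse)
    ultimately show "fst x < \<rho>" by simp
  qed
  have gr1: "x \<in> std_lower \<longleftrightarrow> x \<in> std_triangle m \<and> ?h x \<in> graph y1" if "fst x < \<rho>" for x
  proof -
    obtain u v where x: "x = (u, v)" by fastforce
    show ?thesis
    proof (cases "0 < u")
      case True
      then have "pw m u > 0" "y2 u - y1 u > 0" using pos[of u] that by (auto simp: x)
      then show ?thesis using True by (auto simp: x std_lower_def graph_def std_triangle_pw)
    next
      case False
      then show ?thesis by (cases "u = 0") (auto simp: x std_lower_def graph_def std_triangle_pw)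
    qed
  qed
  have gr2: "x \<in> std_upper m \<longleftrightarrow> x \<in> std_triangle m \<and> ?h x \<in> graph y2" if "fst x < \<rho>" for x
  proof -
    obtain u v where x: "x = (u, v)" by fastforce
    show ?thesis
    proof (cases "0 < u")
      case True
      then have p: "pw m u > 0" "y2 u - y1 u > 0" using pos[of u] that by (auto simp: x)
      have "y1 u + v * (y2 u - y1 u) / pw m u = y2 u \<longleftrightarrow> v * (y2 u - y1 u) = pw m u * (y2 u - y1 u)"
        using p by (auto simp: field_simps)
      also have "\<dots> \<longleftrightarrow> v = pw m u" using p by simp
      finally show ?thesis using True p by (auto simp: x std_upper_graph graph_def std_triangle_pw)
    next
      case False
      then show ?thesis using y0 y20 by (cases "u = 0") (auto simp: x std_upper_graph graph_def std_triangle_pw)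
    qed
  qed
  have "germ_eq std_lower {x \<in> std_triangle m. ?h x \<in> arc_image (arc_of (graph y1))}"
  proof -
    obtain \<delta> where \<delta>: "\<delta> > 0" "\<And>z. norm z < \<delta> \<Longrightarrow> z \<in> arc_image (arc_of (graph y1)) \<longleftrightarrow> z \<in> graph y1"
      using g1(2) unfolding germ_eq_def eventually_nhds_0 by blast
    show ?thesis unfolding germ_eq_def
      using inner_bilipschitz_germ_small[OF h \<delta>(1)] small
    proof eventually_elim
      case (elim x)
      show ?case
        unfolding gr1[OF elim(2)] using elim(1) \<delta>(2)[of "?h x"] by blast
    qed
  qed
  moreover have "germ_eq (std_upper m) {x \<in> std_triangle m. ?h x \<in> arc_image (arc_of (graph y2))}"
  proof -
    obtain \<delta> where \<delta>: "\<delta> > 0" "\<And>z. norm z < \<delta> \<Longrightarrow> z \<in> arc_image (arc_of (graph y2)) \<longleftrightarrow> z \<in> graph y2"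
      using g2(2) unfolding germ_eq_def eventually_nhds_0 by blast
    show ?thesis unfolding germ_eq_def
      using inner_bilipschitz_germ_small[OF h \<delta>(1)] small
    proof eventually_elim
      case (elim x)
      show ?case
        unfolding gr2[OF elim(2)] using elim(1) \<delta>(2)[of "?h x"] by blast
    qed
  qed
  ultimately show "holder_triangle_between D m (region \<rho> y1 y2) (arc_of (graph y1)) (arc_of (graph y2))"
    unfolding holder_triangle_between_def using m g1(1) g2(1) h by blast
qed

end

abbreviation std_region :: "real \<Rightarrow> real \<Rightarrow> (real \<times> real) set" where
  "std_region \<alpha> \<rho> \<equiv> region \<rho> (\<lambda>u. 0) (pw \<alpha>)"

definition std_interior :: "real \<Rightarrow> real \<Rightarrow> (real \<times> real) set" where
  "std_interior \<alpha> \<rho> = {x. 0 < fst x \<and> fst x < \<rho> \<and> 0 < snd x \<and> snd x < pw \<alpha> (fst x)}"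

lemma std_region_sector: "1 \<le> \<alpha> \<Longrightarrow> \<rho> \<le> 1 \<Longrightarrow> std_region \<alpha> \<rho> \<subseteq> sector"
  using pw_le_id[of _ \<alpha>] by (force simp: region_def sector_def)

lemma continuous_on_pw: "1 \<le> \<alpha> \<Longrightarrow> \<rho> \<le> 1 \<Longrightarrow> continuous_on {0..\<rho>} (pw \<alpha>)"
  using lipschitzian_continuous_on[OF lipschitzian_pw] by (rule continuous_on_subset) auto

lemma compact_std_region:
  assumes "1 \<le> \<alpha>" "\<rho> \<le> 1"
  shows "compact (std_region \<alpha> \<rho>)"
proof -
  have eq: "std_region \<alpha> \<rho> = (\<lambda>p. (fst p, snd p * pw \<alpha> (fst p))) ` ({0..\<rho>} \<times> {0..1})"
  proof (intro equalityI subsetI)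
    fix x assume x: "x \<in> std_region \<alpha> \<rho>"
    obtain u v where uv: "x = (u, v)" by fastforce
    have uv0: "0 \<le> u" "u \<le> \<rho>" "0 \<le> v" "v \<le> pw \<alpha> u" using x by (auto simp: uv region_def)
    have "x = (\<lambda>p. (fst p, snd p * pw \<alpha> (fst p))) (u, v / pw \<alpha> u)"
      using uv0 pw_pos[of u \<alpha>] by (cases "u = 0") (auto simp: uv)
    moreover have "(u, v / pw \<alpha> u) \<in> {0..\<rho>} \<times> {0..1}"
      using uv0 pw_pos[of u \<alpha>] by (cases "u = 0") (auto simp: divide_le_eq)
    ultimately show "x \<in> (\<lambda>p. (fst p, snd p * pw \<alpha> (fst p))) ` ({0..\<rho>} \<times> {0..1})" by (rule image_eqI)
  qed (auto simp: region_def pw_nonneg mult_left_le_one_le)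
  have "continuous_on ({0..\<rho>} \<times> {0..1}) (\<lambda>p. pw \<alpha> (fst p :: real))"
    by (rule continuous_on_compose2[OF continuous_on_pw[OF assms]]) (auto intro: continuous_intros)
  then show ?thesis unfolding eq
    by (intro compact_continuous_image compact_Times continuous_intros) auto
qed

lemma open_std_interior: "open (std_interior \<alpha> \<rho>)"
proof -
  let ?S = "{0<..<\<rho>} \<times> (UNIV :: real set)"
  have "open (?S \<inter> (\<lambda>x. fst x powr \<alpha> - snd x) -` {0<..})"
    by (intro continuous_open_preimage open_Times continuous_intros) auto
  moreover have "open {x :: real \<times> real. 0 < snd x}" by (intro open_Collect_less continuous_intros)
  moreover have "std_interior \<alpha> \<rho> = (?S \<inter> (\<lambda>x. fst x powr \<alpha> - snd x) -` {0<..}) \<inter> {x. 0 < snd x}"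
    by (auto simp: std_interior_def pw_def)
  ultimately show ?thesis by (simp only: open_Int)
qed

lemma connected_std_interior:
  assumes "1 \<le> \<alpha>" "\<rho> \<le> 1"
  shows "connected (std_interior \<alpha> \<rho>)"
proof -
  have eq: "std_interior \<alpha> \<rho> = (\<lambda>p. (fst p, snd p * pw \<alpha> (fst p))) ` ({0<..<\<rho>} \<times> {0<..<1})"
  proof (intro equalityI subsetI)
    fix x assume x: "x \<in> std_interior \<alpha> \<rho>"
    obtain u v where uv: "x = (u, v)" by fastforce
    have "x = (\<lambda>p. (fst p, snd p * pw \<alpha> (fst p))) (u, v / pw \<alpha> u)"
      using x pw_pos[of u \<alpha>] by (auto simp: uv std_interior_def)
    moreover have "(u, v / pw \<alpha> u) \<in> {0<..<\<rho>} \<times> {0<..<1}"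
      using x pw_pos[of u \<alpha>] by (auto simp: uv std_interior_def)
    ultimately show "x \<in> (\<lambda>p. (fst p, snd p * pw \<alpha> (fst p))) ` ({0<..<\<rho>} \<times> {0<..<1})" by (rule image_eqI)
  qed (auto simp: std_interior_def pw_pos)
  have "continuous_on ({0<..<\<rho>} \<times> {0<..<1}) (\<lambda>p. pw \<alpha> (fst p :: real))"
    by (rule continuous_on_compose2[OF continuous_on_pw[OF assms]]) (auto intro: continuous_intros)
  moreover have "connected ({0<..<\<rho>} \<times> {0<..<1::real})" by (intro connected_Times connected_Ioo)
  ultimately show ?thesis unfolding eq
    by (intro connected_continuous_image continuous_intros) auto
qed

lemma std_interior_subset: "std_interior \<alpha> \<rho> \<subseteq> std_region \<alpha> \<rho>"
  by (auto simp: std_interior_def region_def)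

lemma not_std_interior:
  "k \<in> std_region \<alpha> \<rho> \<Longrightarrow> fst k < \<rho> \<Longrightarrow> k \<notin> std_interior \<alpha> \<rho> \<Longrightarrow> snd k = 0 \<or> snd k = pw \<alpha> (fst k)"
  by (cases "fst k = 0") (auto simp: std_interior_def region_def)

text \<open>Near the origin a Hoelder triangle is the homeomorphic image of a compact piece of the standard
  one. All later arguments take place in such a chart.\<close>

definition holder_chart ::
  "(nat \<Rightarrow> real list set set) \<Rightarrow> real \<Rightarrow> (real \<times> real) set \<Rightarrow> (real \<times> real \<Rightarrow> real \<times> real)
    \<Rightarrow> real \<Rightarrow> real \<Rightarrow> real \<Rightarrow> bool" where
  "holder_chart D \<alpha> T h \<rho> r K \<longleftrightarrow> 1 \<le> \<alpha> \<and> 0 < \<rho> \<and> \<rho> \<le> 1 \<and> 0 < r \<and> 0 < K \<and> h 0 = 0 \<and>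
    continuous_on (std_region \<alpha> \<rho>) h \<and> inj_on h (std_region \<alpha> \<rho>) \<and>
    h ` std_region \<alpha> \<rho> \<subseteq> T \<and> h ` std_region \<alpha> \<rho> \<subseteq> sector \<and>
    (\<forall>p\<in>T. norm p < r \<longrightarrow> (\<exists>k\<in>std_region \<alpha> \<rho>. fst k < \<rho> \<and> h k = p)) \<and>
    (\<forall>x\<in>std_region \<alpha> \<rho>. \<forall>y\<in>std_region \<alpha> \<rho>.
      inner_dist T (h x) (h y) \<le> ennreal K * inner_dist (std_triangle \<alpha>) x y \<and>
      inner_dist (std_triangle \<alpha>) x y \<le> ennreal K * inner_dist T (h x) (h y)) \<and>
    definable_on D (std_region \<alpha> \<rho>) h"

lemma (in o_minimal_structure) definable_on_subset:
  assumes "definable_on D X f" "Y \<subseteq> X" "dP (\<lambda>x. x \<in> Y)"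
  shows "definable_on D Y f"
proof -
  have "dP (\<lambda>z. fst z \<in> Y \<and> (fst z \<in> X \<and> snd z = f (fst z)))"
    using dP_vimage[OF assms(3) coordmap_projections(1)] assms(1)[unfolded definable_on_dP] by (rule dP_conj)
  moreover have "(fst z \<in> Y \<and> (fst z \<in> X \<and> snd z = f (fst z))) \<longleftrightarrow> fst z \<in> Y \<and> snd z = f (fst z)" for z
    using assms(2) by blast
  ultimately show ?thesis unfolding definable_on_dP by simp
qed

lemma (in o_minimal_structure) holder_chart_exists:
  assumes h: "inner_bilipschitz_germ D (std_triangle \<alpha>) T h" and \<alpha>: "1 \<le> \<alpha>" "\<alpha> \<in> exponents D"
    and T: "germ_subset T sector" and \<eta>: "\<eta> > 0"
  obtains \<rho> r K where "holder_chart D \<alpha> T h \<rho> r K" "\<rho> < \<eta>"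
proof -
  let ?X = "std_triangle \<alpha>"
  obtain U V g K where U: "open U" "0 \<in> U" and V: "open V" "0 \<in> V" and h0: "0 \<in> ?X" "h 0 = 0"
    and dh: "definable_on D (?X \<inter> U) h" and hom: "homeomorphism (?X \<inter> U) (T \<inter> V) h g"
    and K: "\<And>x y. x \<in> ?X \<inter> U \<Longrightarrow> y \<in> ?X \<inter> U \<Longrightarrow>
        inner_dist T (h x) (h y) \<le> ennreal K * inner_dist ?X x y \<and>
        inner_dist ?X x y \<le> ennreal K * inner_dist T (h x) (h y)"
    using h unfolding inner_bilipschitz_germ_def by blast
  obtain d where d: "d > 0" "\<And>x. norm x < d \<Longrightarrow> x \<in> T \<Longrightarrow> x \<in> sector"
    using T unfolding germ_subset_def eventually_nhds_0 by blast
  obtain e1 where e1: "e1 > 0" "\<And>x. norm x < e1 \<Longrightarrow> x \<in> U" using U unfolding open_contains_ball by (metis mem_ball_0 subsetD)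
  obtain e2 where e2: "e2 > 0" "\<And>x. norm x < e2 \<Longrightarrow> x \<in> ?X \<Longrightarrow> norm (h x) < d"
    using inner_bilipschitz_germ_small[OF h d(1)] unfolding eventually_nhds_0 by blast
  define \<rho> where "\<rho> = min (min 1 (\<eta> / 2)) (min (e1 / 3) (e2 / 3))"
  have \<rho>: "0 < \<rho>" "\<rho> \<le> 1" "\<rho> < \<eta>" "2 * \<rho> < e1" "2 * \<rho> < e2" using \<eta> e1(1) e2(1) by (auto simp: \<rho>_def)
  have reg: "norm x < e1 \<and> norm x < e2 \<and> x \<in> ?X" if "x \<in> std_region \<alpha> \<rho>" for x
  proof -
    have "x \<in> sector" using that std_region_sector[OF \<alpha>(1) \<rho>(2)] by blast
    moreover have "fst x \<le> \<rho>" using that by (auto simp: region_def)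
    ultimately have "norm x \<le> 2 * \<rho>" using sector_norm[of x] by linarith
    then show ?thesis using \<rho> that region_subset_std_triangle by fastforce
  qed
  have sub: "std_region \<alpha> \<rho> \<subseteq> ?X \<inter> U" using reg e1 by blast
  have hs: "h ` std_region \<alpha> \<rho> \<subseteq> T \<inter> V" using homeomorphism_image1[OF hom] image_mono[OF sub, of h] by simp
  have "0 \<in> ?X \<inter> U" using h0 U by simp
  then have "h 0 \<in> T \<inter> V" "g (h 0) = 0"
    using homeomorphism_image1[OF hom] homeomorphism_apply1[OF hom] by blast+
  then have "0 \<in> T \<inter> V" "g 0 = 0" using h0 by simp_all
  moreover have "continuous_on (T \<inter> V) g" using hom by (simp add: homeomorphism_def)
  ultimately obtain r1 where r1: "r1 > 0" "\<And>p. p \<in> T \<inter> V \<Longrightarrow> norm p < r1 \<Longrightarrow> norm (g p) < \<rho>"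
    using \<rho>(1) unfolding continuous_on_iff by (metis dist_0_norm dist_commute)
  obtain r2 where r2: "r2 > 0" "\<And>x. norm x < r2 \<Longrightarrow> x \<in> V" using V unfolding open_contains_ball by (metis mem_ball_0 subsetD)
  have surj: "\<exists>k\<in>std_region \<alpha> \<rho>. fst k < \<rho> \<and> h k = p" if "p \<in> T" "norm p < min r1 r2" for p
  proof (rule bexI[of _ "g p"])
    have p: "p \<in> T \<inter> V" using that r2 by auto
    then have gp: "g p \<in> ?X" "h (g p) = p" using hom by (auto simp: homeomorphism_def)
    have "norm (fst (g p)) \<le> norm (g p)" by (metis norm_fst_le prod.collapse)
    then have "fst (g p) < \<rho>" using r1(2)[OF p] that by simp
    then show "fst (g p) < \<rho> \<and> h (g p) = p" "g p \<in> std_region \<alpha> \<rho>"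
      using gp std_triangle_region[of "g p" \<alpha> \<rho>] by auto
  qed
  have chart: "holder_chart D \<alpha> T h \<rho> (min r1 r2) (max K 1)"
    unfolding holder_chart_def
  proof (intro conjI ballI)
    show "continuous_on (std_region \<alpha> \<rho>) h" using homeomorphism_cont1[OF hom] sub by (rule continuous_on_subset)
    have "inj_on h (?X \<inter> U)" using homeomorphism_apply1[OF hom] by (rule inj_on_inverseI)
    then show "inj_on h (std_region \<alpha> \<rho>)" using sub by (rule inj_on_subset)
    show "h ` std_region \<alpha> \<rho> \<subseteq> sector"
    proof (rule image_subsetI)
      fix x assume x: "x \<in> std_region \<alpha> \<rho>"
      then have "norm (h x) < d" using reg e2 by blast
      then show "h x \<in> sector" using d(2) hs x by blast
    qed
    have "dP (\<lambda>x. x \<in> {x. 0 \<le> fst x \<and> fst x \<le> \<rho> \<and> 0 \<le> snd x \<and> snd x \<le> pw \<alpha> (fst x)})"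
      unfolding mem_Collect_eq by (intro dP_intros dF_pw \<alpha> dF_arith)
    then have "dP (\<lambda>x. x \<in> std_region \<alpha> \<rho>)" by (simp add: region_def case_prod_unfold)
    then show "definable_on D (std_region \<alpha> \<rho>) h" by (rule definable_on_subset[OF dh sub])
    fix x y assume xy: "x \<in> std_region \<alpha> \<rho>" "y \<in> std_region \<alpha> \<rho>"
    have mono: "ennreal K * z \<le> ennreal (max K 1) * z" for z by (intro mult_right_mono ennreal_leI) auto
    show "inner_dist T (h x) (h y) \<le> ennreal (max K 1) * inner_dist ?X x y"
      "inner_dist ?X x y \<le> ennreal (max K 1) * inner_dist T (h x) (h y)"
    proof -
      have "x \<in> ?X \<inter> U" "y \<in> ?X \<inter> U" using sub xy by blast+
      note Kxy = K[OF this]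
      show "inner_dist T (h x) (h y) \<le> ennreal (max K 1) * inner_dist ?X x y"
        by (rule order_trans[OF conjunct1[OF Kxy] mono])
      show "inner_dist ?X x y \<le> ennreal (max K 1) * inner_dist T (h x) (h y)"
        by (rule order_trans[OF conjunct2[OF Kxy] mono])
    qed
  qed (use \<alpha> \<rho> r1 r2 h0 hs surj in auto)
  show ?thesis by (rule that[OF chart \<rho>(3)])
qed

definition vsection :: "real \<Rightarrow> (real \<times> real) set \<Rightarrow> real set" where
  "vsection u A = {v. (u, v) \<in> A}"

definition vboundary :: "real \<Rightarrow> (real \<times> real \<Rightarrow> real \<times> real) \<Rightarrow> real \<Rightarrow> real \<Rightarrow> real set" where
  "vboundary \<alpha> h \<rho> u = {v. \<exists>k\<in>std_region \<alpha> \<rho>. fst k < \<rho> \<and> (snd k = 0 \<or> snd k = pw \<alpha> (fst k)) \<and> h k = (u, v)}"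

text \<open>By invariance of domain, the chart maps interior points of the standard triangle to interior points of the
  plane set \<open>T\<close>. A point of a vertical section is therefore interior to the section unless it comes from a boundary
  curve.\<close>

lemma holder_chart_section:
  assumes c: "holder_chart D \<alpha> T h \<rho> r K" and u: "2 * u < r"
  shows "compact (vsection u (h ` std_region \<alpha> \<rho>))"
    "\<And>v. v \<in> vsection u (h ` std_region \<alpha> \<rho>) \<Longrightarrow> v \<notin> vboundary \<alpha> h \<rho> u \<Longrightarrow>
      \<exists>e>0. \<forall>v'. \<bar>v' - v\<bar> < e \<longrightarrow> v' \<in> vsection u (h ` std_region \<alpha> \<rho>)"
proof -
  let ?R = "std_region \<alpha> \<rho>" and ?S = "vsection u (h ` std_region \<alpha> \<rho>)"
  have "compact (h ` ?R)"
    using c unfolding holder_chart_def by (intro compact_continuous_image compact_std_region) auto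
  then have "compact (h ` ?R \<inter> {x. fst x = u})"
    by (intro compact_Int_closed closed_Collect_eq continuous_intros)
  then have "compact (snd ` (h ` ?R \<inter> {x. fst x = u}))" by (intro compact_continuous_image continuous_intros)
  moreover have "?S = snd ` (h ` ?R \<inter> {x. fst x = u})"
  proof (intro equalityI subsetI)
    fix v assume "v \<in> ?S"
    then have "(u, v) \<in> h ` ?R \<inter> {x. fst x = u}" by (simp add: vsection_def)
    then show "v \<in> snd ` (h ` ?R \<inter> {x. fst x = u})" by (metis image_eqI snd_conv)
  next
    fix v assume "v \<in> snd ` (h ` ?R \<inter> {x. fst x = u})"
    then obtain x where "x \<in> h ` ?R" "fst x = u" "v = snd x" by blast
    then show "v \<in> ?S" unfolding vsection_def by (metis mem_Collect_eq prod.collapse)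
  qed
  ultimately show "compact ?S" by simp
  fix v assume v: "v \<in> ?S" "v \<notin> vboundary \<alpha> h \<rho> u"
  then have uvT: "(u, v) \<in> T" "(u, v) \<in> sector" using c unfolding holder_chart_def vsection_def by auto
  then have "norm (u, v) < r" using sector_norm[of "(u, v)"] u by auto
  then obtain k where k: "k \<in> ?R" "fst k < \<rho>" "h k = (u, v)" using c uvT(1) unfolding holder_chart_def by blast
  then have ki: "k \<in> std_interior \<alpha> \<rho>" using not_std_interior[OF k(1,2)] v(2) unfolding vboundary_def by blast
  have "open (h ` std_interior \<alpha> \<rho>)"
    using c std_interior_subset unfolding holder_chart_def
    by (intro invariance_of_domain open_std_interior) (auto intro: continuous_on_subset inj_on_subset)
  then obtain e where e: "e > 0" "ball (u, v) e \<subseteq> h ` std_interior \<alpha> \<rho>"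
    using ki k(3) unfolding open_contains_ball by (metis imageI)
  have "v' \<in> ?S" if "\<bar>v' - v\<bar> < e" for v'
  proof -
    have "dist (u, v) (u, v') = \<bar>v' - v\<bar>" by (simp add: dist_Pair_Pair dist_real_def abs_minus_commute)
    then have "(u, v') \<in> h ` std_interior \<alpha> \<rho>" using that e(2) by auto
    then show ?thesis using std_interior_subset unfolding vsection_def by blast
  qed
  then show "\<exists>e>0. \<forall>v'. \<bar>v' - v\<bar> < e \<longrightarrow> v' \<in> ?S" using e(1) by blast
qed

lemma extreme_points_in_boundary:
  fixes S B :: "real set"
  assumes S: "compact S" and int: "\<And>v. v \<in> S \<Longrightarrow> v \<notin> B \<Longrightarrow> \<exists>e>0. \<forall>v'. \<bar>v' - v\<bar> < e \<longrightarrow> v' \<in> S" and v: "v \<in> S"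
  shows "\<exists>a\<in>B. \<exists>b\<in>B. a \<in> S \<and> b \<in> S \<and> a \<le> v \<and> v \<le> b"
proof -
  obtain a where a: "a \<in> S" "\<And>x. x \<in> S \<Longrightarrow> a \<le> x" using compact_attains_inf[OF S] v by blast
  obtain b where b: "b \<in> S" "\<And>x. x \<in> S \<Longrightarrow> x \<le> b" using compact_attains_sup[OF S] v by blast
  have "a \<in> B"
  proof (rule ccontr)
    assume "a \<notin> B"
    then obtain e where "e > 0" "\<forall>v'. \<bar>v' - a\<bar> < e \<longrightarrow> v' \<in> S" using int a by blast
    then have "a - e / 2 \<in> S" by simp
    then show False using a(2)[of "a - e / 2"] \<open>e > 0\<close> by simp
  qed
  moreover have "b \<in> B"
  proof (rule ccontr)
    assume "b \<notin> B"
    then obtain e where "e > 0" "\<forall>v'. \<bar>v' - b\<bar> < e \<longrightarrow> v' \<in> S" using int b by blast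
    then have "b + e / 2 \<in> S" by simp
    then show False using b(2)[of "b + e / 2"] \<open>e > 0\<close> by simp
  qed
  ultimately show ?thesis using a b v by blast
qed

text \<open>A gap in \<open>S\<close> between \<open>a\<close> and \<open>b\<close> on one side of \<open>x\<close> would have an end in \<open>S\<close> that is neither \<open>a\<close> nor
  \<open>b\<close>.\<close>

lemma segment_in_section:
  fixes S :: "real set"
  assumes S: "compact S" and int: "\<And>v. v \<in> S \<Longrightarrow> v \<noteq> a \<Longrightarrow> v \<noteq> b \<Longrightarrow> \<exists>e>0. \<forall>v'. \<bar>v' - v\<bar> < e \<longrightarrow> v' \<in> S"
    and ab: "a \<in> S" "b \<in> S" "a < b" and x: "x \<in> S" "x \<noteq> a" "x \<noteq> b"
  shows "{a..b} \<subseteq> S"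
proof (rule subsetI, rule ccontr)
  fix y assume y: "y \<in> {a..b}" "y \<notin> S"
  then have yab: "a < y" "y < b" using ab by (auto simp: order_less_le)
  have bnd: "a \<le> v \<and> v \<le> b" if "v \<in> S" for v
    using extreme_points_in_boundary[OF S, of "{a, b}" v] int that ab(3) by auto
  show False
  proof (cases "x < y")
    case True
    have "compact (S \<inter> {..y})" using S by (intro compact_Int_closed) auto
    then obtain w where w: "w \<in> S" "w \<le> y" "\<And>z. z \<in> S \<Longrightarrow> z \<le> y \<Longrightarrow> z \<le> w"
      using compact_attains_sup[of "S \<inter> {..y}"] x True by force
    have "w < y" using w y by (auto simp: order_less_le)
    have "x \<le> w" "a < x" using w(3) x True bnd[of x] by auto
    then obtain e where e: "e > 0" "\<forall>v'. \<bar>v' - w\<bar> < e \<longrightarrow> v' \<in> S" using int[OF w(1)] \<open>w < y\<close> yab by force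
    define z where "z = min y (w + e / 2)"
    have "z \<in> S" "z \<le> y" "w < z" using e \<open>w < y\<close> by (auto simp: z_def)
    then show False using w(3)[of z] by simp
  next
    case False
    then have yx: "y < x" using y x by (auto simp: order_less_le)
    have "compact (S \<inter> {y..})" using S by (intro compact_Int_closed) auto
    then obtain w where w: "w \<in> S" "y \<le> w" "\<And>z. z \<in> S \<Longrightarrow> y \<le> z \<Longrightarrow> w \<le> z"
      using compact_attains_inf[of "S \<inter> {y..}"] x yx by force
    have "y < w" using w y by (auto simp: order_less_le)
    have "w \<le> x" "x < b" using w(3) x yx bnd[of x] by auto
    then obtain e where e: "e > 0" "\<forall>v'. \<bar>v' - w\<bar> < e \<longrightarrow> v' \<in> S" using int[OF w(1)] \<open>y < w\<close> yab by force
    define z where "z = max y (w - e / 2)"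
    have "z \<in> S" "y \<le> z" "z < w" using e \<open>y < w\<close> by (auto simp: z_def)
    then show False using w(3)[of z] by simp
  qed
qed

definition vertically_monotone :: "(real \<times> real \<Rightarrow> real) \<Rightarrow> (real \<times> real) set \<Rightarrow> bool" where
  "vertically_monotone f A \<longleftrightarrow> (\<forall>u v1 v v2. (u, v1) \<in> A \<longrightarrow> (u, v) \<in> A \<longrightarrow> (u, v2) \<in> A \<longrightarrow> v1 \<le> v \<longrightarrow> v \<le> v2 \<longrightarrow>
     min (f (u, v1)) (f (u, v2)) \<le> f (u, v) \<and> f (u, v) \<le> max (f (u, v1)) (f (u, v2)))"

text \<open>Every point of the triangle lies vertically between two points of its boundary curves, so a
  vertically monotone function is squeezed between its values there.\<close>

lemma (in o_minimal_structure) has_order_of_boundary: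
  assumes h: "inner_bilipschitz_germ D (std_triangle \<alpha>) T h" and \<alpha>: "1 \<le> \<alpha>" "\<alpha> \<in> exponents D"
    and T: "germ_subset T A" and A: "germ_subset A sector" and f: "vertically_monotone f A"
    and B1: "eventually (\<lambda>x. x \<in> std_lower \<longrightarrow> h x \<in> B1) (nhds 0)" "has_order f q B1"
    and B2: "eventually (\<lambda>x. x \<in> std_upper \<alpha> \<longrightarrow> h x \<in> B2) (nhds 0)" "has_order f q B2"
  shows "has_order f q T"
proof -
  from B1(2) obtain c1 c2 where c: "c1 > 0" "c2 > 0"
    "eventually (\<lambda>x. x \<in> B1 \<longrightarrow> c1 * epow q (fst x) \<le> f x \<and> f x \<le> c2 * epow q (fst x)) (nhds 0)" by (rule has_orderE)
  from B2(2) obtain d1 d2 where d: "d1 > 0" "d2 > 0"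
    "eventually (\<lambda>x. x \<in> B2 \<longrightarrow> d1 * epow q (fst x) \<le> f x \<and> f x \<le> d2 * epow q (fst x)) (nhds 0)" by (rule has_orderE)
  define m M where "m = min c1 d1" and "M = max c2 d2"
  have mM: "m > 0" "M > 0" using c d by (auto simp: m_def M_def)
  have b: "c1 * epow q t \<ge> m * epow q t" "d1 * epow q t \<ge> m * epow q t"
    "c2 * epow q t \<le> M * epow q t" "d2 * epow q t \<le> M * epow q t" for t
    using epow_nonneg[of q t] by (auto simp: m_def M_def intro!: mult_right_mono)
  have "eventually (\<lambda>x. (x \<in> T \<longrightarrow> x \<in> A) \<and> (x \<in> B1 \<union> B2 \<longrightarrow> m * epow q (fst x) \<le> f x \<and> f x \<le> M * epow q (fst x))) (nhds 0)"
    using c(3) d(3) T unfolding germ_subset_def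
  proof eventually_elim
    case (elim x)
    then show ?case using b[of "fst x"] by (auto intro: order_trans)
  qed
  then obtain s where s: "s > 0" "\<And>x. norm x < s \<Longrightarrow> x \<in> T \<Longrightarrow> x \<in> A"
    "\<And>x. norm x < s \<Longrightarrow> x \<in> B1 \<union> B2 \<Longrightarrow> m * epow q (fst x) \<le> f x \<and> f x \<le> M * epow q (fst x)"
    unfolding eventually_nhds_0 by blast
  have "eventually (\<lambda>x. x \<in> std_lower \<union> std_upper \<alpha> \<longrightarrow> h x \<in> B1 \<union> B2) (nhds 0)"
    using B1(1) B2(1) by eventually_elim auto
  then obtain \<eta> where \<eta>: "\<eta> > 0" "\<And>x. norm x < \<eta> \<Longrightarrow> x \<in> std_lower \<union> std_upper \<alpha> \<Longrightarrow> h x \<in> B1 \<union> B2"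
    unfolding eventually_nhds_0 by blast
  have Ts: "germ_subset T sector" using T A unfolding germ_subset_def by eventually_elim simp
  have "\<eta> / 2 > 0" using \<eta> by simp
  from holder_chart_exists[OF h \<alpha> Ts this] obtain \<rho> r K where ch: "holder_chart D \<alpha> T h \<rho> r K" and \<rho>\<eta>: "\<rho> < \<eta> / 2" .
  let ?R = "std_region \<alpha> \<rho>"
  have \<rho>: "0 < \<rho>" "\<rho> \<le> 1" "0 < r" using ch by (auto simp: holder_chart_def)
  have hs: "h ` ?R \<subseteq> sector" "h ` ?R \<subseteq> T" using ch by (simp_all add: holder_chart_def)
  have bdry: "(u, v) \<in> B1 \<union> B2" if "v \<in> vboundary \<alpha> h \<rho> u" for u v
  proof -
    obtain k where k: "k \<in> ?R" "snd k = 0 \<or> snd k = pw \<alpha> (fst k)" "h k = (u, v)" using \<open>v \<in> vboundary \<alpha> h \<rho> u\<close> unfolding vboundary_def by blast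
    have "k \<in> sector" "fst k \<le> \<rho>" "0 \<le> fst k" using k(1) std_region_sector[OF \<alpha>(1) \<rho>(2)] by (auto simp: region_def)
    then have "norm k < \<eta>" using sector_norm[of k] \<rho>\<eta> by linarith
    moreover have "k \<in> std_lower \<union> std_upper \<alpha>" using k(2) \<open>0 \<le> fst k\<close>
      by (cases k) (auto simp: std_lower_def std_upper_def pw_eq')
    ultimately show ?thesis using \<eta>(2) k(3) by metis
  qed
  have "m * epow q (fst p) \<le> f p \<and> f p \<le> M * epow q (fst p)" if p: "p \<in> T" "norm p < min s r / 2" for p
  proof -
    obtain u v where uv: "p = (u, v)" by fastforce
    have "norm p < r" using p \<rho> s norm_ge_zero[of p] by linarith
    then obtain k where k: "k \<in> ?R" "h k = p" using ch p(1) unfolding holder_chart_def by blast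
    then have "p \<in> h ` ?R" by blast
    then have ps: "p \<in> sector" "(u, v) \<in> h ` ?R" using hs uv by auto
    have u: "2 * u < r" "2 * u < s" using sector_norm[OF ps(1)] p by (auto simp: uv)
    have "v \<in> vsection u (h ` ?R)" using ps(2) by (simp add: vsection_def)
    from extreme_points_in_boundary[OF holder_chart_section[OF ch u(1)] this]
    obtain a b where ab: "a \<in> vboundary \<alpha> h \<rho> u" "b \<in> vboundary \<alpha> h \<rho> u" "(u, a) \<in> h ` ?R" "(u, b) \<in> h ` ?R" "a \<le> v" "v \<le> b"
      unfolding vsection_def by blast
    have small: "norm x < s \<and> x \<in> A" if "x \<in> h ` ?R" "fst x = u" for x
    proof -
      have "x \<in> T" "x \<in> sector" using that hs by blast+
      then have "norm x < s" using sector_norm[of x] u that by linarith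
      with \<open>x \<in> T\<close> show ?thesis using s(2) by blast
    qed
    have A: "(u, a) \<in> A" "(u, b) \<in> A" "(u, v) \<in> A"
      using small[OF ab(3)] small[OF ab(4)] small[OF ps(2)] by simp_all
    have "min (f (u, a)) (f (u, b)) \<le> f (u, v) \<and> f (u, v) \<le> max (f (u, a)) (f (u, b))"
      using f A ab(5,6) unfolding vertically_monotone_def by blast
    moreover have "m * epow q u \<le> f (u, a) \<and> f (u, a) \<le> M * epow q u" "m * epow q u \<le> f (u, b) \<and> f (u, b) \<le> M * epow q u"
      using s(3)[OF _ bdry[OF ab(1)]] s(3)[OF _ bdry[OF ab(2)]] small[OF ab(3)] small[OF ab(4)] by simp_all
    ultimately show ?thesis by (auto simp: uv)
  qed
  then have "eventually (\<lambda>x. x \<in> T \<longrightarrow> m * epow q (fst x) \<le> f x \<and> f x \<le> M * epow q (fst x)) (nhds 0)"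
    unfolding eventually_nhds_0 using s(1) \<rho>(3) by (intro exI[of _ "min s r / 2"]) auto
  then show ?thesis using mM by (intro has_orderI)
qed

text \<open>If \<open>t'\<close> is less than \<open>t / 2\<close>, the first coordinates are far apart; otherwise the second coordinate
  \<open>pw \<alpha> t'\<close> is large.\<close>

lemma pw_half_le_dist:
  assumes \<alpha>: "1 \<le> \<alpha>" and t: "0 \<le> t" "t \<le> 1" "0 \<le> t'"
  shows "2 powr (- \<alpha>) * pw \<alpha> t \<le> dist (t, 0) (t', pw \<alpha> t')"
proof -
  have d: "\<bar>t - t'\<bar> \<le> dist (t, 0) (t', pw \<alpha> t')" "pw \<alpha> t' \<le> dist (t, 0) (t', pw \<alpha> t')"
    using dist_fst_le[of "(t, 0)" "(t', pw \<alpha> t')"] dist_snd_le[of "(t, 0)" "(t', pw \<alpha> t')"] pw_nonneg[of \<alpha> t']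
    by (auto simp: dist_real_def)
  have eq: "2 powr (- \<alpha>) * pw \<alpha> t = (t / 2) powr \<alpha>"
    using t by (simp add: pw_eq' powr_divide powr_minus divide_simps)
  show ?thesis
  proof (cases "t / 2 \<le> t'")
    case True
    then have "(t / 2) powr \<alpha> \<le> t' powr \<alpha>" using t \<alpha> by (intro powr_mono2) auto
    then show ?thesis using d(2) t eq by (simp add: pw_eq')
  next
    case False
    have "(t / 2) powr \<alpha> \<le> (t / 2) powr 1" using t \<alpha> by (intro powr_mono') auto
    also have "\<dots> = t / 2" using t by simp
    also have "\<dots> \<le> \<bar>t - t'\<bar>" using False by linarith
    finally show ?thesis using d(1) eq by linarith
  qed
qed

text \<open>The vertical segment between points of the two boundary curves with the same first coordinate \<open>u\<close> lies in the
  triangle, so that the inner distance of these points is \<open>O(u powr m)\<close>. In the standard triangle the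
  corresponding points have distance at least of order \<open>u powr \<alpha>\<close>.\<close>

lemma (in o_minimal_structure) holder_exponent_lower_bound:
  assumes hT: "holder_triangle D \<alpha> T" and T: "germ_subset T sector" and m: "1 \<le> m"
    and thin: "\<And>\<gamma>. \<gamma> \<in> arcs_in D T \<Longrightarrow>
      \<exists>C. eventually (\<lambda>x. x \<in> arc_image \<gamma> \<longrightarrow> \<bar>snd x - e (fst x)\<bar> \<le> C * pw m (fst x)) (nhds 0)"
  shows "m \<le> \<alpha>"
proof -
  obtain h where h: "inner_bilipschitz_germ D (std_triangle \<alpha>) T h" and \<alpha>: "1 \<le> \<alpha>" "\<alpha> \<in> exponents D"
    using hT unfolding holder_triangle_def by blast
  from holder_chart_exists[OF h \<alpha> T zero_less_one] obtain \<rho> r K where ch: "holder_chart D \<alpha> T h \<rho> r K" .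
  let ?R = "std_region \<alpha> \<rho>"
  have \<rho>: "0 < \<rho>" "\<rho> \<le> 1" and r: "0 < r" and K: "0 < K" and h0: "h 0 = 0" and contR: "continuous_on ?R h"
    and injR: "inj_on h ?R" and hT: "h ` ?R \<subseteq> T" and hS: "h ` ?R \<subseteq> sector" and defR: "definable_on D ?R h"
    and bil: "\<And>x y. x \<in> ?R \<Longrightarrow> y \<in> ?R \<Longrightarrow> inner_dist T (h x) (h y) \<le> ennreal K * inner_dist (std_triangle \<alpha>) x y"
      "\<And>x y. x \<in> ?R \<Longrightarrow> y \<in> ?R \<Longrightarrow> inner_dist (std_triangle \<alpha>) x y \<le> ennreal K * inner_dist T (h x) (h y)"
    using ch unfolding holder_chart_def by blast+
  define H where "H x = (if x \<in> ?R then h x else (0, 0))" for x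
  have dH: "dF H" unfolding H_def[abs_def] using defR by (rule definable_on_extend) (rule dF_const_pair)
  have bd: "\<exists>\<delta>>0. \<exists>C\<ge>0. (\<forall>s. 0 \<le> s \<longrightarrow> s < \<delta> \<longrightarrow> (\<exists>!t. t \<in> {0..\<rho>} \<and> fst (h (t, y t)) = s)) \<and>
      (\<forall>t\<in>{0..\<rho>}. norm (h (t, y t)) < \<delta> \<longrightarrow> \<bar>snd (h (t, y t)) - e (fst (h (t, y t)))\<bar> \<le> C * pw m (fst (h (t, y t))))"
    (is "\<exists>\<delta>>0. \<exists>C\<ge>0. ?P y \<delta> C")
    if y: "dF y" "continuous_on {0..\<rho>} y" "y 0 = 0" "\<forall>t\<in>{0..\<rho>}. (t, y t) \<in> ?R" for y
  proof -
    define c where "c t = H (t, y t)" for t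
    have ceq: "c t = h (t, y t)" if "t \<in> {0..\<rho>}" for t using bspec[OF y(4) that] by (simp add: c_def H_def)
    have dc: "dF c" unfolding c_def[abs_def] by (intro dF_comp[OF dH] dF_Pair dF_id y)
    have "continuous_on {0..\<rho>} (\<lambda>t. h (t, y t))"
      by (rule continuous_on_compose2[OF contR]) (use y(4) in \<open>auto intro!: continuous_intros y\<close>)
    then have cc: "continuous_on {0..\<rho>} c" by (rule continuous_on_eq) (simp add: ceq)
    have c0: "c 0 = 0" using ceq[of 0] y(3) h0 \<rho> by (simp flip: zero_prod_def)
    have cpos: "c t \<noteq> 0" "fst (c t) > 0" if "0 < t" "t \<le> \<rho>" for t
    proof -
      have "(0, 0) \<in> ?R" "(t, y t) \<in> ?R" using y(3) bspec[OF y(4), of 0] bspec[OF y(4), of t] that \<rho> by auto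
      then have "h (t, y t) \<noteq> h (0, 0)" using injR that by (auto dest: inj_onD)
      then show "c t \<noteq> 0" using ceq[of t] that h0 by (simp flip: zero_prod_def)
      moreover have "c t \<in> sector" using ceq[of t] that hS bspec[OF y(4), of t] by auto
      ultimately show "fst (c t) > 0" using sector_norm[of "c t"] by (smt (verit) norm_le_zero_iff)
    qed
    have cT: "c ` {0..\<rho>} \<subseteq> T" using ceq y(4) hT by force
    let ?\<gamma> = "arc_of (c ` {0..\<rho>})"
    note arc = curve_arc[OF dc cc c0 cpos(1) \<rho>(1)]
    obtain \<delta>1 where \<delta>1: "\<delta>1 > 0" "\<And>x. norm x < \<delta>1 \<Longrightarrow> x \<in> arc_image ?\<gamma> \<longleftrightarrow> x \<in> c ` {0..\<rho>}" using arc(2) by blast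
    have "?\<gamma> \<in> arcs_in D T"
      unfolding arcs_in_def germ_subset_def eventually_nhds_0 using arc(1) \<delta>1 cT by blast
    from thin[OF this] obtain C \<delta>2 where \<delta>2: "\<delta>2 > 0"
      "\<And>x. norm x < \<delta>2 \<Longrightarrow> x \<in> arc_image ?\<gamma> \<Longrightarrow> \<bar>snd x - e (fst x)\<bar> \<le> C * pw m (fst x)"
      unfolding eventually_nhds_0 by blast
    have dn: "dF (\<lambda>t. fst (c t))" by (intro dF_fst dc)
    have cn: "continuous_on {0..\<rho>} (\<lambda>t. fst (c t))" by (intro continuous_intros cc)
    obtain \<delta>3 where \<delta>3: "\<delta>3 > 0" "\<And>s. 0 \<le> s \<Longrightarrow> s < \<delta>3 \<Longrightarrow> \<exists>!t. t \<in> {0..\<rho>} \<and> fst (c t) = s"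
      using definable_germ_parameter[OF dn cn _ cpos(2) \<rho>(1)] c0 by auto
    let ?\<delta> = "min \<delta>1 (min \<delta>2 \<delta>3)"
    have "?P y ?\<delta> (max C 0)"
    proof (intro conjI allI impI ballI)
      fix s assume s: "0 \<le> s" "s < ?\<delta>"
      have "\<exists>!t. t \<in> {0..\<rho>} \<and> fst (c t) = s" by (rule \<delta>3(2)) (use s in auto)
      then show "\<exists>!t. t \<in> {0..\<rho>} \<and> fst (h (t, y t)) = s" using ceq by (metis (no_types, lifting))
    next
      fix t assume t: "t \<in> {0..\<rho>}" "norm (h (t, y t)) < ?\<delta>"
      have "h (t, y t) \<in> c ` {0..\<rho>}" using ceq[OF t(1)] t(1) by (metis imageI)
      then have "h (t, y t) \<in> arc_image ?\<gamma>" using \<delta>1(2)[of "h (t, y t)"] t(2) by simp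
      then have "\<bar>snd (h (t, y t)) - e (fst (h (t, y t)))\<bar> \<le> C * pw m (fst (h (t, y t)))"
        using \<delta>2(2) t by auto
      also have "\<dots> \<le> max C 0 * pw m (fst (h (t, y t)))" by (intro mult_right_mono pw_nonneg) auto
      finally show "\<bar>snd (h (t, y t)) - e (fst (h (t, y t)))\<bar> \<le> max C 0 * pw m (fst (h (t, y t)))" .
    qed
    moreover have "?\<delta> > 0" "max C 0 \<ge> 0" using \<delta>1 \<delta>2 \<delta>3 by auto
    ultimately show ?thesis by blast
  qed
  have R0: "(t, 0) \<in> ?R" "(t, pw \<alpha> t) \<in> ?R" if "t \<in> {0..\<rho>}" for t
    using that by (auto simp: region_def pw_nonneg)
  have R1: "\<forall>t\<in>{0..\<rho>}. (t, 0) \<in> ?R" "\<forall>t\<in>{0..\<rho>}. (t, pw \<alpha> t) \<in> ?R" using R0 by blast+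
  have cpw: "continuous_on {0..\<rho>} (pw \<alpha>)" by (rule continuous_on_pw[OF \<alpha>(1) \<rho>(2)])
  obtain \<delta>1 C1 where \<delta>1: "0 < \<delta>1" and C1: "0 \<le> C1"
    and u1: "\<forall>s. 0 \<le> s \<longrightarrow> s < \<delta>1 \<longrightarrow> (\<exists>!t. t \<in> {0..\<rho>} \<and> fst (h (t, 0)) = s)"
    and b1: "\<forall>t\<in>{0..\<rho>}. norm (h (t, 0)) < \<delta>1 \<longrightarrow> \<bar>snd (h (t, 0)) - e (fst (h (t, 0)))\<bar> \<le> C1 * pw m (fst (h (t, 0)))"
  proof -
    from bd[OF dF_const_real continuous_on_const refl R1(1)]
    show thesis by (elim exE conjE) (rule that, assumption+)
  qed
  obtain \<delta>2 C2 where \<delta>2: "0 < \<delta>2" and C2: "0 \<le> C2"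
    and u2: "\<forall>s. 0 \<le> s \<longrightarrow> s < \<delta>2 \<longrightarrow> (\<exists>!t. t \<in> {0..\<rho>} \<and> fst (h (t, pw \<alpha> t)) = s)"
    and b2: "\<forall>t\<in>{0..\<rho>}. norm (h (t, pw \<alpha> t)) < \<delta>2 \<longrightarrow> \<bar>snd (h (t, pw \<alpha> t)) - e (fst (h (t, pw \<alpha> t)))\<bar> \<le> C2 * pw m (fst (h (t, pw \<alpha> t)))"
  proof -
    from bd[OF dF_pw[OF \<alpha>(2) dF_id] cpw pw_0 R1(2)]
    show thesis by (elim exE conjE) (rule that, assumption+)
  qed
  note u1 = u1[rule_format] and u2 = u2[rule_format] and b1 = b1[rule_format] and b2 = b2[rule_format]
  define n where "n t = fst (h (t, 0))" for t
  have cn: "continuous_on {0..\<rho>} n" unfolding n_def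
    by (intro continuous_intros continuous_on_compose2[OF contR]) (use R0 in auto)
  have n0: "n 0 = 0" using h0 by (simp add: n_def flip: zero_prod_def)
  have npos: "n t > 0" if "0 < t" "t \<le> \<rho>" for t
  proof -
    have "h (t, 0) \<noteq> h (0, 0)" using injR R0(1)[of t] R0(1)[of 0] that by (auto dest: inj_onD)
    then have "h (t, 0) \<noteq> 0" using h0 by (simp flip: zero_prod_def)
    moreover have "h (t, 0) \<in> sector" using hS R0(1)[of t] that by auto
    ultimately show ?thesis using sector_norm[of "h (t, 0)"] unfolding n_def by (smt (verit) norm_le_zero_iff)
  qed
  define b where "b = min (min (\<delta>1 / 4) (\<delta>2 / 4)) (min (r / 4) (n \<rho> / 4))"
  have b: "0 < b" "4 * b \<le> \<delta>1" "4 * b \<le> \<delta>2" "4 * b \<le> r" "4 * b \<le> n \<rho>"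
    using \<delta>1 \<delta>2 r npos[of \<rho>] \<rho> by (auto simp: b_def)
  define K2 where "K2 = K * (C1 + C2) * K powr m"
  have main: "2 powr (- \<alpha>) * pw \<alpha> t \<le> K2 * pw m t" if t: "0 < t" "t < \<rho>" "n t < b" for t
  proof -
    define u where "u = n t"
    have u: "0 < u" "u < b" using npos[of t] t by (auto simp: u_def)
    obtain v1 where v1: "h (t, 0) = (u, v1)" by (metis n_def u_def prod.collapse)
    have tR: "t \<in> {0..\<rho>}" using t by simp
    obtain t2 where t2: "t2 \<in> {0..\<rho>}" "fst (h (t2, pw \<alpha> t2)) = u" using u2[of u] u b by auto
    obtain v2 where v2: "h (t2, pw \<alpha> t2) = (u, v2)" by (metis t2(2) prod.collapse)
    have "t2 \<noteq> 0" using t2 u h0 by (auto simp flip: zero_prod_def)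
    then have t2pos: "t2 > 0" using t2 by simp
    let ?S = "vsection u (h ` ?R)"
    have ur: "2 * u < r" using u b by simp
    note sec = holder_chart_section[OF ch ur]
    have bsub: "vboundary \<alpha> h \<rho> u \<subseteq> {v1, v2}"
    proof
      fix v assume "v \<in> vboundary \<alpha> h \<rho> u"
      then obtain k where k: "k \<in> ?R" "snd k = 0 \<or> snd k = pw \<alpha> (fst k)" "h k = (u, v)" unfolding vboundary_def by blast
      have kR: "fst k \<in> {0..\<rho>}" using k(1) by (auto simp: region_def)
      show "v \<in> {v1, v2}" using k(2)
      proof
        assume "snd k = 0"
        then have kk: "k = (fst k, 0)" by (simp add: prod_eq_iff)
        then have "fst (h (fst k, 0)) = u" using k(3) by (metis fst_conv)
        moreover have "fst (h (t, 0)) = u" "u < \<delta>1" using v1 u b by auto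
        ultimately have "fst k = t" using u1[of u] kR tR u by auto
        then show ?thesis using kk k(3) v1 by auto
      next
        assume "snd k = pw \<alpha> (fst k)"
        then have kk: "k = (fst k, pw \<alpha> (fst k))" by (simp add: prod_eq_iff)
        then have "fst (h (fst k, pw \<alpha> (fst k))) = u" using k(3) by (metis fst_conv)
        moreover have "u < \<delta>2" using u b by linarith
        ultimately have "fst k = t2" using u2[of u] kR t2 u by auto
        then show ?thesis using kk k(3) v2 by auto
      qed
    qed
    have ne: "v1 \<noteq> v2"
    proof
      assume "v1 = v2"
      then have "h (t, 0) = h (t2, pw \<alpha> t2)" using v1 v2 by simp
      from inj_onD[OF injR this R0(1)[OF tR] R0(2)[OF t2(1)]] have "t2 = t \<and> pw \<alpha> t2 = 0" by simp
      then show False using pw_pos[OF t2pos, of \<alpha>] by auto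
    qed
    have vS: "v1 \<in> ?S" "v2 \<in> ?S" using v1 v2 R0(1)[OF tR] R0(2)[OF t2(1)] unfolding vsection_def by (metis imageI mem_Collect_eq)+
    \<comment> \<open>The image of the interior is connected and contains points on both sides of the vertical line, hence
       a point on it.\<close>
    obtain x where x: "x \<in> ?S" "x \<noteq> v1" "x \<noteq> v2"
    proof -
      let ?O = "std_interior \<alpha> \<rho>"
      have near: "\<exists>k\<in>?O. \<bar>fst (h k) - n t'\<bar> < u / 4" if t': "0 < t'" "t' < \<rho>" for t'
      proof -
        have seg: "(t', s * pw \<alpha> t') \<in> ?R" if "s \<in> {0..1}" for s
          using that t' pw_nonneg[of \<alpha> t'] by (auto simp: region_def mult_left_le_one_le)
        have "continuous_on {0..1} (\<lambda>s. fst (h (t', s * pw \<alpha> t')))"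
          by (intro continuous_intros continuous_on_compose2[OF contR]) (use seg in auto)
        then have "((\<lambda>s. fst (h (t', s * pw \<alpha> t'))) \<longlongrightarrow> fst (h (t', 0 * pw \<alpha> t'))) (at 0 within {0..1})"
          unfolding continuous_on by (rule bspec) simp
        then have "((\<lambda>s. fst (h (t', s * pw \<alpha> t'))) \<longlongrightarrow> n t') (at_right 0)"
          by (simp add: at_within_Icc_at_right n_def)
        then have "eventually (\<lambda>s. dist (fst (h (t', s * pw \<alpha> t'))) (n t') < u / 4) (at_right 0)"
          using u by (intro tendstoD) auto
        moreover have "eventually (\<lambda>s. 0 < s \<and> s < 1) (at_right (0::real))" by (rule eventually_at_right_0_small) simp
        ultimately have "eventually (\<lambda>s. 0 < s \<and> s < 1 \<and> \<bar>fst (h (t', s * pw \<alpha> t')) - n t'\<bar> < u / 4) (at_right 0)"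
          by eventually_elim (simp add: dist_real_def)
        then obtain s where "0 < s" "s < 1" "\<bar>fst (h (t', s * pw \<alpha> t')) - n t'\<bar> < u / 4"
          using eventually_happens'[OF trivial_limit_at_right_real] by blast
        moreover have "(t', s * pw \<alpha> t') \<in> ?O" using t' \<open>0 < s\<close> \<open>s < 1\<close> pw_pos[of t' \<alpha>] by (auto simp: std_interior_def)
        ultimately show ?thesis by blast
      qed
      have par: "\<exists>t'. 0 < t' \<and> t' < \<rho> \<and> n t' = s" if "0 < s" "s < 4 * b" for s
      proof -
        have "s < \<delta>1" using that b by linarith
        then have "\<exists>!t. t \<in> {0..\<rho>} \<and> fst (h (t, 0)) = s" using \<open>0 < s\<close> by (intro u1) auto
        then obtain t' where t': "t' \<in> {0..\<rho>}" "n t' = s" unfolding n_def by blast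
        moreover have "t' \<noteq> 0" "t' \<noteq> \<rho>" using t' \<open>0 < s\<close> \<open>s < 4 * b\<close> n0 b by auto
        ultimately show ?thesis by (intro exI[of _ t']) auto
      qed
      obtain ta where ta: "0 < ta" "ta < \<rho>" "n ta = u / 2" using par[of "u / 2"] u by auto
      obtain tb where tb: "0 < tb" "tb < \<rho>" "n tb = 2 * u" using par[of "2 * u"] u by auto
      obtain ka where ka: "ka \<in> ?O" "\<bar>fst (h ka) - n ta\<bar> < u / 4" using near[OF ta(1,2)] by blast
      obtain kb where kb: "kb \<in> ?O" "\<bar>fst (h kb) - n tb\<bar> < u / 4" using near[OF tb(1,2)] by blast
      have "continuous_on ?O (\<lambda>k. fst (h k))"
        using contR std_interior_subset by (intro continuous_intros) (rule continuous_on_subset)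
      then have "connected ((\<lambda>k. fst (h k)) ` ?O)"
        using connected_std_interior[OF \<alpha>(1) \<rho>(2)] by (rule connected_continuous_image)
      from connected_contains_Icc[OF this imageI[OF ka(1)] imageI[OF kb(1)]]
      have "{fst (h ka)..fst (h kb)} \<subseteq> (\<lambda>k. fst (h k)) ` ?O" .
      moreover have "fst (h ka) \<le> u" "u \<le> fst (h kb)"
        using ka(2) kb(2) u(1) unfolding ta(3) tb(3) abs_less_iff by linarith+
      ultimately have "u \<in> (\<lambda>k. fst (h k)) ` ?O" by (meson atLeastAtMost_iff subsetD)
      then obtain k where k: "k \<in> ?O" "fst (h k) = u" by blast
      have kR: "k \<in> ?R" using k(1) std_interior_subset by blast
      have hk: "h k = (u, snd (h k))" using k(2) by (simp add: prod_eq_iff)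
      show ?thesis
      proof (rule that)
        show "snd (h k) \<in> ?S" using kR hk unfolding vsection_def by (metis imageI mem_Collect_eq)
        show "snd (h k) \<noteq> v1"
        proof
          assume "snd (h k) = v1"
          then have "h k = h (t, 0)" using hk v1 by simp
          from inj_onD[OF injR this kR R0(1)[OF tR]] have "k = (t, 0)" .
          then show False using k(1) by (simp add: std_interior_def)
        qed
        show "snd (h k) \<noteq> v2"
        proof
          assume "snd (h k) = v2"
          then have "h k = h (t2, pw \<alpha> t2)" using hk v2 by simp
          from inj_onD[OF injR this kR R0(2)[OF t2(1)]] have "k = (t2, pw \<alpha> t2)" .
          then show False using k(1) by (simp add: std_interior_def)
        qed
      qed
    qed
    have int: "\<exists>e>0. \<forall>v'. \<bar>v' - v\<bar> < e \<longrightarrow> v' \<in> ?S" if "v \<in> ?S" "v \<noteq> v1" "v \<noteq> v2" for v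
      using sec(2)[OF that(1)] bsub that by blast
    have seg: "closed_segment v1 v2 \<subseteq> ?S"
    proof (cases "v1 < v2")
      case True
      then show ?thesis using segment_in_section[OF sec(1) int vS(1,2) True x] by (simp add: closed_segment_eq_real_ivl)
    next
      case False
      then have "v2 < v1" using ne by simp
      then show ?thesis using segment_in_section[OF sec(1) int vS(2,1) \<open>v2 < v1\<close> x(1,3,2)] by (simp add: closed_segment_eq_real_ivl)
    qed
    have segT: "closed_segment (u, v1) (u, v2) \<subseteq> T"
    proof
      fix z assume z: "z \<in> closed_segment (u, v1) (u, v2)"
      obtain z1 z2 where zz: "z = (z1, z2)" by fastforce
      have "z1 \<in> closed_segment u u \<and> z2 \<in> closed_segment v1 v2" using z unfolding zz by (rule closed_segment_PairD)
      then have "(z1, z2) \<in> h ` ?R" using seg by (auto simp: vsection_def)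
      then show "z \<in> T" using hT zz by blast
    qed
    let ?x1 = "(t, 0) :: real \<times> real" and ?x2 = "(t2, pw \<alpha> t2)"
    have "inner_dist T (u, v1) (u, v2) \<le> ennreal (1 * dist (u, v1) (u, v2))"
      using inner_dist_le_lipschitz_image[of "(u, v1)" "(u, v2)" "\<lambda>x. x" 1 T] segT by simp
    also have "dist (u, v1) (u, v2) = \<bar>v1 - v2\<bar>" by (simp add: dist_Pair_Pair dist_real_def)
    finally have i1: "inner_dist T (h ?x1) (h ?x2) \<le> ennreal \<bar>v1 - v2\<bar>" by (simp add: v1 v2)
    have "ennreal (dist ?x1 ?x2) \<le> inner_dist (std_triangle \<alpha>) ?x1 ?x2" by (rule dist_le_inner_dist)
    also have "\<dots> \<le> ennreal K * inner_dist T (h ?x1) (h ?x2)" by (rule bil(2)[OF R0(1)[OF tR] R0(2)[OF t2(1)]])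
    also have "\<dots> \<le> ennreal K * ennreal \<bar>v1 - v2\<bar>" using i1 by (rule mult_left_mono) simp
    also have "\<dots> = ennreal (K * \<bar>v1 - v2\<bar>)" using K by (simp add: ennreal_mult)
    finally have d12: "dist ?x1 ?x2 \<le> K * \<bar>v1 - v2\<bar>" using K by (simp add: ennreal_le_iff)
    have sv: "(u, v1) \<in> sector" "(u, v2) \<in> sector" using hS R0(1)[OF tR] R0(2)[OF t2(1)] v1 v2 by (metis imageI subsetD)+
    then have nv: "norm (u, v1) < \<delta>1" "norm (u, v2) < \<delta>2" using sector_norm[of "(u, v1)"] sector_norm[of "(u, v2)"] u b by auto
    have "\<bar>v1 - e u\<bar> \<le> C1 * pw m u" "\<bar>v2 - e u\<bar> \<le> C2 * pw m u"
      using b1[OF tR] b2[OF t2(1)] nv unfolding v1 v2 by auto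
    then have v12: "\<bar>v1 - v2\<bar> \<le> (C1 + C2) * pw m u" by (simp add: algebra_simps)
    have uK: "u \<le> K * t"
    proof -
      have "closed_segment (0, 0) (t, 0) \<subseteq> std_triangle \<alpha>"
      proof clarify
        fix a c assume "(a, c) \<in> closed_segment (0, 0) (t, 0 :: real)"
        then have "a \<in> closed_segment 0 t \<and> c \<in> closed_segment 0 0" by (rule closed_segment_PairD)
        then show "(a, c) \<in> std_triangle \<alpha>" using t by (auto simp: std_triangle_def closed_segment_eq_real_ivl)
      qed
      then have "inner_dist (std_triangle \<alpha>) (0, 0) ?x1 \<le> ennreal (1 * dist (0, 0) ?x1)"
        using inner_dist_le_lipschitz_image[of "(0 :: real, 0 :: real)" "(t, 0)" "\<lambda>x. x" 1 "std_triangle \<alpha>"] by simp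
      also have "dist (0, 0) ?x1 = t" using t by (simp add: dist_Pair_Pair)
      finally have i2: "inner_dist (std_triangle \<alpha>) (0, 0) ?x1 \<le> ennreal t" by simp
      have "ennreal (dist (h (0, 0)) (h ?x1)) \<le> inner_dist T (h (0, 0)) (h ?x1)" by (rule dist_le_inner_dist)
      also have "\<dots> \<le> ennreal K * inner_dist (std_triangle \<alpha>) (0, 0) ?x1" using \<rho> by (intro bil(1) R0 tR) auto
      also have "\<dots> \<le> ennreal K * ennreal t" using i2 by (rule mult_left_mono) simp
      also have "\<dots> = ennreal (K * t)" using K t by (simp add: ennreal_mult)
      finally have "dist (h (0, 0)) (h ?x1) \<le> K * t" using K t by (simp add: ennreal_le_iff)
      moreover have "dist (h (0, 0)) (h ?x1) = norm (u, v1)" using h0 v1 by (simp flip: zero_prod_def)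
      ultimately show ?thesis using sector_norm[OF sv(1)] by auto
    qed
    have "pw m u = u powr m" using u by (simp add: pw_def)
    also have "\<dots> \<le> (K * t) powr m" using uK u m by (intro powr_mono2) auto
    also have "\<dots> = K powr m * pw m t" using K t by (simp add: powr_mult pw_def)
    finally have pwu: "pw m u \<le> K powr m * pw m t" .
    have "2 powr (- \<alpha>) * pw \<alpha> t \<le> dist ?x1 ?x2" using t t2pos \<rho> by (intro pw_half_le_dist \<alpha>(1)) auto
    also have "\<dots> \<le> K * \<bar>v1 - v2\<bar>" by (rule d12)
    also have "\<dots> \<le> K * ((C1 + C2) * pw m u)" using v12 K by (intro mult_left_mono) auto
    also have "\<dots> \<le> K * ((C1 + C2) * (K powr m * pw m t))" using pwu K C1 C2 by (intro mult_left_mono) auto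
    also have "\<dots> = K2 * pw m t" by (simp add: K2_def)
    finally show ?thesis .
  qed
  have "(n \<longlongrightarrow> n 0) (at 0 within {0..\<rho>})" using cn \<rho> by (simp add: continuous_on)
  then have "(n \<longlongrightarrow> 0) (at_right 0)" unfolding at_within_Icc_at_right[OF \<rho>(1)] n0 .
  then have "eventually (\<lambda>t. n t < b) (at_right 0)" using b(1) by (rule order_tendstoD)
  moreover have "eventually (\<lambda>t. 0 < t \<and> t < \<rho>) (at_right 0)" using \<rho>(1) by (rule eventually_at_right_0_small)
  ultimately have "eventually (\<lambda>t. 2 powr (- \<alpha>) * epow (ereal \<alpha>) t \<le> K2 * epow (ereal m) t) (at_right 0)"
    by eventually_elim (use main in auto)
  then have "ereal m \<le> ereal \<alpha>" by (rule epow_compare) auto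
  then show ?thesis by simp
qed

section \<open>The profile of a function on a single slice\<close>

text \<open>On a slice of exponent \<open>\<beta>\<close> the function is \<open>\<phi> u w\<close>, where \<open>w \<ge> 0\<close> is the vertical
  distance from the boundary curve on which the width is largest. The order along the curve
  \<open>w = c * u powr \<mu> q\<close> is \<open>q\<close>; the zone of order \<open>q\<close> consists of the \<open>w\<close> comparable to
  \<open>u powr \<mu> q\<close>, except that at the extreme values of \<open>\<mu> q\<close> it extends to the respective boundary
  curve of the slice.\<close>

definition slice_profile ::
  "(nat \<Rightarrow> real list set set) \<Rightarrow> (real \<Rightarrow> real \<Rightarrow> real) \<Rightarrow> real \<Rightarrow> real \<Rightarrow> ereal set \<Rightarrow> (ereal \<Rightarrow> ereal)
    \<Rightarrow> ereal \<Rightarrow> ereal \<Rightarrow> bool" where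
  "slice_profile D \<phi> \<beta> c Q \<mu> qA qB \<longleftrightarrow>
    o_minimal_structure.dF D (\<lambda>p. \<phi> (fst p) (snd p)) \<and>
    lipschitzian ({0..1} \<times> UNIV) (\<lambda>p. \<phi> (fst p) (snd p)) \<and>
    (\<forall>u\<in>{0..1}. \<phi> u 0 = epow qA u \<and> (\<forall>w\<ge>c * pw \<beta> u. \<phi> u w = epow qB u)) \<and>
    (\<forall>u\<in>{0..1}. (\<forall>w w'. 0 \<le> w \<longrightarrow> w \<le> w' \<longrightarrow> \<phi> u w \<le> \<phi> u w') \<or>
                (\<forall>w w'. 0 \<le> w \<longrightarrow> w \<le> w' \<longrightarrow> \<phi> u w' \<le> \<phi> u w)) \<and>
    (\<forall>q\<in>Q. \<forall>m. ereal m \<le> \<mu> q \<longrightarrow> (\<forall>c1>0. \<forall>c2>0. \<exists>C. \<forall>u\<in>{0..1}. \<forall>w. 0 \<le> w \<longrightarrow> w \<le> pw \<beta> u \<longrightarrow>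
       c1 * epow q u \<le> \<phi> u w \<longrightarrow> \<phi> u w \<le> c2 * epow q u \<longrightarrow> w \<le> C * pw m u)) \<and>
    (\<forall>q\<in>Q. \<forall>m. \<mu> q = ereal m \<longrightarrow> (\<forall>c1>0. \<forall>c2>0. \<exists>\<rho>>0. \<exists>d>0. \<exists>e. d \<le> c / 2 \<and> 2 * d \<le> e \<and>
       (\<forall>u w. 0 < u \<longrightarrow> u < \<rho> \<longrightarrow> 0 \<le> w \<longrightarrow> w \<le> pw \<beta> u \<longrightarrow>
          c1 * epow q u \<le> \<phi> u w \<longrightarrow> \<phi> u w \<le> c2 * epow q u \<longrightarrow>
          (\<mu> qA \<noteq> ereal m \<longrightarrow> d * pw m u \<le> w) \<and> (m \<noteq> \<beta> \<longrightarrow> w \<le> e * pw m u)) \<and>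
       (\<exists>d1>0. \<exists>d2>0. \<forall>u w. 0 < u \<longrightarrow> u < \<rho> \<longrightarrow> 0 \<le> w \<longrightarrow> w \<le> pw \<beta> u \<longrightarrow>
          (\<mu> qA \<noteq> ereal m \<longrightarrow> d * pw m u \<le> w) \<longrightarrow> (m \<noteq> \<beta> \<longrightarrow> w \<le> e * pw m u) \<longrightarrow>
          d1 * epow q u \<le> \<phi> u w \<and> \<phi> u w \<le> d2 * epow q u))) \<and>
    (\<forall>q\<in>Q. \<forall>u\<in>{0..1}. \<phi> u (c * epow (\<mu> q) u) = epow q u)"

lemma powr_between:
  assumes "0 < a" "a \<le> y" "y \<le> (b::real)"
  shows "min (a powr s) (b powr s) \<le> y powr s \<and> y powr s \<le> max (a powr s) (b powr s)"
proof (cases "0 \<le> s")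
  case True
  then have "a powr s \<le> y powr s" "y powr s \<le> b powr s" using assms by (auto intro!: powr_mono2)
  then show ?thesis by auto
next
  case False
  then have "y powr s \<le> a powr s" "b powr s \<le> y powr s" using assms by (auto intro!: powr_mono2')
  then show ?thesis by auto
qed

text \<open>The monomial \<open>x powr s * u powr k\<close> is Lipschitz on the region between \<open>x = u powr M\<close> and
  \<open>x = u powr \<beta>\<close> because its partial derivatives are bounded there by its values divided by \<open>u\<close> and by
  \<open>x\<close>, and the exponents are such that the monomial is bounded by both variables. The region is convex in both
  coordinate directions; two of its points are connected by moving along these
  directions and, if necessary, along the curve \<open>x = u powr M\<close>, on which the monomial is a power of
  \<open>u\<close>.\<close>

context
  fixes s k \<beta> :: real and M :: ereal
  assumes \<beta>: "1 \<le> \<beta>" and \<beta>M: "ereal \<beta> \<le> M"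
    and qB: "1 \<le> s * \<beta> + k" "\<beta> \<le> s * \<beta> + k"
    and qA: "\<And>M'. M = ereal M' \<Longrightarrow> 1 \<le> s * M' + k \<and> M' \<le> s * M' + k"
    and Minf: "M = \<infinity> \<Longrightarrow> 1 \<le> s"
begin

lemma M_cases: obtains "M = \<infinity>" "1 \<le> s" | M' where "M = ereal M'" "\<beta> \<le> M'" "1 \<le> s * M' + k" "M' \<le> s * M' + k"
  using \<beta>M qA Minf by (cases M) auto

lemma monomial_le_u:
  assumes "0 < u" "u \<le> 1" "0 < x" "epow M u \<le> x" "x \<le> pw \<beta> u"
  shows "x powr s * u powr (k - 1) \<le> 1"
proof -
  have *: "x powr s * u powr (k - 1) \<le> 1" if "x powr s \<le> (u powr m) powr s" "1 \<le> s * m + k" for m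
  proof -
    have "x powr s * u powr (k - 1) \<le> (u powr m) powr s * u powr (k - 1)" using that(1) by (intro mult_right_mono) auto
    also have "\<dots> = u powr (s * m + k - 1)" using assms by (simp add: powr_powr mult.commute flip: powr_add) (simp add: algebra_simps)
    also have "\<dots> \<le> u powr 0" using assms that by (intro powr_mono') auto
    finally show ?thesis using assms by simp
  qed
  show ?thesis
  proof (cases "0 \<le> s")
    case True
    then show ?thesis using assms qB by (intro *[of \<beta>] powr_mono2) (auto simp: pw_def)
  next
    case False
    show ?thesis
    proof (rule M_cases)
      fix M' assume "M = ereal M'" "1 \<le> s * M' + k"
      then show ?thesis using assms False by (intro *[of M'] powr_mono2') (auto simp: pw_def)
    qed (use False in simp)
  qed
qed

lemma monomial_le_x:
  assumes "0 < u" "u \<le> 1" "0 < x" "epow M u \<le> x" "x \<le> pw \<beta> u"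
  shows "x powr (s - 1) * u powr k \<le> 1"
proof -
  have *: "x powr (s - 1) * u powr k \<le> 1" if "x powr (s - 1) \<le> (u powr m) powr (s - 1)" "m \<le> s * m + k" for m
  proof -
    have "x powr (s - 1) * u powr k \<le> (u powr m) powr (s - 1) * u powr k" using that(1) by (intro mult_right_mono) auto
    also have "\<dots> = u powr (s * m + k - m)" using assms by (simp add: powr_powr flip: powr_add) (simp add: algebra_simps)
    also have "\<dots> \<le> u powr 0" using assms that by (intro powr_mono') auto
    finally show ?thesis using assms by simp
  qed
  show ?thesis
  proof (cases "1 \<le> s")
    case True
    then show ?thesis using assms qB by (intro *[of \<beta>] powr_mono2) (auto simp: pw_def)
  next
    case False
    show ?thesis
    proof (rule M_cases)
      fix M' assume "M = ereal M'" "M' \<le> s * M' + k"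
      then show ?thesis using assms False by (intro *[of M'] powr_mono2') (auto simp: pw_def)
    qed (use False in simp)
  qed
qed

lemma monomial_horizontal:
  assumes u: "0 \<le> u1" "u1 \<le> u2" "u2 \<le> 1" and x: "epow M u2 \<le> x" "0 \<le> x" "x \<le> pw \<beta> u1"
  shows "\<bar>pw s x * pw k u1 - pw s x * pw k u2\<bar> \<le> \<bar>k\<bar> * (u2 - u1)"
proof (cases "x = 0 \<or> u1 = u2")
  case True
  then show ?thesis using u by auto
next
  case False
  then have x0: "0 < x" and u12: "u1 < u2" using x u by auto
  have u1: "0 < u1" using x x0 u by (cases "u1 = 0") auto
  have deriv: "((\<lambda>u. x powr s * u powr k) has_real_derivative k * (x powr s * z powr (k - 1))) (at z)" if "z > 0" for z
    using that by (auto intro!: derivative_eq_intros simp: powr_diff)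
  have "\<exists>z>u1. z < u2 \<and> x powr s * u2 powr k - x powr s * u1 powr k = (u2 - u1) * (k * (x powr s * z powr (k - 1)))"
    using u12 u1 by (intro MVT2 deriv) auto
  then obtain z where z: "u1 < z" "z < u2"
    "x powr s * u2 powr k - x powr s * u1 powr k = (u2 - u1) * (k * (x powr s * z powr (k - 1)))" by blast
  have "epow M z \<le> x"
  proof (rule M_cases)
    fix M' assume M: "M = ereal M'" "\<beta> \<le> M'"
    have "z powr M' \<le> u2 powr M'" using z u1 M \<beta> by (intro powr_mono2) auto
    then show ?thesis using x M z u1 by (simp add: pw_def)
  qed (use x in simp)
  moreover have "x \<le> pw \<beta> z"
  proof -
    have "u1 powr \<beta> \<le> z powr \<beta>" using z u1 \<beta> by (intro powr_mono2) auto
    then show ?thesis using x z u1 by (simp add: pw_def)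
  qed
  ultimately have "x powr s * z powr (k - 1) \<le> 1" using z u u1 x0 by (intro monomial_le_u) auto
  then have "\<bar>k * (x powr s * z powr (k - 1))\<bar> \<le> \<bar>k\<bar> * 1"
    unfolding abs_mult by (intro mult_left_mono) auto
  then have "(u2 - u1) * \<bar>k * (x powr s * z powr (k - 1))\<bar> \<le> (u2 - u1) * \<bar>k\<bar>"
    using u by (intro mult_left_mono) auto
  moreover have "\<bar>x powr s * u1 powr k - x powr s * u2 powr k\<bar> = (u2 - u1) * \<bar>k * (x powr s * z powr (k - 1))\<bar>"
    using z(3) u12 by (metis abs_minus_commute abs_mult abs_of_pos diff_gt_0_iff_gt)
  ultimately show ?thesis using x0 u1 u12 by (simp add: pw_def mult.commute)
qed

lemma monomial_vertical:
  assumes u: "0 \<le> u" "u \<le> 1" and x: "epow M u \<le> x1" "x1 \<le> x2" "x2 \<le> pw \<beta> u"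
  shows "\<bar>pw s x1 * pw k u - pw s x2 * pw k u\<bar> \<le> (\<bar>s\<bar> + 1) * (x2 - x1)"
proof (cases "x1 = x2 \<or> u = 0")
  case True
  then show ?thesis using x by auto
next
  case False
  then have u0: "0 < u" and x12: "x1 < x2" and x1: "0 \<le> x1" using x u epow_nonneg[of M u] by auto
  have l2: "x2 powr (s - 1) * u powr k \<le> 1" using x x12 x1 u0 u by (intro monomial_le_x) auto
  show ?thesis
  proof (cases "x1 = 0")
    case True
    have "x2 powr s * u powr k = x2 * (x2 powr (s - 1) * u powr k)"
      using x12 True by (simp add: powr_diff)
    also have "\<dots> \<le> x2 * 1" using l2 x12 True by (intro mult_left_mono) auto
    also have "\<dots> \<le> (\<bar>s\<bar> + 1) * x2" using x12 True by (simp add: algebra_simps)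
    finally show ?thesis using True x12 u0 by (simp add: pw_def)
  next
    case False
    then have x0: "0 < x1" using x1 by simp
    have deriv: "((\<lambda>x. x powr s * u powr k) has_real_derivative s * (z powr (s - 1) * u powr k)) (at z)" if "z > 0" for z
      using that by (auto intro!: derivative_eq_intros simp: powr_diff)
    have "\<exists>z>x1. z < x2 \<and> x2 powr s * u powr k - x1 powr s * u powr k = (x2 - x1) * (s * (z powr (s - 1) * u powr k))"
      using x12 x0 by (intro MVT2 deriv) auto
    then obtain z where z: "x1 < z" "z < x2"
      "x2 powr s * u powr k - x1 powr s * u powr k = (x2 - x1) * (s * (z powr (s - 1) * u powr k))" by blast
    have "z powr (s - 1) * u powr k \<le> 1" using z u u0 x0 x by (intro monomial_le_x) auto
    then have "\<bar>s * (z powr (s - 1) * u powr k)\<bar> \<le> \<bar>s\<bar> * 1"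
      unfolding abs_mult by (intro mult_left_mono) auto
    then have "(x2 - x1) * \<bar>s * (z powr (s - 1) * u powr k)\<bar> \<le> (x2 - x1) * (\<bar>s\<bar> + 1)"
      using x12 by (intro mult_left_mono) auto
    moreover have "\<bar>x1 powr s * u powr k - x2 powr s * u powr k\<bar> = (x2 - x1) * \<bar>s * (z powr (s - 1) * u powr k)\<bar>"
      using z(3) x12 by (metis abs_minus_commute abs_mult abs_of_pos diff_gt_0_iff_gt)
    ultimately show ?thesis using x0 x12 u0 by (simp add: pw_def mult.commute)
  qed
qed

lemma monomial_lipschitz: "lipschitzian (region 1 (epow M) (pw \<beta>)) (\<lambda>p. pw s (snd p) * pw k (fst p))"
proof -
  define qa where "qa = (if M = \<infinity> then 0 else s * real_of_ereal M + k)"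
  define L where "L = \<bar>k\<bar> + \<bar>qa\<bar> + (\<bar>s\<bar> + 1)"
  let ?\<Phi> = "\<lambda>u x. pw s x * pw k u"
  have *: "\<bar>?\<Phi> u1 x1 - ?\<Phi> u2 x2\<bar> \<le> (\<bar>k\<bar> + \<bar>qa\<bar>) * (u2 - u1) + (\<bar>s\<bar> + 1) * \<bar>x2 - x1\<bar>"
    if u: "0 \<le> u1" "u1 \<le> u2" "u2 \<le> 1" and x1: "epow M u1 \<le> x1" "x1 \<le> pw \<beta> u1"
      and x2: "epow M u2 \<le> x2" "x2 \<le> pw \<beta> u2" for u1 u2 x1 x2
  proof -
    have x10: "0 \<le> x1" using x1 epow_nonneg[of M u1] by linarith
    have pwm: "pw \<beta> u1 \<le> pw \<beta> u2" using u \<beta> by (auto simp: pw_eq' intro!: powr_mono2)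
    show ?thesis
    proof (cases "epow M u2 \<le> x1")
      case True
      have h: "\<bar>?\<Phi> u1 x1 - ?\<Phi> u2 x1\<bar> \<le> \<bar>k\<bar> * (u2 - u1)"
        using u True x10 x1 by (intro monomial_horizontal) auto
      have v: "\<bar>?\<Phi> u2 x1 - ?\<Phi> u2 x2\<bar> \<le> (\<bar>s\<bar> + 1) * \<bar>x2 - x1\<bar>"
      proof (cases "x1 \<le> x2")
        case le: True
        then show ?thesis using monomial_vertical[of u2 x1 x2] u True x2 by auto
      next
        case False
        then show ?thesis using monomial_vertical[of u2 x2 x1] u x1 x2 pwm by (auto simp: abs_minus_commute)
      qed
      have "\<bar>?\<Phi> u1 x1 - ?\<Phi> u2 x2\<bar> \<le> \<bar>k\<bar> * (u2 - u1) + (\<bar>s\<bar> + 1) * \<bar>x2 - x1\<bar>" using h v by linarith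
      moreover have "\<bar>k\<bar> * (u2 - u1) \<le> (\<bar>k\<bar> + \<bar>qa\<bar>) * (u2 - u1)" using u by (intro mult_right_mono) auto
      ultimately show ?thesis by linarith
    next
      case False
      then have Mfin: "M \<noteq> \<infinity>" using x10 by auto
      show ?thesis
      proof (rule M_cases)
        fix M' assume M: "M = ereal M'" "\<beta> \<le> M'" "1 \<le> s * M' + k"
        have M'1: "1 \<le> M'" using M \<beta> by simp
        have qa: "qa = s * M' + k" by (simp add: qa_def M)
        have curve: "?\<Phi> t (pw M' t) = pw qa t" for t
          by (auto simp: pw_def qa powr_powr mult.commute add.commute simp flip: powr_add)
        define u' where "u' = x1 powr (1 / M')"
        have pu': "pw M' u' = x1" using x10 M'1 by (auto simp: u'_def pw_def powr_powr)
        have u': "u1 \<le> u'" "u' \<le> u2" "0 \<le> u'"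
        proof -
          have "(u1 powr M') powr (1 / M') \<le> x1 powr (1 / M')"
            using x1 M M'1 u by (intro powr_mono2) (auto simp: pw_eq')
          then show "u1 \<le> u'" using M'1 u by (simp add: u'_def powr_powr)
          have "x1 powr (1 / M') \<le> (u2 powr M') powr (1 / M')"
            using False M M'1 u x10 by (intro powr_mono2) (auto simp: pw_eq')
          then show "u' \<le> u2" using M'1 u by (simp add: u'_def powr_powr)
          show "0 \<le> u'" by (simp add: u'_def)
        qed
        have h: "\<bar>?\<Phi> u1 x1 - ?\<Phi> u' x1\<bar> \<le> \<bar>k\<bar> * (u' - u1)"
          using u u' x10 x1 pu' M by (intro monomial_horizontal) auto
        have c: "\<bar>?\<Phi> u' x1 - ?\<Phi> u2 (pw M' u2)\<bar> \<le> \<bar>qa\<bar> * (u2 - u')"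
        proof -
          have "?\<Phi> u' x1 = pw qa u'" using curve[of u'] pu' by simp
          then show ?thesis using pw_lipschitz[of qa u' u2] M(3) qa u u' curve[of u2] by simp
        qed
        have v: "\<bar>?\<Phi> u2 (pw M' u2) - ?\<Phi> u2 x2\<bar> \<le> (\<bar>s\<bar> + 1) * (x2 - pw M' u2)"
          using u x2 M by (intro monomial_vertical) auto
        have "(\<bar>s\<bar> + 1) * (x2 - pw M' u2) \<le> (\<bar>s\<bar> + 1) * \<bar>x2 - x1\<bar>"
          using False M by (intro mult_left_mono) auto
        moreover have "\<bar>k\<bar> * (u' - u1) \<le> \<bar>k\<bar> * (u2 - u1)" "\<bar>qa\<bar> * (u2 - u') \<le> \<bar>qa\<bar> * (u2 - u1)"
          using u' by (auto intro: mult_left_mono)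
        ultimately have hcv: "\<bar>?\<Phi> u1 x1 - ?\<Phi> u' x1\<bar> \<le> \<bar>k\<bar> * (u2 - u1)"
          "\<bar>?\<Phi> u' x1 - ?\<Phi> u2 (pw M' u2)\<bar> \<le> \<bar>qa\<bar> * (u2 - u1)"
          "\<bar>?\<Phi> u2 (pw M' u2) - ?\<Phi> u2 x2\<bar> \<le> (\<bar>s\<bar> + 1) * \<bar>x2 - x1\<bar>"
          using order_trans[OF h] order_trans[OF c] order_trans[OF v] by blast+
        have tri: "\<bar>a - d\<bar> \<le> A + B + C" if "\<bar>a - b\<bar> \<le> A" "\<bar>b - c\<bar> \<le> B" "\<bar>c - d\<bar> \<le> C" for a b c d A B C :: real
          using that by linarith
        have "\<bar>?\<Phi> u1 x1 - ?\<Phi> u2 x2\<bar> \<le> \<bar>k\<bar> * (u2 - u1) + \<bar>qa\<bar> * (u2 - u1) + (\<bar>s\<bar> + 1) * \<bar>x2 - x1\<bar>"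
          by (rule tri[OF hcv])
        then show ?thesis by (simp only: distrib_right[of "\<bar>k\<bar>" "\<bar>qa\<bar>"])
      qed (use Mfin in simp)
    qed
  qed
  show ?thesis
  proof (rule lipschitzianI[where L = L])
    fix p p' assume p: "p \<in> region 1 (epow M) (pw \<beta>)" "p' \<in> region 1 (epow M) (pw \<beta>)"
    obtain u x where e1: "p = (u, x)" by fastforce
    obtain u' x' where e2: "p' = (u', x')" by fastforce
    note e = e1 e2
    have P: "0 \<le> u" "u \<le> 1" "epow M u \<le> x" "x \<le> pw \<beta> u" using p(1) by (auto simp: e region_def)
    have Q: "0 \<le> u'" "u' \<le> 1" "epow M u' \<le> x'" "x' \<le> pw \<beta> u'" using p(2) by (auto simp: e region_def)
    have "\<bar>?\<Phi> u x - ?\<Phi> u' x'\<bar> \<le> (\<bar>k\<bar> + \<bar>qa\<bar>) * \<bar>u - u'\<bar> + (\<bar>s\<bar> + 1) * \<bar>x - x'\<bar>"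
    proof (cases "u \<le> u'")
      case True
      have "\<bar>?\<Phi> u x - ?\<Phi> u' x'\<bar> \<le> (\<bar>k\<bar> + \<bar>qa\<bar>) * (u' - u) + (\<bar>s\<bar> + 1) * \<bar>x' - x\<bar>"
        by (rule *[OF P(1) True Q(2) P(3,4) Q(3,4)])
      then show ?thesis using True by (simp only: abs_minus_commute[of u u'] abs_minus_commute[of x x'] abs_of_nonneg diff_ge_0_iff_ge)
    next
      case False
      then have le: "u' \<le> u" by simp
      have "\<bar>?\<Phi> u' x' - ?\<Phi> u x\<bar> \<le> (\<bar>k\<bar> + \<bar>qa\<bar>) * (u - u') + (\<bar>s\<bar> + 1) * \<bar>x - x'\<bar>"
        by (rule *[OF Q(1) le P(2) Q(3,4) P(3,4)])
      then show ?thesis using le by (simp only: abs_minus_commute[of "?\<Phi> u x"] abs_of_nonneg diff_ge_0_iff_ge)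
    qed
    also have "\<dots> \<le> (\<bar>k\<bar> + \<bar>qa\<bar>) * dist p p' + (\<bar>s\<bar> + 1) * dist p p'"
    proof -
      have "\<bar>u - u'\<bar> \<le> dist p p'" "\<bar>x - x'\<bar> \<le> dist p p'"
        using dist_fst_le[of p p'] dist_snd_le[of p p'] by (simp_all add: e dist_real_def)
      then show ?thesis by (intro add_mono mult_left_mono) simp_all
    qed
    finally show "dist (pw s (snd p) * pw k (fst p)) (pw s (snd p') * pw k (fst p')) \<le> L * dist p p'"
      by (simp add: e dist_real_def L_def algebra_simps)
  qed
qed

end

lemma epow_antimono: "q \<le> q' \<Longrightarrow> q \<noteq> - \<infinity> \<Longrightarrow> u \<le> 1 \<Longrightarrow> epow q' u \<le> epow q u"
  by (cases q; cases q') (auto simp: pw_nonneg intro: pw_antimono_exp)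

lemma lipschitzian_epow: "ereal 1 \<le> q \<Longrightarrow> lipschitzian {0..1} (epow q)"
proof (cases "q = \<infinity>")
  case True then show ?thesis unfolding epow_def[abs_def] by (simp add: lipschitzian_const)
next
  case False
  assume "ereal 1 \<le> q"
  with False obtain r where "q = ereal r" "1 \<le> r" by (cases q) auto
  then show ?thesis unfolding epow_def[abs_def] by (simp add: lipschitzian_pw)
qed

lemma (in o_minimal_structure) dF_epow: "q \<in> ereal ` exponents D \<union> {\<infinity>} \<Longrightarrow> dF f \<Longrightarrow> dF (\<lambda>x. epow q (f x))"
  by (auto intro: dF_pw dF_const_real)

lemma epow_less_pw:
  assumes "ereal m < M" "0 < e"
  shows "\<exists>\<rho>>0. \<forall>u. 0 < u \<longrightarrow> u < \<rho> \<longrightarrow> epow M u < e * pw m u"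
proof (cases M)
  case (real M')
  then have d: "M' - m > 0" using assms by simp
  have "epow M u < e * pw m u" if u: "0 < u" "u < e powr (1 / (M' - m))" for u
  proof -
    have "u powr (M' - m) < (e powr (1 / (M' - m))) powr (M' - m)" using u d by (intro powr_less_mono2) auto
    also have "\<dots> = e" using d assms by (simp add: powr_powr)
    finally have "u powr (M' - m) * u powr m < e * u powr m" using u by simp
    then show ?thesis using u by (simp add: real pw_def flip: powr_add)
  qed
  then show ?thesis using assms by (intro exI[of _ "e powr (1 / (M' - m))"]) auto
next
  case PInf
  then show ?thesis using assms by (intro exI[of _ 1]) (auto simp: pw_pos)
qed (use assms in simp)

lemma monomial_on_curve: "pw s (pw m u) * pw k u = pw (s * m + k) u"
  by (auto simp: pw_def powr_powr mult.commute add.commute simp flip: powr_add)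

text \<open>On a vertical line, comparability of the monomial with \<open>u powr q\<close> is comparability of \<open>x\<close>
  with \<open>u powr m\<close>, where \<open>q = s * m + k\<close>.\<close>

lemma monomial_zone:
  assumes s: "s \<noteq> 0" and c: "0 < c1" "0 < c2" and u: "0 < u" and x: "0 \<le> x"
    and b: "c1 * pw (s * m + k) u \<le> pw s x * pw k u" "pw s x * pw k u \<le> c2 * pw (s * m + k) u"
  shows "min (c1 powr (1 / s)) (c2 powr (1 / s)) * pw m u \<le> x"
    "x \<le> max (c1 powr (1 / s)) (c2 powr (1 / s)) * pw m u"
proof -
  have "0 < c1 * pw (s * m + k) u" using c u by (simp add: pw_pos)
  then have "x \<noteq> 0" using b(1) by auto
  then have x0: "0 < x" using x by simp
  define y where "y = x / u powr m"
  have y: "0 < y" using x0 u by (simp add: y_def)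
  have "pw s x * pw k u = y powr s * pw (s * m + k) u"
    using x0 u by (simp add: y_def pw_def powr_divide powr_powr powr_add mult.commute)
  then have "c1 \<le> y powr s" "y powr s \<le> c2" using b pw_pos[OF u, of "s * m + k"] by auto
  from powr_between[OF c(1) this, of "1 / s"]
  have "min (c1 powr (1 / s)) (c2 powr (1 / s)) \<le> y" "y \<le> max (c1 powr (1 / s)) (c2 powr (1 / s))"
    using s y by (auto simp: powr_powr)
  then show "min (c1 powr (1 / s)) (c2 powr (1 / s)) * pw m u \<le> x"
    "x \<le> max (c1 powr (1 / s)) (c2 powr (1 / s)) * pw m u"
    using u by (auto simp: y_def pw_def field_simps)
qed

lemma monomial_in_zone:
  assumes e: "0 < e1" and u: "0 < u" and x: "e1 * pw m u \<le> x" "x \<le> e2 * pw m u"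
  shows "min (e1 powr s) (e2 powr s) * pw (s * m + k) u \<le> pw s x * pw k u"
    "pw s x * pw k u \<le> max (e1 powr s) (e2 powr s) * pw (s * m + k) u"
proof -
  have "0 < e1 * pw m u" using e u by (simp add: pw_pos)
  then have x0: "0 < x" using x by linarith
  define y where "y = x / u powr m"
  have "e1 \<le> y" "y \<le> e2" using x u by (auto simp: y_def pw_def field_simps)
  from powr_between[OF e this, of s] have *: "min (e1 powr s) (e2 powr s) \<le> y powr s" "y powr s \<le> max (e1 powr s) (e2 powr s)" by auto
  have "pw s x * pw k u = y powr s * pw (s * m + k) u"
    using x0 u by (simp add: y_def pw_def powr_divide powr_powr powr_add mult.commute)
  then show "min (e1 powr s) (e2 powr s) * pw (s * m + k) u \<le> pw s x * pw k u"
    "pw s x * pw k u \<le> max (e1 powr s) (e2 powr s) * pw (s * m + k) u"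
    using * pw_nonneg by (auto intro!: mult_right_mono)
qed

text \<open>The monomial is evaluated at \<open>w / c\<close>, clamped to the interval between \<open>u powr M\<close> and \<open>u powr \<beta>\<close>; the factor
  \<open>c\<close> allows for slices whose height is only \<open>c * u powr \<beta>\<close>. On a slice with a single finite order
  the exponent \<open>s\<close> is \<open>0\<close>.\<close>

lemma (in o_minimal_structure) slice_profile_monomial:
  assumes exps: "s \<in> exponents D" "k \<in> exponents D" "\<beta> \<in> exponents D" "M \<in> ereal ` exponents D \<union> {\<infinity>}"
    and \<beta>: "1 \<le> \<beta>" and \<beta>M: "ereal \<beta> \<le> M"
    and qBge: "1 \<le> s * \<beta> + k" "\<beta> \<le> s * \<beta> + k"
    and qAge: "\<And>M'. M = ereal M' \<Longrightarrow> 1 \<le> s * M' + k \<and> M' \<le> s * M' + k"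
    and Minf: "M = \<infinity> \<Longrightarrow> 1 \<le> s"
    and c: "0 < c" and s0: "s = 0 \<Longrightarrow> M = ereal \<beta>"
    and qA: "qA = (if M = \<infinity> then \<infinity> else ereal (s * real_of_ereal M + k))" and qB: "qB = ereal (s * \<beta> + k)"
    and \<mu>A: "\<mu> qA = M"
    and Q: "\<And>q. q \<in> Q \<Longrightarrow> (q = \<infinity> \<and> \<mu> q = \<infinity> \<and> M = \<infinity>) \<or>
        (\<exists>m. q = ereal (s * m + k) \<and> \<mu> q = ereal m \<and> \<beta> \<le> m \<and> ereal m \<le> M)"
  shows "slice_profile D (\<lambda>u w. pw s (max (epow M u) (min (w / c) (pw \<beta> u))) * pw k u) \<beta> c Q \<mu> qA qB"
proof -
  define X where "X u w = max (epow M u) (min (w / c) (pw \<beta> u))" for u w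
  have Mn: "M \<noteq> - \<infinity>" using \<beta>M by auto
  have M1: "ereal 1 \<le> M" using \<beta> \<beta>M by (meson ereal_less_eq(3) order_trans)
  have eMb: "epow M u \<le> pw \<beta> u" if "u \<le> 1" for u
    using epow_antimono[OF \<beta>M, of u] that by simp
  have X0: "0 \<le> X u w" for u w using epow_nonneg[of M u] by (simp add: X_def le_max_iff_disj)
  have Xreg: "epow M u \<le> X u w" "X u w \<le> pw \<beta> u" if "u \<le> 1" for u w
    using eMb[OF that] by (auto simp: X_def)
  have Xmono: "X u w \<le> X u w'" if "w \<le> w'" for u w w'
  proof -
    have "w / c \<le> w' / c" using that c by (simp add: divide_right_mono)
    then show ?thesis unfolding X_def by (intro max.mono min.mono) auto
  qed
  have nonneg: "0 \<le> pw s (X u w) * pw k u" for u w by (simp add: pw_nonneg)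
  show ?thesis unfolding slice_profile_def X_def[symmetric]
  proof (intro conjI ballI allI impI)
    show "dF (\<lambda>p. pw s (X (fst p) (snd p)) * pw k (fst p))"
      unfolding X_def by (intro dF_mult dF_pw exps dF_max dF_min dF_divide dF_epow dF_fst dF_snd dF_id dF_const_real)
    have "lipschitzian ({0..1} \<times> UNIV) (\<lambda>p. epow M (fst p))"
      by (rule lipschitzian_comp[OF lipschitzian_epow[OF M1] lipschitzian_fst]) auto
    moreover have "lipschitzian ({0..1} \<times> UNIV) (\<lambda>p. pw \<beta> (fst p))"
      by (rule lipschitzian_comp[OF lipschitzian_pw[OF \<beta>] lipschitzian_fst]) auto
    moreover have "lipschitzian ({0..1} \<times> UNIV) (\<lambda>p. snd p / c)"
      using lipschitzian_cmult[OF lipschitzian_snd, of "{0..1} \<times> UNIV" "1 / c"] by simp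
    ultimately have "lipschitzian ({0..1} \<times> UNIV) (\<lambda>p. (fst p, X (fst p) (snd p)))"
      unfolding X_def by (intro lipschitzian_intros)
    from lipschitzian_comp[OF monomial_lipschitz[OF \<beta> \<beta>M qBge qAge Minf] this]
    show "lipschitzian ({0..1} \<times> UNIV) (\<lambda>p. pw s (X (fst p) (snd p)) * pw k (fst p))"
      using Xreg by (force simp: region_def)
  next
    fix u :: real assume u: "u \<in> {0..1}"
    have "X u 0 = epow M u" using pw_nonneg[of \<beta> u] epow_nonneg[of M u] by (auto simp: X_def)
    then show "pw s (X u 0) * pw k u = epow qA u"
      using Mn by (cases M) (auto simp: qA monomial_on_curve)
    fix w assume "c * pw \<beta> u \<le> w"
    then have "pw \<beta> u \<le> w / c" using c by (simp add: pos_le_divide_eq mult.commute)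
    then have "X u w = pw \<beta> u" using eMb[of u] u by (auto simp: X_def)
    then show "pw s (X u w) * pw k u = epow qB u" by (simp add: qB monomial_on_curve)
  next
    fix u :: real assume u: "u \<in> {0..1}"
    show "(\<forall>w w'. 0 \<le> w \<longrightarrow> w \<le> w' \<longrightarrow> pw s (X u w) * pw k u \<le> pw s (X u w') * pw k u) \<or>
        (\<forall>w w'. 0 \<le> w \<longrightarrow> w \<le> w' \<longrightarrow> pw s (X u w') * pw k u \<le> pw s (X u w) * pw k u)"
    proof (cases "0 \<le> s")
      case True
      have "pw s (X u w) \<le> pw s (X u w')" if "w \<le> w'" for w w'
        using Xmono[OF that, of u] X0[of u w] True by (auto simp: pw_def intro: powr_mono2)
      then show ?thesis using pw_nonneg by (auto intro!: mult_right_mono)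
    next
      case False
      then obtain M' where M': "M = ereal M'" using Minf Mn by (cases M) auto
      have "pw s (X u w') * pw k u \<le> pw s (X u w) * pw k u" if "w \<le> w'" for w w'
      proof (cases "u = 0")
        case False
        then have "0 < epow M u" using u M' by (simp add: pw_pos)
        then have "0 < X u w" using Xreg(1)[of u w] u by auto
        then have "pw s (X u w') \<le> pw s (X u w)"
          using Xmono[OF that, of u] \<open>\<not> 0 \<le> s\<close> by (auto simp: pw_def intro: powr_mono2')
        then show ?thesis using pw_nonneg by (intro mult_right_mono)
      qed simp
      then show ?thesis by auto
    qed
  next
    fix q m and c1 c2 :: real assume q: "q \<in> Q" "ereal m \<le> \<mu> q" and cc: "0 < c1" "0 < c2"
    from Q[OF q(1)]
    show "\<exists>C. \<forall>u\<in>{0..1}. \<forall>w. 0 \<le> w \<longrightarrow> w \<le> pw \<beta> u \<longrightarrow> c1 * epow q u \<le> pw s (X u w) * pw k u \<longrightarrow>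
        pw s (X u w) * pw k u \<le> c2 * epow q u \<longrightarrow> w \<le> C * pw m u"
    proof (elim disjE exE conjE)
      assume "q = \<infinity>" "M = \<infinity>"
      have "w \<le> 0" if "u \<in> {0..1}" "0 \<le> w" "w \<le> pw \<beta> u" "pw s (X u w) * pw k u \<le> 0" for u w
      proof (cases "u = 0")
        case False
        then have "0 < u" using that by simp
        then have "pw k u > 0" "pw \<beta> u > 0" by (auto simp: pw_pos)
        moreover have "pw s (X u w) = 0" using that(4) nonneg[of u w] \<open>pw k u > 0\<close> by simp
        then have "\<not> 0 < X u w" using pw_pos[of "X u w" s] by auto
        ultimately have "w / c \<le> 0" by (auto simp: X_def \<open>M = \<infinity>\<close> min_def split: if_splits)
        then show ?thesis using c by (simp add: divide_le_0_iff)
      qed (use that in simp)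
      then show ?thesis using \<open>q = \<infinity>\<close> by (intro exI[of _ 0]) auto
    next
      fix m0 assume q0: "q = ereal (s * m0 + k)" "\<mu> q = ereal m0" "\<beta> \<le> m0" "ereal m0 \<le> M"
      have m: "m \<le> m0" using q q0 by simp
      show ?thesis
      proof (cases "s = 0")
        case True
        then have "m \<le> \<beta>" using s0 q0 m by simp
        then have "w \<le> 1 * pw m u" if "u \<in> {0..1}" "w \<le> pw \<beta> u" for u w
          using pw_antimono_exp[of u m \<beta>] that by simp
        then show ?thesis by blast
      next
        case False
        define e where "e = max (c1 powr (1 / s)) (c2 powr (1 / s))"
        have e: "e > 0" using cc by (simp add: e_def less_max_iff_disj)
        have "w \<le> ((c + 1) * e) * pw m u"
          if w: "u \<in> {0..1}" "0 \<le> w" "w \<le> pw \<beta> u" "c1 * epow q u \<le> pw s (X u w) * pw k u"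
            "pw s (X u w) * pw k u \<le> c2 * epow q u" for u w
        proof (cases "u = 0")
          case True then show ?thesis using w by simp
        next
          case u0: False
          then have u: "0 < u" "u \<le> 1" using w by auto
          have Xe: "X u w \<le> e * pw m0 u"
            unfolding e_def using monomial_zone(2)[OF False cc u(1) X0] w q0 by simp
          have p: "0 \<le> e * pw m0 u" using e by (simp add: pw_nonneg)
          have "w \<le> (c + 1) * (e * pw m0 u)"
          proof (cases "w / c \<le> pw \<beta> u")
            case True
            then have "w / c \<le> X u w" by (simp add: X_def)
            then have "w / c \<le> e * pw m0 u" using Xe by simp
            then have "w \<le> c * (e * pw m0 u)" using c by (simp add: pos_divide_le_eq mult.commute)
            then show ?thesis using p by (simp add: distrib_right)
          next
            case False
            then have "pw \<beta> u \<le> X u w" by (simp add: X_def)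
            then have "w \<le> e * pw m0 u" using w Xe by linarith
            moreover have "0 \<le> c * (e * pw m0 u)" using p c by simp
            ultimately show ?thesis by (simp add: distrib_right)
          qed
          also have "\<dots> \<le> (c + 1) * (e * pw m u)"
            using pw_antimono_exp[OF u(2) m] c e by (intro mult_left_mono) auto
          finally show ?thesis by simp
        qed
        then show ?thesis by blast
      qed
    qed
  next
    fix q m and c1 c2 :: real assume q: "q \<in> Q" "\<mu> q = ereal m" and cc: "0 < c1" "0 < c2"
    then have qm: "q = ereal (s * m + k)" "\<beta> \<le> m" "ereal m \<le> M" using Q[OF q(1)] by auto
    have "\<exists>\<rho>>0. \<exists>d>0. \<exists>e. d \<le> c / 2 \<and> 2 * d \<le> e \<and> (\<forall>u w. 0 < u \<longrightarrow> u < \<rho> \<longrightarrow> 0 \<le> w \<longrightarrow> w \<le> pw \<beta> u \<longrightarrow>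
        c1 * epow q u \<le> pw s (X u w) * pw k u \<longrightarrow> pw s (X u w) * pw k u \<le> c2 * epow q u \<longrightarrow>
        (\<mu> qA \<noteq> ereal m \<longrightarrow> d * pw m u \<le> w) \<and> (m \<noteq> \<beta> \<longrightarrow> w \<le> e * pw m u))"
    proof (cases "s = 0")
      case True
      then have "M = ereal m" "m = \<beta>" using s0 qm by auto
      then show ?thesis using c \<mu>A by (intro exI[of _ 1] conjI exI[of _ "c / 2"] exI[of _ c]) auto
    next
      case False
      define e1 where "e1 = min (c1 powr (1 / s)) (c2 powr (1 / s))"
      define e2 where "e2 = max (c1 powr (1 / s)) (c2 powr (1 / s))"
      have e12: "e1 > 0" "e2 > 0" using cc by (auto simp: e1_def e2_def less_max_iff_disj)
      obtain \<rho> where \<rho>: "\<rho> > 0" "\<And>u. 0 < u \<Longrightarrow> u < \<rho> \<Longrightarrow> M \<noteq> ereal m \<Longrightarrow> epow M u < e1 * pw m u"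
      proof (cases "M = ereal m")
        case True then show ?thesis using that[of 1] by simp
      next
        case ne: False
        then have "ereal m < M" using qm by (simp add: order_less_le)
        then show ?thesis using epow_less_pw[OF _ e12(1)] that by blast
      qed
      define d where "d = min (c / 2) (c * e1)"
      define e where "e = max ((c + 1) * e2) (2 * d)"
      have d: "d > 0" "d \<le> c / 2" "2 * d \<le> e" "d \<le> c * e1" using c e12 by (auto simp: d_def e_def)
      have *: "(\<mu> qA \<noteq> ereal m \<longrightarrow> d * pw m u \<le> w) \<and> (m \<noteq> \<beta> \<longrightarrow> w \<le> e * pw m u)"
        if u: "0 < u" "u < \<rho>" and w: "0 \<le> w" "w \<le> pw \<beta> u" "c1 * epow q u \<le> pw s (X u w) * pw k u"
            "pw s (X u w) * pw k u \<le> c2 * epow q u" for u w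
      proof (intro conjI impI)
        have Xz: "e1 * pw m u \<le> X u w" "X u w \<le> e2 * pw m u"
          unfolding e1_def e2_def using monomial_zone[OF False cc u(1) X0] w qm by simp_all
        have pm: "0 < pw m u" using u by (simp add: pw_pos)
        {
          assume "\<mu> qA \<noteq> ereal m"
          then have "epow M u < e1 * pw m u" using \<rho>(2)[OF u] \<mu>A by simp
          then have "e1 * pw m u \<le> w / c" using Xz(1) by (auto simp: X_def)
          then have "c * e1 * pw m u \<le> w" using c by (simp add: pos_le_divide_eq mult_ac)
          moreover have "d * pw m u \<le> c * e1 * pw m u" using d pm by (intro mult_right_mono) auto
          ultimately show "d * pw m u \<le> w" by linarith
        }
        {
          have p: "0 \<le> e2 * pw m u" using e12 pm by simp
          have "w \<le> (c + 1) * (e2 * pw m u)"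
          proof (cases "w / c \<le> pw \<beta> u")
            case True
            then have "w / c \<le> X u w" by (simp add: X_def)
            then have "w / c \<le> e2 * pw m u" using Xz by simp
            then have "w \<le> c * (e2 * pw m u)" using c by (simp add: pos_divide_le_eq mult.commute)
            then show ?thesis using p by (simp add: distrib_right)
          next
            case False
            then have "pw \<beta> u \<le> X u w" by (simp add: X_def)
            then have "w \<le> e2 * pw m u" using w Xz by linarith
            moreover have "0 \<le> c * (e2 * pw m u)" using p c by simp
            ultimately show ?thesis by (simp add: distrib_right)
          qed
          also have "\<dots> \<le> e * pw m u" using pm by (simp add: e_def flip: mult.assoc)
          finally show "w \<le> e * pw m u" .
        }
      qed
      show ?thesis using \<rho>(1) d * by (intro exI[of _ \<rho>] conjI exI[of _ d] exI[of _ e]) auto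
    qed
    then obtain \<rho> d e where \<rho>: "\<rho> > 0" and d: "d > 0" "d \<le> c / 2" "2 * d \<le> e"
      and 1: "\<forall>u w. 0 < u \<longrightarrow> u < \<rho> \<longrightarrow> 0 \<le> w \<longrightarrow> w \<le> pw \<beta> u \<longrightarrow>
        c1 * epow q u \<le> pw s (X u w) * pw k u \<longrightarrow> pw s (X u w) * pw k u \<le> c2 * epow q u \<longrightarrow>
        (\<mu> qA \<noteq> ereal m \<longrightarrow> d * pw m u \<le> w) \<and> (m \<noteq> \<beta> \<longrightarrow> w \<le> e * pw m u)" by blast
    define e1 where "e1 = min (d / c) 1"
    define e2 where "e2 = max 1 (e / c)"
    have e12: "e1 > 0" "e2 > 0" using d c by (auto simp: e1_def e2_def)
    define d1 where "d1 = min (e1 powr s) (e2 powr s)"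
    define d2 where "d2 = max (e1 powr s) (e2 powr s)"
    have d12: "d1 > 0" "d2 > 0" using e12 by (auto simp: d1_def d2_def less_max_iff_disj)
    have 2: "d1 * epow q u \<le> pw s (X u w) * pw k u \<and> pw s (X u w) * pw k u \<le> d2 * epow q u"
      if u: "0 < u" "u < min \<rho> 1" and w: "0 \<le> w" "w \<le> pw \<beta> u" "\<mu> qA \<noteq> ereal m \<longrightarrow> d * pw m u \<le> w"
        "m \<noteq> \<beta> \<longrightarrow> w \<le> e * pw m u" for u w
    proof -
      have pm: "0 < pw m u" using u by (simp add: pw_pos)
      have pmb: "pw m u \<le> pw \<beta> u" using u qm by (intro pw_antimono_exp) auto
      have eMm: "epow M u \<le> pw m u" using epow_antimono[OF qm(3), of u] u by simp
      have "e1 * pw m u \<le> X u w"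
      proof (cases "\<mu> qA = ereal m")
        case True
        then have "pw m u \<le> X u w" using \<mu>A by (simp add: X_def)
        moreover have "e1 * pw m u \<le> 1 * pw m u" using pm by (intro mult_right_mono) (auto simp: e1_def)
        ultimately show ?thesis by simp
      next
        case False
        then have "d * pw m u / c \<le> w / c" using w c by (intro divide_right_mono) auto
        moreover have "e1 * pw m u \<le> d / c * pw m u" unfolding e1_def using pm by (intro mult_right_mono) simp_all
        moreover have "e1 * pw m u \<le> 1 * pw m u" unfolding e1_def using pm by (intro mult_right_mono) simp_all
        ultimately have "e1 * pw m u \<le> min (w / c) (pw \<beta> u)" using pmb by simp
        then show ?thesis by (simp add: X_def le_max_iff_disj)
      qed
      moreover have "X u w \<le> e2 * pw m u"
      proof (cases "m = \<beta>")
        case True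
        have "X u w \<le> 1 * pw m u" using Xreg(2)[of u w] u True by simp
        also have "\<dots> \<le> e2 * pw m u" using pm by (intro mult_right_mono) (auto simp: e2_def)
        finally show ?thesis .
      next
        case False
        then have "w / c \<le> e * pw m u / c" using w c by (intro divide_right_mono) auto
        moreover have "e / c * pw m u \<le> e2 * pw m u" unfolding e2_def using pm by (intro mult_right_mono) simp_all
        moreover have "1 * pw m u \<le> e2 * pw m u" unfolding e2_def using pm by (intro mult_right_mono) simp_all
        ultimately show ?thesis using eMm by (simp add: X_def min_le_iff_disj)
      qed
      ultimately show ?thesis
        unfolding d1_def d2_def qm(1) epow_ereal using monomial_in_zone[OF e12(1) u(1)] by blast
    qed
    have 3: "\<exists>d1>0. \<exists>d2>0. \<forall>u w. 0 < u \<longrightarrow> u < min \<rho> 1 \<longrightarrow> 0 \<le> w \<longrightarrow> w \<le> pw \<beta> u \<longrightarrow>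
          (\<mu> qA \<noteq> ereal m \<longrightarrow> d * pw m u \<le> w) \<longrightarrow> (m \<noteq> \<beta> \<longrightarrow> w \<le> e * pw m u) \<longrightarrow>
          d1 * epow q u \<le> pw s (X u w) * pw k u \<and> pw s (X u w) * pw k u \<le> d2 * epow q u"
      using d12 2 by blast
    have 4: "\<forall>u w. 0 < u \<longrightarrow> u < min \<rho> 1 \<longrightarrow> 0 \<le> w \<longrightarrow> w \<le> pw \<beta> u \<longrightarrow>
        c1 * epow q u \<le> pw s (X u w) * pw k u \<longrightarrow> pw s (X u w) * pw k u \<le> c2 * epow q u \<longrightarrow>
        (\<mu> qA \<noteq> ereal m \<longrightarrow> d * pw m u \<le> w) \<and> (m \<noteq> \<beta> \<longrightarrow> w \<le> e * pw m u)" using 1 by simp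
    have \<rho>1: "min \<rho> 1 > 0" using \<rho> by simp
    show "\<exists>\<rho>>0. \<exists>d>0. \<exists>e. d \<le> c / 2 \<and> 2 * d \<le> e \<and> (\<forall>u w. 0 < u \<longrightarrow> u < \<rho> \<longrightarrow> 0 \<le> w \<longrightarrow> w \<le> pw \<beta> u \<longrightarrow>
          c1 * epow q u \<le> pw s (X u w) * pw k u \<longrightarrow> pw s (X u w) * pw k u \<le> c2 * epow q u \<longrightarrow>
          (\<mu> qA \<noteq> ereal m \<longrightarrow> d * pw m u \<le> w) \<and> (m \<noteq> \<beta> \<longrightarrow> w \<le> e * pw m u)) \<and>
       (\<exists>d1>0. \<exists>d2>0. \<forall>u w. 0 < u \<longrightarrow> u < \<rho> \<longrightarrow> 0 \<le> w \<longrightarrow> w \<le> pw \<beta> u \<longrightarrow>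
          (\<mu> qA \<noteq> ereal m \<longrightarrow> d * pw m u \<le> w) \<longrightarrow> (m \<noteq> \<beta> \<longrightarrow> w \<le> e * pw m u) \<longrightarrow>
          d1 * epow q u \<le> pw s (X u w) * pw k u \<and> pw s (X u w) * pw k u \<le> d2 * epow q u)"
      by (insert \<rho>1 d 3 4, rule exI[of _ "min \<rho> 1"], rule conjI, assumption, rule exI[of _ d], rule conjI, assumption,
          rule exI[of _ e], intro conjI) assumption+
  next
    fix q and u :: real assume q: "q \<in> Q" and u: "u \<in> {0..1}"
    from Q[OF q] show "pw s (X u (c * epow (\<mu> q) u)) * pw k u = epow q u"
    proof (elim disjE exE conjE)
      assume "q = \<infinity>" "\<mu> q = \<infinity>" "M = \<infinity>"
      then show ?thesis using pw_nonneg[of \<beta> u] by (simp add: X_def)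
    next
      fix m assume m: "q = ereal (s * m + k)" "\<mu> q = ereal m" "\<beta> \<le> m" "ereal m \<le> M"
      have "pw m u \<le> pw \<beta> u" using u m by (intro pw_antimono_exp) auto
      moreover have "epow M u \<le> pw m u" using epow_antimono[OF m(4), of u] u by simp
      ultimately have "X u (c * epow (\<mu> q) u) = pw m u" using c m(2) by (simp add: X_def)
      then show ?thesis by (simp add: m(1) monomial_on_curve)
    qed
  qed
qed

lemma (in o_minimal_structure) slice_profile_zero:
  assumes c: "0 < c" and \<mu>: "\<mu> \<infinity> = ereal \<beta>"
  shows "slice_profile D (\<lambda>u w. 0) \<beta> c {\<infinity>} \<mu> \<infinity> \<infinity>"
proof -
  have "w \<le> 1 * pw m u" if "ereal m \<le> \<mu> \<infinity>" "u \<in> {0..1}" "w \<le> pw \<beta> u" for m u w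
    using pw_antimono_exp[of u m \<beta>] that \<mu> by simp
  then have 1: "\<exists>C. \<forall>u\<in>{0..1}. \<forall>w. 0 \<le> w \<longrightarrow> w \<le> pw \<beta> u \<longrightarrow> w \<le> C * pw m u" if "ereal m \<le> \<mu> \<infinity>" for m
    using that by blast
  have 2: "\<exists>\<rho>>0. \<exists>d>0. \<exists>e. d \<le> c / 2 \<and> 2 * d \<le> e \<and> (\<forall>u w :: real. 0 < u \<longrightarrow> u < \<rho> \<longrightarrow> 0 \<le> w \<longrightarrow> w \<le> pw \<beta> u \<longrightarrow>
      (m \<noteq> \<beta> \<longrightarrow> w \<le> e * pw m u))" if "\<mu> \<infinity> = ereal m" for m
    using that \<mu> c by (intro exI[of _ 1] conjI exI[of _ "c / 2"] exI[of _ c]) auto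
  show ?thesis unfolding slice_profile_def
    using 1 2 \<mu> by (auto intro: dF_const_real lipschitzian_const zero_less_one)
qed

lemma order_interval_commute: "order_interval D a b = order_interval D b a"
  by (simp add: order_interval_def min.commute max.commute)

text \<open>Solving \<open>\<mu> q = a * q + b\<close> for \<open>q\<close> gives the exponents \<open>s = 1 / a\<close> and \<open>k = - b / a\<close> of the monomial.
  They lie in the field of exponents because \<open>\<mu>\<close> takes values there at two finite orders. For
  \<open>a > 0\<close> the width is largest at the end of larger order. An infinite order excludes
  \<open>a < 0\<close>, since \<open>\<mu>\<close> is bounded below by \<open>\<beta>\<close>, and forces \<open>a \<le> 1\<close>, since \<open>\<mu> q \<le> q\<close> for arbitrarily large
  finite \<open>q\<close>.\<close>

lemma (in o_minimal_structure) slice_profile_exists: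
  assumes q: "q0 \<in> orders D" "q1 \<in> orders D" and \<beta>: "\<beta> \<in> exponents D" "1 \<le> \<beta>" and c: "0 < c"
    and Q: "Q = order_interval D q0 q1"
    and \<mu>: "\<mu> ` Q \<subseteq> ereal ` exponents D \<union> {\<infinity>}" "ereal_affine_on Q \<mu>"
    and nc: "\<not> is_singleton Q \<Longrightarrow> \<not> \<mu> constant_on Q"
    and le: "\<And>q. q \<in> Q \<Longrightarrow> \<mu> q \<le> q" and \<beta>in: "ereal \<beta> \<in> \<mu> ` Q" and \<beta>le: "\<And>q. q \<in> Q \<Longrightarrow> ereal \<beta> \<le> \<mu> q"
  shows "\<exists>\<phi>. slice_profile D \<phi> \<beta> c Q \<mu> q0 q1 \<or> slice_profile D \<phi> \<beta> c Q \<mu> q1 q0"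
proof (cases "q0 = q1")
  case True
  have Qs: "Q = {q0}" using q True by (auto simp: Q order_interval_def)
  then have \<mu>\<beta>: "\<mu> q0 = ereal \<beta>" using \<beta>in by auto
  show ?thesis
  proof (cases "q0 = \<infinity>")
    case inf: True
    then show ?thesis using slice_profile_zero[OF c, of \<mu> \<beta>] \<mu>\<beta> Qs True by auto
  next
    case False
    then obtain r where r: "q0 = ereal r" "r \<in> exponents D" "1 \<le> r" using q by (auto simp: orders_def)
    have "\<beta> \<le> r" using le[of q0] Qs \<mu>\<beta> r by simp
    then have "slice_profile D (\<lambda>u w. pw 0 (max (epow (ereal \<beta>) u) (min (w / c) (pw \<beta> u))) * pw r u) \<beta> c Q \<mu> q0 q1"
      using r \<beta> c Qs \<mu>\<beta> True exponents_0 by (intro slice_profile_monomial) auto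
    then show ?thesis by blast
  qed
next
  case False
  define lo where "lo = min q0 q1"
  define hi where "hi = max q0 q1"
  have lohi: "lo < hi" using False by (auto simp: lo_def hi_def min_def max_def)
  have QI: "Q = order_interval D lo hi" "Q = order_interval D hi lo"
    using lohi by (auto simp: Q order_interval_def lo_def hi_def)
  have Qiff: "x \<in> Q \<longleftrightarrow> x \<in> orders D \<and> lo \<le> x \<and> x \<le> hi" for x
    using lohi by (simp add: QI(1) order_interval_def)
  have ords: "lo \<in> orders D" "hi \<in> orders D" using q by (auto simp: lo_def hi_def min_def max_def)
  have inQ: "lo \<in> Q" "hi \<in> Q" using ords lohi by (auto simp: Qiff)
  obtain l where l: "lo = ereal l" "l \<in> exponents D" "1 \<le> l" using ords(1) lohi by (auto simp: orders_def)
  obtain a b where ab: "\<And>x. x \<in> Q \<Longrightarrow> \<mu> x = ereal a * x + ereal b" using \<mu>(2) by (auto simp: ereal_affine_on_def)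
  have real_mu: "a * r + b \<in> exponents D \<and> \<mu> (ereal r) = ereal (a * r + b)" if "ereal r \<in> Q" for r
    using \<mu>(1) ab[OF that] that by fastforce
  have a0: "a \<noteq> 0"
  proof
    assume "a = 0"
    then have "\<mu> constant_on Q" using ab unfolding constant_on_def by (intro exI[of _ "ereal b"]) (simp add: zero_ereal_def[symmetric])
    moreover have "\<not> is_singleton Q" using inQ lohi by (auto simp: is_singleton_def)
    ultimately show False using nc by blast
  qed
  have large: "ereal (l + of_nat n) \<in> Q" if "hi = \<infinity>" for n
    using that l exponents_add[OF l(2) exponents_of_nat] by (auto simp: Qiff orders_def)
  obtain h where h: "ereal h \<in> Q" "l < h" "h \<in> exponents D" "hi \<noteq> \<infinity> \<longrightarrow> hi = ereal h"
  proof (cases "hi = \<infinity>")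
    case True
    have "ereal (l + 1) \<in> Q" using large[OF True, of 1] by simp
    then show ?thesis using exponents_add[OF l(2) exponents_1] True by (intro that[of "l + 1"]) simp_all
  next
    case False
    then obtain h where h: "hi = ereal h" "h \<in> exponents D" using ords(2) by (auto simp: orders_def)
    have "ereal h \<in> Q" "l < h" using inQ(2) lohi unfolding h(1) l(1) by simp_all
    then show ?thesis using h that by blast
  qed
  have lQ: "ereal l \<in> Q" using inQ l by simp
  have aD: "a \<in> exponents D"
  proof -
    have "((a * h + b) - (a * l + b)) / (h - l) \<in> exponents D"
      using real_mu[OF h(1)] real_mu[OF lQ] h l by (intro exponents_divide exponents_diff) auto
    moreover have "((a * h + b) - (a * l + b)) / (h - l) = a" using h(2) by (simp add: field_simps)
    ultimately show ?thesis by simp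
  qed
  have bD: "b \<in> exponents D" using exponents_diff[OF conjunct1[OF real_mu[OF lQ]] exponents_mult[OF aD l(2)]] by simp
  define s where "s = 1 / a"
  define k where "k = - b / a"
  have sk: "s \<in> exponents D" "k \<in> exponents D"
    using aD bD exponents_1 by (auto simp: s_def k_def intro: exponents_divide exponents_uminus)
  have inv: "s * (a * r + b) + k = r" for r using a0 by (simp add: s_def k_def field_simps)
  have s0: "s \<noteq> 0" using a0 by (simp add: s_def)
  have Qreal: "\<exists>m. x = ereal (s * m + k) \<and> \<mu> x = ereal m \<and> \<beta> \<le> m" if x: "x \<in> Q" "x \<noteq> \<infinity>" for x
  proof -
    obtain r where r: "x = ereal r" using x by (auto simp: Qiff orders_def)
    then have \<mu>r: "\<mu> x = ereal (a * r + b)" using real_mu[of r] x by simp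
    moreover have "x = ereal (s * (a * r + b) + k)" unfolding inv r ..
    moreover have "\<beta> \<le> a * r + b" using \<beta>le[OF x(1)] \<mu>r by simp
    ultimately show ?thesis by blast
  qed
  have Qge1: "1 \<le> r" if "ereal r \<in> Q" for r using that by (auto simp: Qiff orders_def)
  have dirs: "\<exists>\<phi>. slice_profile D \<phi> \<beta> c Q \<mu> hi lo" if "a > 0"
  proof -
    have \<beta>eq: "\<beta> = a * l + b"
    proof -
      obtain x where x: "x \<in> Q" "\<mu> x = ereal \<beta>" using \<beta>in by auto
      have "x \<noteq> \<infinity>" using ab[OF x(1)] x(2) that by auto
      then obtain r where r: "x = ereal r" using x(1) by (auto simp: Qiff orders_def)
      then have "\<beta> = a * r + b" "l \<le> r" using x ab l by (auto simp: Qiff)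
      moreover have "\<beta> \<le> a * l + b" using \<beta>le[OF lQ] real_mu[OF lQ] by simp
      ultimately show ?thesis using that mult_left_mono[of l r a] by simp
    qed
    have qlo: "lo = ereal (s * \<beta> + k)" unfolding \<beta>eq inv l(1) ..
    have b1: "1 \<le> s * \<beta> + k" "\<beta> \<le> s * \<beta> + k" using l(3) le[OF lQ] real_mu[OF lQ] unfolding \<beta>eq inv by auto
    show ?thesis
    proof (cases "hi = \<infinity>")
      case True
      have "a \<le> 1"
      proof (rule ccontr)
        assume "\<not> a \<le> 1"
        then obtain n where n: "- (a * l + b - l) < of_nat n * (a - 1)" using reals_Archimedean3[of "a - 1"] by auto
        have "a * (l + of_nat n) + b \<le> l + of_nat n" using le[OF large[OF True, of n]] real_mu[OF large[OF True, of n]] by simp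
        then show False using n by (simp add: algebra_simps)
      qed
      then have s1: "1 \<le> s" using that by (simp add: s_def)
      have \<mu>hi: "\<mu> hi = \<infinity>" using ab[OF inQ(2)] True that by simp
      have "slice_profile D (\<lambda>u w. pw s (max (epow \<infinity> u) (min (w / c) (pw \<beta> u))) * pw k u) \<beta> c Q \<mu> hi lo"
        using sk \<beta> c b1 s1 \<mu>hi True qlo Qreal s0 by (intro slice_profile_monomial) auto
      then show ?thesis by blast
    next
      case False
      then have hi: "hi = ereal h" using h by simp
      have \<mu>hi: "\<mu> hi = ereal (a * h + b)" using real_mu[OF h(1)] hi by simp
      have up: "\<mu> x \<le> ereal (a * h + b)" if x: "x \<in> Q" for x
      proof -
        obtain r where r: "x = ereal r" "r \<le> h" using x hi by (auto simp: Qiff orders_def)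
        then have "a * r \<le> a * h" using \<open>a > 0\<close> by (intro mult_left_mono) auto
        then show ?thesis using real_mu[of r] x r by simp
      qed
      have Qc: "\<exists>m. x = ereal (s * m + k) \<and> \<mu> x = ereal m \<and> \<beta> \<le> m \<and> ereal m \<le> ereal (a * h + b)" if "x \<in> Q" for x
        using Qreal[OF that] up[OF that] that hi by (cases "x = \<infinity>") (auto simp: Qiff)
      have "slice_profile D (\<lambda>u w. pw s (max (epow (ereal (a * h + b)) u) (min (w / c) (pw \<beta> u))) * pw k u) \<beta> c Q \<mu> hi lo"
      proof (rule slice_profile_monomial)
        show "ereal (a * h + b) \<in> ereal ` exponents D \<union> {\<infinity>}" using real_mu[OF h(1)] by simp
        show "ereal \<beta> \<le> ereal (a * h + b)" using h that by (simp add: \<beta>eq)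
        show "1 \<le> s * M' + k \<and> M' \<le> s * M' + k" if "ereal (a * h + b) = ereal M'" for M'
          using that Qge1[OF h(1)] le[OF h(1)] real_mu[OF h(1)] inv[of h] by auto
      qed (use sk \<beta> c b1 \<mu>hi qlo Qc s0 inv[of h] hi in auto)
      then show ?thesis by blast
    qed
  qed
  have dirs': "\<exists>\<phi>. slice_profile D \<phi> \<beta> c Q \<mu> lo hi" if "\<not> a > 0"
  proof -
    have a: "a < 0" using that a0 by simp
    have hi: "hi = ereal h"
    proof (rule ccontr)
      assume "hi \<noteq> ereal h"
      then have "hi = \<infinity>" using h by blast
      then have "\<mu> hi = - \<infinity>" using ab[OF inQ(2)] a by simp
      then show False using \<beta>le[OF inQ(2)] by simp
    qed
    have Qr: "\<exists>r. x = ereal r \<and> l \<le> r \<and> r \<le> h" if "x \<in> Q" for x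
      using that hi l by (auto simp: Qiff orders_def)
    have \<beta>eq: "\<beta> = a * h + b"
    proof -
      obtain x where x: "x \<in> Q" "\<mu> x = ereal \<beta>" using \<beta>in by auto
      obtain r where r: "x = ereal r" "r \<le> h" using Qr[OF x(1)] by blast
      then have "\<beta> = a * r + b" using x real_mu[of r] by simp
      moreover have "\<beta> \<le> a * h + b" using \<beta>le[OF h(1)] real_mu[OF h(1)] by simp
      moreover have "a * h \<le> a * r" using r a by (simp add: mult_left_mono_neg)
      ultimately show ?thesis by linarith
    qed
    have qhi: "hi = ereal (s * \<beta> + k)" unfolding \<beta>eq inv hi ..
    have b1: "1 \<le> s * \<beta> + k" "\<beta> \<le> s * \<beta> + k" using Qge1[OF h(1)] le[OF h(1)] real_mu[OF h(1)] unfolding \<beta>eq inv by auto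
    have \<mu>lo: "\<mu> lo = ereal (a * l + b)" using real_mu[OF lQ] l by simp
    have up: "\<mu> x \<le> ereal (a * l + b)" if x: "x \<in> Q" for x
    proof -
      obtain r where r: "x = ereal r" "l \<le> r" using Qr[OF x] by blast
      then have "a * r \<le> a * l" using a by (simp add: mult_left_mono_neg)
      then show ?thesis using real_mu[of r] x r by simp
    qed
    have Qc: "\<exists>m. x = ereal (s * m + k) \<and> \<mu> x = ereal m \<and> \<beta> \<le> m \<and> ereal m \<le> ereal (a * l + b)" if "x \<in> Q" for x
      using Qreal[OF that] up[OF that] Qr[OF that] by auto
    have "slice_profile D (\<lambda>u w. pw s (max (epow (ereal (a * l + b)) u) (min (w / c) (pw \<beta> u))) * pw k u) \<beta> c Q \<mu> lo hi"
    proof (rule slice_profile_monomial)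
      show "ereal (a * l + b) \<in> ereal ` exponents D \<union> {\<infinity>}" using real_mu[OF lQ] by simp
      show "ereal \<beta> \<le> ereal (a * l + b)" using h a mult_left_mono_neg[of l h a] by (simp add: \<beta>eq)
      show "1 \<le> s * M' + k \<and> M' \<le> s * M' + k" if "ereal (a * l + b) = ereal M'" for M'
        using that l(3) le[OF lQ] real_mu[OF lQ] inv[of l] by auto
    qed (use sk \<beta> c b1 \<mu>lo qhi Qc s0 inv[of l] l in auto)
    then show ?thesis by blast
  qed
  have "(q0 = lo \<and> q1 = hi) \<or> (q0 = hi \<and> q1 = lo)" by (auto simp: lo_def hi_def min_def max_def)
  then show ?thesis using dirs dirs' by blast
qed

lemma arc_epow_compare:
  assumes \<gamma>: "arc_germ D \<gamma>" "germ_subset (arc_image \<gamma>) sector" and c: "0 < c" "0 \<le> K" and q: "0 \<le> q" "0 \<le> q'"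
    and ev: "eventually (\<lambda>x. x \<in> arc_image \<gamma> \<longrightarrow> c * epow q (fst x) \<le> K * epow q' (fst x)) (nhds 0)"
  shows "q' \<le> q"
proof -
  define C where "C = 2 powr real_of_ereal q"
  have C: "0 < C" by (simp add: C_def)
  have "eventually (\<lambda>x. x \<in> arc_image \<gamma> \<longrightarrow> c / C * epow q (norm x) \<le> K * epow q' (norm x)) (nhds 0)"
    using ev \<gamma>(2) unfolding germ_subset_def
  proof eventually_elim
    case (elim x)
    show ?case
    proof
      assume x: "x \<in> arc_image \<gamma>"
      then have xs: "x \<in> sector" using elim by simp
      have "c / C * epow q (norm x) \<le> c / C * (C * epow q (fst x))"
        using epow_sector[OF xs q(1)] c C by (intro mult_left_mono) (auto simp: C_def)
      also have "\<dots> = c * epow q (fst x)" using C by simp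
      also have "\<dots> \<le> K * epow q' (fst x)" using elim x by simp
      also have "\<dots> \<le> K * epow q' (norm x)" using epow_sector[OF xs q(2)] c by (intro mult_left_mono) auto
      finally show "c / C * epow q (norm x) \<le> K * epow q' (norm x)" .
    qed
  qed
  then have ev': "eventually (\<lambda>t. c / C * epow q (norm (\<gamma> t)) \<le> K * epow q' (norm (\<gamma> t))) (at_right 0)"
    by (subst eventually_arc_iff[OF \<gamma>(1)]) auto
  obtain e where e: "e > 0" "\<And>t. 0 \<le> t \<Longrightarrow> t < e \<Longrightarrow> norm (\<gamma> t) = t" using arc_germD[OF \<gamma>(1)] by metis
  have "eventually (\<lambda>t. c / C * epow q t \<le> K * epow q' t) (at_right 0)"
    using ev' eventually_at_right_0_small[OF e(1)] by eventually_elim (use e in auto)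
  then show ?thesis by (rule epow_compare) (use c C q in auto)
qed

lemma arcs_in_mono: "\<gamma> \<in> arcs_in D A \<Longrightarrow> germ_subset A B \<Longrightarrow> \<gamma> \<in> arcs_in D B"
  unfolding arcs_in_def germ_subset_def by (auto elim: eventually_elim2)

section \<open>A function with a given profile on a slice\<close>

lemma slice_profile_between:
  assumes P: "slice_profile D \<phi> \<beta> c Q \<mu> qA qB" and u: "u \<in> {0..1}" and w: "0 \<le> w"
  shows "min (epow qA u) (epow qB u) \<le> \<phi> u w \<and> \<phi> u w \<le> max (epow qA u) (epow qB u)"
proof -
  define w1 where "w1 = max w (c * pw \<beta> u)"
  have w1: "w \<le> w1" "c * pw \<beta> u \<le> w1" by (auto simp: w1_def)
  have "\<phi> u 0 = epow qA u \<and> (\<forall>w\<ge>c * pw \<beta> u. \<phi> u w = epow qB u)"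
    using P[unfolded slice_profile_def, THEN conjunct2, THEN conjunct2, THEN conjunct1] u by (rule bspec)
  then have v: "\<phi> u 0 = epow qA u" "\<phi> u w1 = epow qB u" using w1(2) by simp_all
  have "(\<forall>w w'. 0 \<le> w \<longrightarrow> w \<le> w' \<longrightarrow> \<phi> u w \<le> \<phi> u w') \<or> (\<forall>w w'. 0 \<le> w \<longrightarrow> w \<le> w' \<longrightarrow> \<phi> u w' \<le> \<phi> u w)"
    using P[unfolded slice_profile_def, THEN conjunct2, THEN conjunct2, THEN conjunct2, THEN conjunct1] u by (rule bspec)
  then show ?thesis
  proof
    assume m: "\<forall>w w'. 0 \<le> w \<longrightarrow> w \<le> w' \<longrightarrow> \<phi> u w \<le> \<phi> u w'"
    have "\<phi> u 0 \<le> \<phi> u w" "\<phi> u w \<le> \<phi> u w1" using m w w1 by auto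
    then show ?thesis using v by auto
  next
    assume m: "\<forall>w w'. 0 \<le> w \<longrightarrow> w \<le> w' \<longrightarrow> \<phi> u w' \<le> \<phi> u w"
    have "\<phi> u w \<le> \<phi> u 0" "\<phi> u w1 \<le> \<phi> u w" using m w w1 by auto
    then show ?thesis using v by auto
  qed
qed

text \<open>The base curve \<open>e\<close>, from which the vertical distance is measured, is the lower boundary curve for
  \<open>\<sigma> = 1\<close> and the upper one for \<open>\<sigma> = -1\<close>.\<close>

locale profiled_slice = polynomially_bounded_structure D for D +
  fixes \<phi> :: "real \<Rightarrow> real \<Rightarrow> real" and \<beta> c :: real and Q :: "ereal set" and \<mu> :: "ereal \<Rightarrow> ereal"
    and qA qB :: ereal and y1 y2 e :: "real \<Rightarrow> real" and \<sigma> :: real and f :: "real \<times> real \<Rightarrow> real"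
  assumes profile: "slice_profile D \<phi> \<beta> c Q \<mu> qA qB"
    and \<beta>: "\<beta> \<in> exponents D" "1 \<le> \<beta>" and c: "0 < c"
    and dFy: "dF y1" "dF y2" and lip: "lipschitzian {0..1} y1" "lipschitzian {0..1} y2"
    and y0: "y1 0 = 0" and ysec: "\<And>u. 0 \<le> u \<Longrightarrow> u \<le> 1 \<Longrightarrow> 0 \<le> y1 u \<and> y2 u \<le> u"
    and height: "\<And>u. 0 \<le> u \<Longrightarrow> u \<le> 1 \<Longrightarrow> c * pw \<beta> u \<le> y2 u - y1 u \<and> y2 u - y1 u \<le> pw \<beta> u"
    and \<sigma>: "\<sigma> = 1 \<and> e = y1 \<or> \<sigma> = -1 \<and> e = y2"
    and df: "dF f" and f0: "f 0 = 0"
    and feq: "\<And>p. p \<in> region 1 y1 y2 \<Longrightarrow> f p = \<phi> (fst p) (\<sigma> * (snd p - e (fst p)))"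
    and q: "qA \<in> orders D" "qB \<in> orders D" and Q: "Q = order_interval D qA qB"
    and \<mu>: "\<And>q. q \<in> Q \<Longrightarrow> \<mu> q \<in> ereal ` exponents D \<union> {\<infinity>} \<and> ereal \<beta> \<le> \<mu> q"
begin

abbreviation "\<Lambda> \<equiv> region 1 y1 y2"
abbreviation "ht p \<equiv> \<sigma> * (snd p - e (fst p))"

lemmas profile' = profile[unfolded slice_profile_def]
lemmas P_value = profile'[THEN conjunct2, THEN conjunct2, THEN conjunct1, rule_format]
lemmas P_mono = profile'[THEN conjunct2, THEN conjunct2, THEN conjunct2, THEN conjunct1, rule_format]
lemmas P_zone = profile'[THEN conjunct2, THEN conjunct2, THEN conjunct2, THEN conjunct2, THEN conjunct2, THEN conjunct1, rule_format]
lemmas P_curve = profile'[THEN conjunct2, THEN conjunct2, THEN conjunct2, THEN conjunct2, THEN conjunct2, THEN conjunct2, rule_format]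

lemma region_sector: "\<Lambda> \<subseteq> sector"
proof
  fix p assume "p \<in> \<Lambda>"
  then have "0 \<le> fst p" "fst p \<le> 1" "y1 (fst p) \<le> snd p" "snd p \<le> y2 (fst p)" by (auto simp: region_def)
  then show "p \<in> sector" using ysec[of "fst p"] by (auto simp: sector_def)
qed

lemma germ_sector: "germ_subset \<Lambda> sector"
  using region_sector unfolding germ_subset_def by (intro always_eventually) blast

lemma ht_bounds: "p \<in> \<Lambda> \<Longrightarrow> 0 \<le> ht p \<and> ht p \<le> pw \<beta> (fst p) \<and> 0 \<le> fst p \<and> fst p \<le> 1"
  using height[of "fst p"] \<sigma> by (auto simp: region_def)

lemma q_nonneg: "q \<in> orders D \<Longrightarrow> 0 \<le> q \<and> q \<noteq> - \<infinity>"
  by (auto simp: orders_def zero_ereal_def)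

lemma holder: "holder_triangle D \<beta> \<Lambda>" "holder_triangle_between D \<beta> \<Lambda> (arc_of (graph y1)) (arc_of (graph y2))"
proof -
  have h: "c * pw \<beta> u \<le> y2 u - y1 u \<and> y2 u - y1 u \<le> 1 * pw \<beta> u" if "0 \<le> u" "u \<le> 1" for u
    using height[OF that] by simp
  show "holder_triangle D \<beta> \<Lambda>" "holder_triangle_between D \<beta> \<Lambda> (arc_of (graph y1)) (arc_of (graph y2))"
    by (rule region_holder_triangle[OF \<beta> zero_less_one order_refl dFy lip c h y0]; assumption)+
qed

lemma f_between:
  assumes p: "p \<in> \<Lambda>"
  shows "epow (max qA qB) (fst p) \<le> f p \<and> f p \<le> epow (min qA qB) (fst p)"
proof -
  have u: "fst p \<in> {0..1}" "0 \<le> ht p" using ht_bounds[OF p] by simp_all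
  have "epow (max qA qB) (fst p) \<le> min (epow qA (fst p)) (epow qB (fst p))"
    "max (epow qA (fst p)) (epow qB (fst p)) \<le> epow (min qA qB) (fst p)"
    using epow_antimono[of _ _ "fst p"] u q_nonneg[OF q(1)] q_nonneg[OF q(2)] by (auto simp: min_def max_def)
  then show ?thesis using slice_profile_between[OF profile u] unfolding feq[OF p] by linarith
qed

lemma f_bound: "p \<in> \<Lambda> \<Longrightarrow> 0 \<le> f p \<and> f p \<le> 1 * fst p"
proof -
  assume p: "p \<in> \<Lambda>"
  have u: "0 \<le> fst p" "fst p \<le> 1" using ht_bounds[OF p] by simp_all
  have "ereal 1 \<le> min qA qB" using q by (auto simp: orders_def)
  then have "epow (min qA qB) (fst p) \<le> epow (ereal 1) (fst p)" using u by (intro epow_antimono) auto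
  also have "\<dots> = fst p" using u by (auto simp: pw_def)
  finally show ?thesis using f_between[OF p] epow_nonneg[of "max qA qB" "fst p"] by simp
qed

lemma f_bound_germ: "eventually (\<lambda>x. x \<in> \<Lambda> \<longrightarrow> 0 \<le> f x \<and> f x \<le> 1 * fst x) (nhds 0)"
  using f_bound by (intro always_eventually) blast

lemmas slice_arc_order = arc_order[OF df f0 germ_sector f_bound_germ]

lemma vertically_monotone: "vertically_monotone f \<Lambda>"
  unfolding vertically_monotone_def
proof (intro allI impI)
  fix u v1 v v2 assume p: "(u, v1) \<in> \<Lambda>" "(u, v) \<in> \<Lambda>" "(u, v2) \<in> \<Lambda>" "v1 \<le> v" "v \<le> v2"
  have u: "u \<in> {0..1}" using p(1) by (auto simp: region_def)
  have h: "0 \<le> \<sigma> * (v1 - e u)" "0 \<le> \<sigma> * (v - e u)" "0 \<le> \<sigma> * (v2 - e u)"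
    using ht_bounds[OF p(1)] ht_bounds[OF p(2)] ht_bounds[OF p(3)] by auto
  have o: "\<sigma> * (v1 - e u) \<le> \<sigma> * (v - e u) \<and> \<sigma> * (v - e u) \<le> \<sigma> * (v2 - e u) \<or>
      \<sigma> * (v2 - e u) \<le> \<sigma> * (v - e u) \<and> \<sigma> * (v - e u) \<le> \<sigma> * (v1 - e u)"
    using \<sigma> p(4,5) by auto
  have "f (u, v1) = \<phi> u (\<sigma> * (v1 - e u))" "f (u, v) = \<phi> u (\<sigma> * (v - e u))" "f (u, v2) = \<phi> u (\<sigma> * (v2 - e u))"
    using feq[OF p(1)] feq[OF p(2)] feq[OF p(3)] by auto
  moreover have "min (\<phi> u a1) (\<phi> u a2) \<le> \<phi> u a \<and> \<phi> u a \<le> max (\<phi> u a1) (\<phi> u a2)"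
    if "0 \<le> a1" "0 \<le> a" "0 \<le> a2" "a1 \<le> a \<and> a \<le> a2 \<or> a2 \<le> a \<and> a \<le> a1" for a1 a a2
    using P_mono[OF u] that by (auto simp: min_le_iff_disj le_max_iff_disj)
  ultimately show "min (f (u, v1)) (f (u, v2)) \<le> f (u, v) \<and> f (u, v) \<le> max (f (u, v1)) (f (u, v2))"
    using h o by metis
qed

text \<open>The values of \<open>f\<close> lie between those on the two boundary curves of the slice.\<close>

lemma order_in_Q:
  assumes \<gamma>: "\<gamma> \<in> arcs_in D \<Lambda>"
  shows "order_along f \<gamma> \<in> Q"
proof -
  let ?q = "order_along f \<gamma>"
  have arc: "arc_germ D \<gamma>" and sub: "eventually (\<lambda>x. x \<in> arc_image \<gamma> \<longrightarrow> x \<in> \<Lambda>) (nhds 0)"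
    using \<gamma> by (auto simp: arcs_in_def germ_subset_def)
  have sec: "germ_subset (arc_image \<gamma>) sector"
    using sub region_sector unfolding germ_subset_def by (auto elim: eventually_mono)
  have o: "?q \<in> orders D" by (rule slice_arc_order(1)[OF \<gamma>])
  from slice_arc_order(2)[OF \<gamma>] obtain c1 c2 where cc: "c1 > 0" "c2 > 0"
    "eventually (\<lambda>x. x \<in> arc_image \<gamma> \<longrightarrow> c1 * epow ?q (fst x) \<le> f x \<and> f x \<le> c2 * epow ?q (fst x)) (nhds 0)"
    by (rule has_orderE)
  have 1: "eventually (\<lambda>x. x \<in> arc_image \<gamma> \<longrightarrow> c1 * epow ?q (fst x) \<le> 1 * epow (min qA qB) (fst x)) (nhds 0)"
    using cc(3) sub
  proof eventually_elim
    case (elim x) then show ?case using f_between[of x] by auto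
  qed
  have 2: "eventually (\<lambda>x. x \<in> arc_image \<gamma> \<longrightarrow> 1 * epow (max qA qB) (fst x) \<le> c2 * epow ?q (fst x)) (nhds 0)"
    using cc(3) sub
  proof eventually_elim
    case (elim x) then show ?case using f_between[of x] by auto
  qed
  have mm: "0 \<le> min qA qB" "0 \<le> max qA qB" using q_nonneg[OF q(1)] q_nonneg[OF q(2)] by (auto simp: le_max_iff_disj)
  have "min qA qB \<le> ?q" using arc_epow_compare[OF arc sec cc(1) _ _ mm(1) 1] q_nonneg[OF o] by simp
  moreover have "?q \<le> max qA qB" using arc_epow_compare[OF arc sec _ _ mm(2) _ 2] q_nonneg[OF o] cc by simp
  ultimately show ?thesis using o by (simp add: Q order_interval_def)
qed

lemma order_along_graph:
  assumes y: "dF y" "continuous_on {0..1} y" "y 0 = 0" and q': "q' \<in> orders D"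
    and yL: "\<And>u. 0 \<le> u \<Longrightarrow> u \<le> 1 \<Longrightarrow> (u, y u) \<in> \<Lambda> \<and> f (u, y u) = epow q' u"
  shows "arc_of (graph y) \<in> arcs_in D \<Lambda>" "order_along f (arc_of (graph y)) = q'"
proof -
  note g = graph_arc[OF y zero_less_one]
  let ?\<gamma> = "arc_of (graph y)"
  have "eventually (\<lambda>x :: real \<times> real. norm x < 1) (nhds 0)" unfolding eventually_nhds_0 by (intro exI[of _ 1]) simp
  then have sub: "eventually (\<lambda>x. x \<in> arc_image ?\<gamma> \<longrightarrow> x \<in> \<Lambda> \<and> f x = epow q' (fst x)) (nhds 0)"
    using g(2) unfolding germ_eq_def
  proof eventually_elim
    case (elim x)
    have n: "norm (fst x) \<le> norm x" by (metis norm_fst_le prod.collapse)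
    show ?case
    proof
      assume "x \<in> arc_image ?\<gamma>"
      then have x: "0 \<le> fst x" "fst x \<le> 1" "(fst x, y (fst x)) = x"
        using elim n by (auto simp: graph_def prod_eq_iff)
      then show "x \<in> \<Lambda> \<and> f x = epow q' (fst x)" using yL[OF x(1,2)] by simp
    qed
  qed
  show in\<Lambda>: "?\<gamma> \<in> arcs_in D \<Lambda>" using g(1) sub unfolding arcs_in_def germ_subset_def by (auto elim: eventually_mono)
  have "has_order f q' (arc_image ?\<gamma>)"
    by (rule has_orderI[of 1 1]) (use sub in \<open>auto elim: eventually_mono\<close>)
  then show "order_along f ?\<gamma> = q'"
    using slice_arc_order(3)[OF in\<Lambda>] q_nonneg[OF q'] by simp
qed

lemma order_along_boundary:
  "\<sigma> = 1 \<Longrightarrow> order_along f (arc_of (graph y1)) = qA \<and> order_along f (arc_of (graph y2)) = qB"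
  "\<sigma> = -1 \<Longrightarrow> order_along f (arc_of (graph y1)) = qB \<and> order_along f (arc_of (graph y2)) = qA"
proof -
  have hL: "(u, y1 u) \<in> \<Lambda>" "(u, y2 u) \<in> \<Lambda>" "c * pw \<beta> u \<le> y2 u - y1 u" if "0 \<le> u" "u \<le> 1" for u
  proof -
    have "0 \<le> c * pw \<beta> u" using c pw_nonneg[of \<beta> u] by simp
    then show "(u, y1 u) \<in> \<Lambda>" "(u, y2 u) \<in> \<Lambda>" "c * pw \<beta> u \<le> y2 u - y1 u"
      using height[OF that] that by (auto simp: region_def)
  qed
  have y20: "y2 0 = 0" using height[of 0] y0 by simp
  note c1 = lipschitzian_continuous_on[OF lip(1)] and c2 = lipschitzian_continuous_on[OF lip(2)]
  {
    assume "\<sigma> = 1"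
    then have s: "\<sigma> = 1" "e = y1" using \<sigma> by auto
    have "f (u, y1 u) = epow qA u" "f (u, y2 u) = epow qB u" if u: "0 \<le> u" "u \<le> 1" for u
      using feq[OF hL(1)[OF u]] feq[OF hL(2)[OF u]] hL(3)[OF u] P_value[of u] u by (auto simp: s)
    then show "order_along f (arc_of (graph y1)) = qA \<and> order_along f (arc_of (graph y2)) = qB"
      using order_along_graph(2)[OF dFy(1) c1 y0 q(1)] order_along_graph(2)[OF dFy(2) c2 y20 q(2)] hL by blast
  }
  {
    assume "\<sigma> = -1"
    then have s: "\<sigma> = -1" "e = y2" using \<sigma> by auto
    have "f (u, y1 u) = epow qB u" "f (u, y2 u) = epow qA u" if u: "0 \<le> u" "u \<le> 1" for u
      using feq[OF hL(1)[OF u]] feq[OF hL(2)[OF u]] hL(3)[OF u] P_value[of u] u by (auto simp: s)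
    then show "order_along f (arc_of (graph y1)) = qB \<and> order_along f (arc_of (graph y2)) = qA"
      using order_along_graph(2)[OF dFy(1) c1 y0 q(2)] order_along_graph(2)[OF dFy(2) c2 y20 q(1)] hL by blast
  }
qed

text \<open>The curve of height \<open>c * u powr \<mu> q'\<close> has order \<open>q'\<close>.\<close>

lemma arc_of_order:
  assumes qQ: "q' \<in> Q"
  shows "\<exists>\<gamma>\<in>arcs_in D \<Lambda>. order_along f \<gamma> = q'"
proof -
  define y where "y u = e u + \<sigma> * (c * epow (\<mu> q') u)" for u
  have \<mu>1: "ereal 1 \<le> \<mu> q'" using \<mu>[OF qQ] \<beta>(2) by (meson ereal_less_eq(3) order_trans)
  have de: "dF e" "lipschitzian {0..1} e" "e 0 = 0" using \<sigma> dFy lip y0 height[of 0] by auto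
  have dy: "dF y" unfolding y_def[abs_def] using \<mu>[OF qQ]
    by (intro dF_add dF_mult dF_const_real de dF_epow dF_id) auto
  have cy: "continuous_on {0..1} y" unfolding y_def
    by (intro continuous_intros lipschitzian_continuous_on[OF de(2)] lipschitzian_continuous_on[OF lipschitzian_epow[OF \<mu>1]])
  have yz: "y 0 = 0" by (simp add: y_def de)
  have qo: "q' \<in> orders D" using qQ by (simp add: Q order_interval_def)
  have yL: "(u, y u) \<in> \<Lambda> \<and> f (u, y u) = epow q' u" if u: "0 \<le> u" "u \<le> 1" for u
  proof -
    have "epow (\<mu> q') u \<le> pw \<beta> u" using epow_antimono[of "ereal \<beta>" "\<mu> q'" u] \<mu>[OF qQ] u by simp
    then have "c * epow (\<mu> q') u \<le> c * pw \<beta> u" using c by simp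
    then have "c * epow (\<mu> q') u \<le> y2 u - y1 u" using height[OF u] by linarith
    moreover have "0 \<le> c * epow (\<mu> q') u" using c epow_nonneg[of "\<mu> q'" u] by simp
    ultimately have L: "(u, y u) \<in> \<Lambda>" using \<sigma> u by (auto simp: region_def y_def)
    have "\<sigma> * (y u - e u) = c * epow (\<mu> q') u" using \<sigma> by (auto simp: y_def)
    then have "f (u, y u) = epow q' u" using feq[OF L] P_curve[OF qQ, of u] u by simp
    with L show ?thesis ..
  qed
  show ?thesis using order_along_graph[OF dy cy yz qo yL] by blast
qed

lemma order_set_eq: "order_set D \<Lambda> f = Q"
  unfolding order_set_def using order_in_Q arc_of_order by blast

text \<open>The order on the two boundary arcs is the order on the triangle between them because \<open>f\<close> is monotone on
  vertical segments.\<close>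

lemma elementary: "elementary D \<Lambda> f"
  unfolding elementary_def
proof (intro ballI allI impI)
  fix \<gamma> \<gamma>' T \<theta> assume \<gamma>: "\<gamma> \<in> arcs_in D \<Lambda>" "\<gamma>' \<in> arcs_in D \<Lambda>" "order_along f \<gamma> = order_along f \<gamma>'"
    and T: "subtriangle D \<Lambda> \<gamma> \<gamma>' T" and \<theta>: "\<theta> \<in> arcs_in D T"
  let ?q = "order_along f \<gamma>"
  obtain \<alpha> h where \<alpha>: "\<alpha> \<in> exponents D" "1 \<le> \<alpha>" and TL: "germ_subset T \<Lambda>"
    and h: "inner_bilipschitz_germ D (std_triangle \<alpha>) T h"
    and b1: "germ_eq std_lower {x \<in> std_triangle \<alpha>. h x \<in> arc_image \<gamma>}"
    and b2: "germ_eq (std_upper \<alpha>) {x \<in> std_triangle \<alpha>. h x \<in> arc_image \<gamma>'}"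
    using T unfolding subtriangle_def holder_triangle_between_def by blast
  have "has_order f ?q T"
  proof (rule has_order_of_boundary[OF h \<alpha>(2,1) TL germ_sector vertically_monotone])
    show "has_order f ?q (arc_image \<gamma>)" by (rule slice_arc_order(2)[OF \<gamma>(1)])
    show "has_order f ?q (arc_image \<gamma>')" using slice_arc_order(2)[OF \<gamma>(2)] \<gamma>(3) by simp
    show "\<forall>\<^sub>F x in nhds 0. x \<in> std_lower \<longrightarrow> h x \<in> arc_image \<gamma>" using b1 unfolding germ_eq_def by (auto elim: eventually_mono)
    show "\<forall>\<^sub>F x in nhds 0. x \<in> std_upper \<alpha> \<longrightarrow> h x \<in> arc_image \<gamma>'" using b2 unfolding germ_eq_def by (auto elim: eventually_mono)
  qed
  then have "has_order f ?q (arc_image \<theta>)" by (rule has_order_subset) (use \<theta> in \<open>simp add: arcs_in_def\<close>)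
  then show "order_along f \<theta> = ?q"
    using slice_arc_order(3)[OF arcs_in_mono[OF \<theta> TL]] q_nonneg slice_arc_order(1)[OF \<gamma>(1)] by blast
qed

text \<open>All arcs of the triangle, in particular its boundary arcs, lie in the zone of one order \<open>q\<close>, whose
  height is \<open>O(u powr m)\<close> for every \<open>m \<le> \<mu> q\<close>.\<close>

lemma width_ge:
  assumes \<gamma>: "\<gamma> \<in> arcs_in D \<Lambda>" and T: "holder_triangle D \<alpha> T" "germ_subset T \<Lambda>" "\<gamma> \<in> arcs_in D T"
    and single: "is_singleton (order_set D T f)"
  shows "\<mu> (order_along f \<gamma>) \<le> ereal \<alpha>"
proof -
  let ?q = "order_along f \<gamma>"
  have qQ: "?q \<in> Q" by (rule order_in_Q[OF \<gamma>])
  have ord: "order_along f \<gamma>' = ?q" if "\<gamma>' \<in> arcs_in D T" for \<gamma>'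
    using single that T(3) unfolding order_set_def is_singleton_def by (metis imageI singletonD)
  have Ts: "germ_subset T sector" using T(2) region_sector unfolding germ_subset_def by (auto elim: eventually_mono)
  have *: "m \<le> \<alpha>" if m: "1 \<le> m" "ereal m \<le> \<mu> ?q" for m
  proof (rule holder_exponent_lower_bound[OF T(1) Ts m(1)])
    fix \<gamma>' assume \<gamma>': "\<gamma>' \<in> arcs_in D T"
    have in\<Lambda>: "\<gamma>' \<in> arcs_in D \<Lambda>" by (rule arcs_in_mono[OF \<gamma>' T(2)])
    have "has_order f ?q (arc_image \<gamma>')" using slice_arc_order(2)[OF in\<Lambda>] ord[OF \<gamma>'] by simp
    then obtain c1 c2 where cc: "c1 > 0" "c2 > 0"
      "eventually (\<lambda>x. x \<in> arc_image \<gamma>' \<longrightarrow> c1 * epow ?q (fst x) \<le> f x \<and> f x \<le> c2 * epow ?q (fst x)) (nhds 0)"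
      by (rule has_orderE)
    obtain C where C: "\<forall>u\<in>{0..1}. \<forall>w. 0 \<le> w \<longrightarrow> w \<le> pw \<beta> u \<longrightarrow> c1 * epow ?q u \<le> \<phi> u w \<longrightarrow> \<phi> u w \<le> c2 * epow ?q u \<longrightarrow> w \<le> C * pw m u"
      using profile'[THEN conjunct2, THEN conjunct2, THEN conjunct2, THEN conjunct2, THEN conjunct1] qQ m(2) cc(1,2) by blast
    have "eventually (\<lambda>x. x \<in> arc_image \<gamma>' \<longrightarrow> x \<in> \<Lambda>) (nhds 0)" using in\<Lambda> by (simp add: arcs_in_def germ_subset_def)
    with cc(3) have "eventually (\<lambda>x. x \<in> arc_image \<gamma>' \<longrightarrow> \<bar>snd x - e (fst x)\<bar> \<le> C * pw m (fst x)) (nhds 0)"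
    proof eventually_elim
      case (elim x)
      show ?case
      proof
        assume x: "x \<in> arc_image \<gamma>'"
        then have L: "x \<in> \<Lambda>" using elim by simp
        have "ht x \<le> C * pw m (fst x)" using C ht_bounds[OF L] elim x feq[OF L] by simp
        moreover have "\<bar>snd x - e (fst x)\<bar> = ht x" using ht_bounds[OF L] \<sigma> by auto
        ultimately show "\<bar>snd x - e (fst x)\<bar> \<le> C * pw m (fst x)" by simp
      qed
    qed
    then show "\<exists>C. eventually (\<lambda>x. x \<in> arc_image \<gamma>' \<longrightarrow> \<bar>snd x - e (fst x)\<bar> \<le> C * pw m (fst x)) (nhds 0)" by blast
  qed
  show ?thesis
  proof (cases "\<mu> ?q")
    case (real m)
    then have "1 \<le> m" using \<mu>[OF qQ] \<beta>(2) by simp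
    then show ?thesis using *[of m] real by simp
  next
    case PInf
    then show ?thesis using *[of "max 1 (\<alpha> + 1)"] by simp
  next
    case MInf
    then show ?thesis by simp
  qed
qed

text \<open>The triangle is the zone of the order of \<open>f\<close> along \<open>\<gamma>\<close>. At an extreme value of the width the zone reaches the
  corresponding boundary curve of the slice; otherwise it is cut out by two multiples of \<open>u powr m\<close>.\<close>

lemma width_le:
  assumes \<gamma>: "\<gamma> \<in> arcs_in D \<Lambda>" and m: "\<mu> (order_along f \<gamma>) = ereal m"
  shows "\<exists>T. holder_triangle D m T \<and> germ_subset T \<Lambda> \<and> \<gamma> \<in> arcs_in D T \<and> order_set D T f = {order_along f \<gamma>}"
proof -
  let ?q = "order_along f \<gamma>"
  have qQ: "?q \<in> Q" by (rule order_in_Q[OF \<gamma>])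
  have mD: "m \<in> exponents D" "\<beta> \<le> m" "1 \<le> m" using \<mu>[OF qQ] m \<beta>(2) by auto
  have arc: "arc_germ D \<gamma>" and sub: "eventually (\<lambda>x. x \<in> arc_image \<gamma> \<longrightarrow> x \<in> \<Lambda>) (nhds 0)"
    using \<gamma> by (auto simp: arcs_in_def germ_subset_def)
  from slice_arc_order(2)[OF \<gamma>] obtain c1 c2 where cc: "c1 > 0" "c2 > 0"
    "eventually (\<lambda>x. x \<in> arc_image \<gamma> \<longrightarrow> c1 * epow ?q (fst x) \<le> f x \<and> f x \<le> c2 * epow ?q (fst x)) (nhds 0)"
    by (rule has_orderE)
  obtain \<rho>1 d E d1 d2 where \<rho>1: "\<rho>1 > 0" and d: "d > 0" "d \<le> c / 2" "2 * d \<le> E" and d12: "d1 > 0" "d2 > 0"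
    and Z1: "\<forall>u w. 0 < u \<longrightarrow> u < \<rho>1 \<longrightarrow> 0 \<le> w \<longrightarrow> w \<le> pw \<beta> u \<longrightarrow> c1 * epow ?q u \<le> \<phi> u w \<longrightarrow> \<phi> u w \<le> c2 * epow ?q u \<longrightarrow>
          (\<mu> qA \<noteq> ereal m \<longrightarrow> d * pw m u \<le> w) \<and> (m \<noteq> \<beta> \<longrightarrow> w \<le> E * pw m u)"
    and Z2: "\<forall>u w. 0 < u \<longrightarrow> u < \<rho>1 \<longrightarrow> 0 \<le> w \<longrightarrow> w \<le> pw \<beta> u \<longrightarrow> (\<mu> qA \<noteq> ereal m \<longrightarrow> d * pw m u \<le> w) \<longrightarrow>
          (m \<noteq> \<beta> \<longrightarrow> w \<le> E * pw m u) \<longrightarrow> d1 * epow ?q u \<le> \<phi> u w \<and> \<phi> u w \<le> d2 * epow ?q u"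
  proof -
    have "\<exists>\<rho>>0. \<exists>d>0. \<exists>e. d \<le> c / 2 \<and> 2 * d \<le> e \<and>
       (\<forall>u w. 0 < u \<longrightarrow> u < \<rho> \<longrightarrow> 0 \<le> w \<longrightarrow> w \<le> pw \<beta> u \<longrightarrow>
          c1 * epow ?q u \<le> \<phi> u w \<longrightarrow> \<phi> u w \<le> c2 * epow ?q u \<longrightarrow>
          (\<mu> qA \<noteq> ereal m \<longrightarrow> d * pw m u \<le> w) \<and> (m \<noteq> \<beta> \<longrightarrow> w \<le> e * pw m u)) \<and>
       (\<exists>d1>0. \<exists>d2>0. \<forall>u w. 0 < u \<longrightarrow> u < \<rho> \<longrightarrow> 0 \<le> w \<longrightarrow> w \<le> pw \<beta> u \<longrightarrow>
          (\<mu> qA \<noteq> ereal m \<longrightarrow> d * pw m u \<le> w) \<longrightarrow> (m \<noteq> \<beta> \<longrightarrow> w \<le> e * pw m u) \<longrightarrow>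
          d1 * epow ?q u \<le> \<phi> u w \<and> \<phi> u w \<le> d2 * epow ?q u)"
      by (rule P_zone[OF qQ m cc(1,2)])
    then show thesis by (elim exE conjE) (rule that, assumption+)
  qed
  note Z1 = Z1[rule_format] and Z2 = Z2[rule_format]
  have E: "E > 0" using d by linarith
  obtain \<rho>2 where \<rho>2: "\<rho>2 > 0" "\<And>u. 0 < u \<Longrightarrow> u < \<rho>2 \<Longrightarrow> m \<noteq> \<beta> \<Longrightarrow> E * pw m u \<le> c * pw \<beta> u"
  proof (cases "m = \<beta>")
    case True then show ?thesis using that[of 1] by simp
  next
    case False
    then have "ereal \<beta> < ereal m" using mD by simp
    moreover have "0 < c / E" using c E by simp
    ultimately have "\<exists>\<rho>>0. \<forall>u. 0 < u \<longrightarrow> u < \<rho> \<longrightarrow> epow (ereal m) u < c / E * pw \<beta> u" by (rule epow_less_pw)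
    then obtain \<rho> where "\<rho> > 0" "\<And>u. 0 < u \<Longrightarrow> u < \<rho> \<Longrightarrow> pw m u < c / E * pw \<beta> u" by auto
    then show ?thesis using that[of \<rho>] E by (simp add: field_simps less_imp_le)
  qed
  define \<rho> where "\<rho> = min 1 (min \<rho>1 \<rho>2) / 2"
  have \<rho>: "0 < \<rho>" "\<rho> \<le> 1" "\<rho> < \<rho>1" "\<rho> < \<rho>2" using \<rho>1 \<rho>2(1) by (auto simp: \<rho>_def)
  define lo where "lo u = (if \<mu> qA = ereal m then 0 else d * pw m u)" for u
  define hi where "hi u = (if m = \<beta> then y2 u - y1 u else E * pw m u)" for u
  have lohi: "0 \<le> lo u" "hi u \<le> y2 u - y1 u" "min d (c / 2) * pw m u \<le> hi u - lo u" "hi u - lo u \<le> (E + 1) * pw m u"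
    if u: "0 \<le> u" "u \<le> \<rho>" for u
  proof -
    have h: "c * pw \<beta> u \<le> y2 u - y1 u" "y2 u - y1 u \<le> pw \<beta> u" using height[of u] u \<rho> by auto
    have pm: "0 \<le> pw m u" by (rule pw_nonneg)
    show "0 \<le> lo u" using d pm by (simp add: lo_def)
    have lod: "lo u \<le> d * pw m u" using d pm by (simp add: lo_def)
    show "hi u \<le> y2 u - y1 u"
    proof (cases "u = 0 \<or> m = \<beta>")
      case True then show ?thesis using h by (auto simp: hi_def)
    next
      case False
      then show ?thesis using \<rho>2(2)[of u] h u \<rho> by (auto simp: hi_def)
    qed
    have Edp: "d * pw m u \<le> (E - d) * pw m u" using d pm by (intro mult_right_mono) auto
    show "min d (c / 2) * pw m u \<le> hi u - lo u"
    proof (cases "m = \<beta>")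
      case True
      have "d * pw m u \<le> c / 2 * pw m u" using d pm by (intro mult_right_mono) auto
      moreover have "min d (c / 2) * pw m u \<le> c / 2 * pw m u" using pm by (intro mult_right_mono) auto
      ultimately show ?thesis using h(1) lod True by (simp add: hi_def)
    next
      case False
      have "min d (c / 2) * pw m u \<le> d * pw m u" using pm by (intro mult_right_mono) auto
      also note Edp
      finally show ?thesis using lod False by (simp add: hi_def left_diff_distrib)
    qed
    have "hi u \<le> (E + 1) * pw m u"
    proof (cases "m = \<beta>")
      case True
      have "1 * pw m u \<le> (E + 1) * pw m u" using E pm by (intro mult_right_mono) auto
      then show ?thesis using h(2) True by (simp add: hi_def)
    next
      case False
      then show ?thesis using pm by (simp add: hi_def distrib_right)
    qed
    then show "hi u - lo u \<le> (E + 1) * pw m u" using \<open>0 \<le> lo u\<close> by linarith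
  qed
  have lpw: "lipschitzian {0..\<rho>} (pw m)" using lipschitzian_pw[OF mD(3)] by (rule lipschitzian_subset) (use \<rho> in auto)
  have ly: "lipschitzian {0..\<rho>} y1" "lipschitzian {0..\<rho>} y2"
    using lip[THEN lipschitzian_subset, of "{0..\<rho>}"] \<rho> by auto
  have dlo: "dF lo" unfolding lo_def[abs_def] by (cases "\<mu> qA = ereal m") (auto intro!: dF_arith dF_pw mD)
  have llo: "lipschitzian {0..\<rho>} lo" unfolding lo_def[abs_def] by (cases "\<mu> qA = ereal m") (auto intro!: lipschitzian_intros lpw)
  have dhi: "dF hi" unfolding hi_def[abs_def] by (cases "m = \<beta>") (auto intro!: dF_arith dF_pw mD dFy)
  have lhi: "lipschitzian {0..\<rho>} hi" unfolding hi_def[abs_def] by (cases "m = \<beta>") (auto intro!: lipschitzian_intros lpw ly)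
  have de: "dF e" "lipschitzian {0..\<rho>} e" "e 0 = 0" using \<sigma> dFy ly y0 height[of 0] by auto
  define z1 where "z1 u = (if \<sigma> = 1 then e u + lo u else e u - hi u)" for u
  define z2 where "z2 u = (if \<sigma> = 1 then e u + hi u else e u - lo u)" for u
  let ?T = "region \<rho> z1 z2"
  have dz: "dF z1" "dF z2" unfolding z1_def[abs_def] z2_def[abs_def] by (cases "\<sigma> = 1"; auto intro!: dF_arith de dlo dhi)+
  have lz: "lipschitzian {0..\<rho>} z1" "lipschitzian {0..\<rho>} z2"
    unfolding z1_def[abs_def] z2_def[abs_def] by (cases "\<sigma> = 1"; auto intro!: lipschitzian_intros de llo lhi)+
  have zz: "min d (c / 2) * pw m u \<le> z2 u - z1 u \<and> z2 u - z1 u \<le> (E + 1) * pw m u" if "0 \<le> u" "u \<le> \<rho>" for u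
    using lohi[OF that] by (auto simp: z1_def z2_def)
  have lohi0: "lo 0 = 0" "hi 0 = 0" using height[of 0] by (auto simp: lo_def hi_def)
  have z0: "z1 0 = 0" using lohi0 de by (simp add: z1_def)
  have mp: "0 < min d (c / 2)" using d c by simp
  have hT: "holder_triangle D m ?T"
    by (rule region_holder_triangle(1)[OF mD(1,3) \<rho>(1,2) dz lz mp zz z0])
  have Tiff: "p \<in> ?T \<longleftrightarrow> 0 \<le> fst p \<and> fst p \<le> \<rho> \<and> lo (fst p) \<le> ht p \<and> ht p \<le> hi (fst p)" for p
    using \<sigma> by (auto simp: region_def z1_def z2_def case_prod_unfold)
  have TL: "p \<in> \<Lambda>" if "p \<in> ?T" for p
  proof -
    have p: "0 \<le> fst p" "fst p \<le> \<rho>" "lo (fst p) \<le> ht p" "ht p \<le> hi (fst p)" using that Tiff by auto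
    then have "0 \<le> ht p" "ht p \<le> y2 (fst p) - y1 (fst p)" using lohi[of "fst p"] by auto
    then show ?thesis using \<sigma> p \<rho> by (auto simp: region_def case_prod_unfold)
  qed
  have gTL: "germ_subset ?T \<Lambda>" using TL unfolding germ_subset_def by (intro always_eventually) blast
  have hoT: "has_order f ?q ?T"
  proof (rule has_orderI[OF d12], intro always_eventually allI impI)
    fix x assume x: "x \<in> ?T"
    have L: "x \<in> \<Lambda>" by (rule TL[OF x])
    show "d1 * epow ?q (fst x) \<le> f x \<and> f x \<le> d2 * epow ?q (fst x)"
    proof (cases "fst x = 0")
      case True
      then have "x = 0" using L y0 height[of 0] by (auto simp: region_def prod_eq_iff)
      then show ?thesis by (simp add: f0)
    next
      case False
      have t: "0 \<le> fst x" "fst x \<le> \<rho>" "lo (fst x) \<le> ht x" "ht x \<le> hi (fst x)" using x Tiff by auto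
      have "d1 * epow ?q (fst x) \<le> \<phi> (fst x) (ht x) \<and> \<phi> (fst x) (ht x) \<le> d2 * epow ?q (fst x)"
        using t False \<rho> ht_bounds[OF L] by (intro Z2) (auto simp: lo_def hi_def split: if_splits)
      then show ?thesis using feq[OF L] by simp
    qed
  qed
  have gT: "\<gamma> \<in> arcs_in D ?T"
  proof -
    have "eventually (\<lambda>x :: real \<times> real. norm x < \<rho>) (nhds 0)" unfolding eventually_nhds_0 using \<rho>(1) by (intro exI[of _ \<rho>]) simp
    with cc(3) sub have "eventually (\<lambda>x. x \<in> arc_image \<gamma> \<longrightarrow> x \<in> ?T) (nhds 0)"
    proof eventually_elim
      case (elim x)
      show ?case
      proof
        assume x: "x \<in> arc_image \<gamma>"
        have L: "x \<in> \<Lambda>" using elim x by simp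
        have "norm (fst x) \<le> norm x" by (metis norm_fst_le prod.collapse)
        then have u: "0 \<le> fst x" "fst x < \<rho>" using elim ht_bounds[OF L] by auto
        show "x \<in> ?T"
        proof (cases "fst x = 0")
          case True
          then have "x = 0" using L y0 height[of 0] by (auto simp: region_def prod_eq_iff)
          then show ?thesis unfolding Tiff using \<rho> lohi0 de by simp
        next
          case False
          have f\<phi>: "c1 * epow ?q (fst x) \<le> \<phi> (fst x) (ht x)" "\<phi> (fst x) (ht x) \<le> c2 * epow ?q (fst x)"
            using elim(1) x unfolding feq[OF L] by blast+
          have "0 < fst x" "fst x < \<rho>1" using False u \<rho> by auto
          then have "(\<mu> qA \<noteq> ereal m \<longrightarrow> d * pw m (fst x) \<le> ht x) \<and> (m \<noteq> \<beta> \<longrightarrow> ht x \<le> E * pw m (fst x))"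
            using ht_bounds[OF L] f\<phi> by (intro Z1) blast+
          moreover have "ht x \<le> y2 (fst x) - y1 (fst x)" using L \<sigma> by (auto simp: region_def)
          ultimately have "lo (fst x) \<le> ht x \<and> ht x \<le> hi (fst x)"
            using ht_bounds[OF L] unfolding lo_def hi_def by (cases "\<mu> qA = ereal m"; cases "m = \<beta>") simp_all
          then show ?thesis unfolding Tiff using u by simp
        qed
      qed
    qed
    then show ?thesis using arc by (simp add: arcs_in_def germ_subset_def)
  qed
  have "order_along f \<theta> = ?q" if \<theta>: "\<theta> \<in> arcs_in D ?T" for \<theta>
  proof -
    have "has_order f ?q (arc_image \<theta>)" by (rule has_order_subset[OF hoT]) (use \<theta> in \<open>simp add: arcs_in_def\<close>)
    then show ?thesis
      by (rule slice_arc_order(3)[OF arcs_in_mono[OF \<theta> gTL] conjunct1[OF q_nonneg[OF slice_arc_order(1)[OF \<gamma>]]]])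
  qed
  then have "order_set D ?T f \<subseteq> {?q}" unfolding order_set_def by (intro image_subsetI) (simp only: singletonI)
  moreover have "?q \<in> order_set D ?T f" unfolding order_set_def using gT by (rule imageI)
  ultimately have "order_set D ?T f = {?q}" by blast
  then show ?thesis using hT gTL gT by blast
qed

lemma width_function: "width_function D \<Lambda> f \<mu>"
  unfolding width_function_def
proof
  fix \<gamma> assume \<gamma>: "\<gamma> \<in> arcs_in D \<Lambda>"
  show "arc_width D \<Lambda> f \<gamma> = \<mu> (order_along f \<gamma>)"
    unfolding arc_width_def
  proof (rule antisym)
    show "\<mu> (order_along f \<gamma>) \<le> Inf {ereal \<alpha> |\<alpha> T'. holder_triangle D \<alpha> T' \<and> germ_subset T' \<Lambda> \<and> \<gamma> \<in> arcs_in D T' \<and>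
      is_singleton (order_set D T' f)}"
      by (rule Inf_greatest) (auto intro: width_ge[OF \<gamma>])
    show "Inf {ereal \<alpha> |\<alpha> T'. holder_triangle D \<alpha> T' \<and> germ_subset T' \<Lambda> \<and> \<gamma> \<in> arcs_in D T' \<and>
      is_singleton (order_set D T' f)} \<le> \<mu> (order_along f \<gamma>)"
    proof (cases "\<mu> (order_along f \<gamma>)")
      case (real m)
      then obtain T where "holder_triangle D m T" "germ_subset T \<Lambda>" "\<gamma> \<in> arcs_in D T" "order_set D T f = {order_along f \<gamma>}"
        using width_le[OF \<gamma>] by blast
      then have "ereal m \<in> {ereal \<alpha> |\<alpha> T'. holder_triangle D \<alpha> T' \<and> germ_subset T' \<Lambda> \<and> \<gamma> \<in> arcs_in D T' \<and>
          is_singleton (order_set D T' f)}" by auto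
      then show ?thesis unfolding real by (rule Inf_lower)
    next
      case MInf
      then show ?thesis using \<mu>[OF order_in_Q[OF \<gamma>]] by simp
    qed simp
  qed
qed

end

section \<open>Stacking the slices\<close>

text \<open>The slices are stacked on top of each other in the standard triangle. Slice \<open>l\<close> has height
  \<open>u powr (b l) / p\<close>, except for a slice \<open>l0\<close> of smallest exponent, which takes what is left.\<close>

definition slice_curve :: "(nat \<Rightarrow> real) \<Rightarrow> nat \<Rightarrow> nat \<Rightarrow> nat \<Rightarrow> real \<Rightarrow> real" where
  "slice_curve b p l0 l u =
    (if l < l0 then \<Sum>k\<in>{1..l}. 1 / real p * pw (b k) u
     else pw (b l0) u - (\<Sum>k\<in>{Suc l..p}. 1 / real p * pw (b k) u))"

context
  fixes b :: "nat \<Rightarrow> real" and p l0 :: nat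
  assumes l0: "l0 \<in> {1..p}" and bmin: "\<And>k. k \<in> {1..p} \<Longrightarrow> b l0 \<le> b k" and b1: "1 \<le> b l0"
begin

lemma slice_curve_0: "slice_curve b p l0 0 = (\<lambda>u. 0)"
  using l0 by (auto simp: slice_curve_def)

lemma slice_curve_p: "slice_curve b p l0 p = pw (b l0)"
  using l0 by (auto simp: slice_curve_def)

lemma slice_curve_at_0: "slice_curve b p l0 l 0 = 0"
  by (simp add: slice_curve_def)

lemma slice_curve_height:
  assumes l: "l \<in> {1..p}" and u: "0 \<le> u" "u \<le> 1"
  shows "1 / real p * pw (b l) u \<le> slice_curve b p l0 l u - slice_curve b p l0 (l - 1) u"
    "slice_curve b p l0 l u - slice_curve b p l0 (l - 1) u \<le> pw (b l) u"
proof -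
  let ?Y = "slice_curve b p l0" and ?t = "\<lambda>k. 1 / real p * pw (b k) u"
  have p: "real p \<ge> 1" using l by auto
  have t0: "0 \<le> ?t k" for k using pw_nonneg[of "b k" u] by simp
  have tle: "?t k \<le> pw (b k) u" for k using p pw_nonneg[of "b k" u] by (intro mult_left_le_one_le) (auto simp: divide_le_eq)
  have tmax: "?t k \<le> 1 / real p * pw (b l0) u" if "k \<in> {1..p}" for k
    using bmin[OF that] u by (intro mult_left_mono pw_antimono_exp) auto
  consider "l < l0" | "l > l0" | "l = l0" by linarith
  then have "?t l \<le> ?Y l u - ?Y (l - 1) u \<and> ?Y l u - ?Y (l - 1) u \<le> pw (b l) u"
  proof cases
    case 1
    obtain l' where l': "l = Suc l'" using l by (cases l) auto
    then have "?Y l u - ?Y (l - 1) u = ?t l" using 1 by (simp add: slice_curve_def)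
    then show ?thesis using tle by simp
  next
    case 2
    have "(\<Sum>k\<in>{l..p}. ?t k) = ?t l + (\<Sum>k\<in>{Suc l..p}. ?t k)" using l by (intro sum.atLeast_Suc_atMost) simp
    moreover have "Suc (l - 1) = l" "\<not> l - 1 < l0" "\<not> l < l0" using l 2 by auto
    ultimately have "?Y l u - ?Y (l - 1) u = ?t l" by (simp only: slice_curve_def if_False)
    then show ?thesis using tle by simp
  next
    case 3
    \<comment> \<open>The other \<open>p - 1\<close> slices have total height at most \<open>(p - 1) / p * u powr (b l0)\<close>.\<close>
    have eq: "?Y l u - ?Y (l - 1) u = pw (b l0) u - (\<Sum>k\<in>{Suc l0..p}. ?t k) - (\<Sum>k\<in>{1..l0 - 1}. ?t k)"
      using l0 3 by (simp add: slice_curve_def)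
    have s1: "(\<Sum>k\<in>{Suc l0..p}. ?t k) \<le> of_nat (card {Suc l0..p}) * (1 / real p * pw (b l0) u)"
      by (rule sum_bounded_above, rule tmax) simp
    have s2: "(\<Sum>k\<in>{1..l0 - 1}. ?t k) \<le> of_nat (card {1..l0 - 1}) * (1 / real p * pw (b l0) u)"
      by (rule sum_bounded_above, rule tmax) (use l0 in auto)
    have cd: "real (card {Suc l0..p}) + real (card {1..l0 - 1}) = real p - 1" using l0 by auto
    have "(\<Sum>k\<in>{Suc l0..p}. ?t k) + (\<Sum>k\<in>{1..l0 - 1}. ?t k) \<le>
        (real (card {Suc l0..p}) + real (card {1..l0 - 1})) * (1 / real p * pw (b l0) u)"
      using s1 s2 by (simp only: distrib_right)
    also have "\<dots> = pw (b l0) u - ?t l0" unfolding cd using p by (simp add: field_simps)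
    finally have "?t l0 \<le> ?Y l u - ?Y (l - 1) u" unfolding eq by linarith
    moreover have "0 \<le> (\<Sum>k\<in>{Suc l0..p}. ?t k)" "0 \<le> (\<Sum>k\<in>{1..l0 - 1}. ?t k)"
      by (rule sum_nonneg[OF t0])+
    then have "?Y l u - ?Y (l - 1) u \<le> pw (b l0) u" unfolding eq by linarith
    ultimately show ?thesis using 3 by metis
  qed
  then show "1 / real p * pw (b l) u \<le> slice_curve b p l0 l u - slice_curve b p l0 (l - 1) u"
    "slice_curve b p l0 l u - slice_curve b p l0 (l - 1) u \<le> pw (b l) u" by auto
qed

lemma slice_curve_mono:
  assumes "i \<le> j" "j \<le> p" "0 \<le> u" "u \<le> 1"
  shows "slice_curve b p l0 i u \<le> slice_curve b p l0 j u"
  using assms(1,2)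
proof (induction j rule: dec_induct)
  case (step n)
  have "1 / real p * pw (b (Suc n)) u \<le> slice_curve b p l0 (Suc n) u - slice_curve b p l0 n u"
    using slice_curve_height(1)[of "Suc n" u] step assms by simp
  moreover have "0 \<le> 1 / real p * pw (b (Suc n)) u" using pw_nonneg by simp
  ultimately show ?case using step by simp
qed simp

lemma slice_curve_strict_mono:
  assumes "i < j" "j \<le> p" "0 < u" "u \<le> 1"
  shows "slice_curve b p l0 i u < slice_curve b p l0 j u"
proof -
  have "0 < 1 / real p * pw (b j) u" using assms pw_pos by simp
  also have "\<dots> \<le> slice_curve b p l0 j u - slice_curve b p l0 (j - 1) u"
    using assms by (intro slice_curve_height) auto
  finally have "slice_curve b p l0 (j - 1) u < slice_curve b p l0 j u" by simp
  moreover have "slice_curve b p l0 i u \<le> slice_curve b p l0 (j - 1) u"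
    using assms by (intro slice_curve_mono) auto
  ultimately show ?thesis by simp
qed

lemma slice_curve_bounds:
  assumes "l \<le> p" "0 \<le> u" "u \<le> 1"
  shows "0 \<le> slice_curve b p l0 l u \<and> slice_curve b p l0 l u \<le> pw (b l0) u"
  using slice_curve_mono[of 0 l u] slice_curve_mono[of l p u] assms
  by (simp add: slice_curve_0 slice_curve_p)

lemma in_some_slice:
  assumes "0 \<le> u" "u \<le> 1" "0 \<le> v" "v \<le> pw (b l0) u"
  shows "\<exists>l\<in>{1..p}. slice_curve b p l0 (l - 1) u \<le> v \<and> v \<le> slice_curve b p l0 l u"
proof -
  define n where "n = (LEAST l. 1 \<le> l \<and> v \<le> slice_curve b p l0 l u)"
  have ex: "1 \<le> p \<and> v \<le> slice_curve b p l0 p u" using assms l0 by (simp add: slice_curve_p)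
  then have n: "1 \<le> n" "v \<le> slice_curve b p l0 n u"
    using LeastI[of "\<lambda>l. 1 \<le> l \<and> v \<le> slice_curve b p l0 l u" p] by (auto simp: n_def)
  have np: "n \<le> p" unfolding n_def by (rule Least_le) (rule ex)
  have "slice_curve b p l0 (n - 1) u \<le> v"
  proof (cases "n = 1")
    case True
    then show ?thesis using assms by (simp add: slice_curve_0)
  next
    case False
    then have "\<not> (1 \<le> n - 1 \<and> v \<le> slice_curve b p l0 (n - 1) u)"
      using not_less_Least[of "n - 1" "\<lambda>l. 1 \<le> l \<and> v \<le> slice_curve b p l0 l u"] n unfolding n_def[symmetric] by auto
    then show ?thesis using False n by auto
  qed
  then show ?thesis using n np by auto
qed

lemma lipschitzian_slice_curve: "lipschitzian {0..1} (slice_curve b p l0 l)" if "l \<le> p"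
proof -
  have 1: "1 \<le> b k" if "k \<in> {1..p}" for k using bmin[OF that] b1 by linarith
  show ?thesis
  proof (cases "l < l0")
    case True
    have "lipschitzian {0..1} (\<lambda>u. \<Sum>k\<in>{1..l}. 1 / real p * pw (b k) u)"
      using that by (intro lipschitzian_sum lipschitzian_cmult lipschitzian_pw 1) auto
    then show ?thesis using True by (simp add: slice_curve_def[abs_def])
  next
    case False
    have "lipschitzian {0..1} (\<lambda>u. pw (b l0) u - (\<Sum>k\<in>{Suc l..p}. 1 / real p * pw (b k) u))"
      by (intro lipschitzian_diff lipschitzian_sum lipschitzian_cmult lipschitzian_pw 1 b1) auto
    then show ?thesis using False by (simp add: slice_curve_def[abs_def])
  qed
qed

end

lemma (in o_minimal_structure) dF_slice_curve:
  assumes "\<And>k. k \<in> {1..p} \<Longrightarrow> b k \<in> exponents D" "l0 \<in> {1..p}" "l \<le> p"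
  shows "dF (slice_curve b p l0 l)"
proof (cases "l < l0")
  case True
  have "dF (\<lambda>u. \<Sum>k\<in>{1..l}. 1 / real p * pw (b k) u)"
    using assms by (intro dF_sum dF_mult dF_const_real dF_pw dF_id) auto
  then show ?thesis using True by (simp add: slice_curve_def[abs_def])
next
  case False
  have "dF (\<lambda>u. pw (b l0) u - (\<Sum>k\<in>{Suc l..p}. 1 / real p * pw (b k) u))"
    using assms by (intro dF_diff dF_sum dF_mult dF_const_real dF_pw dF_id) auto
  then show ?thesis using False by (simp add: slice_curve_def[abs_def])
qed

text \<open>For the functions of one slice each, continued by their boundary values \<open>E (k - 1)\<close> below and
  \<open>E k\<close> above the slice: on slice \<open>l\<close> the sum telescopes to the function of that slice.\<close>

lemma telescoping_step:
  fixes E F :: "nat \<Rightarrow> real"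
  assumes "l \<in> {1..p}" "\<And>k. k \<in> {1..<l} \<Longrightarrow> F k = E k" "\<And>k. k \<in> {Suc l..p} \<Longrightarrow> F k = E (k - 1)"
  shows "E 0 + (\<Sum>k\<in>{1..p}. F k - E (k - 1)) = F l"
  using assms
proof (induction p)
  case (Suc p)
  have lower: "E 0 + (\<Sum>k\<in>{1..n}. F k - E (k - 1)) = E n" if "\<And>k. k \<in> {1..n} \<Longrightarrow> F k = E k" for n
    using that by (induction n) auto
  show ?case
  proof (cases "l = Suc p")
    case True
    then have "E 0 + (\<Sum>k\<in>{1..p}. F k - E (k - 1)) = E p" using Suc.prems by (intro lower) auto
    then show ?thesis using True by simp
  next
    case False
    then have "E 0 + (\<Sum>k\<in>{1..p}. F k - E (k - 1)) = F l" using Suc by auto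
    moreover have "F (Suc p) = E p" using Suc.prems(3)[of "Suc p"] Suc.prems(1) False by auto
    ultimately show ?thesis by simp
  qed
qed simp

lemma (in o_minimal_structure) holder_triangle_between_std:
  assumes \<beta>: "\<beta> \<in> exponents D" "1 \<le> \<beta>"
  shows "holder_triangle_between D \<beta> (std_triangle \<beta>) (arc_of std_lower) (arc_of (std_upper \<beta>))"
proof -
  let ?T = "std_triangle \<beta>"
  have g1: "arc_germ D (arc_of std_lower)" "germ_eq (arc_image (arc_of std_lower)) std_lower"
    unfolding std_lower_graph by (rule graph_arc[OF dF_const_real continuous_on_const refl zero_less_one])+
  have g2: "arc_germ D (arc_of (std_upper \<beta>))" "germ_eq (arc_image (arc_of (std_upper \<beta>))) (std_upper \<beta>)"
    unfolding std_upper_graph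
    by (rule graph_arc[OF dF_pw[OF \<beta>(1) dF_id] continuous_on_pw[OF \<beta>(2) order_refl] pw_0 zero_less_one])+
  have dT: "dP (\<lambda>x. x \<in> ?T)" unfolding std_triangle_pw by (intro dP_intros dF_pw \<beta> dF_arith)
  have id: "inner_bilipschitz_germ D ?T ?T (\<lambda>x. x)"
    unfolding inner_bilipschitz_germ_def
  proof (intro conjI exI[of _ UNIV] exI[of _ "\<lambda>x. x"] exI[of _ "1::real"] ballI)
    show "definable_on D (?T \<inter> UNIV) (\<lambda>x. x)" using dT by (intro definable_onI dF_id) simp
    show "homeomorphism (?T \<inter> UNIV) (?T \<inter> UNIV) (\<lambda>x. x) (\<lambda>x. x)" by (rule homeomorphism_ident)
  qed (auto simp: std_triangle_pw)
  have e1: "germ_eq std_lower {x \<in> ?T. x \<in> arc_image (arc_of std_lower)}"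
    using g1(2) std_boundary_subset(1)[of \<beta>] unfolding germ_eq_def by (auto elim!: eventually_mono)
  have e2: "germ_eq (std_upper \<beta>) {x \<in> ?T. x \<in> arc_image (arc_of (std_upper \<beta>))}"
    using g2(2) std_boundary_subset(2)[of \<beta>] unfolding germ_eq_def by (auto elim!: eventually_mono)
  show ?thesis unfolding holder_triangle_between_def
    using \<beta> g1(1) g2(1) id e1 e2 by blast
qed

lemma germ_eqI_small: "(\<And>x. norm x < 1 \<Longrightarrow> x \<in> A \<longleftrightarrow> x \<in> B) \<Longrightarrow> germ_eq A B"
  unfolding germ_eq_def eventually_nhds_0 by (intro exI[of _ 1]) auto

lemma germ_eq_trans: "germ_eq A B \<Longrightarrow> germ_eq B C \<Longrightarrow> germ_eq A C"
  unfolding germ_eq_def by (auto elim: eventually_elim2)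

lemma germ_eq_sym: "germ_eq A B \<Longrightarrow> germ_eq B A"
  unfolding germ_eq_def by (auto elim: eventually_mono)

theorem theorem2p28:
  fixes D :: "nat \<Rightarrow> real list set set" and P :: abstract_pizza and \<beta> :: real
  assumes "polynomially_bounded_structure D"
    and "is_abstract_pizza D P"
    and "\<beta> = Min (pz_beta P ` {1..pz_len P})"
  shows "\<exists>(f :: real \<times> real \<Rightarrow> real) lam \<Lambda>.
    nonneg_lipschitz_germ D (std_triangle \<beta>) f \<and>
    pizza D (std_triangle \<beta>) (arc_of std_lower) (arc_of (std_upper \<beta>)) f (pz_len P) lam \<Lambda> \<and>
    corresponding_abstract_pizza D f (pz_len P) lam \<Lambda> P"
proof -
  interpret polynomially_bounded_structure D by (rule assms(1))
  define p b q where "p = pz_len P" and "b = pz_beta P" and "q = pz_q P"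
  have p: "1 \<le> p" and qo: "\<And>l. l \<le> p \<Longrightarrow> q l \<in> orders D"
    and sl: "\<And>l. l \<in> {1..p} \<Longrightarrow> b l \<in> exponents D \<and> 1 \<le> b l \<and>
      pz_Q P l = order_interval D (q (l - 1)) (q l) \<and>
      pz_mu P l ` pz_Q P l \<subseteq> ereal ` exponents D \<union> {\<infinity>} \<and>
      ereal_affine_on (pz_Q P l) (pz_mu P l) \<and>
      (\<not> is_singleton (pz_Q P l) \<longrightarrow> \<not> pz_mu P l constant_on pz_Q P l) \<and>
      (\<forall>q\<in>pz_Q P l. pz_mu P l q \<le> q) \<and>
      ereal (b l) \<in> pz_mu P l ` pz_Q P l \<and>
      (\<forall>q\<in>pz_Q P l. ereal (b l) \<le> pz_mu P l q)"
    and nu: "pizza_nu P"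
    using assms(2) unfolding is_abstract_pizza_def p_def b_def q_def by blast+
  have fin: "finite (b ` {1..p})" "b ` {1..p} \<noteq> {}" using p by auto
  have \<beta>Min: "\<beta> = Min (b ` {1..p})" using assms(3) by (simp add: p_def b_def)
  then obtain l0 where l0: "l0 \<in> {1..p}" "b l0 = \<beta>" using Min_in[OF fin] by (metis imageE)
  have bmin: "b l0 \<le> b k" if "k \<in> {1..p}" for k using fin that by (simp add: l0 \<beta>Min)
  have b1: "1 \<le> b l0" and bD: "b l0 \<in> exponents D" using sl[OF l0(1)] by auto
  note curve = l0(1) bmin b1
  define Y where "Y = slice_curve b p l0"
  define c where "c = 1 / real p"
  have c: "0 < c" using p by (simp add: c_def)
  have Y0: "Y 0 = (\<lambda>u. 0)" unfolding Y_def by (rule slice_curve_0[of l0 p b, OF curve])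
  have Yp: "Y p = pw \<beta>" unfolding Y_def using slice_curve_p[of l0 p b, OF curve] l0(2) by simp
  have Y_0: "Y l 0 = 0" for l unfolding Y_def by (rule slice_curve_at_0[of l0 p b, OF curve])
  have dY: "dF (Y l)" "lipschitzian {0..1} (Y l)" if "l \<le> p" for l
    unfolding Y_def using sl that by (auto intro!: dF_slice_curve lipschitzian_slice_curve[of l0 p b, OF curve] l0(1))
  have Yb: "0 \<le> Y l u \<and> Y l u \<le> pw \<beta> u \<and> Y l u \<le> u" if "l \<le> p" "0 \<le> u" "u \<le> 1" for l u
    using slice_curve_bounds[of l0 p b, OF curve that] pw_le_id[OF that(2,3) b1] unfolding Y_def by (simp add: l0(2))
  have Yh: "c * pw (b l) u \<le> Y l u - Y (l - 1) u \<and> Y l u - Y (l - 1) u \<le> pw (b l) u"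
    if "l \<in> {1..p}" "0 \<le> u" "u \<le> 1" for l u
    unfolding Y_def c_def using slice_curve_height[of l0 p b, OF curve that] by blast
  have Ymono: "Y i u \<le> Y j u" if "i \<le> j" "j \<le> p" "0 \<le> u" "u \<le> 1" for i j u
    unfolding Y_def by (rule slice_curve_mono[of l0 p b, OF curve that])
  have Ystrict: "Y i u < Y j u" if "i < j" "j \<le> p" "0 < u" "u \<le> 1" for i j u
    unfolding Y_def by (rule slice_curve_strict_mono[of l0 p b, OF curve that])
  define \<Lambda> where "\<Lambda> l = region 1 (Y (l - 1)) (Y l)" for l
  define lam where "lam l = arc_of (graph (Y l))" for l
  \<comment> \<open>\<open>\<sigma>\<close> records from which side the height is measured: from below for \<open>1\<close>, from above for \<open>-1\<close>.\<close>
  have "\<exists>\<phi> \<sigma> qA qB. slice_profile D \<phi> (b l) c (pz_Q P l) (pz_mu P l) qA qB \<and>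
      (\<sigma> = (1::real) \<and> qA = q (l - 1) \<and> qB = q l \<or> \<sigma> = -1 \<and> qA = q l \<and> qB = q (l - 1))" if l: "l \<in> {1..p}" for l
  proof -
    have "q (l - 1) \<in> orders D" "q l \<in> orders D" using qo l by auto
    then obtain \<phi> where "slice_profile D \<phi> (b l) c (pz_Q P l) (pz_mu P l) (q (l - 1)) (q l) \<or>
        slice_profile D \<phi> (b l) c (pz_Q P l) (pz_mu P l) (q l) (q (l - 1))"
      using slice_profile_exists[of "q (l - 1)" "q l" "b l" c "pz_Q P l" "pz_mu P l"] sl[OF l] c by blast
    then show ?thesis by blast
  qed
  then obtain \<phi> \<sigma> qA qB where prof: "\<And>l. l \<in> {1..p} \<Longrightarrow> slice_profile D (\<phi> l) (b l) c (pz_Q P l) (pz_mu P l) (qA l) (qB l)"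
    and side: "\<And>l. l \<in> {1..p} \<Longrightarrow> \<sigma> l = (1::real) \<and> qA l = q (l - 1) \<and> qB l = q l \<or> \<sigma> l = -1 \<and> qA l = q l \<and> qB l = q (l - 1)"
    by metis
  \<comment> \<open>\<open>F l\<close> is the function of slice \<open>l\<close>, continued to the whole triangle by clamping the second coordinate to
     the slice.\<close>
  define e where "e l = (if \<sigma> l = 1 then Y (l - 1) else Y l)" for l
  define cl where "cl l x = max (Y (l - 1) (fst x)) (min (snd x) (Y l (fst x)))" for l and x :: "real \<times> real"
  define F where "F l x = \<phi> l (fst x) (\<sigma> l * (cl l x - e l (fst x)))" for l x
  define f where "f x = epow (q 0) (fst x) + (\<Sum>l\<in>{1..p}. F l x - epow (q (l - 1)) (fst x))" for x
  have qe: "q l \<in> ereal ` exponents D \<union> {\<infinity>}" "ereal 1 \<le> q l" if "l \<le> p" for l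
    using qo[OF that] by (auto simp: orders_def)
  have pval: "\<phi> l u 0 = epow (qA l) u" "\<And>w. c * pw (b l) u \<le> w \<Longrightarrow> \<phi> l u w = epow (qB l) u"
    if "l \<in> {1..p}" "u \<in> {0..1}" for l u
    using prof[OF that(1), unfolded slice_profile_def, THEN conjunct2, THEN conjunct2, THEN conjunct1, rule_format, OF that(2)] by auto
  have F_above: "F l (u, v) = epow (q l) u" if l: "l \<in> {1..p}" and u: "0 \<le> u" "u \<le> 1" and v: "Y l u \<le> v" for l u v
  proof -
    have "Y (l - 1) u \<le> Y l u" using Ymono[of "l - 1" l u] l u by auto
    then have "cl l (u, v) = Y l u" using v by (auto simp: cl_def)
    then show ?thesis using side[OF l] pval[OF l, of u] u Yh[OF l u] by (auto simp: F_def e_def)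
  qed
  have F_below: "F l (u, v) = epow (q (l - 1)) u" if l: "l \<in> {1..p}" and u: "0 \<le> u" "u \<le> 1" and v: "v \<le> Y (l - 1) u" for l u v
  proof -
    have "cl l (u, v) = Y (l - 1) u" using v by (auto simp: cl_def)
    then show ?thesis using side[OF l] pval[OF l, of u] u Yh[OF l u] by (auto simp: F_def e_def)
  qed
  have f_slice: "f x = \<phi> l (fst x) (\<sigma> l * (snd x - e l (fst x)))" if l: "l \<in> {1..p}" and x: "x \<in> \<Lambda> l" for l x
  proof -
    obtain u v where uv: "x = (u, v)" by fastforce
    have u: "0 \<le> u" "u \<le> 1" "Y (l - 1) u \<le> v" "v \<le> Y l u" using x by (auto simp: \<Lambda>_def region_def uv)
    have "f x = F l x" unfolding f_def
    proof (rule telescoping_step[OF l])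
      fix k assume k: "k \<in> {1..<l}"
      then have "k \<le> l - 1" "l - 1 \<le> p" using l by auto
      then have "Y k u \<le> v" using Ymono[of k "l - 1" u] u by linarith
      then show "F k x = epow (q k) (fst x)" unfolding uv using F_above[of k u v] k l u by simp
    next
      fix k assume k: "k \<in> {Suc l..p}"
      then have "l \<le> k - 1" "k - 1 \<le> p" by auto
      then have "v \<le> Y (k - 1) u" using Ymono[of l "k - 1" u] u by linarith
      then show "F k x = epow (q (k - 1)) (fst x)" unfolding uv using F_below[of k u v] k l u by simp
    qed
    moreover have "cl l x = snd x" using u by (simp add: cl_def uv)
    ultimately show ?thesis by (simp add: F_def)
  qed
  have de: "dF (e l)" "lipschitzian {0..1} (e l)" if "l \<in> {1..p}" for l
    using dY[of l] dY[of "l - 1"] that by (auto simp: e_def)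
  have dphi: "dF (\<lambda>p. \<phi> l (fst p) (snd p))" "lipschitzian ({0..1} \<times> UNIV) (\<lambda>p. \<phi> l (fst p) (snd p))" if "l \<in> {1..p}" for l
    using prof[OF that, unfolded slice_profile_def, THEN conjunct1]
      prof[OF that, unfolded slice_profile_def, THEN conjunct2, THEN conjunct1] by this
  have dcl: "dF (cl l)" if "l \<in> {1..p}" for l
    unfolding cl_def[abs_def] using that
    by (intro dF_max dF_min dF_snd dF_id dF_comp[OF dY(1)] dF_fst) auto
  have dFF: "dF (F l)" if l: "l \<in> {1..p}" for l
  proof -
    have "dF (\<lambda>x. (fst x, \<sigma> l * (cl l x - e l (fst x))))"
      by (intro dF_Pair dF_mult dF_const_real dF_diff dcl l dF_comp[OF de(1)] dF_fst dF_id)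
    from dF_comp[OF dphi(1)[OF l] this] show ?thesis by (simp add: F_def[abs_def])
  qed
  have df: "dF f"
    unfolding f_def[abs_def] by (intro dF_add dF_sum dF_diff dFF dF_epow dF_fst dF_id qe(1)) auto
  let ?S = "{0..1} \<times> (UNIV :: real set)"
  have fst_S: "lipschitzian ?S (\<lambda>x. g (fst x))" if "lipschitzian {0..1} g" for g :: "real \<Rightarrow> real"
    by (rule lipschitzian_comp[OF that lipschitzian_fst]) auto
  have lF: "lipschitzian ?S (F l)" if l: "l \<in> {1..p}" for l
  proof -
    have "lipschitzian ?S (cl l)" unfolding cl_def[abs_def] using l
      by (intro lipschitzian_max lipschitzian_min lipschitzian_snd fst_S dY) auto
    then have "lipschitzian ?S (\<lambda>x. (fst x, \<sigma> l * (cl l x - e l (fst x))))"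
      by (intro lipschitzian_Pair lipschitzian_fst lipschitzian_cmult lipschitzian_diff fst_S de l)
    moreover have "(\<lambda>x. (fst x, \<sigma> l * (cl l x - e l (fst x)))) ` ?S \<subseteq> ?S" by (intro image_subsetI) auto
    ultimately have "lipschitzian ?S (\<lambda>x. \<phi> l (fst (fst x, \<sigma> l * (cl l x - e l (fst x)))) (snd (fst x, \<sigma> l * (cl l x - e l (fst x)))))"
      by (rule lipschitzian_comp[OF dphi(2)[OF l]])
    then show ?thesis by (simp add: F_def[abs_def])
  qed
  have lf: "lipschitzian ?S f"
    unfolding f_def[abs_def]
    by (intro lipschitzian_add lipschitzian_sum lipschitzian_diff lF fst_S lipschitzian_epow qe(2)) auto
  have f0: "f 0 = 0"
  proof -
    have "F l (0, 0) = 0" if "l \<in> {1..p}" for l using F_above[OF that, of 0 0] Y_0 by simp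
    then show ?thesis by (simp add: f_def zero_prod_def)
  qed
  have slice: "profiled_slice D (\<phi> l) (b l) c (pz_Q P l) (pz_mu P l) (qA l) (qB l) (Y (l - 1)) (Y l) (e l) (\<sigma> l) f"
    if l: "l \<in> {1..p}" for l
  proof (unfold_locales)
    have l1: "l - 1 \<le> p" "l \<le> p" using l by auto
    show "slice_profile D (\<phi> l) (b l) c (pz_Q P l) (pz_mu P l) (qA l) (qB l)" by (rule prof[OF l])
    show "dF (Y (l - 1))" "dF (Y l)" "lipschitzian {0..1} (Y (l - 1))" "lipschitzian {0..1} (Y l)" using dY l1 by auto
    show "0 \<le> Y (l - 1) u \<and> Y l u \<le> u" if "0 \<le> u" "u \<le> 1" for u using Yb l1 that by blast
    show "\<sigma> l = 1 \<and> e l = Y (l - 1) \<or> \<sigma> l = -1 \<and> e l = Y l" using side[OF l] by (auto simp: e_def)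
    show "f x = \<phi> l (fst x) (\<sigma> l * (snd x - e l (fst x)))" if "x \<in> region 1 (Y (l - 1)) (Y l)" for x
      using f_slice[OF l] that by (simp add: \<Lambda>_def)
    show "qA l \<in> orders D" "qB l \<in> orders D" using side[OF l] qo l1 by auto
    show "pz_Q P l = order_interval D (qA l) (qB l)" using side[OF l] sl[OF l] order_interval_commute by metis
    show "pz_mu P l q' \<in> ereal ` exponents D \<union> {\<infinity>} \<and> ereal (b l) \<le> pz_mu P l q'" if "q' \<in> pz_Q P l" for q'
      using sl[OF l] that by blast
  qed (use sl[OF l] c Y_0 df f0 Yh[OF l] in auto)
  note holder = profiled_slice.holder[OF slice] and order_set = profiled_slice.order_set_eq[OF slice]
    and elem = profiled_slice.elementary[OF slice] and width = profiled_slice.width_function[OF slice]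
    and bnd = profiled_slice.order_along_boundary[OF slice] and fpos = profiled_slice.f_bound[OF slice]
  have \<Lambda>T: "\<Lambda> l \<subseteq> std_triangle \<beta>" if "l \<in> {1..p}" for l
  proof
    fix x assume x: "x \<in> \<Lambda> l"
    then have u: "0 \<le> fst x" "fst x \<le> 1" "Y (l - 1) (fst x) \<le> snd x" "snd x \<le> Y l (fst x)" by (auto simp: \<Lambda>_def region_def)
    have "l - 1 \<le> p" "l \<le> p" using that by auto
    from Yb[OF this(1) u(1,2)] Yb[OF this(2) u(1,2)] show "x \<in> std_triangle \<beta>"
      unfolding std_triangle_pw using u by linarith
  qed
  have fst_small: "fst x \<le> 1" if "norm x < 1" for x :: "real \<times> real"
  proof -
    have "norm (fst x) \<le> norm x" by (metis norm_fst_le prod.collapse)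
    then show ?thesis using that by simp
  qed
  have cover: "\<exists>l\<in>{1..p}. x \<in> \<Lambda> l" if "x \<in> std_triangle \<beta>" "norm x < 1" for x
  proof -
    have x: "0 \<le> fst x" "0 \<le> snd x" "snd x \<le> pw (b l0) (fst x)" using that(1) by (auto simp: std_triangle_pw l0(2))
    from in_some_slice[of l0 p b, OF curve x(1) fst_small[OF that(2)] x(2,3)] show ?thesis
      using x(1) fst_small[OF that(2)] unfolding \<Lambda>_def Y_def region_def by (auto simp: case_prod_unfold)
  qed
  have nonneg: "nonneg_lipschitz_germ D (std_triangle \<beta>) f"
  proof -
    have "dP (\<lambda>x. x \<in> std_triangle \<beta> \<inter> ball 0 1)"
      unfolding Int_iff std_triangle_pw mem_ball_0
      by (intro dP_intros dF_pw dF_arith) (use bD l0 in auto)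
    then have "definable_on D (std_triangle \<beta> \<inter> ball 0 1) f" using df by (rule definable_onI)
    moreover have "lipschitzian (std_triangle \<beta> \<inter> ball 0 1) f"
      using lf
    proof (rule lipschitzian_subset, intro subsetI)
      fix x assume "x \<in> std_triangle \<beta> \<inter> ball 0 1"
      then show "x \<in> ?S" using fst_small[of x] by (simp add: std_triangle_pw mem_Times_iff)
    qed
    moreover have "0 \<le> f x" if "x \<in> std_triangle \<beta> \<inter> ball 0 1" for x
      using cover[of x] that fpos[of _ x] unfolding \<Lambda>_def by auto
    ultimately show ?thesis unfolding nonneg_lipschitz_germ_def lipschitzian_def
      using zero_less_one by blast
  qed
  have lam_germ: "germ_eq (arc_image (lam l)) (graph (Y l))" if "l \<le> p" for l
    unfolding lam_def by (rule graph_arc(2)[OF dY(1)[OF that] lipschitzian_continuous_on[OF dY(2)[OF that]] Y_0 zero_less_one])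
  have lam0: "lam 0 = arc_of std_lower" by (simp add: lam_def Y0 std_lower_graph)
  have lamp: "lam p = arc_of (std_upper \<beta>)" by (simp add: lam_def Yp std_upper_graph)
  have \<Lambda>iff: "x \<in> \<Lambda> l \<longleftrightarrow> 0 \<le> fst x \<and> fst x \<le> 1 \<and> Y (l - 1) (fst x) \<le> snd x \<and> snd x \<le> Y l (fst x)" for x l
    by (auto simp: \<Lambda>_def region_def)
  have pizza: "pizza D (std_triangle \<beta>) (arc_of std_lower) (arc_of (std_upper \<beta>)) f p lam \<Lambda>"
    unfolding pizza_def
  proof (intro conjI ballI impI)
    show "\<exists>\<beta>'. holder_triangle_between D \<beta>' (std_triangle \<beta>) (arc_of std_lower) (arc_of (std_upper \<beta>))"
      using holder_triangle_between_std[of \<beta>] bD b1 l0(2) by blast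
    show "normally_embedded (std_triangle \<beta>)" using normally_embedded_std_triangle b1 l0(2) by simp
    show "germ_eq (std_triangle \<beta>) (\<Union>l\<in>{1..p}. \<Lambda> l)"
      using cover \<Lambda>T by (intro germ_eqI_small) blast
  next
    fix l assume l: "l \<in> {1..p}"
    show "subtriangle D (std_triangle \<beta>) (lam (l - 1)) (lam l) (\<Lambda> l)"
      unfolding subtriangle_def germ_subset_def
      using \<Lambda>T[OF l] holder(2)[OF l] unfolding \<Lambda>_def lam_def by (auto intro!: always_eventually)
    have "m q' = ereal (b l)" if "pz_Q P l = {q'}" "m = pz_mu P l" for m q' using sl[OF l] that by auto
    then show "pizza_slice D (\<Lambda> l) f"
      unfolding pizza_slice_def \<Lambda>_def order_set[OF l]
      using elem[OF l] holder(1)[OF l] width[OF l] sl[OF l] by (metis is_singletonE)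
  next
    fix l assume l: "l \<in> {1..<p}"
    have "germ_eq (\<Lambda> l \<inter> \<Lambda> (Suc l)) (graph (Y l))"
    proof (rule germ_eqI_small)
      fix x :: "real \<times> real" assume "norm x < 1"
      then have u: "fst x \<le> 1" by (rule fst_small)
      show "x \<in> \<Lambda> l \<inter> \<Lambda> (Suc l) \<longleftrightarrow> x \<in> graph (Y l)"
        using u Ymono[of "l - 1" l "fst x"] Ymono[of l "Suc l" "fst x"] l by (auto simp: \<Lambda>iff graph_def)
    qed
    then show "germ_eq (\<Lambda> l \<inter> \<Lambda> (Suc l)) (arc_image (lam l))"
      using germ_eq_sym[OF lam_germ[of l]] germ_eq_trans l by auto
  next
    fix k l assume kl: "k \<in> {1..p}" "l \<in> {1..p}" "Suc k < l"
    have "x \<in> \<Lambda> k \<inter> \<Lambda> l \<longleftrightarrow> x \<in> {0}" for x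
    proof
      assume x: "x \<in> \<Lambda> k \<inter> \<Lambda> l"
      then have u: "0 \<le> fst x" "fst x \<le> 1" "Y (l - 1) (fst x) \<le> snd x" "snd x \<le> Y k (fst x)" by (auto simp: \<Lambda>iff)
      have "fst x = 0"
      proof (rule ccontr)
        assume "fst x \<noteq> 0"
        then have "Y k (fst x) < Y (l - 1) (fst x)" using kl u by (intro Ystrict) auto
        then show False using u by linarith
      qed
      then show "x \<in> {0}" using u Y_0 by (auto simp: prod_eq_iff)
    next
      assume "x \<in> {0}"
      then show "x \<in> \<Lambda> k \<inter> \<Lambda> l" using Y_0 by (simp add: \<Lambda>iff)
    qed
    then show "germ_eq (\<Lambda> k \<inter> \<Lambda> l) {0}" by (intro germ_eqI_small)
  qed (use p nonneg lam0 lamp in \<open>auto simp: germ_eq_def\<close>)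
  have lam_order: "order_along f (lam (l - 1)) = q (l - 1) \<and> order_along f (lam l) = q l" if l: "l \<in> {1..p}" for l
    using side[OF l] bnd[OF l] unfolding lam_def by auto
  have "corresponding_abstract_pizza D f p lam \<Lambda> P"
    unfolding corresponding_abstract_pizza_def
  proof (intro conjI allI impI ballI nu)
    show "pz_len P = p" by (simp add: p_def)
    fix l assume l: "l \<le> p"
    show "pz_q P l = order_along f (lam l)"
    proof (cases "l = 0")
      case True then show ?thesis using lam_order[of 1] p by (simp add: q_def)
    next
      case False then show ?thesis using lam_order[of l] l by (simp add: q_def)
    qed
  next
    fix l assume l: "l \<in> {1..p}"
    show "holder_triangle D (pz_beta P l) (\<Lambda> l)" using holder(1)[OF l] by (simp add: \<Lambda>_def b_def)
    show "pz_Q P l = order_set D (\<Lambda> l) f" using order_set[OF l] by (simp add: \<Lambda>_def)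
    show "width_function D (\<Lambda> l) f (pz_mu P l)" using width[OF l] by (simp add: \<Lambda>_def)
  qed
  then show ?thesis using nonneg pizza unfolding p_def by blast
qed

end
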